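(* Let $q>1$ and $f(x)=(\ln(x+\kappa))^q$, and consider the Hamiltonian $H=H_0+P$ with $H_0=\sum_{j\in\mathbb{Z}^{\mathsf d}}\omega_j|u_j|^2$ and $P\in\mathcal{P}_{3,\infty}$, with initial datum $u(0)=u_0$ in the logarithmic ultra-differentiable space $W^U_{s,q}$ (that is, $W_s$ with weight $f(x)=(\ln(x+\kappa))^q$). Assume the frequencies $\omega_j$ satisfy Assumption 2 (stated in the context, with exponent $p$ in A.2) with $\beta>1$. Then for all sufficiently large $s$ there exist a threshold $\varepsilon_0>0$ and constants $C_{\mathrm{sta}},C_{\mathrm{fin}}>0$ such that the following holds: if $u(0)$ is real and $$\varepsilon:=\|u(0)\|_s<\varepsilon_0,$$ then the solution $u(t)$ of the Hamiltonian system of $H$ satisfies $$\sup_{|t|\le T_\varepsilon}\|u(t)\|_s<C_{\mathrm{sta}}\,\varepsilon,\qquad\text{where}\qquad T_\varepsilon>\frac1{C_{\mathrm{sta}}}\exp\left(C_{\mathrm{fin}}|\ln\varepsilon|^{1+a}\right)$$ for any $a<\dfrac{q-1}{qp+1}$.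
   Context: Fix an integer $\mathsf d\ge1$. Let $\mathcal{Z}=\mathbb{Z}^{\mathsf d}\times\{-1,1\}$; for $J=(j,\sigma)\in\mathcal{Z}$ put $|J|=|j|$ (Euclidean norm) and $\overline J=(j,-\sigma)$. Fix a constant $c>0$ and put $\langle j\rangle=\max\{|j|,c\}$. The constants $\kappa>0$ and $c>0$ are chosen so that $f$ is positive, increasing, tends to $+\infty$, and for some constant $C_f<1$ satisfies $f(\sum_{l=1}^dx_l)\le f(x_m)+C_f\sum_{l\ne m}f(x_l)$ whenever all $x_l\ge c$ and $x_m=\max_l x_l$. Spaces. For a weight $f$ and $s>0$, $W_s$ is the space of $u=(u_J)_{J\in\mathcal{Z}}$, $u_J\in\mathbb{C}$, with $\|u\|_s:=\big(\sum_{J=(j,\sigma)\in\mathcal{Z}}|u_J|^2e^{2sf(\langle j\rangle)}\big)^{1/2}<\infty$; $B_s(r)$ is the ball of radius $r$ centered at $0$. $u$ is real if $u_{\overline J}=\overline{u_J}$ for all $J$. $|u_j|^2$ denotes $u_{(j,1)}u_{(j,-1)}$. Hamiltonian system. For a functional $H$, the system is $\dot u_{(j,+1)}=-\mathrm{i}\,\partial H/\partial u_{(j,-1)}$, $\dot u_{(j,-1)}=\mathrm{i}\,\partial H/\partial u_{(j,+1)}$, i.e. $\dot u=X_H(u)$ with $(X_H)_{(j,\sigma)}=-\sigma\mathrm{i}\,\partial H/\partial u_{(j,-\sigma)}$. Perturbations. For $\mathcal{J}=(J_1,\dots,J_d)\in\mathcal{Z}^d$, $J_l=(j_l,\sigma_l)$,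 put $u^{\mathcal J}=u_{J_1}\cdots u_{J_d}$, $\overline{\mathcal J}=(\overline{J_1},\dots,\overline{J_d})$ and $\mathcal{I}_d=\{\mathcal{J}\in\mathcal{Z}^d:\sum_{l}\sigma_lj_l=0\}$. $\mathcal{P}_d$ is the space of formal homogeneous polynomials $P=\sum_{\mathcal J\in\mathcal I_d}P_{\mathcal J}u^{\mathcal J}$ with $\overline{P_{\mathcal J}}=P_{\overline{\mathcal J}}$ and $\sup_{\mathcal J\in\mathcal I_d}|P_{\mathcal J}|<\infty$. $\mathcal{P}_{d,\infty}$ is the space of $P=\sum_{k\ge d}P_k$, $P_k\in\mathcal{P}_k$, endowed with the norm $|P|_{r,s}=\frac1r\sup_{u\in B_s(r)}\|X_P(u)\|_s$ (understood to be finite for small $r$). Assumption 2 on $(\omega_j)_{j\in\mathbb{Z}^{\mathsf d}}\subset\mathbb{R}$. A.1: there are constants $C_0$ and $\beta>1$ with $\frac1{C_0}\le\frac{\omega_j}{|j|^\beta}\le C_0$ for all sufficiently large $|j|$. A.2: there are $\gamma>0$, $\tau>0$, $p\ge1$ such that for $N$ large enough, for all $d$ and all $J_1,\dots,J_d$ with $|J_l|\le N$ and $\sum_{l=1}^d\omega_{j_l}\sigma_l\ne0$, one has $\big|\sum_{l=1}^d\omega_{j_l}\sigma_l\big|\ge\gamma N^{-\tau d^p}$; and when $\sum_{l=1}^d\omega_{j_l}\sigma_l=0$, $d$ is even and there is a permutation $\pi$ of $\{1,\dots,d\}$ such that $\omega_{j_{\pi(i)}}=\omega_{j_{\pi(i+d/2)}}$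 and $\sigma_{\pi(i)}=-\sigma_{\pi(i+d/2)}$ for all $i=1,\dots,d/2$. A.3: there is a partition $\mathcal{Z}=\bigcup_\alpha\Omega_\alpha$ such that: (1) there is a block $\Omega_0$ with $|J|\le C_0$ for all $J\in\Omega_0$; (2) there is a constant $C_1$ with $\sup_{J\in\Omega_\alpha}|J|-\inf_{J\in\Omega_\alpha}|J|\le C_1$ for all $\alpha\ne0$; (3) there are $C_2>0$, $\delta>0$ such that for $J_1=(j_1,\sigma_1)\in\Omega_\alpha$, $J_2=(j_2,\sigma_2)\in\Omega_{\alpha'}$ with $\alpha\ne\alpha'$, $|\omega_{j_1}-\omega_{j_2}|\ge C_2(|j_1|^\delta+|j_2|^\delta)$. *)

theory Defs
  imports "HOL-Analysis.Analysis" "HOL-Library.Disjoint_Sets"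
begin

section \<open>Modes\<close>

text \<open>The dimension of the lattice is \<open>CARD('n)\<close>. A mode is a pair \<open>(j, \<sigma>)\<close>; the sign is
  encoded by a Boolean, with \<open>True\<close> standing for \<open>+1\<close> and \<open>False\<close> for \<open>-1\<close>.\<close>

type_synonym 'n mode = "(int ^ 'n) \<times> bool"

definition sg :: "bool \<Rightarrow> int" where
  "sg \<sigma> = (if \<sigma> then 1 else - 1)"

definition site_norm :: "int ^ ('n::finite) \<Rightarrow> real" where
  "site_norm j = norm (\<chi> i. real_of_int (j $ i))"

definition mode_norm :: "('n::finite) mode \<Rightarrow> real" where
  "mode_norm J = site_norm (fst J)"

definition bar :: "('n::finite) mode \<Rightarrow> 'n mode" where
  "bar J = (fst J, \<not> snd J)"

definition bracket :: "real \<Rightarrow> int ^ ('n::finite) \<Rightarrow> real" where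
  "bracket c j = max (site_norm j) c"

section \<open>Weights and weighted spaces\<close>

definition log_weight :: "real \<Rightarrow> real \<Rightarrow> real \<Rightarrow> real" where
  "log_weight \<kappa> q x = (ln (x + \<kappa>)) powr q"

text \<open>A weight is only ever evaluated on \<open>{c..}\<close>. The constant \<open>Cf\<close> does not depend on the
  number \<open>d\<close> of summands.\<close>

definition admissible_weight :: "real \<Rightarrow> (real \<Rightarrow> real) \<Rightarrow> bool" where
  "admissible_weight c f \<longleftrightarrow>
     (\<forall>x\<ge>c. 0 < f x) \<and> mono_on {c..} f \<and> filterlim f at_top at_top \<and>
     (\<exists>Cf<1. \<forall>(d::nat) (x :: nat \<Rightarrow> real) m.
        m < d \<longrightarrow> (\<forall>l<d. c \<le> x l \<and> x l \<le> x m) \<longrightarrow>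
        f (\<Sum>l<d. x l) \<le> f (x m) + Cf * (\<Sum>l\<in>{..<d} - {m}. f (x l)))"

text \<open>The condition \<open>1 < c + \<kappa>\<close> says that \<open>ln (x + \<kappa>)\<close> is positive for all \<open>x \<ge> c\<close>, so that
  its real power is the genuine one: \<open>powr\<close> is not meaningful at negative bases.\<close>

definition admissible_log_constants :: "real \<Rightarrow> real \<Rightarrow> real \<Rightarrow> bool" where
  "admissible_log_constants \<kappa> c q \<longleftrightarrow>
     0 < \<kappa> \<and> 0 < c \<and> 1 < c + \<kappa> \<and> admissible_weight c (log_weight \<kappa> q)"

definition W_space :: "real \<Rightarrow> (real \<Rightarrow> real) \<Rightarrow> real \<Rightarrow> (('n::finite) mode \<Rightarrow> complex) set" where
  "W_space c f s =
     {u. (\<lambda>J. (cmod (u J))\<^sup>2 * exp (2 * s * f (bracket c (fst J)))) summable_on UNIV}"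

definition W_norm :: "real \<Rightarrow> (real \<Rightarrow> real) \<Rightarrow> real \<Rightarrow> (('n::finite) mode \<Rightarrow> complex) \<Rightarrow> real" where
  "W_norm c f s u =
     sqrt (\<Sum>\<^sub>\<infinity>J\<in>UNIV. (cmod (u J))\<^sup>2 * exp (2 * s * f (bracket c (fst J))))"

definition W_ball :: "real \<Rightarrow> (real \<Rightarrow> real) \<Rightarrow> real \<Rightarrow> real \<Rightarrow> (('n::finite) mode \<Rightarrow> complex) set" where
  "W_ball c f s r = {u \<in> W_space c f s. W_norm c f s u < r}"

definition real_state :: "(('n::finite) mode \<Rightarrow> complex) \<Rightarrow> bool" where
  "real_state u \<longleftrightarrow> (\<forall>J. u (bar J) = cnj (u J))"

section \<open>Formal Hamiltonians and their vector fields\<close>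

text \<open>A formal Hamiltonian is given by its coefficients: \<open>H Js\<close> is the coefficient of the
  monomial \<open>u\<^bsub>J1\<^esub> \<cdots> u\<^bsub>Jd\<^esub>\<close> for \<open>Js = [J1, \<dots>, Jd]\<close>. The length of the list is the degree.\<close>

type_synonym 'n ham = "'n mode list \<Rightarrow> complex"

text \<open>Partial derivative of the monomial with index list \<open>Js\<close> with respect to \<open>u\<^bsub>K\<^esub>\<close>.\<close>

definition monomial_partial :: "('n::finite) mode \<Rightarrow> 'n mode list \<Rightarrow> ('n mode \<Rightarrow> complex) \<Rightarrow> complex" where
  "monomial_partial K Js u =
     (\<Sum>l | l < length Js \<and> Js ! l = K. \<Prod>m\<in>{..<length Js} - {l}. u (Js ! m))"

definition ham_partial_degree ::
    "('n::finite) ham \<Rightarrow> nat \<Rightarrow> 'n mode \<Rightarrow> ('n mode \<Rightarrow> complex) \<Rightarrow> complex" where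
  "ham_partial_degree H k K u = (\<Sum>\<^sub>\<infinity>Js\<in>{Js. length Js = k}. H Js * monomial_partial K Js u)"

definition ham_partial :: "('n::finite) ham \<Rightarrow> 'n mode \<Rightarrow> ('n mode \<Rightarrow> complex) \<Rightarrow> complex" where
  "ham_partial H K u = (\<Sum>k. ham_partial_degree H k K u)"

text \<open>All series defining the partial derivatives at \<open>u\<close> converge.\<close>

definition ham_converges :: "('n::finite) ham \<Rightarrow> ('n mode \<Rightarrow> complex) \<Rightarrow> bool" where
  "ham_converges H u \<longleftrightarrow>
     (\<forall>K. (\<forall>k. (\<lambda>Js. H Js * monomial_partial K Js u) summable_on {Js. length Js = k}) \<and>
          summable (\<lambda>k. ham_partial_degree H k K u))"

definition ham_vf :: "('n::finite) ham \<Rightarrow> ('n mode \<Rightarrow> complex) \<Rightarrow> ('n mode \<Rightarrow> complex)" where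
  "ham_vf H u J = - of_int (sg (snd J)) * \<i> * ham_partial H (bar J) u"

text \<open>The quadratic Hamiltonian with value \<open>\<Sum>j. \<omega> j * u (j, +1) * u (j, -1)\<close>.\<close>

definition H0 :: "(int ^ ('n::finite) \<Rightarrow> real) \<Rightarrow> 'n ham" where
  "H0 \<omega> Js = (if \<exists>j. Js = [(j, True), (j, False)] then of_real (\<omega> (fst (hd Js))) else 0)"

definition zero_momentum :: "nat \<Rightarrow> ('n::finite) mode list set" where
  "zero_momentum d = {Js. length Js = d \<and> (\<Sum>J\<leftarrow>Js. sg (snd J) *s fst J) = 0}"

definition hom_polys :: "nat \<Rightarrow> ('n::finite) ham set" where
  "hom_polys d =
     {P. (\<forall>Js. Js \<notin> zero_momentum d \<longrightarrow> P Js = 0) \<and>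
         (\<forall>Js\<in>zero_momentum d. cnj (P Js) = P (map bar Js)) \<and>
         bdd_above ((\<lambda>Js. cmod (P Js)) ` zero_momentum d)}"

definition degree_part :: "nat \<Rightarrow> ('n::finite) ham \<Rightarrow> 'n ham" where
  "degree_part k P = (\<lambda>Js. if length Js = k then P Js else 0)"

text \<open>Finiteness of the norm \<open>sup {W_norm (X\<^sub>P u) | u \<in> B\<^sub>s(r)} / r\<close>. That the vector field is
  defined on the ball and takes values in the space has to be said separately, since infinite
  sums and \<open>W_norm\<close> are total functions.\<close>

definition vf_norm_finite :: "real \<Rightarrow> (real \<Rightarrow> real) \<Rightarrow> real \<Rightarrow> real \<Rightarrow> ('n::finite) ham \<Rightarrow> bool" where
  "vf_norm_finite c f r s P \<longleftrightarrow>
     (\<forall>u\<in>W_ball c f s r. ham_converges P u \<and> ham_vf P u \<in> W_space c f s) \<and>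
     bdd_above ((\<lambda>u. 1 / r * W_norm c f s (ham_vf P u)) ` W_ball c f s r)"

text \<open>The admissible radii \<open>r\<close> may depend on \<open>s\<close>.\<close>

definition perturbations :: "real \<Rightarrow> (real \<Rightarrow> real) \<Rightarrow> nat \<Rightarrow> ('n::finite) ham set" where
  "perturbations c f d =
     {P. (\<forall>Js. length Js < d \<longrightarrow> P Js = 0) \<and>
         (\<forall>k\<ge>d. degree_part k P \<in> hom_polys k) \<and>
         (\<forall>\<^sub>F s in at_top. \<forall>\<^sub>F r in at_right 0. vf_norm_finite c f r s P)}"

section \<open>Assumptions on the frequencies\<close>

definition freq_sum :: "(int ^ ('n::finite) \<Rightarrow> real) \<Rightarrow> 'n mode list \<Rightarrow> real" where
  "freq_sum \<omega> Js = (\<Sum>J\<leftarrow>Js. \<omega> (fst J) * of_int (sg (snd J)))"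

definition asymptotics :: "real \<Rightarrow> real \<Rightarrow> (int ^ ('n::finite) \<Rightarrow> real) \<Rightarrow> bool" where
  "asymptotics C0 \<beta> \<omega> \<longleftrightarrow> 1 < \<beta> \<and>
     (\<exists>R. \<forall>j. R \<le> site_norm j \<longrightarrow>
        1 / C0 \<le> \<omega> j / site_norm j powr \<beta> \<and> \<omega> j / site_norm j powr \<beta> \<le> C0)"

definition paired :: "(int ^ ('n::finite) \<Rightarrow> real) \<Rightarrow> 'n mode list \<Rightarrow> bool" where
  "paired \<omega> Js \<longleftrightarrow> even (length Js) \<and>
     (\<exists>\<pi>. \<pi> permutes {..<length Js} \<and>
        (\<forall>i < length Js div 2.
           \<omega> (fst (Js ! \<pi> i)) = \<omega> (fst (Js ! \<pi> (i + length Js div 2))) \<and>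
           sg (snd (Js ! \<pi> i)) = - sg (snd (Js ! \<pi> (i + length Js div 2)))))"

definition nonresonance :: "real \<Rightarrow> (int ^ ('n::finite) \<Rightarrow> real) \<Rightarrow> bool" where
  "nonresonance p \<omega> \<longleftrightarrow> 1 \<le> p \<and>
     (\<exists>\<gamma>>0. \<exists>\<tau>>0. \<forall>\<^sub>F N :: real in at_top.
        \<forall>Js. (\<forall>J\<in>set Js. mode_norm J \<le> N) \<longrightarrow>
          (freq_sum \<omega> Js \<noteq> 0 \<longrightarrow>
             \<gamma> * N powr (- \<tau> * real (length Js) powr p) \<le> \<bar>freq_sum \<omega> Js\<bar>) \<and>
          (freq_sum \<omega> Js = 0 \<longrightarrow> paired \<omega> Js))"

definition clustering :: "real \<Rightarrow> (int ^ ('n::finite) \<Rightarrow> real) \<Rightarrow> bool" where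
  "clustering C0 \<omega> \<longleftrightarrow>
     (\<exists>\<B> :: 'n mode set set. partition_on UNIV \<B> \<and>
        (\<exists>\<Omega>0\<in>\<B>. (\<forall>J\<in>\<Omega>0. mode_norm J \<le> C0) \<and>
           (\<exists>C1. \<forall>\<Omega>\<in>\<B> - {\<Omega>0}. bdd_above (mode_norm ` \<Omega>) \<and>
              (SUP J\<in>\<Omega>. mode_norm J) - (INF J\<in>\<Omega>. mode_norm J) \<le> C1)) \<and>
        (\<exists>C2>0. \<exists>\<delta>>0. \<forall>\<Omega>\<in>\<B>. \<forall>\<Omega>'\<in>\<B>. \<Omega> \<noteq> \<Omega>' \<longrightarrow>
           (\<forall>J1\<in>\<Omega>. \<forall>J2\<in>\<Omega>'.
              C2 * (mode_norm J1 powr \<delta> + mode_norm J2 powr \<delta>) \<le> \<bar>\<omega> (fst J1) - \<omega> (fst J2)\<bar>)))"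

definition frequency_assumption :: "real \<Rightarrow> real \<Rightarrow> (int ^ ('n::finite) \<Rightarrow> real) \<Rightarrow> bool" where
  "frequency_assumption \<beta> p \<omega> \<longleftrightarrow>
     (\<exists>C0>0. asymptotics C0 \<beta> \<omega> \<and> clustering C0 \<omega>) \<and> nonresonance p \<omega>"

section \<open>Solutions\<close>

text \<open>A solution on a time set \<open>I\<close> is a continuous curve in the weighted space that satisfies
  every component of \<open>u' = X\<^sub>H u\<close>. Componentwise derivatives are used because the linear
  part of \<open>X\<^sub>H\<close> does not map the weighted space into itself.\<close>

definition ham_solution ::
    "real \<Rightarrow> (real \<Rightarrow> real) \<Rightarrow> real \<Rightarrow> ('n::finite) ham \<Rightarrow> real set \<Rightarrow> (real \<Rightarrow> 'n mode \<Rightarrow> complex) \<Rightarrow> bool" where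
  "ham_solution c f s H I u \<longleftrightarrow>
     (\<forall>t\<in>I. u t \<in> W_space c f s \<and> ham_converges H (u t) \<and>
        ((\<lambda>t'. W_norm c f s (\<lambda>J. u t' J - u t J)) \<longlongrightarrow> 0) (at t within I) \<and>
        (\<forall>J. ((\<lambda>t'. u t' J) has_vector_derivative ham_vf H (u t) J) (at t within I)))"

text \<open>The solution with initial datum \<open>u0\<close> exists on \<open>{-T..T}\<close> and has norm with supremum less
  than \<open>M\<close> there; every other solution on an interval around \<open>0\<close> agrees with it on the
  common part.\<close>

definition the_solution_bounded ::
    "real \<Rightarrow> (real \<Rightarrow> real) \<Rightarrow> real \<Rightarrow> ('n::finite) ham \<Rightarrow> ('n mode \<Rightarrow> complex) \<Rightarrow> real \<Rightarrow> real \<Rightarrow> bool" where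
  "the_solution_bounded c f s H u0 T M \<longleftrightarrow>
     (\<exists>u. ham_solution c f s H {-T..T} u \<and> u 0 = u0 \<and>
        bdd_above ((\<lambda>t. W_norm c f s (u t)) ` {-T..T}) \<and>
        (SUP t\<in>{-T..T}. W_norm c f s (u t)) < M \<and>
        (\<forall>I v. is_interval I \<and> 0 \<in> I \<and> ham_solution c f s H I v \<and> v 0 = u0 \<longrightarrow>
           (\<forall>t\<in>I \<inter> {-T..T}. v t = u t)))"

end

theory Submission
  imports Defs "HOL-Combinatorics.Multiset_Permutations" "HOL-Complex_Analysis.Complex_Analysis"
begin

text \<open>The perturbation is brought to normal form on the level of coefficients only. Generators
  that solve the homological equations up to grade \<open>r\<close> define a formal Lie transform, and the
  transform of a quadratic energy \<open>\<Sum>w j * |u j|^2\<close> is a polynomial whose derivative along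
  solutions contains, up to grade \<open>r\<close>, only brackets of the quadratic energy with monomials of
  small divisor. The weights \<open>w\<close> are comparable with \<open>exp (2 s f)\<close> and constant on the clusters of
  frequencies. Hence such a bracket vanishes, by the nonresonance condition and the separation of
  the clusters, unless at least three modes exceed a threshold \<open>N\<close>; in that case the
  subadditivity of \<open>f\<close> together with the larger exponent \<open>s > s0\<close> gains a factor \<open>exp (- g * f N)\<close>.
  With \<open>r\<close> of size \<open>|ln \<epsilon>|^a\<close> and \<open>ln N\<close> of size \<open>|ln \<epsilon>|^(1 - p a)\<close> the divisors cost
  at most \<open>\<epsilon>^(-1/2)\<close> per grade, and both \<open>\<epsilon>^(r/2)\<close> and \<open>exp (- g * f N)\<close> are of size
  \<open>exp (- m |ln \<epsilon>|^(1 + a))\<close> exactly for \<open>a = (q - 1) / (q p + 1)\<close>.\<close>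

section \<open>Shuffle products and Poisson brackets of coefficient functions\<close>

text \<open>Working with coefficients means that no canonical transformation of the weighted space
  is ever constructed: the generators need neither convergence nor a flow, since only finitely many
  grades of the transformed energy are evaluated along true solutions. The main obstacle is to
  estimate infinite multilinear sums without losing smoothness. The perturbation is only known
  through the norm of its vector field, so its coefficients are recovered at one exponent
  \<open>s0\<close> by Cauchy estimates and polarisation, and the room between \<open>s0\<close> and
  \<open>s\<close> pays for the subadditivity constant of the weight, for the absolute summation of
  all but two modes, and for the final gain. Weights must agree on clusters because two high modes
  of almost equal frequency cancel in the energy bracket only if their weights do. The linear part
  is unbounded; therefore existence and uniqueness are proved in the frame rotating with the linear
  flow, where the retracted perturbation is a Lipschitz field on square summable families. The time
  bound is obtained with the critical exponent itself, so a single \<open>T\<close> serves every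
  smaller \<open>a\<close>.\<close>

definition masks :: "nat \<Rightarrow> bool list set" where
  "masks n = {bs. length bs = n}"

fun sel :: "bool list \<Rightarrow> 'a list \<Rightarrow> 'a list" where
  "sel (b # bs) (x # xs) = (if b then x # sel bs xs else sel bs xs)"
| "sel _ _ = []"

text \<open>If coefficients are read as derivatives at the origin, this is the Leibniz formula for
  the derivatives of a product: the index list is distributed over the two factors in all ways. In
  this normalisation no binomial or factorial factors appear.\<close>

definition conv :: "('a list \<Rightarrow> complex) \<Rightarrow> ('a list \<Rightarrow> complex) \<Rightarrow> 'a list \<Rightarrow> complex" where
  "conv F G M = (\<Sum>bs\<in>masks (length M). F (sel bs M) * G (sel (map Not bs) M))"

text \<open>In the same reading, prepending an index is exactly partial differentiation.\<close>

definition dl :: "'a \<Rightarrow> ('a list \<Rightarrow> complex) \<Rightarrow> 'a list \<Rightarrow> complex" where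
  "dl K F M = F (K # M)"

definition symf :: "('a list \<Rightarrow> complex) \<Rightarrow> bool" where
  "symf F \<longleftrightarrow> (\<forall>M M'. mset M = mset M' \<longrightarrow> F M = F M')"

lemma masks_0 [simp]: "masks 0 = {[]}"
  by (auto simp: masks_def)

lemma masks_Suc: "masks (Suc n) = (#) True ` masks n \<union> (#) False ` masks n"
  by (auto simp: masks_def length_Suc_conv)

lemma finite_masks [simp]: "finite (masks n)"
  by (induction n) (auto simp: masks_Suc)

lemma sum_masks_Suc:
  fixes g :: "bool list \<Rightarrow> 'b::comm_monoid_add"
  shows "(\<Sum>bs\<in>masks (Suc n). g bs) = (\<Sum>bs\<in>masks n. g (True # bs)) + (\<Sum>bs\<in>masks n. g (False # bs))"
  unfolding masks_Suc by (subst sum.union_disjoint) (auto simp: sum.reindex)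

lemma mset_sel: "length bs = length M \<Longrightarrow> mset (sel bs M) + mset (sel (map Not bs) M) = mset M"
  by (induction bs M rule: sel.induct) auto

lemma length_sel: "length bs = length M \<Longrightarrow> length (sel bs M) + length (sel (map Not bs) M) = length M"
  by (induction bs M rule: sel.induct) auto

lemma conv_Nil [simp]: "conv F G [] = F [] * G []"
  by (simp add: conv_def)

text \<open>The product rule for one partial derivative. Commutativity, associativity and symmetry
  of \<open>conv\<close> follow from it by induction on the index list, with the factors left
  arbitrary because they get differentiated on the way.\<close>

lemma conv_Cons: "conv F G (K # M) = conv (dl K F) G M + conv F (dl K G) M"
  by (simp add: conv_def sum_masks_Suc dl_def)

lemma dl_conv: "dl K (conv F G) = (\<lambda>M. conv (dl K F) G M + conv F (dl K G) M)"
  by (auto simp: dl_def[abs_def] conv_Cons)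

lemma conv_add_left: "conv (\<lambda>M. F M + F' M) G M = conv F G M + conv F' G M"
  by (simp add: conv_def sum.distrib algebra_simps)

lemma conv_add_right: "conv F (\<lambda>M. G M + G' M) M = conv F G M + conv F G' M"
  by (simp add: conv_def sum.distrib algebra_simps)

lemma conv_sum_left: "conv (\<lambda>M. \<Sum>i\<in>I. F i M) G M = (\<Sum>i\<in>I. conv (F i) G M)"
  unfolding conv_def sum_distrib_right by (rule sum.swap)

lemma conv_sum_right: "conv F (\<lambda>M. \<Sum>i\<in>I. G i M) M = (\<Sum>i\<in>I. conv F (G i) M)"
  unfolding conv_def sum_distrib_left by (rule sum.swap)

lemma conv_scale_left: "conv (\<lambda>M. c * F M) G M = c * conv F G M"
  by (simp add: conv_def sum_distrib_left mult_ac)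

lemma conv_scale_right: "conv F (\<lambda>M. c * G M) M = c * conv F G M"
  by (simp add: conv_def sum_distrib_left mult_ac)

lemma conv_commute: "conv F G M = conv G F M"
  by (induction M arbitrary: F G) (simp_all add: conv_Cons add.commute)

lemma conv_assoc: "conv (conv F G) H M = conv F (conv G H) M"
  by (induction M arbitrary: F G H)
     (simp_all add: conv_Cons dl_conv conv_add_left conv_add_right)

lemma conv_cong:
  assumes "\<And>bs. bs \<in> masks (length M) \<Longrightarrow> F (sel bs M) = F' (sel bs M)"
    and "\<And>bs. bs \<in> masks (length M) \<Longrightarrow> G (sel bs M) = G' (sel bs M)"
  shows "conv F G M = conv F' G' M"
proof -
  have "map Not bs \<in> masks (length M)" if "bs \<in> masks (length M)" for bs
    using that by (simp add: masks_def)
  thus ?thesis using assms by (simp add: conv_def)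
qed

lemma symf_dl: "symf F \<Longrightarrow> symf (dl K F)"
  by (auto simp: symf_def dl_def)

lemma dl_commute: "symf F \<Longrightarrow> dl K (dl L F) = dl L (dl K F)"
  unfolding symf_def dl_def by (intro ext) (metis add_mset_commute mset.simps(2))

lemma conv_move:
  assumes "symf F" "symf G"
  shows "conv F G (xs @ K # ys) = conv F G (K # xs @ ys)"
  using assms
proof (induction xs arbitrary: F G)
  case (Cons x xs)
  have "conv F G ((x # xs) @ K # ys) = conv (dl x F) G (K # xs @ ys) + conv F (dl x G) (K # xs @ ys)"
    using Cons by (simp add: conv_Cons symf_dl)
  also have "... = conv F G (K # x # xs @ ys)"
    using Cons.prems by (simp add: conv_Cons dl_commute)
  finally show ?case by simp
qed simp

text \<open>After \<open>K\<close> is moved to the front of the permuted list, the product rule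
  reduces both sides to derivatives of the factors, which are again symmetric.\<close>

lemma symf_conv:
  assumes "symf F" "symf G"
  shows "symf (conv F G)"
  unfolding symf_def
proof (intro allI impI)
  fix M M' :: "'a list"
  assume "mset M = mset M'"
  thus "conv F G M = conv F G M'"
    using assms
  proof (induction M arbitrary: M' F G)
    case (Cons K M)
    hence "K \<in> set M'" by (metis list.set_intros(1) set_mset_mset)
    then obtain xs ys where M': "M' = xs @ K # ys" by (meson split_list)
    have e: "mset M = mset (xs @ ys)" using Cons.prems(1) by (simp add: M')
    have "conv F G M' = conv F G (K # xs @ ys)" by (simp add: M' conv_move Cons.prems)
    also have "... = conv F G (K # M)"
      unfolding conv_Cons using Cons.IH[OF e] Cons.prems by (simp add: symf_dl)
    finally show ?case by simp
  qed simp
qed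

section \<open>Momentum, the Poisson bracket and the Jacobi identity\<close>

definition smom :: "('n::finite) mode \<Rightarrow> int ^ 'n" where
  "smom J = sg (snd J) *s fst J"

definition mom :: "('n::finite) mode list \<Rightarrow> int ^ 'n" where
  "mom M = sum_list (map smom M)"

definition mnorm :: "('n::finite) mode list \<Rightarrow> real" where
  "mnorm M = sum_list (map mode_norm M)"

definition mbox :: "real \<Rightarrow> ('n::finite) mode set" where
  "mbox R = {K. mode_norm K \<le> R}"

definition zm :: "('n::finite) ham \<Rightarrow> bool" where
  "zm F \<longleftrightarrow> (\<forall>M. F M \<noteq> 0 \<longrightarrow> mom M = 0)"

definition cf :: "('n::finite) mode \<Rightarrow> complex" where
  "cf K = - \<i> * of_int (sg (snd K))"

text \<open>With this sign the bracket is the derivative of \<open>F\<close> along the Hamiltonian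
  field of \<open>G\<close>: the \<open>K\<close> component in \<open>ham_vf\<close> is
  \<open>cf K\<close> times the derivative with respect to \<open>bar K\<close>. The finite set of
  contraction modes is a parameter so that the algebra can be done with finite sums over one common
  set.\<close>

definition pb :: "('n::finite) mode set \<Rightarrow> 'n ham \<Rightarrow> 'n ham \<Rightarrow> 'n ham" where
  "pb S F G M = (\<Sum>K\<in>S. cf K * conv (dl K F) (dl (bar K) G) M)"

text \<open>For zero-momentum coefficients only the modes of \<open>mbox (mnorm M)\<close> contribute, so this is the
  bracket with the sum extended over all modes.\<close>

definition br :: "('n::finite) ham \<Rightarrow> 'n ham \<Rightarrow> 'n ham" where
  "br F G M = pb (mbox (mnorm M)) F G M"

lemma bar_bar [simp]: "bar (bar K) = K"
  by (simp add: bar_def)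

lemma fst_bar [simp]: "fst (bar K) = fst K" and snd_bar [simp]: "snd (bar K) = (\<not> snd K)"
  by (simp_all add: bar_def)

lemma mode_norm_bar [simp]: "mode_norm (bar K) = mode_norm K"
  by (simp add: mode_norm_def)

lemma cf_bar [simp]: "cf (bar K) = - cf K"
  by (simp add: cf_def sg_def)

lemma norm_cf [simp]: "cmod (cf K) = 1"
  by (simp add: cf_def sg_def norm_mult)

lemma smom_bar: "smom (bar K) = - smom K"
  by (simp add: smom_def sg_def vec_eq_iff)

lemma mom_Nil [simp]: "mom [] = 0" and mom_Cons [simp]: "mom (K # M) = smom K + mom M"
  by (simp_all add: mom_def)

lemma mom_append [simp]: "mom (A @ B) = mom A + mom B"
  by (simp add: mom_def)

lemma mom_mset: "mset M = mset M' \<Longrightarrow> mom M = mom M'"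
  by (simp add: mom_def flip: sum_mset_sum_list)

lemma mnorm_Nil [simp]: "mnorm [] = 0" and mnorm_Cons [simp]: "mnorm (K # M) = mode_norm K + mnorm M"
  by (simp_all add: mnorm_def)

lemma mode_norm_nonneg [simp]: "0 \<le> mode_norm K"
  by (simp add: mode_norm_def site_norm_def)

lemma mnorm_nonneg [simp]: "0 \<le> mnorm M"
  by (induction M) auto

lemma mnorm_sel: "mnorm (sel bs M) \<le> mnorm M"
proof (induction bs M rule: sel.induct)
  case (1 b bs x xs)
  have "0 \<le> mode_norm x" by simp
  with 1 show ?case by (cases b) (simp_all del: mode_norm_nonneg)
qed auto

lemma mom_sel: "bs \<in> masks (length M) \<Longrightarrow> mom (sel bs M) + mom (sel (map Not bs) M) = mom M"
  using mom_mset[of "sel bs M @ sel (map Not bs) M" M] mset_sel[of bs M] by (simp add: masks_def)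

lemma site_norm_add: "site_norm (i + j) \<le> site_norm i + site_norm j"
proof -
  have "(\<chi> k. real_of_int ((i + j) $ k)) = (\<chi> k. real_of_int (i $ k)) + (\<chi> k. real_of_int (j $ k))"
    by (simp add: vec_eq_iff)
  thus ?thesis unfolding site_norm_def by (metis norm_triangle_ineq)
qed

lemma site_norm_minus [simp]: "site_norm (- j) = site_norm j"
proof -
  have "(\<chi> k. real_of_int ((- j) $ k)) = - (\<chi> k. real_of_int (j $ k))"
    by (simp add: vec_eq_iff)
  thus ?thesis unfolding site_norm_def by (metis norm_minus_cancel)
qed

lemma site_norm_0 [simp]: "site_norm 0 = 0"
  by (simp add: site_norm_def vec_eq_iff)

lemma smom_alt: "smom J = (if snd J then fst J else - fst J)"
  by (simp add: smom_def sg_def vec_eq_iff)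

lemma site_norm_smom [simp]: "site_norm (smom J) = mode_norm J"
  by (simp add: smom_alt mode_norm_def)

lemma site_norm_mom: "site_norm (mom M) \<le> mnorm M"
proof (induction M)
  case (Cons K M)
  thus ?case using site_norm_add[of "smom K" "mom M"] by simp
qed simp

text \<open>Zero momentum expresses the signed site of \<open>K\<close> through the others. This
  makes the bracket a finite sum, and later it rules out a monomial with a single very high
  mode.\<close>

lemma mode_norm_le_mnorm: "mom (K # A) = 0 \<Longrightarrow> mode_norm K \<le> mnorm A"
  using site_norm_mom[of A] site_norm_minus[of "mom A"]
  by (metis add_eq_0_iff mom_Cons site_norm_minus site_norm_smom)

lemma abs_le_site_norm: "\<bar>real_of_int (j $ i)\<bar> \<le> site_norm j"
  unfolding site_norm_def using component_le_norm_cart[of "\<chi> i. real_of_int (j $ i)" i] by simp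

lemma finite_sites: "finite {j :: int ^ 'n::finite. site_norm j \<le> R}"
proof -
  let ?B = "{-\<lceil>\<bar>R\<bar>\<rceil>..\<lceil>\<bar>R\<bar>\<rceil>}"
  have "{j :: int ^ 'n. site_norm j \<le> R} \<subseteq> (\<lambda>g. \<chi> i. g i) ` (UNIV \<rightarrow>\<^sub>E ?B)"
  proof
    fix j :: "int ^ 'n"
    assume j: "j \<in> {j. site_norm j \<le> R}"
    have "j $ i \<in> ?B" for i
    proof -
      have "\<bar>real_of_int (j $ i)\<bar> \<le> \<bar>R\<bar>" using abs_le_site_norm[of j i] j by auto
      hence "real_of_int \<bar>j $ i\<bar> \<le> real_of_int \<lceil>\<bar>R\<bar>\<rceil>" by linarith
      hence "\<bar>j $ i\<bar> \<le> \<lceil>\<bar>R\<bar>\<rceil>" by (simp only: of_int_le_iff)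
      thus ?thesis by auto
    qed
    hence "($) j \<in> UNIV \<rightarrow>\<^sub>E ?B" by auto
    moreover have "j = (\<chi> i. ($) j i)" by simp
    ultimately show "j \<in> (\<lambda>g. \<chi> i. g i) ` (UNIV \<rightarrow>\<^sub>E ?B)" by blast
  qed
  moreover have "finite ((UNIV :: 'n set) \<rightarrow>\<^sub>E ?B)" by (intro finite_PiE) auto
  ultimately show ?thesis by (meson finite_imageI finite_subset)
qed

lemma finite_box [simp]: "finite (mbox R :: ('n::finite) mode set)"
proof -
  have "(mbox R :: 'n mode set) = {j. site_norm j \<le> R} \<times> UNIV" by (auto simp: mbox_def mode_norm_def)
  thus ?thesis by (simp add: finite_sites)
qed

lemma bar_box: "bar ` mbox R = (mbox R :: ('a::finite) mode set)"
proof -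
  have "x \<in> bar ` mbox R" if "x \<in> mbox R" for x :: "'a mode"
    using that by (intro image_eqI[of _ _ "bar x"]) (auto simp: mbox_def)
  thus ?thesis by (auto simp: mbox_def)
qed

lemma sum_bar:
  assumes "bar ` S = S"
  shows "(\<Sum>K\<in>S. g (bar K)) = (\<Sum>K\<in>S. g K)"
proof -
  have "inj_on bar S" by (metis bar_bar inj_onI)
  hence "sum g (bar ` S) = (\<Sum>K\<in>S. g (bar K))" by (simp add: sum.reindex)
  thus ?thesis using assms by simp
qed

text \<open>A contraction index outside the box would be larger than all remaining indices of a
  factor together, which contradicts zero momentum of that factor; one such factor suffices.\<close>

lemma zm_conv_0:
  assumes "zm F \<or> zm G" "K \<notin> mbox (mnorm M)"
  shows "conv (dl K F) (dl (bar K) G) M = 0"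
  unfolding conv_def
proof (rule sum.neutral, intro ballI)
  fix bs assume bs: "bs \<in> masks (length M)"
  show "dl K F (sel bs M) * dl (bar K) G (sel (map Not bs) M) = 0"
  proof (rule ccontr)
    assume n: "\<not> ?thesis"
    from assms(1) show False
    proof
      assume "zm F"
      hence "mode_norm K \<le> mnorm (sel bs M)"
        using n by (intro mode_norm_le_mnorm) (auto simp: zm_def dl_def)
      thus False using assms(2) mnorm_sel[of bs M] by (auto simp: mbox_def)
    next
      assume "zm G"
      hence "mode_norm (bar K) \<le> mnorm (sel (map Not bs) M)"
        using n by (intro mode_norm_le_mnorm) (auto simp: zm_def dl_def)
      thus False using assms(2) mnorm_sel[of "map Not bs" M] by (auto simp: mbox_def)
    qed
  qed
qed

text \<open>Brackets evaluated at different lists can thus be computed over one common finite set,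
  where the algebra of \<open>pb\<close> applies.\<close>

lemma pb_eq_br:
  assumes "zm F \<or> zm G" "finite S" "mbox (mnorm M) \<subseteq> S"
  shows "pb S F G M = br F G M"
  unfolding pb_def br_def
  using assms zm_conv_0[OF assms(1)] by (intro sum.mono_neutral_right ballI) simp_all

lemma pb_antisym: "bar ` S = S \<Longrightarrow> pb S F G M = - pb S G F M"
proof -
  assume S: "bar ` S = S"
  have "pb S G F M = (\<Sum>K\<in>S. cf (bar K) * conv (dl (bar K) G) (dl K F) M)"
    unfolding pb_def using sum_bar[OF S, of "\<lambda>K. cf K * conv (dl K G) (dl (bar K) F) M"] by simp
  also have "... = - pb S F G M"
    unfolding pb_def sum_negf[symmetric] by (intro sum.cong) (auto simp: conv_commute)
  finally show ?thesis by simp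
qed

lemma br_antisym: "br F G M = - br G F M"
  unfolding br_def by (rule pb_antisym) (rule bar_box)

lemma symf_sum: "(\<And>i. i \<in> I \<Longrightarrow> symf (F i)) \<Longrightarrow> symf (\<lambda>M. \<Sum>i\<in>I. c i * F i M)"
  unfolding symf_def by (metis (no_types, lifting) sum.cong)

lemma symf_pb:
  assumes "symf F" "symf G"
  shows "symf (pb S F G)"
proof -
  have "symf (conv (dl K F) (dl (bar K) G))" for K
    by (rule symf_conv[OF symf_dl[OF assms(1)] symf_dl[OF assms(2)]])
  thus ?thesis unfolding pb_def[abs_def] by (rule symf_sum)
qed

lemma mnorm_mset: "mset M = mset M' \<Longrightarrow> mnorm M = mnorm M'"
  by (simp add: mnorm_def flip: sum_mset_sum_list)

lemma symf_br: "symf F \<Longrightarrow> symf G \<Longrightarrow> symf (br F G)"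
proof -
  assume "symf F" "symf G"
  hence *: "symf (pb S F G)" for S by (rule symf_pb)
  show ?thesis unfolding symf_def br_def
  proof (intro allI impI)
    fix M M' :: "'a mode list" assume e: "mset M = mset M'"
    thus "pb (mbox (mnorm M)) F G M = pb (mbox (mnorm M')) F G M'"
      using * unfolding mnorm_mset[OF e] symf_def by blast
  qed
qed

lemma zm_br:
  assumes "zm F" "zm G"
  shows "zm (br F G)"
  unfolding zm_def
proof (intro allI impI)
  fix M assume "br F G M \<noteq> 0"
  hence "(\<Sum>K\<in>mbox (mnorm M). cf K * conv (dl K F) (dl (bar K) G) M) \<noteq> 0"
    by (simp add: br_def pb_def)
  then obtain K where "cf K * conv (dl K F) (dl (bar K) G) M \<noteq> 0"
    by (rule sum.not_neutral_contains_not_neutral)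
  hence "(\<Sum>bs\<in>masks (length M). F (K # sel bs M) * G (bar K # sel (map Not bs) M)) \<noteq> 0"
    by (simp add: conv_def dl_def)
  then obtain bs where bs: "bs \<in> masks (length M)"
      "F (K # sel bs M) * G (bar K # sel (map Not bs) M) \<noteq> 0"
    by (rule sum.not_neutral_contains_not_neutral)
  hence "smom K + mom (sel bs M) = 0" "smom (bar K) + mom (sel (map Not bs) M) = 0"
    using assms by (auto simp: zm_def)
  hence "mom (sel bs M) = - smom K" "mom (sel (map Not bs) M) = smom K"
    unfolding add_eq_0_iff smom_bar by simp_all
  thus "mom M = 0" using mom_sel[OF bs(1)] by simp
qed

lemma br_sum_left: "br (\<lambda>M. \<Sum>i\<in>I. F i M) G M = (\<Sum>i\<in>I. br (F i) G M)"
proof -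
  have "dl K (\<lambda>M. \<Sum>i\<in>I. F i M) = (\<lambda>M. \<Sum>i\<in>I. dl K (F i) M)" for K :: "'a mode"
    by (auto simp: dl_def)
  thus ?thesis unfolding br_def pb_def by (simp add: conv_sum_left sum_distrib_left) (rule sum.swap)
qed

lemma br_sum_right: "br F (\<lambda>M. \<Sum>i\<in>I. G i M) M = (\<Sum>i\<in>I. br F (G i) M)"
proof -
  have "br F (\<lambda>M. \<Sum>i\<in>I. G i M) M = - (\<Sum>i\<in>I. br (G i) F M)"
    by (subst br_antisym) (simp add: br_sum_left)
  also have "... = (\<Sum>i\<in>I. br F (G i) M)"
    unfolding sum_negf[symmetric] by (intro sum.cong refl) (simp add: br_antisym[of F])
  finally show ?thesis .
qed

lemma br_scale_left: "br (\<lambda>M. c * F M) G M = c * br F G M"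
proof -
  have "dl K (\<lambda>M. c * F M) = (\<lambda>M. c * dl K F M)" for K :: "'a mode"
    by (auto simp: dl_def)
  thus ?thesis unfolding br_def pb_def by (simp add: conv_scale_left sum_distrib_left mult_ac)
qed

text \<open>The products of first derivatives of two factors with a second derivative of the third cancel
  in pairs.\<close>

lemma pb_jacobi:
  assumes "bar ` S = S" "symf F" "symf G" "symf H"
  shows "pb S F (pb S G H) M = pb S (pb S F G) H M + pb S G (pb S F H) M"
proof -
  let ?c = "\<lambda>A B C. conv (conv A B) C M"
  have dpb: "dl L (pb S A B) = (\<lambda>M. \<Sum>K\<in>S. cf K * (conv (dl L (dl K A)) (dl (bar K) B) M
      + conv (dl K A) (dl L (dl (bar K) B)) M))" for L A and B :: "'a ham"
    by (simp add: fun_eq_iff dl_def[of L "pb _ _ _"] pb_def conv_Cons)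
  have ac: "conv A (conv B C) M = ?c A B C" for A B C :: "'a ham"
    by (simp add: conv_assoc)
  have sw: "?c A B C = ?c B A C" for A B C :: "'a ham"
    by (rule conv_cong) (auto simp: conv_commute)
  have lhs: "pb S F (pb S G H) M = (\<Sum>K\<in>S. \<Sum>L\<in>S. cf K * cf L * ?c (dl K F) (dl (bar K) (dl L G)) (dl (bar L) H))
      + (\<Sum>K\<in>S. \<Sum>L\<in>S. cf K * cf L * ?c (dl K F) (dl L G) (dl (bar K) (dl (bar L) H)))"
    unfolding pb_def[of S F] dpb
    by (simp add: conv_sum_right conv_scale_right conv_add_right ac sum_distrib_left sum.distrib algebra_simps)
  have r1: "pb S (pb S F G) H M = (\<Sum>L\<in>S. \<Sum>K\<in>S. cf K * cf L * ?c (dl L (dl K F)) (dl (bar K) G) (dl (bar L) H))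
      + (\<Sum>L\<in>S. \<Sum>K\<in>S. cf K * cf L * ?c (dl K F) (dl L (dl (bar K) G)) (dl (bar L) H))"
    unfolding pb_def[of S _ H] dpb
    by (simp add: conv_sum_left conv_scale_left conv_add_left sum_distrib_left sum.distrib algebra_simps)
  have r2: "pb S G (pb S F H) M = (\<Sum>K\<in>S. \<Sum>L\<in>S. cf K * cf L * ?c (dl (bar K) (dl L F)) (dl K G) (dl (bar L) H))
      + (\<Sum>K\<in>S. \<Sum>L\<in>S. cf K * cf L * ?c (dl L F) (dl K G) (dl (bar K) (dl (bar L) H)))"
    unfolding pb_def[of S G] dpb
    by (simp add: conv_sum_right conv_scale_right conv_add_right ac sw[of "dl _ G"] sum_distrib_left sum.distrib algebra_simps)
  \<comment> \<open>Here, as in the second sum of \<open>lhs\<close>, both derivatives fall on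
    \<open>H\<close>; exchanging the summation indices and using the symmetry of \<open>H\<close>
    identifies the two.\<close>
  have e3: "(\<Sum>K\<in>S. \<Sum>L\<in>S. cf K * cf L * ?c (dl L F) (dl K G) (dl (bar K) (dl (bar L) H)))
      = (\<Sum>K\<in>S. \<Sum>L\<in>S. cf K * cf L * ?c (dl K F) (dl L G) (dl (bar K) (dl (bar L) H)))"
    by (subst sum.swap) (simp add: dl_commute[OF assms(4)] mult.commute)
  have e2: "(\<Sum>L\<in>S. \<Sum>K\<in>S. cf K * cf L * ?c (dl K F) (dl L (dl (bar K) G)) (dl (bar L) H))
      = (\<Sum>K\<in>S. \<Sum>L\<in>S. cf K * cf L * ?c (dl K F) (dl (bar K) (dl L G)) (dl (bar L) H))"
    by (subst sum.swap) (simp add: dl_commute[OF assms(3)])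
  \<comment> \<open>Renaming \<open>K\<close> to \<open>bar K\<close> flips the sign of
    \<open>cf K\<close>, so the two sums with a second derivative of \<open>F\<close> cancel instead
    of adding up.\<close>
  have "(\<Sum>K\<in>S. \<Sum>L\<in>S. cf K * cf L * ?c (dl (bar K) (dl L F)) (dl K G) (dl (bar L) H))
      = (\<Sum>K\<in>S. \<Sum>L\<in>S. cf (bar K) * cf L * ?c (dl K (dl L F)) (dl (bar K) G) (dl (bar L) H))"
    using sum_bar[OF assms(1), of "\<lambda>K. \<Sum>L\<in>S. cf K * cf L * ?c (dl (bar K) (dl L F)) (dl K G) (dl (bar L) H)"]
    by simp
  also have "... = - (\<Sum>L\<in>S. \<Sum>K\<in>S. cf K * cf L * ?c (dl L (dl K F)) (dl (bar K) G) (dl (bar L) H))"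
    by (subst sum.swap) (simp add: dl_commute[OF assms(2)] sum_negf)
  finally show ?thesis unfolding lhs r1 r2 e3 e2 by simp
qed

lemma br_jacobi:
  assumes "symf F" "symf G" "symf H" "zm F" "zm G" "zm H"
  shows "br F (br G H) M = br (br F G) H M + br G (br F H) M"
proof -
  \<comment> \<open>An inner bracket is evaluated at modes of \<open>M\<close> with one contraction
    index from the box of \<open>M\<close> prepended. Its size is at most twice that of
    \<open>M\<close>, so one set serves all brackets.\<close>
  define S :: "'a mode set" where "S = mbox (2 * mnorm M)"
  have fin: "finite S" and barS: "bar ` S = S" by (simp_all add: S_def bar_box)
  have sub: "mbox (mnorm (K # sel bs M)) \<subseteq> S" if "K \<in> mbox (mnorm M)" for K :: "'a mode" and bs
    using that mnorm_sel[of bs M] by (auto simp: S_def mbox_def)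
  have subM: "mbox (mnorm M) \<subseteq> S" proof -
    have "mnorm M \<le> 2 * mnorm M" by simp
    thus ?thesis unfolding S_def mbox_def by (auto intro: order_trans)
  qed
  have subM': "bar K \<in> mbox (mnorm M)" if "K \<in> mbox (mnorm M)" for K :: "'a mode"
    using that by (simp add: mbox_def)
  have inner: "br A (br B C) M = pb S A (pb S B C) M" if "zm A" "zm B" for A B C :: "'a ham"
  proof -
    have "br A (br B C) M = pb (mbox (mnorm M)) A (pb S B C) M"
      unfolding br_def[of A] pb_def[of _ A]
    proof (intro sum.cong refl arg_cong2[where f = "(*)"] conv_cong)
      fix K :: "'a mode" and bs assume "K \<in> mbox (mnorm M)"
      hence "mbox (mnorm (bar K # sel bs M)) \<subseteq> S" by (intro sub subM')
      thus "dl (bar K) (br B C) (sel bs M) = dl (bar K) (pb S B C) (sel bs M)"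
        unfolding dl_def using pb_eq_br that fin by metis
    qed
    also have "... = pb S A (pb S B C) M" using pb_eq_br[OF _ fin subM, of A "pb S B C"] that by (simp add: br_def)
    finally show ?thesis .
  qed
  \<comment> \<open>A bracket nested on the left is turned round first, because \<open>inner\<close>
    covers right nesting only.\<close>
  have "br (br F G) H M = - br H (br F G) M" by (rule br_antisym)
  also have "... = - pb S H (pb S F G) M" using inner assms by simp
  also have "... = pb S (pb S F G) H M" using pb_antisym[OF barS, of "pb S F G" H M] by simp
  finally show ?thesis using pb_jacobi[OF barS assms(1-3)] assms by (simp add: inner)
qed

text \<open>Commuting update steps make a fold independent of the order of the list. This supplies
  permutation invariance for recursively defined quantities that are no plain sums.\<close>

lemma foldr_mset:
  assumes "\<And>x y b. f x (f y b) = f y (f x b)" and "mset M = mset M'"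
  shows "foldr f M b = foldr f M' b"
  using assms(2)
proof (induction M arbitrary: M')
  case (Cons K M)
  hence "K \<in> set M'" by (metis list.set_intros(1) set_mset_mset)
  then obtain xs ys where M': "M' = xs @ K # ys" by (meson split_list)
  have "mset M = mset (xs @ ys)" using Cons.prems by (simp add: M')
  hence "foldr f M b = foldr f (xs @ ys) b" by (rule Cons.IH)
  hence "foldr f (K # M) b = foldr f (K # xs @ ys) b" by simp
  moreover have "foldr f (xs @ K # ys) b = foldr f (K # xs @ ys) b"
    by (induction xs) (simp_all add: assms(1))
  ultimately show ?case by (simp add: M')
qed simp

section \<open>Exponents measuring the decay of coefficients\<close>

definition sm :: "('a \<Rightarrow> real) \<Rightarrow> 'a list \<Rightarrow> real" where
  "sm \<phi> M = sum_list (map \<phi> M)"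

fun mx :: "('a \<Rightarrow> real) \<Rightarrow> 'a list \<Rightarrow> real" where
  "mx \<phi> [] = 0"
| "mx \<phi> (K # M) = max (\<phi> K) (mx \<phi> M)"

text \<open>The sum of the two largest values when \<phi> is nonnegative; for a one-element list it
  is that value alone.\<close>

fun top2 :: "('a \<Rightarrow> real) \<Rightarrow> 'a list \<Rightarrow> real" where
  "top2 \<phi> [] = 0"
| "top2 \<phi> (K # M) = max (top2 \<phi> M) (\<phi> K + mx \<phi> M)"

lemma sm_Nil [simp]: "sm \<phi> [] = 0" and sm_Cons [simp]: "sm \<phi> (K # M) = \<phi> K + sm \<phi> M"
  by (simp_all add: sm_def)

lemma sm_append [simp]: "sm \<phi> (A @ B) = sm \<phi> A + sm \<phi> B"
  by (simp add: sm_def)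

lemma sm_mset: "mset M = mset M' \<Longrightarrow> sm \<phi> M = sm \<phi> M'"
  by (simp add: sm_def flip: sum_mset_sum_list)

text \<open>The recursion of \<open>top2\<close> needs the maximum of the tail, so only the pair of
  both quantities is a fold; its update steps commute.\<close>

lemma top2_mx_foldr:
  "(top2 \<phi> M, mx \<phi> M) = foldr (\<lambda>K (t, m). (max t (\<phi> K + m), max (\<phi> K) m)) M (0, 0)"
  by (induction M) (auto simp flip: split: prod.splits)

lemma top2_mx_mset:
  assumes "mset M = mset M'"
  shows "top2 \<phi> M = top2 \<phi> M'" "mx \<phi> M = mx \<phi> M'"
proof -
  have "(top2 \<phi> M, mx \<phi> M) = (top2 \<phi> M', mx \<phi> M')"
    unfolding top2_mx_foldr by (rule foldr_mset[OF _ assms]) (auto simp: max_def)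
  thus "top2 \<phi> M = top2 \<phi> M'" "mx \<phi> M = mx \<phi> M'" by simp_all
qed

lemma mx_nonneg [simp]: "0 \<le> mx \<phi> M"
  by (induction M) auto

lemma sm_sel: "bs \<in> masks (length M) \<Longrightarrow> sm \<phi> M = sm \<phi> (sel bs M) + sm \<phi> (sel (map Not bs) M)"
  using sm_mset[of "sel bs M @ sel (map Not bs) M" M] mset_sel[of bs M] by (simp add: masks_def)

lemma mx_sel: "bs \<in> masks (length M) \<Longrightarrow> mx \<phi> M = max (mx \<phi> (sel bs M)) (mx \<phi> (sel (map Not bs) M))"
proof (induction bs M rule: sel.induct)
  case (1 b bs x xs)
  thus ?case by (cases b) (auto simp: masks_def max_def)
qed (auto simp: masks_def)

text \<open>The maxima of two complementary parts sit at different positions, so their sum cannot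
  exceed the two largest values of the whole. This is used when a bracket separates the two dominant
  modes.\<close>

lemma top2_sel:
  assumes "bs \<in> masks (length M)" "\<And>J. 0 \<le> \<phi> J"
  shows "top2 \<phi> (sel bs M) \<le> top2 \<phi> M \<and> top2 \<phi> (sel (map Not bs) M) \<le> top2 \<phi> M
    \<and> mx \<phi> (sel bs M) + mx \<phi> (sel (map Not bs) M) \<le> top2 \<phi> M"
  using assms(1)
proof (induction bs M rule: sel.induct)
  case (1 b bs x xs)
  hence IH: "top2 \<phi> (sel bs xs) \<le> top2 \<phi> xs" "top2 \<phi> (sel (map Not bs) xs) \<le> top2 \<phi> xs"
     "mx \<phi> (sel bs xs) + mx \<phi> (sel (map Not bs) xs) \<le> top2 \<phi> xs" 
     and m: "mx \<phi> xs = max (mx \<phi> (sel bs xs)) (mx \<phi> (sel (map Not bs) xs))"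
    using mx_sel[of bs xs \<phi>] by (cases b; simp add: masks_def)+
  show ?case using IH m by (cases b) (auto simp: max_def)
qed (auto simp: masks_def)

lemma mx_le_sm: "(\<And>J. 0 \<le> \<phi> J) \<Longrightarrow> mx \<phi> M \<le> sm \<phi> M"
proof (induction M)
  case (Cons K M)
  moreover have "0 \<le> mx \<phi> M" by simp
  ultimately have "mx \<phi> M \<le> sm \<phi> M" "0 \<le> \<phi> K" "0 \<le> sm \<phi> M" using order_trans[of 0 "mx \<phi> M"] by auto
  thus ?case by simp
qed simp

section \<open>Graded classes of coefficient functions\<close>

text \<open>Coefficients are derivatives at the origin: the monomial sum of degree \<open>k\<close> carries the
  factor \<open>1 / k!\<close>. The grade is the degree minus two, so that brackets add grades.\<close>

definition cls :: "(('n::finite) mode list \<Rightarrow> real) \<Rightarrow> nat \<Rightarrow> real \<Rightarrow> 'n ham \<Rightarrow> bool" where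
  "cls e n A F \<longleftrightarrow> symf F \<and> zm F \<and> 0 \<le> A \<and> (\<forall>M. F M \<noteq> 0 \<longrightarrow> length M = n + 2) \<and>
     (\<forall>M. cmod (F M) \<le> A * fact (n + 2) * exp (e M))"

lemma clsD:
  assumes "cls e n A F"
  shows "symf F" "zm F" "0 \<le> A" "F M \<noteq> 0 \<Longrightarrow> length M = n + 2" "cmod (F M) \<le> A * fact (n + 2) * exp (e M)"
  using assms by (auto simp: cls_def)

lemma symfI: "(\<And>M M'. mset M = mset M' \<Longrightarrow> F M = F M') \<Longrightarrow> symf F"
  unfolding symf_def by blast

lemma symfD: "symf F \<Longrightarrow> mset M = mset M' \<Longrightarrow> F M = F M'"
  unfolding symf_def by blast

lemma cls_mono: "cls e n A F \<Longrightarrow> A \<le> B \<Longrightarrow> cls e n B F"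
  unfolding cls_def by (meson mult_right_mono order_trans exp_ge_zero fact_ge_zero)

lemma cls_zero: "0 \<le> A \<Longrightarrow> cls e n A (\<lambda>_. 0)"
  by (simp add: cls_def symf_def zm_def)

lemma cls_add:
  assumes "cls e n A F" "cls e n B G"
  shows "cls e n (A + B) (\<lambda>M. F M + G M)"
  unfolding cls_def
proof (intro conjI allI impI)
  show "symf (\<lambda>M. F M + G M)" 
    by (rule symfI) (metis symfD clsD(1) assms)
  show "zm (\<lambda>M. F M + G M)" using clsD(2)[OF assms(1)] clsD(2)[OF assms(2)] unfolding zm_def by (metis add.right_neutral)
  show "0 \<le> A + B" using assms by (simp add: cls_def)
  fix M
  show "length M = n + 2" if "F M + G M \<noteq> 0" using that clsD(4)[OF assms(1), of M] clsD(4)[OF assms(2), of M] by fastforce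
  have "cmod (F M + G M) \<le> cmod (F M) + cmod (G M)" by (rule norm_triangle_ineq)
  also have "... \<le> (A + B) * fact (n + 2) * exp (e M)"
    using clsD(5)[OF assms(1), of M] clsD(5)[OF assms(2), of M] by (simp add: algebra_simps)
  finally show "cmod (F M + G M) \<le> (A + B) * fact (n + 2) * exp (e M)" .
qed

lemma cls_scale:
  assumes "cls e n A F"
  shows "cls e n (cmod c * A) (\<lambda>M. c * F M)"
proof -
  have "cmod c * cmod (F M) \<le> cmod c * (A * fact (n + 2) * exp (e M))" for M
    by (rule mult_left_mono[OF clsD(5)[OF assms]]) simp
  moreover have "symf (\<lambda>M. c * F M)"
    by (rule symfI) (metis symfD clsD(1) assms)
  moreover have "zm (\<lambda>M. c * F M)" using clsD(2)[OF assms] by (simp add: zm_def)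
  ultimately show ?thesis using assms unfolding cls_def by (simp add: norm_mult mult.assoc)
qed

lemma cls_sum:
  assumes "finite I" "\<And>i. i \<in> I \<Longrightarrow> cls e n (A i) (F i)"
  shows "cls e n (\<Sum>i\<in>I. A i) (\<lambda>M. \<Sum>i\<in>I. F i M)"
  using assms by (induction I rule: finite_induct) (simp_all add: cls_zero cls_add)

lemma card_masks_sel: "card {bs \<in> masks (length M). length (sel bs M) = k} = length M choose k"
proof (induction M arbitrary: k)
  case Nil
  thus ?case by (cases k) auto
next
  case (Cons x M)
  have "{bs \<in> masks (length (x # M)). length (sel bs (x # M)) = k}
      = (#) True ` {bs \<in> masks (length M). Suc (length (sel bs M)) = k}
        \<union> (#) False ` {bs \<in> masks (length M). length (sel bs M) = k}"
    by (auto simp: masks_Suc)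
  also have "card ... = card {bs \<in> masks (length M). Suc (length (sel bs M)) = k}
      + card {bs \<in> masks (length M). length (sel bs M) = k}"
    by (subst card_Un_disjoint) (auto simp: card_image)
  also have "... = length (x # M) choose k"
    using Cons.IH[of k] Cons.IH[of "k - 1"] by (cases k) simp_all
  finally show ?case .
qed

lemma smom_eq_iff: "smom K = q \<longleftrightarrow> K = (q, True) \<or> K = (- q, False)"
  by (cases K) (auto simp: smom_alt)

text \<open>Only \<open>(q, True)\<close> and \<open>(- q, False)\<close> have the signed momentum
  \<open>q\<close>. Summing over a mode that is fixed by zero momentum therefore costs a factor 2
  and no lattice volume.\<close>

lemma sum_smom_le:
  assumes "finite S" "\<And>K. smom K = q \<Longrightarrow> t K \<le> X" "0 \<le> X"
    and "\<And>K. smom K \<noteq> q \<Longrightarrow> t K = 0"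
  shows "(\<Sum>K\<in>S. t K) \<le> 2 * (X::real)"
proof -
  let ?Q = "{K \<in> S. smom K = q}"
  have "(\<Sum>K\<in>S. t K) = (\<Sum>K\<in>?Q. t K)"
    using assms by (intro sum.mono_neutral_right) auto
  also have "... \<le> (\<Sum>K\<in>?Q. X)" using assms by (intro sum_mono) auto
  also have "... = real (card ?Q) * X" by simp
  also have "... \<le> 2 * X"
  proof (intro mult_right_mono assms)
    have "?Q \<subseteq> {(q, True), (- q, False)}" using smom_eq_iff by blast
    hence "card ?Q \<le> card {(q, True), (- q, False)}" by (intro card_mono) auto
    thus "real (card ?Q) \<le> 2" by simp
  qed
  finally show ?thesis .
qed

text \<open>Once an index splitting is fixed, momentum leaves two contraction modes. The number of
  splittings that give \<open>a + 1\<close> indices to \<open>F\<close> is a binomial coefficient,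
  and the factorials built into \<open>cls\<close> absorb it, so the loss is only quadratic in the
  degrees. The exponents stay abstract since two combinations of them are needed.\<close>

lemma cls_br_gen:
  assumes F: "cls e a A F" and G: "cls e' b B G"
    and compat: "\<And>K bs M. bs \<in> masks (length M) \<Longrightarrow> mom (K # sel bs M) = 0 \<Longrightarrow> length (sel bs M) = a + 1 \<Longrightarrow>
      e (K # sel bs M) + e' (bar K # sel (map Not bs) M) \<le> e'' M"
  shows "cls e'' (a + b) (2 * real (a + 2) * real (b + 2) * A * B) (br F G)"
  unfolding cls_def
proof (intro conjI allI impI)
  note FD = clsD[OF F] and GD = clsD[OF G]
  show "symf (br F G)" "zm (br F G)" by (intro symf_br zm_br FD GD)+
  show "0 \<le> 2 * real (a + 2) * real (b + 2) * A * B" using FD(3) GD(3) by simp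
  fix M :: "'a mode list"
  let ?t = "\<lambda>K bs. cmod (F (K # sel bs M)) * cmod (G (bar K # sel (map Not bs) M))"
  define X where "X = A * fact (a + 2) * (B * fact (b + 2)) * exp (e'' M)"
  have X0: "0 \<le> X" using FD(3) GD(3) by (simp add: X_def)
  have bound: "(\<Sum>K\<in>mbox (mnorm M). ?t K bs)
      \<le> (if length (sel bs M) = a + 1 \<and> length M = a + b + 2 then 2 * X else 0)"
    if bs: "bs \<in> masks (length M)" for bs
  proof (cases "length (sel bs M) = a + 1 \<and> length M = a + b + 2")
    case False
    have "F (K # sel bs M) = 0 \<or> G (bar K # sel (map Not bs) M) = 0" for K
    proof (rule ccontr)
      assume "\<not> ?thesis"
      hence "length (K # sel bs M) = a + 2" "length (bar K # sel (map Not bs) M) = b + 2"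
        using FD(4) GD(4) by blast+
      thus False using False length_sel[of bs M] bs by (simp add: masks_def)
    qed
    hence "?t K bs = 0" for K by (simp add: disj_commute)
    hence "(\<Sum>K\<in>mbox (mnorm M). ?t K bs) = 0" by (intro sum.neutral ballI)
    thus ?thesis unfolding if_not_P[OF False] by simp
  next
    case True
    have "(\<Sum>K\<in>mbox (mnorm M). ?t K bs) \<le> 2 * X"
    proof (rule sum_smom_le[where q = "- mom (sel bs M)"])
      fix K assume "smom K = - mom (sel bs M)"
      hence "e (K # sel bs M) + e' (bar K # sel (map Not bs) M) \<le> e'' M"
        using True by (intro compat bs) auto
      hence "exp (e (K # sel bs M)) * exp (e' (bar K # sel (map Not bs) M)) \<le> exp (e'' M)"
        by (simp flip: exp_add)
      hence "A * fact (a + 2) * (B * fact (b + 2)) * (exp (e (K # sel bs M)) * exp (e' (bar K # sel (map Not bs) M))) \<le> X"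
        unfolding X_def using FD(3) GD(3) by (intro mult_left_mono) auto
      moreover have "?t K bs \<le> (A * fact (a + 2) * exp (e (K # sel bs M)))
          * (B * fact (b + 2) * exp (e' (bar K # sel (map Not bs) M)))"
        by (intro mult_mono FD GD) (use FD(3) GD(3) in auto)
      ultimately show "?t K bs \<le> X" by (simp only: mult_ac)
    next
      fix K assume n: "smom K \<noteq> - mom (sel bs M)"
      have "F (K # sel bs M) = 0"
      proof (rule ccontr)
        assume "F (K # sel bs M) \<noteq> 0"
        hence "smom K + mom (sel bs M) = 0" using FD(2) by (auto simp: zm_def)
        thus False using n by (simp add: eq_neg_iff_add_eq_0)
      qed
      thus "?t K bs = 0" by simp
    qed (use X0 in auto)
    thus ?thesis using True by simp
  qed
  have "cmod (br F G M) \<le> (\<Sum>K\<in>mbox (mnorm M). cmod (cf K * conv (dl K F) (dl (bar K) G) M))"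
    unfolding br_def pb_def by (rule norm_sum)
  also have "... \<le> (\<Sum>K\<in>mbox (mnorm M). \<Sum>bs\<in>masks (length M). ?t K bs)"
    unfolding conv_def dl_def by (intro sum_mono) (simp add: norm_mult flip: norm_mult, simp add: norm_mult sum_norm_le)
  also have "... = (\<Sum>bs\<in>masks (length M). \<Sum>K\<in>mbox (mnorm M). ?t K bs)" by (rule sum.swap)
  also have "... \<le> (\<Sum>bs\<in>masks (length M). if length (sel bs M) = a + 1 \<and> length M = a + b + 2 then 2 * X else 0)"
    by (intro sum_mono bound)
  finally have le: "cmod (br F G M)
    \<le> (\<Sum>bs\<in>masks (length M). if length (sel bs M) = a + 1 \<and> length M = a + b + 2 then 2 * X else 0)" .
  show len: "length M = a + b + 2" if "br F G M \<noteq> 0"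
  proof (rule ccontr)
    assume "length M \<noteq> a + b + 2"
    hence "cmod (br F G M) \<le> 0" using le by simp
    thus False using that by simp
  qed
  show "cmod (br F G M) \<le> 2 * real (a + 2) * real (b + 2) * A * B * fact (a + b + 2) * exp (e'' M)"
  proof (cases "length M = a + b + 2")
    case False
    hence "br F G M = 0" using len by blast
    thus ?thesis using FD(3) GD(3) by simp
  next
    case True
    have "(\<Sum>bs\<in>masks (length M). if length (sel bs M) = a + 1 \<and> length M = a + b + 2 then 2 * X else 0)
      = (\<Sum>bs\<in>{bs \<in> masks (length M). length (sel bs M) = a + 1}. 2 * X)"
      using True by (simp add: sum.If_cases Int_def)
    also have "... = real ((a + b + 2) choose (a + 1)) * (2 * X)"
      using card_masks_sel[of M "a + 1"] by (simp only: sum_constant True of_nat_id)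
    also have "... = 2 * real (a + 2) * real (b + 2) * A * B
        * (fact (a + 1) * fact (b + 1) * real ((a + b + 2) choose (a + 1))) * exp (e'' M)"
      by (simp add: X_def algebra_simps del: binomial_Suc_Suc)
    also have "fact (a + 1) * fact (b + 1) * real ((a + b + 2) choose (a + 1)) = fact (a + b + 2)"
    proof -
      have "fact (a + 1) * fact ((a + b + 2) - (a + 1)) * ((a + b + 2) choose (a + 1)) = (fact (a + b + 2) :: nat)"
        by (rule binomial_fact_lemma) simp
      moreover have "(a + b + 2) - (a + 1) = b + 1" by simp
      ultimately have "fact (a + 1) * fact (b + 1) * ((a + b + 2) choose (a + 1)) = (fact (a + b + 2) :: nat)"
        by metis
      thus ?thesis by (metis of_nat_fact of_nat_mult)
    qed
    finally show ?thesis using le by simp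
  qed
qed

section \<open>Diagonal quadratic forms\<close>

text \<open>The symmetrised form of \<open>H0\<close>: both orders of a conjugate pair carry the
  same value, and the factor \<open>1 / 2!\<close> of the evaluation leaves each term of the
  quadratic form once.\<close>

definition diag :: "(int ^ 'n \<Rightarrow> real) \<Rightarrow> ('n::finite) ham" where
  "diag a M = (if length M = 2 \<and> M ! 1 = bar (M ! 0) then of_real (a (fst (M ! 0))) else 0)"

lemma conv_unit: "conv G (\<lambda>M. if M = [] then 1 else 0) M = G M"
proof (induction M arbitrary: G)
  case (Cons K M)
  have "dl K (\<lambda>M. if M = [] then 1 else 0) = (\<lambda>M. 0)" by (auto simp: dl_def)
  hence "conv G (dl K (\<lambda>M. if M = [] then 1 else 0)) M = 0" by (simp add: conv_def)
  thus ?case by (simp add: conv_Cons Cons.IH) (simp add: dl_def)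
qed simp

text \<open>Euler's identity with weights: differentiating with respect to a mode and multiplying by
  it again reproduces each monomial once for every occurrence of that mode.\<close>

lemma sum_conv_single:
  assumes "symf F" "finite S" "set M \<subseteq> S"
  shows "(\<Sum>K\<in>S. c K * conv (dl K F) (\<lambda>B. if B = [K] then 1 else 0) M) = sum_list (map c M) * F M"
  using assms(1,3)
proof (induction M arbitrary: F)
  case (Cons J M)
  have 1: "dl J (\<lambda>B. if B = [K] then 1 else 0) = (\<lambda>B. if K = J then (if B = [] then 1 else 0) else 0)" for K
    by (auto simp: dl_def)
  have 2: "conv G (\<lambda>B. if K = J then (if B = [] then 1 else 0) else 0) M = (if K = J then G M else 0)" for G K
    by (cases "K = J") (simp_all add: conv_unit, simp add: conv_def)
  have "(\<Sum>K\<in>S. c K * conv (dl K F) (\<lambda>B. if B = [K] then 1 else 0) (J # M))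
      = (\<Sum>K\<in>S. c K * conv (dl K (dl J F)) (\<lambda>B. if B = [K] then 1 else 0) M)
        + (\<Sum>K\<in>S. if K = J then c K * dl K F M else 0)"
    unfolding sum.distrib[symmetric] conv_Cons 1 2 distrib_left dl_commute[OF Cons.prems(1), of J]
    by (intro sum.cong refl arg_cong2[where f = "(+)"]) simp_all
  also have "(\<Sum>K\<in>S. if K = J then c K * dl K F M else 0) = c J * F (J # M)"
    using Cons.prems assms(2) by (simp add: dl_def)
  also have "(\<Sum>K\<in>S. c K * conv (dl K (dl J F)) (\<lambda>B. if B = [K] then 1 else 0) M) = sum_list (map c M) * F (J # M)"
    using Cons.IH[OF symf_dl[OF Cons.prems(1), of J]] Cons.prems(2) by (simp add: dl_def[of J F M])
  finally show ?case by (simp add: algebra_simps)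
qed (simp add: dl_def)

lemma set_subset_mbox: "set M \<subseteq> mbox (mnorm M)"
proof (induction M)
  case (Cons K M)
  have "0 \<le> mode_norm K" "0 \<le> mnorm M" by auto
  thus ?case using Cons by (auto simp: mbox_def simp del: mode_norm_nonneg mnorm_nonneg)
qed simp

text \<open>The derivative of the quadratic form with respect to \<open>bar K\<close> is linear in
  the mode \<open>K\<close>, so the weighted Euler identity applies. Monomials are thus eigenvectors
  of the bracket, and the eigenvalues are the divisors of the homological equation.\<close>

lemma br_diag:
  assumes "symf F"
  shows "br F (diag a) M = - \<i> * of_real (freq_sum a M) * F M"
proof -
  have d: "dl (bar K) (diag a) = (\<lambda>B. of_real (a (fst K)) * (if B = [K] then 1 else 0))" for K
  proof
    fix B
    show "dl (bar K) (diag a) B = of_real (a (fst K)) * (if B = [K] then 1 else 0)"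
      by (cases B; cases "tl B") (auto simp: dl_def diag_def)
  qed
  have "br F (diag a) M = (\<Sum>K\<in>mbox (mnorm M). (cf K * of_real (a (fst K)))
      * conv (dl K F) (\<lambda>B. if B = [K] then 1 else 0) M)"
    unfolding br_def pb_def d conv_scale_right by (simp add: mult.assoc)
  also have "... = sum_list (map (\<lambda>K. cf K * of_real (a (fst K))) M) * F M"
    by (rule sum_conv_single[OF assms finite_box set_subset_mbox])
  also have "sum_list (map (\<lambda>K. cf K * of_real (a (fst K))) M) = - \<i> * of_real (freq_sum a M)"
    unfolding freq_sum_def by (induction M) (auto simp: cf_def algebra_simps)
  finally show ?thesis .
qed

lemma symf_diag: "symf (diag a)"
proof -
  have "diag a M = diag a M'" if "mset M = mset M'" for M M' :: "'a mode list"
  proof (cases "length M = 2")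
    case True
    then obtain x y where M: "M = [x, y]" by (auto simp: numeral_2_eq_2 length_Suc_conv)
    have "length M' = 2" using that True by (metis size_mset)
    then obtain x' y' where M': "M' = [x', y']" by (auto simp: numeral_2_eq_2 length_Suc_conv)
    have "x = x' \<and> y = y' \<or> x = y' \<and> y = x'" using that by (auto simp: M M' add_eq_conv_ex)
    thus ?thesis by (auto simp: M M' diag_def)
  next
    case False
    hence "length M' \<noteq> 2" using that by (metis size_mset)
    thus ?thesis using False by (simp add: diag_def)
  qed
  thus ?thesis by (rule symfI)
qed

lemma zm_diag: "zm (diag a)"
  by (auto simp: zm_def diag_def numeral_2_eq_2 length_Suc_conv smom_bar split: if_splits)

section \<open>The formal Lie transform\<close>

text \<open>These are the Taylor coefficients in a parameter t of the solution of T' = br X(t) T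
  with T(0) = F, where X(t) is the sum of t^j times \<open>X (Suc j)\<close>. A generator depending
  on the parameter yields one recursion for all grades, in place of one exponential per
  grade.\<close>

fun lieT :: "(nat \<Rightarrow> ('n::finite) ham) \<Rightarrow> nat \<Rightarrow> 'n ham \<Rightarrow> 'n ham" where
  "lieT X 0 F = F"
| "lieT X (Suc n) F = (\<lambda>M. (\<Sum>j\<le>n. br (X (Suc j)) (lieT X (n - j) F) M) / of_nat (Suc n))"

declare lieT.simps(2) [simp del]

lemma lieT_rec: "of_nat (Suc n) * lieT X (Suc n) F M = (\<Sum>j\<le>n. br (X (Suc j)) (lieT X (n - j) F) M)"
  by (simp add: lieT.simps del: of_nat_Suc)

lemma symf_divide: "symf F \<Longrightarrow> symf (\<lambda>M. F M / c)"
  by (rule symfI) (metis symfD)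

lemma symf_sum': "(\<And>i. i \<in> I \<Longrightarrow> symf (F i)) \<Longrightarrow> symf (\<lambda>M. \<Sum>i\<in>I. F i M)"
  using symf_sum[of I F "\<lambda>_. 1"] by simp

lemma zm_sum': "(\<And>i. i \<in> I \<Longrightarrow> zm (F i)) \<Longrightarrow> zm (\<lambda>M. \<Sum>i\<in>I. F i M)"
  unfolding zm_def by (meson sum.not_neutral_contains_not_neutral)

lemma zm_divide: "zm F \<Longrightarrow> zm (\<lambda>M. F M / c)"
  by (simp add: zm_def)

lemma symf_lieT:
  assumes "\<And>j. symf (X j)" "symf F"
  shows "symf (lieT X n F)"
proof (induction n rule: less_induct)
  case (less n)
  show ?case
  proof (cases n)
    case (Suc m)
    show ?thesis unfolding Suc lieT.simps(2)
      by (intro symf_divide symf_sum' symf_br assms less) (simp add: Suc)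
  qed (simp add: assms)
qed

lemma zm_lieT:
  assumes "\<And>j. zm (X j)" "zm F"
  shows "zm (lieT X n F)"
proof (induction n rule: less_induct)
  case (less n)
  show ?case
  proof (cases n)
    case (Suc m)
    show ?thesis unfolding Suc lieT.simps(2)
      by (intro zm_divide zm_sum' zm_br assms less) (simp add: Suc)
  qed (simp add: assms)
qed

text \<open>Grade \<open>n\<close> of the transform sees no generator beyond grade \<open>n\<close>;
  this is what allows the grades to be solved one after the other.\<close>

lemma lieT_cong:
  assumes "\<And>j. 1 \<le> j \<Longrightarrow> j \<le> n \<Longrightarrow> X j = X' j"
  shows "lieT X n F = lieT X' n F"
  using assms
proof (induction n rule: less_induct)
  case (less n)
  show ?case
  proof (cases n)
    case (Suc m)
    have "lieT X (m - j) F = lieT X' (m - j) F" if "j \<le> m" for j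
      using that by (intro less) (auto simp: Suc)
    moreover have "X (Suc j) = X' (Suc j)" if "j \<le> m" for j
      using that by (intro less) (auto simp: Suc)
    ultimately show ?thesis unfolding Suc lieT.simps(2) by simp
  qed simp
qed

lemma br_lieT_left:
  "of_nat k * br (lieT X k F) G M = (\<Sum>j<k. br (br (X (Suc j)) (lieT X (k - Suc j) F)) G M)"
proof (cases k)
  case (Suc m)
  have "of_nat k * br (lieT X k F) G M = br (\<lambda>M. of_nat k * lieT X k F M) G M"
    by (simp add: br_scale_left)
  also have "(\<lambda>M. of_nat k * lieT X k F M) = (\<lambda>M. \<Sum>j\<le>m. br (X (Suc j)) (lieT X (m - j) F) M)"
    unfolding Suc lieT_rec ..
  also have "br ... G M = (\<Sum>j\<le>m. br (br (X (Suc j)) (lieT X (m - j) F)) G M)"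
    by (rule br_sum_left)
  finally show ?thesis by (simp add: Suc lessThan_Suc_atMost)
qed simp

lemma sum_triangle_swap:
  fixes h :: "nat \<Rightarrow> nat \<Rightarrow> 'b::comm_monoid_add"
  shows "(\<Sum>j\<le>m. \<Sum>i\<le>m - j. h j i) = (\<Sum>i\<le>m. \<Sum>j\<le>m - i. h j i)"
proof -
  have "(\<Sum>j\<le>m. \<Sum>i\<le>m - j. h j i) = (\<Sum>(j, i)\<in>(SIGMA j:{..m}. {..m - j}). h j i)"
    by (rule sum.Sigma) auto
  also have "... = (\<Sum>(i, j)\<in>(SIGMA i:{..m}. {..m - i}). h j i)"
    by (rule sum.reindex_bij_witness[of _ "\<lambda>(i, j). (j, i)" "\<lambda>(i, j). (j, i)"]) auto
  also have "... = (\<Sum>i\<le>m. \<Sum>j\<le>m - i. h j i)"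
    by (rule sum.Sigma[symmetric]) auto
  finally show ?thesis .
qed

lemma sum_triangle_shift:
  fixes h :: "nat \<Rightarrow> nat \<Rightarrow> 'b::comm_monoid_add"
  shows "(\<Sum>k\<le>Suc m. \<Sum>j<k. h j (k - Suc j)) = (\<Sum>j\<le>m. \<Sum>i\<le>m - j. h j i)"
proof -
  have "(\<Sum>k\<le>Suc m. \<Sum>j<k. h j (k - Suc j)) = (\<Sum>(k, j)\<in>(SIGMA k:{..Suc m}. {..<k}). h j (k - Suc j))"
    by (rule sum.Sigma) auto
  also have "... = (\<Sum>(j, i)\<in>(SIGMA j:{..m}. {..m - j}). h j i)"
    by (rule sum.reindex_bij_witness[of _ "\<lambda>(j, i). (Suc (i + j), j)" "\<lambda>(k, j). (j, k - Suc j)"]) auto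
  also have "... = (\<Sum>j\<le>m. \<Sum>i\<le>m - j. h j i)"
    by (rule sum.Sigma[symmetric]) auto
  finally show ?thesis .
qed

text \<open>The transform preserves brackets, grade by grade. By the Jacobi identity bracketing with
  a generator is a derivation, and writing the factor \<open>n\<close> at the term \<open>k\<close>
  as \<open>k + (n - k)\<close> separates the part where the generator hits \<open>F\<close> from
  the part where it hits \<open>G\<close>.\<close>

theorem lieT_br:
  assumes X: "\<And>j. symf (X j)" "\<And>j. zm (X j)" and F: "symf F" "zm F" and G: "symf G" "zm G"
  shows "lieT X n (br F G) M = (\<Sum>i\<le>n. br (lieT X i F) (lieT X (n - i) G) M)"
proof (induction n arbitrary: M rule: less_induct)
  case (less n)
  show ?case
  proof (cases n)
    case (Suc m)
    let ?F = "\<lambda>i. lieT X i F" and ?G = "\<lambda>i. lieT X i G"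
    note reg = X symf_lieT[OF X(1) F(1)] zm_lieT[OF X(2) F(2)] symf_lieT[OF X(1) G(1)] zm_lieT[OF X(2) G(2)]
    have "of_nat n * lieT X n (br F G) M
        = (\<Sum>j\<le>m. br (X (Suc j)) (\<lambda>M. \<Sum>i\<le>m - j. br (?F i) (?G (m - j - i)) M) M)"
      unfolding Suc lieT_rec
    proof (intro sum.cong refl arg_cong[where f = "\<lambda>g. br _ g _"] ext)
      fix j M show "lieT X (m - j) (br F G) M = (\<Sum>i\<le>m - j. br (?F i) (?G (m - j - i)) M)"
        using less[of "m - j"] Suc by simp
    qed
    also have "... = (\<Sum>j\<le>m. \<Sum>i\<le>m - j. br (br (X (Suc j)) (?F i)) (?G (m - j - i)) M
        + br (?F i) (br (X (Suc j)) (?G (m - j - i))) M)"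
      unfolding br_sum_right by (intro sum.cong refl br_jacobi reg)
    also have "... = (\<Sum>j\<le>m. \<Sum>i\<le>m - j. br (br (X (Suc j)) (?F i)) (?G (m - j - i)) M)
        + (\<Sum>j\<le>m. \<Sum>i\<le>m - j. br (?F (m - j - i)) (br (X (Suc j)) (?G i)) M)"
    proof -
      have "(\<Sum>i\<le>m - j. br (?F i) (br (X (Suc j)) (?G (m - j - i))) M)
          = (\<Sum>i\<le>m - j. br (?F (m - j - i)) (br (X (Suc j)) (?G i)) M)" for j
        by (rule sum.reindex_bij_witness[of _ "\<lambda>i. m - j - i" "\<lambda>i. m - j - i"])
           (auto simp del: diff_diff_left)
      thus ?thesis by (simp add: sum.distrib del: diff_diff_left)
    qed
    also have "(\<Sum>j\<le>m. \<Sum>i\<le>m - j. br (br (X (Suc j)) (?F i)) (?G (m - j - i)) M)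
        = (\<Sum>k\<le>n. of_nat k * br (?F k) (?G (n - k)) M)"
    proof -
      have "(\<Sum>k\<le>n. of_nat k * br (?F k) (?G (n - k)) M)
          = (\<Sum>k\<le>Suc m. \<Sum>j<k. br (br (X (Suc j)) (?F (k - Suc j))) (?G (m - j - (k - Suc j))) M)"
        unfolding Suc br_lieT_left by (intro sum.cong refl) (auto intro!: arg_cong2[where f = "\<lambda>a b. br _ (lieT X a b) _"])
      also have "... = (\<Sum>j\<le>m. \<Sum>i\<le>m - j. br (br (X (Suc j)) (?F i)) (?G (m - j - i)) M)"
        by (rule sum_triangle_shift)
      finally show ?thesis by simp
    qed
    \<comment> \<open>The recursion \<open>br_lieT_left\<close> works in the left slot, so
      antisymmetry moves the transform of \<open>G\<close> there and back.\<close>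
    also have "(\<Sum>j\<le>m. \<Sum>i\<le>m - j. br (?F (m - j - i)) (br (X (Suc j)) (?G i)) M)
        = (\<Sum>k\<le>n. of_nat (n - k) * br (?F k) (?G (n - k)) M)"
    proof -
      have "(\<Sum>k\<le>n. of_nat (n - k) * br (?F k) (?G (n - k)) M)
          = (\<Sum>k\<le>n. of_nat k * br (?F (n - k)) (?G k) M)"
        by (rule sum.reindex_bij_witness[of _ "\<lambda>i. n - i" "\<lambda>i. n - i"]) auto
      also have "... = (\<Sum>k\<le>n. - (of_nat k * br (?G k) (?F (n - k)) M))"
        by (intro sum.cong refl) (simp add: br_antisym[of "?F _"])
      also have "... = (\<Sum>k\<le>Suc m. \<Sum>j<k. - br (br (X (Suc j)) (?G (k - Suc j))) (?F (m - j - (k - Suc j))) M)"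
        unfolding Suc br_lieT_left sum_negf[symmetric]
        by (intro sum.cong refl) (auto intro!: arg_cong2[where f = "\<lambda>a b. br _ (lieT X a b) _"])
      also have "... = (\<Sum>j\<le>m. \<Sum>i\<le>m - j. - br (br (X (Suc j)) (?G i)) (?F (m - j - i)) M)"
        by (rule sum_triangle_shift)
      finally show ?thesis by (simp add: br_antisym[of "?F _"])
    qed
    also have "(\<Sum>k\<le>n. of_nat k * br (?F k) (?G (n - k)) M)
        + (\<Sum>k\<le>n. of_nat (n - k) * br (?F k) (?G (n - k)) M)
        = of_nat n * (\<Sum>k\<le>n. br (?F k) (?G (n - k)) M)"
      unfolding sum.distrib[symmetric] sum_distrib_left
      by (intro sum.cong refl) (simp add: algebra_simps)
    finally have e: "of_nat n * lieT X n (br F G) M = of_nat n * (\<Sum>k\<le>n. br (?F k) (?G (n - k)) M)" .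
    have "(of_nat n :: complex) \<noteq> 0" using Suc by (simp del: of_nat_Suc)
    with e show ?thesis by (simp only: mult_cancel_left simp_thms)
  qed simp
qed

section \<open>The normal form recursion\<close>

text \<open>\<open>nf \<omega> P \<eta> n\<close> is the pair of the generator and the normal form of grade \<open>n\<close>: monomials with
  small divisor below \<open>\<eta>\<close> are kept in the normal form, all others are removed.\<close>

function nf :: "(int ^ ('n::finite) \<Rightarrow> real) \<Rightarrow> (nat \<Rightarrow> 'n ham) \<Rightarrow> real \<Rightarrow> nat \<Rightarrow> 'n ham \<times> 'n ham" where
  "nf \<omega> P \<eta> n = (if n = 0 then (\<lambda>_. 0, diag \<omega>) else
     let X = (\<lambda>j. if j < n then fst (nf \<omega> P \<eta> j) else (\<lambda>_. 0));
         Z = (\<lambda>j. if j < n then snd (nf \<omega> P \<eta> j) else (\<lambda>_. 0));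
         Psi = (\<lambda>M. P n M - (\<Sum>j<n. lieT X (n - j) (Z j) M))
     in (\<lambda>M. if \<bar>freq_sum \<omega> M\<bar> < \<eta> then 0 else \<i> * of_nat n * Psi M / of_real (freq_sum \<omega> M),
         \<lambda>M. if \<bar>freq_sum \<omega> M\<bar> < \<eta> then Psi M else 0))"
  by pat_completeness auto
termination by (relation "Wellfounded.measure (\<lambda>(\<omega>, P, \<eta>, n). n)") auto

declare nf.simps [simp del]

definition nX :: "(int ^ ('n::finite) \<Rightarrow> real) \<Rightarrow> (nat \<Rightarrow> 'n ham) \<Rightarrow> real \<Rightarrow> nat \<Rightarrow> 'n ham" where
  "nX \<omega> P \<eta> n = fst (nf \<omega> P \<eta> n)"

definition nZ :: "(int ^ ('n::finite) \<Rightarrow> real) \<Rightarrow> (nat \<Rightarrow> 'n ham) \<Rightarrow> real \<Rightarrow> nat \<Rightarrow> 'n ham" where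
  "nZ \<omega> P \<eta> n = snd (nf \<omega> P \<eta> n)"

text \<open>What grade \<open>n\<close> still has to absorb once the lower grades are fixed. The
  entry \<open>n\<close> of the generator is set to zero because it enters this grade only through
  its bracket with the quadratic part, which is the left side of the homological equation.\<close>

definition nPsi :: "(int ^ ('n::finite) \<Rightarrow> real) \<Rightarrow> (nat \<Rightarrow> 'n ham) \<Rightarrow> real \<Rightarrow> nat \<Rightarrow> 'n ham" where
  "nPsi \<omega> P \<eta> n M = P n M - (\<Sum>j<n. lieT ((nX \<omega> P \<eta>)(n := \<lambda>_. 0)) (n - j) (nZ \<omega> P \<eta> j) M)"

lemma nf_0: "nX \<omega> P \<eta> 0 = (\<lambda>_. 0)" "nZ \<omega> P \<eta> 0 = diag \<omega>"
  by (simp_all add: nX_def nZ_def nf.simps)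

lemma nf_pos:
  assumes "0 < n"
  shows "nX \<omega> P \<eta> n = (\<lambda>M. if \<bar>freq_sum \<omega> M\<bar> < \<eta> then 0 else
       \<i> * of_nat n * nPsi \<omega> P \<eta> n M / of_real (freq_sum \<omega> M))"
    and "nZ \<omega> P \<eta> n = (\<lambda>M. if \<bar>freq_sum \<omega> M\<bar> < \<eta> then nPsi \<omega> P \<eta> n M else 0)"
proof -
  let ?X = "\<lambda>j. if j < n then fst (nf \<omega> P \<eta> j) else (\<lambda>_. 0)"
  have "lieT ?X (n - j) F = lieT ((nX \<omega> P \<eta>)(n := \<lambda>_. 0)) (n - j) F" for j F
    by (rule lieT_cong) (auto simp: nX_def)
  hence eq: "P n M - (\<Sum>j<n. lieT ?X (n - j) (if j < n then snd (nf \<omega> P \<eta> j) else (\<lambda>_. 0)) M)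
      = nPsi \<omega> P \<eta> n M" for M
    by (simp add: nPsi_def nZ_def)
  show "nX \<omega> P \<eta> n = (\<lambda>M. if \<bar>freq_sum \<omega> M\<bar> < \<eta> then 0 else
       \<i> * of_nat n * nPsi \<omega> P \<eta> n M / of_real (freq_sum \<omega> M))"
    and "nZ \<omega> P \<eta> n = (\<lambda>M. if \<bar>freq_sum \<omega> M\<bar> < \<eta> then nPsi \<omega> P \<eta> n M else 0)"
    unfolding nX_def nZ_def nf.simps[of \<omega> P \<eta> n] Let_def eq using assms by simp_all
qed

lemma freq_sum_mset: "mset M = mset M' \<Longrightarrow> freq_sum \<omega> M = freq_sum \<omega> M'"
  by (simp add: freq_sum_def flip: sum_mset_sum_list)

lemma symf_if_freq: "symf F \<Longrightarrow> symf (\<lambda>M. if \<bar>freq_sum \<omega> M\<bar> < \<eta> then 0 else c * F M / of_real (freq_sum \<omega> M))"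
  "symf F \<Longrightarrow> symf (\<lambda>M. if \<bar>freq_sum \<omega> M\<bar> < \<eta> then F M else 0)"
  by (rule symfI, metis symfD freq_sum_mset)+

lemma regular_nf:
  assumes P: "\<And>n. symf (P n)" "\<And>n. zm (P n)"
  shows "symf (nX \<omega> P \<eta> n)" "zm (nX \<omega> P \<eta> n)" "symf (nZ \<omega> P \<eta> n)" "zm (nZ \<omega> P \<eta> n)"
    "0 < n \<Longrightarrow> symf (nPsi \<omega> P \<eta> n)" "0 < n \<Longrightarrow> zm (nPsi \<omega> P \<eta> n)"
proof -
  have zero: "symf (\<lambda>_. 0 :: complex)" "zm (\<lambda>_. 0)" by (simp_all add: symf_def zm_def)
  have "symf (nX \<omega> P \<eta> n) \<and> zm (nX \<omega> P \<eta> n) \<and> symf (nZ \<omega> P \<eta> n) \<and> zm (nZ \<omega> P \<eta> n)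
      \<and> (0 < n \<longrightarrow> symf (nPsi \<omega> P \<eta> n) \<and> zm (nPsi \<omega> P \<eta> n))"
  proof (induction n rule: less_induct)
    case (less n)
    show ?case
    proof (cases "n = 0")
      case True
      thus ?thesis by (simp add: nf_0 zero symf_diag zm_diag)
    next
      case False
      let ?X = "\<lambda>j. if j < n then nX \<omega> P \<eta> j else (\<lambda>_. 0)"
      have eq: "lieT ((nX \<omega> P \<eta>)(n := \<lambda>_. 0)) (n - j) F = lieT ?X (n - j) F" for j F
        by (rule lieT_cong) auto
      have X: "symf (?X j)" "zm (?X j)" for j using less zero by auto
      have s: "symf (lieT ?X (n - j) (nZ \<omega> P \<eta> j))" if "j < n" for j
        by (intro symf_lieT X(1)) (use less that in blast)
      have z: "zm (lieT ?X (n - j) (nZ \<omega> P \<eta> j))" if "j < n" for j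
        by (intro zm_lieT X(2)) (use less that in blast)
      have sP: "symf (nPsi \<omega> P \<eta> n)"
      proof (rule symfI)
        fix M M' :: "'a mode list" assume m: "mset M = mset M'"
        have "lieT ?X (n - j) (nZ \<omega> P \<eta> j) M = lieT ?X (n - j) (nZ \<omega> P \<eta> j) M'" if "j < n" for j
          using symfD[OF s[OF that] m] .
        thus "nPsi \<omega> P \<eta> n M = nPsi \<omega> P \<eta> n M'"
          unfolding nPsi_def eq using symfD[OF P(1) m] by simp
      qed
      have zP: "zm (nPsi \<omega> P \<eta> n)"
        unfolding zm_def
      proof (intro allI impI)
        fix M assume M: "nPsi \<omega> P \<eta> n M \<noteq> 0"
        show "mom M = 0"
        proof (rule ccontr)
          assume "mom M \<noteq> 0"
          hence "P n M = 0" "\<And>j. j < n \<Longrightarrow> lieT ?X (n - j) (nZ \<omega> P \<eta> j) M = 0"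
            using P(2) z unfolding zm_def by blast+
          thus False using M unfolding nPsi_def eq by simp
        qed
      qed
      show ?thesis using False sP zP symf_if_freq[OF sP]
        by (auto simp: nf_pos zm_def)
    qed
  qed
  thus "symf (nX \<omega> P \<eta> n)" "zm (nX \<omega> P \<eta> n)" "symf (nZ \<omega> P \<eta> n)" "zm (nZ \<omega> P \<eta> n)"
    "0 < n \<Longrightarrow> symf (nPsi \<omega> P \<eta> n)" "0 < n \<Longrightarrow> zm (nPsi \<omega> P \<eta> n)" by blast+
qed

lemma br_zero_left: "br (\<lambda>_. 0) G M = 0"
  using br_scale_left[of 0 "\<lambda>_. 0" G M] by simp

text \<open>The given Hamiltonian is the transform of its normal form, so no inverse transform is
  needed. The new generator contributes to grade \<open>n\<close> a multiplication by the divisor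
  over \<open>n\<close>; \<open>nf\<close> solves for it wherever the divisor is at least \<eta> and
  keeps the remainder elsewhere.\<close>

lemma nf_identity:
  assumes P: "\<And>n. symf (P n)" "\<And>n. zm (P n)" and P0: "P 0 = diag \<omega>" and eta: "0 < \<eta>"
  shows "P n M = (\<Sum>j\<le>n. lieT (nX \<omega> P \<eta>) (n - j) (nZ \<omega> P \<eta> j) M)"
proof (cases n)
  case 0
  thus ?thesis by (simp add: P0 nf_0)
next
  case (Suc m)
  let ?X = "nX \<omega> P \<eta>" and ?Z = "nZ \<omega> P \<eta>"
  let ?Y = "?X(n := \<lambda>_. 0)"
  have low: "lieT ?X (n - j) (?Z j) M = lieT ?Y (n - j) (?Z j) M" if "0 < j" "j < n" for j
    using that by (intro fun_cong[OF lieT_cong]) auto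
  \<comment> \<open>The summand \<open>j = m\<close> of the recursion is the only one containing
    \<open>?X n\<close>; it is the whole difference between \<open>?X\<close> and
    \<open>?Y\<close>.\<close>
  have top: "lieT ?X n (?Z 0) M = lieT ?Y n (?Z 0) M + br (?X n) (?Z 0) M / of_nat n"
  proof -
    have "lieT ?Y (m - j) (?Z 0) = lieT ?X (m - j) (?Z 0)" for j
      by (rule lieT_cong) (auto simp: Suc)
    hence "(\<Sum>j\<le>m. br (?Y (Suc j)) (lieT ?Y (m - j) (?Z 0)) M)
        = (\<Sum>j\<le>m. if j = m then 0 else br (?X (Suc j)) (lieT ?X (m - j) (?Z 0)) M)"
      by (intro sum.cong) (auto simp: Suc br_zero_left)
    moreover have "(\<Sum>j\<le>m. br (?X (Suc j)) (lieT ?X (m - j) (?Z 0)) M)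
        = (\<Sum>j\<le>m. if j = m then 0 else br (?X (Suc j)) (lieT ?X (m - j) (?Z 0)) M)
          + (\<Sum>j\<le>m. if j = m then br (?X (Suc m)) (?Z 0) M else 0)"
      unfolding sum.distrib[symmetric] by (intro sum.cong) auto
    ultimately show ?thesis unfolding Suc lieT.simps(2)
      by (simp add: add_divide_distrib del: of_nat_Suc)
  qed
  have "(\<Sum>j\<le>n. lieT ?X (n - j) (?Z j) M) = ?Z n M + (\<Sum>j<n. lieT ?X (n - j) (?Z j) M)"
    by (simp add: lessThan_Suc_atMost[symmetric] add.commute)
  also have "(\<Sum>j<n. lieT ?X (n - j) (?Z j) M)
      = (\<Sum>j<n. lieT ?Y (n - j) (?Z j) M + (if j = 0 then br (?X n) (?Z 0) M / of_nat n else 0))"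
    by (intro sum.cong refl) (use top low in auto)
  also have "... = (\<Sum>j<n. lieT ?Y (n - j) (?Z j) M) + br (?X n) (?Z 0) M / of_nat n"
    unfolding sum.distrib using Suc by simp
  also have "(\<Sum>j<n. lieT ?Y (n - j) (?Z j) M) = P n M - nPsi \<omega> P \<eta> n M"
    by (simp add: nPsi_def)
  also have "br (?X n) (?Z 0) M / of_nat n = - \<i> * of_real (freq_sum \<omega> M) * ?X n M / of_nat n"
    unfolding nf_0(2) br_diag[OF regular_nf(1)[where P = P, OF P]] by simp
  also have "?Z n M + (P n M - nPsi \<omega> P \<eta> n M + ...) = P n M"
  proof (cases "\<bar>freq_sum \<omega> M\<bar> < \<eta>")
    case True
    thus ?thesis using Suc by (simp add: nf_pos)
  next
    case False
    hence "freq_sum \<omega> M \<noteq> 0" using eta by auto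
    thus ?thesis using Suc False by (simp add: nf_pos field_simps del: of_nat_Suc)
  qed
  finally show ?thesis by simp
qed

text \<open>The right-hand side contains only brackets with the normal form, whose monomials have small
  divisors.\<close>

lemma nf_energy_identity:
  assumes P: "\<And>n. symf (P n)" "\<And>n. zm (P n)" and P0: "P 0 = diag \<omega>" and eta: "0 < \<eta>"
  shows "(\<Sum>m\<le>g. br (lieT (nX \<omega> P \<eta>) m (diag W)) (P (g - m)) M)
    = (\<Sum>j\<le>g. lieT (nX \<omega> P \<eta>) (g - j) (br (diag W) (nZ \<omega> P \<eta> j)) M)"
proof -
  let ?T = "lieT (nX \<omega> P \<eta>)" and ?Z = "nZ \<omega> P \<eta>"
  note reg = regular_nf[where P = P, OF P]
  have "(\<Sum>m\<le>g. br (?T m (diag W)) (P (g - m)) M)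
      = (\<Sum>m\<le>g. br (?T m (diag W)) (\<lambda>M. \<Sum>j\<le>g - m. ?T (g - m - j) (?Z j) M) M)"
    by (intro sum.cong refl arg_cong[where f = "\<lambda>G. br _ G _"] ext nf_identity[where P = P, OF P P0 eta])
  also have "... = (\<Sum>m\<le>g. \<Sum>j\<le>g - m. br (?T m (diag W)) (?T (g - m - j) (?Z j)) M)"
    by (simp add: br_sum_right)
  also have "... = (\<Sum>j\<le>g. \<Sum>m\<le>g - j. br (?T m (diag W)) (?T (g - m - j) (?Z j)) M)"
    by (rule sum_triangle_swap)
  also have "... = (\<Sum>j\<le>g. ?T (g - j) (br (diag W) (?Z j)) M)"
  proof (intro sum.cong refl)
    fix j assume "j \<in> {..g}"
    show "(\<Sum>m\<le>g - j. br (?T m (diag W)) (?T (g - m - j) (?Z j)) M) = ?T (g - j) (br (diag W) (?Z j)) M"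
      by (subst lieT_br[OF reg(1,2) symf_diag zm_diag reg(3,4)]) (simp add: add.commute)
  qed
  finally show ?thesis .
qed

section \<open>Weights\<close>

text \<open>\<open>C1\<close> divides the room between \<open>s0\<close> and \<open>s\<close>. The
  fraction \<open>1 - C1\<close> is what remains above \<open>s1\<close> and makes sums over minor
  modes converge; \<open>C1 - Cf\<close> is the rate gained from minor modes in
  \<open>e1_gain\<close>. The last assumption is the subadditivity of the weight, stated for
  zero-momentum lists.\<close>

locale weight =
  fixes \<phi> :: "('n::finite) mode \<Rightarrow> real" and Cf C1 s0 s :: real
  assumes phi_pos: "0 < \<phi> J"
    and phi_bar [simp]: "\<phi> (bar J) = \<phi> J"
    and Cf: "0 \<le> Cf" "Cf < C1" "C1 < 1"
    and s0: "0 \<le> s0" "s0 < s"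
    and phi_mom: "mom (K # A) = 0 \<Longrightarrow> A \<noteq> [] \<Longrightarrow> \<phi> K \<le> mx \<phi> A + Cf * (sm \<phi> A - mx \<phi> A)"
begin

definition s1 :: real where
  "s1 = s0 + (s - s0) * C1"

text \<open>\<open>e1\<close> is used for the coefficients of Hamiltonians, \<open>e2\<close> for those of energies.\<close>

definition e1 :: "'n mode list \<Rightarrow> real" where
  "e1 M = s0 * (sm \<phi> M - 2 * mx \<phi> M)"

definition e2 :: "'n mode list \<Rightarrow> real" where
  "e2 M = s1 * sm \<phi> M + (s - s1) * top2 \<phi> M"

lemma phi_nonneg [simp]: "0 \<le> \<phi> J"
  using phi_pos[of J] by simp

lemma s1_ge: "s0 \<le> s1" and s1_lt: "s1 < s"
proof -
  have "0 \<le> (s - s0) * C1" using Cf s0 by simp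
  thus "s0 \<le> s1" by (simp add: s1_def)
  have "(s - s0) * C1 < (s - s0) * 1" using Cf s0 by (intro mult_strict_left_mono) auto
  thus "s1 < s" by (simp add: s1_def)
qed

lemma sm_mx: "mx \<phi> M \<le> sm \<phi> M"
  by (rule mx_le_sm) simp

text \<open>Zero momentum bounds \<open>K\<close> by the largest of the other modes plus
  \<open>Cf\<close> times the sum \<open>d\<close> of the rest. Putting the largest mode in the
  place of \<open>K\<close> thus costs the rate \<open>Cf\<close> where \<open>s1\<close> provides
  \<open>C1\<close>, and the surplus multiplies \<open>d\<close>. The case distinction only resolves
  the maximum inside \<open>e1\<close>.\<close>

lemma e1_gain:
  assumes "mom (K # A) = 0" "A \<noteq> []"
  shows "e1 (K # A) + s * \<phi> K + (s - s0) * (C1 - Cf) * (sm \<phi> A - mx \<phi> A)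
    \<le> s1 * sm \<phi> A + (s - s1) * mx \<phi> A"
proof -
  define x m d where "x = \<phi> K" and "m = mx \<phi> A" and "d = sm \<phi> A - mx \<phi> A"
  have S: "sm \<phi> A = m + d" and d: "0 \<le> d" using sm_mx[of A] by (auto simp: m_def d_def)
  have x: "x \<le> m + Cf * d" using phi_mom[OF assms] by (simp add: x_def m_def d_def)
  have rhs: "s1 * sm \<phi> A + (s - s1) * mx \<phi> A = s0 * d + (s - s0) * C1 * d + s * m"
    by (simp add: S s1_def algebra_simps flip: m_def)
  have lhs: "e1 (K # A) = s0 * (x + m + d - 2 * max x m)"
    by (simp add: e1_def S x_def[symmetric] m_def[symmetric] algebra_simps)
  have "e1 (K # A) + s * x \<le> s0 * d + (s - s0) * Cf * d + s * m"
  proof (cases "m \<le> x")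
    case True
    have "(s - s0) * x \<le> (s - s0) * (m + Cf * d)" using x s0 by (intro mult_left_mono) auto
    thus ?thesis using True by (simp add: lhs max_absorb1 algebra_simps)
  next
    case False
    have "(s0 + s) * x \<le> (s0 + s) * m" using False s0 by (intro mult_left_mono) auto
    moreover have "0 \<le> (s - s0) * Cf * d" using s0 Cf d by simp
    ultimately show ?thesis using False by (simp add: lhs max_absorb2 algebra_simps)
  qed
  thus ?thesis unfolding rhs d_def[symmetric] x_def[symmetric] by (simp add: algebra_simps)
qed

text \<open>The variant for a mode that is not among the two dominant ones: \<open>K\<close> is
  charged at rate \<open>s1\<close> instead of \<open>s\<close>, and bounding it by the plain sum of
  the others is enough.\<close>

lemma e1_low:
  assumes "mom (K # A) = 0" "A \<noteq> []"
  shows "e1 (K # A) + s1 * \<phi> K \<le> s1 * sm \<phi> A"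
proof -
  define x m d where "x = \<phi> K" and "m = mx \<phi> A" and "d = sm \<phi> A - mx \<phi> A"
  have S: "sm \<phi> A = m + d" and d: "0 \<le> d" using sm_mx[of A] by (auto simp: m_def d_def)
  have "Cf * d \<le> 1 * d" using Cf d by (intro mult_right_mono) auto
  hence x: "x \<le> m + d" using phi_mom[OF assms] by (simp add: x_def m_def d_def)
  have lhs: "e1 (K # A) = s0 * (x + m + d - 2 * max x m)"
    by (simp add: e1_def S x_def[symmetric] m_def[symmetric] algebra_simps)
  have "e1 (K # A) + s1 * x \<le> s1 * (m + d)"
  proof (cases "m \<le> x")
    case True
    have "(s1 - s0) * x \<le> (s1 - s0) * (m + d)" using x s1_ge by (intro mult_left_mono) auto
    thus ?thesis using True by (simp add: lhs max_absorb1 algebra_simps)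
  next
    case False
    have "(s0 + s1) * x \<le> (s0 + s1) * m" using False s0 s1_ge by (intro mult_left_mono) auto
    moreover have "s0 * d \<le> s1 * d" using s1_ge d by (intro mult_right_mono) auto
    ultimately show ?thesis using False by (simp add: lhs max_absorb2 algebra_simps)
  qed
  thus ?thesis by (simp add: S x_def)
qed

text \<open>With x for \<open>\<phi> K\<close> and a, b for the maxima of the two parts, this comes
  down to x + max a b \<le> max x a + max x b.\<close>

lemma e1_compat:
  assumes "bs \<in> masks (length M)"
  shows "e1 (K # sel bs M) + e1 (bar K # sel (map Not bs) M) \<le> e1 M"
proof -
  let ?A = "sel bs M" and ?B = "sel (map Not bs) M"
  have "sm \<phi> (K # ?A) - 2 * mx \<phi> (K # ?A) + (sm \<phi> (bar K # ?B) - 2 * mx \<phi> (bar K # ?B)) \<le> sm \<phi> M - 2 * mx \<phi> M"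
    unfolding sm_sel[OF assms, of \<phi>] mx_sel[OF assms, of \<phi>] by (auto simp: max_def)
  thus ?thesis unfolding e1_def using s0 by (simp add: mult_left_mono flip: distrib_left)
qed

text \<open>If \<open>K\<close> belongs to the two dominant modes of the energy factor, the largest
  mode of the Hamiltonian factor takes over its place. Otherwise \<open>K\<close> is charged at rate
  \<open>s1\<close> only, and so are the modes that replace it.\<close>

lemma e2_compat:
  assumes bs: "bs \<in> masks (length M)" and K: "mom (K # sel bs M) = 0" "length (sel bs M) = a + 1"
  shows "e1 (K # sel bs M) + e2 (bar K # sel (map Not bs) M) \<le> e2 M"
proof -
  let ?A = "sel bs M" and ?B = "sel (map Not bs) M"
  have ne: "?A \<noteq> []" using K(2) by auto
  have t: "top2 \<phi> ?B \<le> top2 \<phi> M" "mx \<phi> ?A + mx \<phi> ?B \<le> top2 \<phi> M"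
    using top2_sel[OF bs, of \<phi>] by auto
  have g: "0 \<le> (s - s0) * (C1 - Cf) * (sm \<phi> ?A - mx \<phi> ?A)"
    using s0 Cf sm_mx[of ?A] by simp
  show ?thesis
  proof (cases "top2 \<phi> ?B \<le> \<phi> K + mx \<phi> ?B")
    case True
    have "(s - s1) * (mx \<phi> ?A + mx \<phi> ?B) \<le> (s - s1) * top2 \<phi> M"
      using t s1_lt by (intro mult_left_mono) auto
    thus ?thesis using e1_gain[OF K(1) ne] g True
      by (simp add: e2_def sm_sel[OF bs] max_absorb2 algebra_simps)
  next
    case False
    have "(s - s1) * top2 \<phi> ?B \<le> (s - s1) * top2 \<phi> M"
      using t s1_lt by (intro mult_left_mono) auto
    thus ?thesis using e1_low[OF K(1) ne] False
      by (simp add: e2_def sm_sel[OF bs] max_absorb1 algebra_simps)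
  qed
qed

lemma e1_mset: "mset M = mset M' \<Longrightarrow> e1 M = e1 M'"
  unfolding e1_def by (metis sm_mset top2_mx_mset(2))

lemma e2_mset: "mset M = mset M' \<Longrightarrow> e2 M = e2 M'"
  unfolding e2_def by (metis sm_mset top2_mx_mset(1))

text \<open>Needed for vector field components, measured with the weight
  \<open>exp (2 * s * \<phi> K)\<close>: the mode \<open>K\<close> is one of the two charged at rate
  \<open>s\<close>, and the largest of the others is the second.\<close>

lemma e2_gain:
  assumes "mom (K # A) = 0" "A \<noteq> []"
  shows "e1 (K # A) + 2 * s * \<phi> K + (s - s0) * (C1 - Cf) * (sm \<phi> A - mx \<phi> A) \<le> e2 (K # A)"
proof -
  have "(s - s1) * (\<phi> K + mx \<phi> A) \<le> (s - s1) * top2 \<phi> (K # A)"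
    using s1_lt by (intro mult_left_mono) auto
  thus ?thesis using e1_gain[OF assms] by (simp add: e2_def algebra_simps)
qed

lemma e1_vf:
  assumes "mom (K # A) = 0" "A \<noteq> []"
  shows "e1 (K # A) + 2 * s * \<phi> K \<le> e2 (K # A)"
proof -
  have "0 \<le> (s - s0) * (C1 - Cf) * (sm \<phi> A - mx \<phi> A)" using s0 Cf sm_mx[of A] by simp
  thus ?thesis using e2_gain[OF assms] by simp
qed

lemma cls_br_e1: "cls e1 a A F \<Longrightarrow> cls e1 b B G \<Longrightarrow> cls e1 (a + b) (2 * real (a + 2) * real (b + 2) * A * B) (br F G)"
  by (rule cls_br_gen) (auto intro: e1_compat)

lemma cls_br_e2: "cls e1 a A F \<Longrightarrow> cls e2 b B G \<Longrightarrow> cls e2 (a + b) (2 * real (a + 2) * real (b + 2) * A * B) (br F G)"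
  by (rule cls_br_gen) (auto intro: e2_compat)

text \<open>In the recursion for grade \<open>n\<close> each of the \<open>n\<close> summands is at
  most \<delta> \<rho>^n times the bound of \<open>F\<close>, and the division by \<open>n\<close>
  turns their sum into an average, so \<delta> is paid only once. Since merely the bracket estimate
  with a generator is assumed, both exponents are covered.\<close>

lemma cls_lieT:
  assumes e: "\<And>a b A B F G. cls e1 a A F \<Longrightarrow> cls e b B G \<Longrightarrow> cls e (a + b) (2 * real (a + 2) * real (b + 2) * A * B) (br F G)"
    and X: "\<And>j. 1 \<le> j \<Longrightarrow> j \<le> n \<Longrightarrow> cls e1 j (x j) (X j)"
    and small: "\<And>j. 1 \<le> j \<Longrightarrow> j \<le> n \<Longrightarrow> 2 * real (r + 2) * real (r + 2) * x j \<le> \<delta> * \<rho> ^ j"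
    and F: "cls e g B F" and r: "g + n \<le> r" and d: "0 \<le> \<delta>" "\<delta> \<le> 1" "0 \<le> \<rho>"
  shows "cls e (g + n) (B * (if n = 0 then 1 else \<delta> * \<rho> ^ n)) (lieT X n F)"
  using X small r
proof (induction n rule: less_induct)
  case (less n)
  show ?case
  proof (cases n)
    case 0
    thus ?thesis using F by simp
  next
    case (Suc m)
    have B0: "0 \<le> B" using F by (simp add: cls_def)
    have c: "cls e (g + n) (\<delta> * \<rho> ^ n * B) (br (X (Suc j)) (lieT X (m - j) F))" if j: "j \<le> m" for j
    proof -
      let ?t = "if m - j = 0 then 1 else \<delta> * \<rho> ^ (m - j)"
      have t: "0 \<le> ?t" "?t \<le> \<rho> ^ (m - j)" using d by (auto intro: mult_left_le_one_le)
      have X': "cls e1 (Suc j) (x (Suc j)) (X (Suc j))" using less.prems(1)[of "Suc j"] Suc j by simp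
      have x0: "0 \<le> x (Suc j)" using X' by (simp add: cls_def)
      have "cls e (g + (m - j)) (B * ?t) (lieT X (m - j) F)"
        by (rule less.IH) (use less.prems Suc j in auto)
      hence "cls e (Suc j + (g + (m - j))) (2 * real (Suc j + 2) * real (g + (m - j) + 2) * x (Suc j) * (B * ?t))
          (br (X (Suc j)) (lieT X (m - j) F))"
        by (rule e[OF X'])
      moreover have "Suc j + (g + (m - j)) = g + n" using Suc j by simp
      moreover have "2 * real (Suc j + 2) * real (g + (m - j) + 2) * x (Suc j) * (B * ?t) \<le> \<delta> * \<rho> ^ n * B"
      proof -
        have "2 * real (Suc j + 2) * real (g + (m - j) + 2) * x (Suc j) \<le> 2 * real (r + 2) * real (r + 2) * x (Suc j)"
          using less.prems(3) Suc j x0 by (intro mult_right_mono mult_mono) auto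
        also have "... \<le> \<delta> * \<rho> ^ Suc j" using less.prems(2)[of "Suc j"] Suc j by simp
        finally have "2 * real (Suc j + 2) * real (g + (m - j) + 2) * x (Suc j) * (B * ?t)
            \<le> (\<delta> * \<rho> ^ Suc j) * (B * \<rho> ^ (m - j))"
          by (rule mult_mono) (use t B0 d in \<open>auto intro!: mult_left_mono mult_nonneg_nonneg simp del: power_Suc\<close>)
        also have "... = \<delta> * \<rho> ^ (Suc j + (m - j)) * B" by (simp add: power_add algebra_simps)
        finally show ?thesis using Suc j by simp
      qed
      ultimately show ?thesis using cls_mono by metis
    qed
    have "cls e (g + n) (\<Sum>j\<in>{..m}. \<delta> * \<rho> ^ n * B) (\<lambda>M. \<Sum>j\<in>{..m}. br (X (Suc j)) (lieT X (m - j) F) M)"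
      by (rule cls_sum) (use c in auto)
    hence c1: "cls e (g + n) (cmod (1 / of_nat n) * (\<Sum>j\<in>{..m}. \<delta> * \<rho> ^ n * B))
        (\<lambda>M. 1 / of_nat n * (\<Sum>j\<in>{..m}. br (X (Suc j)) (lieT X (m - j) F) M))"
      by (rule cls_scale)
    have c2: "cmod (1 / of_nat n) * (\<Sum>j\<in>{..m}. \<delta> * \<rho> ^ n * B) = B * (\<delta> * \<rho> ^ n)"
      using Suc by (simp add: norm_divide del: of_nat_Suc)
    have c3: "(\<lambda>M. 1 / of_nat n * (\<Sum>j\<in>{..m}. br (X (Suc j)) (lieT X (m - j) F) M)) = lieT X n F"
      unfolding Suc lieT.simps(2) by (simp del: of_nat_Suc)
    show ?thesis using c1 Suc unfolding c2 c3 by simp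
  qed
qed

text \<open>With \<open>\<delta> = 1 / (4 r)\<close>, every grade costs the factor \<open>\<rho>\<close>, which contains the inverse of the
  smallest admitted divisor only once.\<close>

lemma nf_bounds:
  fixes P :: "nat \<Rightarrow> 'n ham"
  assumes P: "\<And>n. symf (P n)" "\<And>n. zm (P n)" and P0: "P 0 = diag \<omega>" and eta: "0 < \<eta>" "\<eta> \<le> 1"
    and r: "1 \<le> r" and A: "1 \<le> A" and Pb: "\<And>n. 1 \<le> n \<Longrightarrow> n \<le> r \<Longrightarrow> cls e1 n (A ^ n) (P n)"
    and del: "\<delta> = 1 / (4 * real r)" and B: "B = \<delta> * \<eta> / (2 * real (r + 2) * real (r + 2) * real r)"
    and rho: "\<rho> = 4 * A / B" and n: "1 \<le> n" "n \<le> r"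
  shows "cls e1 n (B * \<rho> ^ n) (nZ \<omega> P \<eta> n)"
    and "cls e1 n (real r / \<eta> * B * \<rho> ^ n) (nX \<omega> P \<eta> n)"
proof -
  let ?X = "nX \<omega> P \<eta>" and ?Z = "nZ \<omega> P \<eta>"
  let ?k = "2 * real (r + 2) * real (r + 2)"
  define x where "x j = real r / \<eta> * B * \<rho> ^ j" for j
  have d: "0 < \<delta>" "\<delta> \<le> 1 / 4" "real r * \<delta> \<le> 1 / 4" using r by (auto simp: del field_simps)
  have B0: "0 < B" using d eta r by (simp add: B)
  have "1 \<le> 2 * (r + 2) * (r + 2) * r" using r by (simp add: Suc_le_eq)
  hence "real 1 \<le> real (2 * (r + 2) * (r + 2) * r)" by (rule of_nat_mono)
  hence "1 \<le> ?k * real r" by (simp only: of_nat_mult of_nat_1 of_nat_numeral)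
  moreover have "\<delta> * \<eta> \<le> 1 * 1" using d eta by (intro mult_mono) auto
  ultimately have B1: "B \<le> 1" unfolding B by (simp add: divide_le_eq_1)
  have rho0: "0 < \<rho>" using B0 A by (simp add: rho)
  \<comment> \<open>The value of \<open>B\<close> is tuned to this: dividing by a divisor costs
    \<open>r / \<eta>\<close>, a bracket up to \<open>2 (r + 2)^2\<close>, and the product of both
    with \<open>B\<close> is \<delta>.\<close>
  have small: "?k * x j \<le> \<delta> * \<rho> ^ j" for j
  proof -
    have gen: "k * (R / \<eta> * (\<delta> * \<eta> / (k * R)) * y) = \<delta> * y" if "0 < k" "0 < R" for k R y :: real
      using eta that by (simp add: field_simps)
    have "?k * x j = \<delta> * \<rho> ^ j"
      unfolding x_def B by (rule gen) (use r in auto)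
    thus ?thesis by simp
  qed
  have "4 * A / B \<ge> A / B" using A B0 by (simp add: field_simps)
  \<comment> \<open>Since \<open>B \<le> 1\<close>, the base \<open>4 A / B\<close> reserves for the
    perturbation itself only a quarter of the admissible size \<open>B * \<rho> ^ m\<close>.\<close>
  have AB: "A ^ m \<le> B / 4 * \<rho> ^ m" if m: "1 \<le> m" for m
  proof -
    have "1 \<le> 4 / B" using B0 B1 by (simp add: field_simps)
    hence "(4 / B) ^ 1 \<le> (4 / B) ^ m" using m by (intro power_increasing) auto
    hence "A ^ m * (4 / B) \<le> A ^ m * (4 / B) ^ m" using A by (intro mult_left_mono) auto
    hence "A ^ m * (4 / B) * (B / 4) \<le> A ^ m * (4 / B) ^ m * (B / 4)"
      using B0 by (intro mult_right_mono) auto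
    thus ?thesis using B0 by (simp add: rho power_mult_distrib power_divide mult_ac)
  qed
  have main: "cls e1 n (B * \<rho> ^ n) (nPsi \<omega> P \<eta> n) \<and> cls e1 n (B * \<rho> ^ n) (?Z n) \<and> cls e1 n (x n) (?X n)"
    if "1 \<le> n" "n \<le> r" for n
    using that
  proof (induction n rule: less_induct)
    case (less n)
    then obtain n' where n': "n = Suc n'" by (metis Suc_le_D One_nat_def)
    have IH: "cls e1 j (B * \<rho> ^ j) (?Z j)" "cls e1 j (x j) (?X j)" if "1 \<le> j" "j < n" for j
      using less that by auto
    define Y where "Y = ?X(n := \<lambda>_. 0)"
    have Y: "cls e1 j (x j) (Y j)" if "1 \<le> j" "j < n" for j
      using IH that by (simp add: Y_def)
    have eqT: "lieT Y m F = lieT ?X m F" if "m < n" for m F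
      unfolding Y_def by (rule lieT_cong) (use that in auto)
    have TZ: "cls e1 m ((B * \<rho> ^ i) * (if m - i = 0 then 1 else \<delta> * \<rho> ^ (m - i))) (lieT ?X (m - i) (?Z i))"
      if i: "1 \<le> i" "i \<le> m" "i < n" "m \<le> n" for i m
    proof -
      have "cls e1 (i + (m - i)) ((B * \<rho> ^ i) * (if m - i = 0 then 1 else \<delta> * \<rho> ^ (m - i))) (lieT ?X (m - i) (?Z i))"
        by (rule cls_lieT[OF cls_br_e1 IH(2) small IH(1)]) (use that less.prems d rho0 in auto)
      thus ?thesis using i by simp
    qed
    text \<open>The transformed quadratic part is controlled through the identities of lower grade.\<close>
    have TH: "cls e1 m (2 * B * \<rho> ^ m) (lieT ?X m (?Z 0))" if m: "1 \<le> m" "m < n" for m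
    proof -
      let ?c = "\<lambda>i. (B * \<rho> ^ i) * (if m - i = 0 then 1 else \<delta> * \<rho> ^ (m - i))"
      have eqF: "lieT ?X m (?Z 0) = (\<lambda>M. P m M + - 1 * (\<Sum>i\<in>{1..m}. lieT ?X (m - i) (?Z i) M))"
      proof
        fix M
        have "{..m} = insert 0 {1..m}" by auto
        hence "P m M = (\<Sum>i\<in>insert 0 {1..m}. lieT ?X (m - i) (?Z i) M)"
          using nf_identity[where P = P, OF P P0 eta(1), of m M] by simp
        thus "lieT ?X m (?Z 0) M = P m M + - 1 * (\<Sum>i\<in>{1..m}. lieT ?X (m - i) (?Z i) M)" by simp
      qed
      have c: "cls e1 m (A ^ m + cmod (- 1) * (\<Sum>i\<in>{1..m}. ?c i))
          (\<lambda>M. P m M + - 1 * (\<Sum>i\<in>{1..m}. lieT ?X (m - i) (?Z i) M))"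
        by (intro cls_add cls_scale cls_sum Pb TZ) (use m less.prems in auto)
      have le: "A ^ m + cmod (- 1) * (\<Sum>i\<in>{1..m}. ?c i) \<le> 2 * B * \<rho> ^ m"
      proof -
        have "(\<Sum>i\<in>{1..m}. ?c i) \<le> (\<Sum>i\<in>{1..m}. B * \<rho> ^ m * \<delta> + (if i = m then B * \<rho> ^ m else 0))"
        proof (rule sum_mono)
          fix i assume i: "i \<in> {1..m}"
          have "\<rho> ^ i * \<rho> ^ (m - i) = \<rho> ^ m" using i by (simp flip: power_add)
          thus "?c i \<le> B * \<rho> ^ m * \<delta> + (if i = m then B * \<rho> ^ m else 0)"
            using i B0 d rho0 by (auto simp: mult_ac)
        qed
        also have "... = B * \<rho> ^ m * (real m * \<delta>) + B * \<rho> ^ m"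
          using m by (simp add: sum.distrib)
        also have "... \<le> B * \<rho> ^ m * (1 / 4) + B * \<rho> ^ m"
        proof -
          have "real m * \<delta> \<le> real r * \<delta>" using m less.prems d by (intro mult_right_mono) auto
          hence "real m * \<delta> \<le> 1 / 4" using d by linarith
          thus ?thesis using B0 rho0 by (intro add_right_mono mult_left_mono) auto
        qed
        finally have "(\<Sum>i\<in>{1..m}. ?c i) \<le> B * \<rho> ^ m * (1 / 4) + B * \<rho> ^ m" .
        moreover have "0 \<le> B * \<rho> ^ m" using B0 rho0 by simp
        ultimately show ?thesis using AB[OF m(1)] unfolding norm_minus_cancel norm_one by linarith
      qed
      show ?thesis unfolding eqF by (rule cls_mono[OF c le])
    qed
    have T0: "cls e1 n (2 * \<delta> * B * \<rho> ^ n) (lieT Y n (?Z 0))"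
    proof -
      have c: "cls e1 n (2 * \<delta> * B * \<rho> ^ n) (br (Y (Suc j)) (lieT Y (n' - j) (?Z 0)))" if j: "j \<le> n'" for j
      proof (cases "j = n'")
        case True
        have "br (Y (Suc j)) (lieT Y (n' - j) (?Z 0)) = (\<lambda>_. 0)"
          by (simp add: True Y_def n' br_zero_left fun_eq_iff)
        thus ?thesis using d B0 rho0 by (simp add: cls_zero)
      next
        case False
        have "cls e1 (Suc j + (n' - j)) (2 * real (Suc j + 2) * real (n' - j + 2) * x (Suc j) * (2 * B * \<rho> ^ (n' - j)))
            (br (Y (Suc j)) (lieT Y (n' - j) (?Z 0)))"
        proof (rule cls_br_e1)
          show "cls e1 (Suc j) (x (Suc j)) (Y (Suc j))" by (rule Y) (use j n' False in auto)
          have "n' - j < n" using n' by simp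
          show "cls e1 (n' - j) (2 * B * \<rho> ^ (n' - j)) (lieT Y (n' - j) (?Z 0))"
            unfolding eqT[OF \<open>n' - j < n\<close>] by (rule TH) (use j n' False in auto)
        qed
        moreover have "Suc j + (n' - j) = n" using j n' by simp
        moreover have "2 * real (Suc j + 2) * real (n' - j + 2) * x (Suc j) * (2 * B * \<rho> ^ (n' - j)) \<le> 2 * \<delta> * B * \<rho> ^ n"
        proof -
          have x0: "0 \<le> x (Suc j)" using eta B0 rho0 by (simp add: x_def)
          have "2 * real (Suc j + 2) * real (n' - j + 2) * x (Suc j) \<le> ?k * x (Suc j)"
            using less.prems n' j x0 by (intro mult_right_mono mult_mono) auto
          also have "... \<le> \<delta> * \<rho> ^ Suc j" by (rule small)
          finally have "2 * real (Suc j + 2) * real (n' - j + 2) * x (Suc j) * (2 * B * \<rho> ^ (n' - j))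
              \<le> \<delta> * \<rho> ^ Suc j * (2 * B * \<rho> ^ (n' - j))"
            using B0 rho0 by (intro mult_right_mono) auto
          also have "... = 2 * \<delta> * B * \<rho> ^ (Suc j + (n' - j))" by (simp add: power_add)
          finally show ?thesis using j n' by simp
        qed
        ultimately show ?thesis using cls_mono by metis
      qed
      have c1: "cls e1 n (cmod (1 / of_nat n) * (\<Sum>j\<in>{..n'}. 2 * \<delta> * B * \<rho> ^ n))
          (\<lambda>M. 1 / of_nat n * (\<Sum>j\<in>{..n'}. br (Y (Suc j)) (lieT Y (n' - j) (?Z 0)) M))"
        by (intro cls_scale cls_sum c) auto
      have c2: "cmod (1 / of_nat n) * (\<Sum>j\<in>{..n'}. 2 * \<delta> * B * \<rho> ^ n) = 2 * \<delta> * B * \<rho> ^ n"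
        using n' by (simp add: norm_divide del: of_nat_Suc)
      have c3: "(\<lambda>M. 1 / of_nat n * (\<Sum>j\<in>{..n'}. br (Y (Suc j)) (lieT Y (n' - j) (?Z 0)) M)) = lieT Y n (?Z 0)"
        unfolding n' lieT.simps(2) by (simp del: of_nat_Suc)
      show ?thesis using c1 unfolding c2 c3 .
    qed
    have Psi: "cls e1 n (B * \<rho> ^ n) (nPsi \<omega> P \<eta> n)"
    proof -
      let ?c = "\<lambda>i. (B * \<rho> ^ i) * (if n - i = 0 then 1 else \<delta> * \<rho> ^ (n - i))"
      have eqF: "nPsi \<omega> P \<eta> n = (\<lambda>M. (P n M + - 1 * lieT Y n (?Z 0) M) + - 1 * (\<Sum>i\<in>{1..<n}. lieT ?X (n - i) (?Z i) M))"
      proof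
        fix M
        have "{..<n} = insert 0 {1..<n}" using n' by auto
        hence "(\<Sum>j<n. lieT Y (n - j) (?Z j) M) = lieT Y n (?Z 0) M + (\<Sum>i\<in>{1..<n}. lieT Y (n - i) (?Z i) M)"
          by simp
        also have "(\<Sum>i\<in>{1..<n}. lieT Y (n - i) (?Z i) M) = (\<Sum>i\<in>{1..<n}. lieT ?X (n - i) (?Z i) M)"
          by (intro sum.cong refl) (simp add: eqT)
        finally show "nPsi \<omega> P \<eta> n M = (P n M + - 1 * lieT Y n (?Z 0) M) + - 1 * (\<Sum>i\<in>{1..<n}. lieT ?X (n - i) (?Z i) M)"
          unfolding nPsi_def Y_def[symmetric] by simp
      qed
      have c: "cls e1 n ((A ^ n + cmod (- 1) * (2 * \<delta> * B * \<rho> ^ n)) + cmod (- 1) * (\<Sum>i\<in>{1..<n}. ?c i))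
         (\<lambda>M. (P n M + - 1 * lieT Y n (?Z 0) M) + - 1 * (\<Sum>i\<in>{1..<n}. lieT ?X (n - i) (?Z i) M))"
        by (intro cls_add cls_scale cls_sum Pb T0 TZ) (use less.prems in auto)
      \<comment> \<open>The budget: a quarter for the perturbation, a half for the transformed
        quadratic part because \<delta> is at most 1/4, and a quarter for the fewer than
        \<open>r\<close> transformed normal forms of lower grade.\<close>
      have le: "(A ^ n + cmod (- 1) * (2 * \<delta> * B * \<rho> ^ n)) + cmod (- 1) * (\<Sum>i\<in>{1..<n}. ?c i) \<le> B * \<rho> ^ n"
      proof -
        have "(\<Sum>i\<in>{1..<n}. ?c i) = (\<Sum>i\<in>{1..<n}. B * \<rho> ^ n * \<delta>)"
        proof (rule sum.cong[OF refl])
          fix i assume i: "i \<in> {1..<n}"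
          have "\<rho> ^ i * \<rho> ^ (n - i) = \<rho> ^ n" using i by (simp flip: power_add)
          thus "?c i = B * \<rho> ^ n * \<delta>" using i by (auto simp: mult_ac)
        qed
        also have "... = B * \<rho> ^ n * (real (n - 1) * \<delta>)" by simp
        also have "... \<le> B * \<rho> ^ n * (1 / 4)"
        proof -
          have "real (n - 1) * \<delta> \<le> real r * \<delta>" using less.prems d by (intro mult_right_mono) auto
          hence "real (n - 1) * \<delta> \<le> 1 / 4" using d by linarith
          thus ?thesis using B0 rho0 by (intro mult_left_mono) auto
        qed
        finally have 1: "(\<Sum>i\<in>{1..<n}. ?c i) \<le> B * \<rho> ^ n * (1 / 4)" .
        have "\<delta> * (B * \<rho> ^ n) \<le> 1 / 4 * (B * \<rho> ^ n)" using d B0 rho0 by (intro mult_right_mono) auto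
        thus ?thesis using 1 AB[OF less.prems(1)] by (simp add: mult.assoc)
      qed
      show ?thesis unfolding eqF by (rule cls_mono[OF c le])
    qed
    note PD = clsD[OF Psi]
    have "cls e1 n (B * \<rho> ^ n) (?Z n)"
      unfolding cls_def
    proof (intro conjI allI impI)
      show "symf (?Z n)" "zm (?Z n)" using regular_nf(3,4)[where P = P, OF P] by auto
      show "0 \<le> B * \<rho> ^ n" by (rule PD)
      fix M
      show "length M = n + 2" if "?Z n M \<noteq> 0"
        using that PD(4)[of M] n' by (auto simp: nf_pos split: if_splits)
      show "cmod (?Z n M) \<le> B * \<rho> ^ n * fact (n + 2) * exp (e1 M)"
        using PD(3) PD(5)[of M] n' by (auto simp: nf_pos)
    qed
    moreover have "cls e1 n (x n) (?X n)"
      unfolding cls_def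
    proof (intro conjI allI impI)
      show "symf (?X n)" "zm (?X n)" using regular_nf(1,2)[where P = P, OF P] by auto
      show "0 \<le> x n" using eta B0 rho0 by (simp add: x_def)
      fix M
      show "length M = n + 2" if "?X n M \<noteq> 0"
        using that PD(4)[of M] n' by (auto simp: nf_pos split: if_splits)
      show "cmod (?X n M) \<le> x n * fact (n + 2) * exp (e1 M)"
      proof (cases "\<bar>freq_sum \<omega> M\<bar> < \<eta>")
        case True
        thus ?thesis using n' eta B0 rho0 by (simp add: nf_pos x_def)
      next
        case False
        have "cmod (?X n M) = real n * cmod (nPsi \<omega> P \<eta> n M) / \<bar>freq_sum \<omega> M\<bar>"
          using False n' by (simp add: nf_pos norm_mult norm_divide del: of_nat_Suc)
        also have "... \<le> real r * (B * \<rho> ^ n * fact (n + 2) * exp (e1 M)) / \<eta>"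
          using PD(5)[of M] False less.prems eta B0 rho0 by (intro frac_le mult_mono) auto
        finally show ?thesis by (simp add: x_def mult_ac)
      qed
    qed
    ultimately show ?case using Psi by blast
  qed
  thus "cls e1 n (B * \<rho> ^ n) (nZ \<omega> P \<eta> n)"
    and "cls e1 n (real r / \<eta> * B * \<rho> ^ n) (nX \<omega> P \<eta> n)"
    using n by (auto simp: x_def)
qed

end

section \<open>The multilinear estimate\<close>

definition LS :: "'a set \<Rightarrow> nat \<Rightarrow> 'a list set" where
  "LS S k = {M. set M \<subseteq> S \<and> length M = k}"

lemma finite_LS [simp]: "finite S \<Longrightarrow> finite (LS S k)"
  unfolding LS_def by (rule finite_lists_length_eq)

lemma LS_0 [simp]: "LS S 0 = {[]}"
  by (auto simp: LS_def)

lemma LS_Suc: "LS S (Suc k) = (\<lambda>(K, M). K # M) ` (S \<times> LS S k)"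
  by (force simp: LS_def length_Suc_conv)

lemma sum_LS_Suc:
  fixes g :: "'a list \<Rightarrow> 'b::comm_monoid_add"
  shows "(\<Sum>M\<in>LS S (Suc k). g M) = (\<Sum>K\<in>S. \<Sum>M\<in>LS S k. g (K # M))"
proof -
  have "inj_on (\<lambda>(K, M). K # M) (S \<times> LS S k)" by (auto simp: inj_on_def)
  thus ?thesis unfolding LS_Suc
    by (simp add: sum.reindex sum.cartesian_product case_prod_unfold)
qed

fun prodl :: "('a \<Rightarrow> real) list \<Rightarrow> 'a list \<Rightarrow> real" where
  "prodl (x # xs) (J # M) = x J * prodl xs M"
| "prodl _ _ = 1"

text \<open>Cauchy-Schwarz on the pairs of given total momentum: each mode has at most two partners,
  so the squares of either factor are counted at most twice.\<close>

lemma sum_pair_le: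
  assumes S: "finite S" and v: "(\<Sum>K\<in>S. (v K)^2) \<le> z^2" and w: "(\<Sum>K\<in>S. (w K)^2) \<le> y^2"
    and pos: "0 \<le> z" "0 \<le> (y::real)"
  shows "(\<Sum>K\<in>S. \<Sum>L\<in>S. of_bool (smom K + smom L = q) * (v K * w L)) \<le> 2 * z * y"
proof -
  let ?R = "{(K, L) \<in> S \<times> S. smom K + smom L = q}"
  have fin: "finite ?R" using S by (rule_tac finite_subset[of _ "S \<times> S"]) auto
  have split: "(\<Sum>K\<in>S. \<Sum>L\<in>S. of_bool (smom K + smom L = q) * g K L) = (\<Sum>(K, L)\<in>?R. g K L)"
    for g :: "_ \<Rightarrow> _ \<Rightarrow> real"
  proof -
    have "(\<Sum>K\<in>S. \<Sum>L\<in>S. of_bool (smom K + smom L = q) * g K L)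
        = (\<Sum>(K, L)\<in>S \<times> S. of_bool (smom K + smom L = q) * g K L)"
      by (rule sum.cartesian_product)
    also have "... = (\<Sum>(K, L)\<in>?R. of_bool (smom K + smom L = q) * g K L)"
      using S by (intro sum.mono_neutral_right) auto
    also have "... = (\<Sum>(K, L)\<in>?R. g K L)" by (intro sum.cong) auto
    finally show ?thesis .
  qed
  have sq: "(\<Sum>K\<in>S. \<Sum>L\<in>S. of_bool (smom K + smom L = q) * (v K)^2) \<le> 2 * z^2" if "(\<Sum>K\<in>S. (v K)^2) \<le> z^2"
    for v :: "'a mode \<Rightarrow> real" and z
  proof -
    have "(\<Sum>K\<in>S. \<Sum>L\<in>S. of_bool (smom K + smom L = q) * (v K)^2) \<le> (\<Sum>K\<in>S. 2 * (v K)^2)"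
    proof (rule sum_mono)
      fix K
      show "(\<Sum>L\<in>S. of_bool (smom K + smom L = q) * (v K)^2) \<le> 2 * (v K)^2"
        by (rule sum_smom_le[OF S, where q = "q - smom K"]) (auto simp: eq_diff_eq add.commute)
    qed
    also have "... \<le> 2 * z^2" using that by (simp flip: sum_distrib_left)
    finally show ?thesis .
  qed
  have "(\<Sum>(K, L)\<in>?R. v K * w L)^2 \<le> (\<Sum>(K, L)\<in>?R. (v K)^2) * (\<Sum>(K, L)\<in>?R. (w L)^2)"
    using Cauchy_Schwarz_ineq_sum[of "\<lambda>(K, L). v K" "\<lambda>(K, L). w L" ?R] by (simp add: case_prod_unfold)
  also have "... \<le> (2 * z^2) * (2 * y^2)"
  proof (rule mult_mono)
    show "(\<Sum>(K, L)\<in>?R. (v K)^2) \<le> 2 * z^2" using sq[OF v] unfolding split .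
    have "(\<Sum>(K, L)\<in>?R. (w L)^2) = (\<Sum>K\<in>S. \<Sum>L\<in>S. of_bool (smom K + smom L = q) * (w L)^2)"
      unfolding split ..
    also have "... = (\<Sum>L\<in>S. \<Sum>K\<in>S. of_bool (smom L + smom K = q) * (w L)^2)"
      by (subst sum.swap) (simp add: add.commute)
    also have "... \<le> 2 * y^2" by (rule sq[OF w])
    finally show "(\<Sum>(K, L)\<in>?R. (w L)^2) \<le> 2 * y^2" .
  qed (auto intro!: sum_nonneg)
  also have "... = (2 * z * y)^2" by (simp add: power2_eq_square)
  finally have "(\<Sum>(K, L)\<in>?R. v K * w L) \<le> 2 * z * y"
    by (rule power2_le_imp_le) (use pos in simp)
  thus ?thesis unfolding split .
qed

text \<open>The constant \<open>b\<close> converts square sums at rate \<open>s\<close> into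
  absolute sums at rate \<open>s1\<close> by Cauchy-Schwarz; every minor mode of a monomial is
  summed in this way.\<close>

locale weight_sum = weight \<phi> Cf C1 s0 s for \<phi> :: "('n::finite) mode \<Rightarrow> real" and Cf C1 s0 s +
  fixes b :: real
  assumes b1: "1 \<le> b"
    and b_sum: "finite S \<Longrightarrow> (\<Sum>J\<in>S. exp (- 2 * (s - s1) * \<phi> J)) \<le> b^2"
begin

definition bdd2 :: "('n mode \<Rightarrow> real) \<Rightarrow> real \<Rightarrow> bool" where
  "bdd2 x y \<longleftrightarrow> 0 \<le> y \<and> (\<forall>J. 0 \<le> x J) \<and> (\<forall>S. finite S \<longrightarrow> (\<Sum>J\<in>S. (x J * exp (s * \<phi> J))^2) \<le> y^2)"

lemma bdd2_sup: "bdd2 x y \<Longrightarrow> x J * exp (s * \<phi> J) \<le> y"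
proof -
  assume *: "bdd2 x y"
  hence "(\<Sum>J\<in>{J}. (x J * exp (s * \<phi> J))^2) \<le> y^2" unfolding bdd2_def by blast
  thus ?thesis using * by (auto simp: bdd2_def intro: power2_le_imp_le)
qed

lemma bdd2_sum1:
  assumes x: "bdd2 x y" and S: "finite S"
  shows "(\<Sum>J\<in>S. x J * exp (s1 * \<phi> J)) \<le> b * y"
proof -
  have eq: "(\<Sum>J\<in>S. x J * exp (s1 * \<phi> J)) = (\<Sum>J\<in>S. (x J * exp (s * \<phi> J)) * exp (- (s - s1) * \<phi> J))"
    by (intro sum.cong refl) (simp add: mult.assoc left_diff_distrib flip: exp_add)
  have "(\<Sum>J\<in>S. x J * exp (s1 * \<phi> J))^2
      \<le> (\<Sum>J\<in>S. (x J * exp (s * \<phi> J))^2) * (\<Sum>J\<in>S. (exp (- (s - s1) * \<phi> J))^2)"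
    unfolding eq by (rule Cauchy_Schwarz_ineq_sum)
  also have "(\<Sum>J\<in>S. (exp (- (s - s1) * \<phi> J))^2) = (\<Sum>J\<in>S. exp (- 2 * (s - s1) * \<phi> J))"
    by (intro sum.cong refl) (simp add: mult.assoc flip: exp_double)
  also have "(\<Sum>J\<in>S. (x J * exp (s * \<phi> J))^2) * ... \<le> y^2 * b^2"
    using x S b_sum[OF S] by (intro mult_mono) (auto simp: bdd2_def intro: sum_nonneg)
  also have "... = (b * y)^2" by (simp add: power_mult_distrib)
  finally show ?thesis
    by (rule power2_le_imp_le) (use x b1 in \<open>simp add: bdd2_def\<close>)
qed

lemma prodl_nonneg: "list_all2 bdd2 xs ys \<Longrightarrow> 0 \<le> prodl xs M"
  by (induction xs M arbitrary: ys rule: prodl.induct) (auto simp: list_all2_Cons1 bdd2_def)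

lemma prod_bdd2_nonneg: "list_all2 bdd2 xs ys \<Longrightarrow> 0 \<le> prod_list ys"
  by (induction xs ys rule: list_all2_induct) (auto simp: bdd2_def)

lemma multi0:
  assumes "list_all2 bdd2 xs ys" "finite S"
  shows "(\<Sum>M\<in>LS S (length xs). prodl xs M * exp (s1 * sm \<phi> M)) \<le> b ^ length xs * prod_list ys"
  using assms(1)
proof (induction xs ys rule: list_all2_induct)
  case (Cons x xs y ys)
  have "(\<Sum>M\<in>LS S (length (x # xs)). prodl (x # xs) M * exp (s1 * sm \<phi> M))
      = (\<Sum>K\<in>S. x K * exp (s1 * \<phi> K)) * (\<Sum>M\<in>LS S (length xs). prodl xs M * exp (s1 * sm \<phi> M))"
    unfolding length_Cons sum_LS_Suc sum_product by (simp add: distrib_left exp_add mult_ac)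
  also have "... \<le> (b * y) * (b ^ length xs * prod_list ys)"
    using Cons b1 prodl_nonneg[OF Cons(2)] prod_bdd2_nonneg[OF Cons(2)] bdd2_sum1[OF Cons(1) assms(2)]
    by (intro mult_mono) (auto simp: bdd2_def intro!: sum_nonneg)
  finally show ?case by (simp add: mult_ac)
qed simp

lemma exp_max_le: "exp (h * max x y) \<le> exp (h * x) + exp (h * y)" for h x y :: real
  by (cases "x \<le> y") (simp_all add: max_def add_increasing add_increasing2)

text \<open>One dominant mode, with its weight, is already contained in \<open>v\<close>. The other
  one is either the head of the list, and then it is paired with \<open>v\<close> at fixed momentum
  while the rest is summed absolutely, or it lies in the tail, and induction applies. Each position
  of the second mode contributes one pair estimate, whence the linear factor.\<close>

lemma multi1:
  assumes "list_all2 bdd2 xs ys" "finite S"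
    and v: "0 \<le> z" "\<And>K. 0 \<le> v K" "\<And>K. v K \<le> z" "(\<Sum>K\<in>S. (v K)^2) \<le> z^2"
  shows "(\<Sum>K\<in>S. \<Sum>M\<in>LS S (length xs). of_bool (smom K + mom M = q) *
      (v K * (prodl xs M * exp (s1 * sm \<phi> M) * exp ((s - s1) * mx \<phi> M))))
    \<le> 2 * (real (length xs) + 1) * z * (b ^ length xs * prod_list ys)"
  using assms(1)
proof (induction xs ys arbitrary: q rule: list_all2_induct)
  case Nil
  have "(\<Sum>K\<in>S. of_bool (smom K = q) * v K) \<le> 2 * z"
    by (rule sum_smom_le[OF assms(2), where q = q]) (use v in auto)
  thus ?case by simp
next
  case (Cons x xs y ys)
  let ?n = "length xs" and ?h = "s - s1"
  let ?B = "b ^ ?n * prod_list ys"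
  let ?p = "\<lambda>M. prodl xs M * exp (s1 * sm \<phi> M)"
  have pos: "0 \<le> ?p M" for M using prodl_nonneg[OF Cons(2)] by simp
  have x0: "0 \<le> x K" "0 \<le> y" for K using Cons(1) unfolding bdd2_def by blast+
  have B0: "0 \<le> ?B" using prod_bdd2_nonneg[OF Cons(2)] b1 by simp
  have "(\<Sum>K\<in>S. \<Sum>M\<in>LS S (length (x # xs)). of_bool (smom K + mom M = q) *
      (v K * (prodl (x # xs) M * exp (s1 * sm \<phi> M) * exp (?h * mx \<phi> M))))
    = (\<Sum>K\<in>S. \<Sum>K'\<in>S. \<Sum>M\<in>LS S ?n. of_bool (smom K + (smom K' + mom M) = q) *
      (v K * (x K' * exp (s1 * \<phi> K') * ?p M * exp (?h * max (\<phi> K') (mx \<phi> M)))))"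
    unfolding length_Cons sum_LS_Suc by (simp add: distrib_left exp_add mult_ac)
  also have "... \<le> (\<Sum>K\<in>S. \<Sum>K'\<in>S. \<Sum>M\<in>LS S ?n. of_bool (smom K + (smom K' + mom M) = q) *
      (v K * (x K' * exp (s1 * \<phi> K') * ?p M * (exp (?h * \<phi> K') + exp (?h * mx \<phi> M)))))"
    by (intro sum_mono mult_left_mono exp_max_le mult_nonneg_nonneg) (use x0 v pos prodl_nonneg[OF Cons(2)] in auto)
  also have "... = (\<Sum>K\<in>S. \<Sum>K'\<in>S. \<Sum>M\<in>LS S ?n. ?p M *
        (of_bool (smom K + smom K' = q - mom M) * (v K * (x K' * exp (s * \<phi> K')))))
      + (\<Sum>K\<in>S. \<Sum>K'\<in>S. \<Sum>M\<in>LS S ?n. (x K' * exp (s1 * \<phi> K')) *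
        (of_bool (smom K + mom M = q - smom K') * (v K * (?p M * exp (?h * mx \<phi> M)))))"
    unfolding sum.distrib[symmetric]
  proof (intro sum.cong refl)
    fix K K' M
    have "exp (s1 * \<phi> K') * exp (?h * \<phi> K') = exp (s * \<phi> K')"
      by (simp add: algebra_simps flip: exp_add)
    moreover have "smom K + (smom K' + mom M) = q \<longleftrightarrow> smom K + smom K' = q - mom M"
      "smom K + (smom K' + mom M) = q \<longleftrightarrow> smom K + mom M = q - smom K'"
      by (auto simp: algebra_simps)
    ultimately show "of_bool (smom K + (smom K' + mom M) = q) *
      (v K * (x K' * exp (s1 * \<phi> K') * ?p M * (exp (?h * \<phi> K') + exp (?h * mx \<phi> M))))
      = ?p M * (of_bool (smom K + smom K' = q - mom M) * (v K * (x K' * exp (s * \<phi> K'))))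
      + (x K' * exp (s1 * \<phi> K')) * (of_bool (smom K + mom M = q - smom K') * (v K * (?p M * exp (?h * mx \<phi> M))))"
      by (simp add: algebra_simps)
  qed
  also have "(\<Sum>K\<in>S. \<Sum>K'\<in>S. \<Sum>M\<in>LS S ?n. ?p M *
        (of_bool (smom K + smom K' = q - mom M) * (v K * (x K' * exp (s * \<phi> K')))))
    \<le> ?B * (2 * z * y)"
  proof -
    have "(\<Sum>K\<in>S. \<Sum>K'\<in>S. \<Sum>M\<in>LS S ?n. ?p M *
        (of_bool (smom K + smom K' = q - mom M) * (v K * (x K' * exp (s * \<phi> K')))))
      = (\<Sum>M\<in>LS S ?n. \<Sum>K\<in>S. \<Sum>K'\<in>S. ?p M *
        (of_bool (smom K + smom K' = q - mom M) * (v K * (x K' * exp (s * \<phi> K')))))"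
      by (subst sum.swap, subst (2) sum.swap, simp)
    also have "... = (\<Sum>M\<in>LS S ?n. ?p M * (\<Sum>K\<in>S. \<Sum>K'\<in>S.
        of_bool (smom K + smom K' = q - mom M) * (v K * (x K' * exp (s * \<phi> K')))))"
      by (simp add: sum_distrib_left)
    also have "... \<le> (\<Sum>M\<in>LS S ?n. ?p M * (2 * z * y))"
      using Cons(1) assms(2) v pos
      by (intro sum_mono mult_left_mono sum_pair_le) (auto simp: bdd2_def)
    also have "... \<le> ?B * (2 * z * y)"
      unfolding sum_distrib_right[symmetric] using multi0[OF Cons(2) assms(2)] v x0
      by (intro mult_right_mono) auto
    finally show ?thesis .
  qed
  also have "(\<Sum>K\<in>S. \<Sum>K'\<in>S. \<Sum>M\<in>LS S ?n. (x K' * exp (s1 * \<phi> K')) *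
        (of_bool (smom K + mom M = q - smom K') * (v K * (?p M * exp (?h * mx \<phi> M)))))
    \<le> (b * y) * (2 * (real ?n + 1) * z * ?B)"
  proof -
    have "(\<Sum>K\<in>S. \<Sum>K'\<in>S. \<Sum>M\<in>LS S ?n. (x K' * exp (s1 * \<phi> K')) *
        (of_bool (smom K + mom M = q - smom K') * (v K * (?p M * exp (?h * mx \<phi> M)))))
      = (\<Sum>K'\<in>S. (x K' * exp (s1 * \<phi> K')) * (\<Sum>K\<in>S. \<Sum>M\<in>LS S ?n.
        of_bool (smom K + mom M = q - smom K') * (v K * (?p M * exp (?h * mx \<phi> M)))))"
      by (subst sum.swap) (simp add: sum_distrib_left)
    also have "... \<le> (\<Sum>K'\<in>S. (x K' * exp (s1 * \<phi> K')) * (2 * (real ?n + 1) * z * ?B))"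
      using x0 Cons.IH by (intro sum_mono mult_left_mono) auto
    also have "... \<le> (b * y) * (2 * (real ?n + 1) * z * ?B)"
      unfolding sum_distrib_right[symmetric] using bdd2_sum1[OF Cons(1) assms(2)] v B0
      by (intro mult_right_mono) auto
    finally show ?thesis .
  qed
  also have "?B * (2 * z * y) + (b * y) * (2 * (real ?n + 1) * z * ?B)
      \<le> b * (?B * (2 * z * y)) + (b * y) * (2 * (real ?n + 1) * z * ?B)"
    using b1 B0 v x0 mult_right_mono[of 1 b "?B * (2 * z * y)"] by simp
  also have "... = 2 * (real (length (x # xs)) + 1) * z * (b ^ length (x # xs) * prod_list (y # ys))"
    by (simp add: algebra_simps)
  finally show ?case by simp
qed

text \<open>Square summability alone does not sum all modes absolutely at rate \<open>s\<close>, but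
  momentum conservation lets two of them be paired. Either the head is not dominant and is summed at
  rate \<open>s1\<close>, or it is dominant and \<open>multi1\<close> locates the second dominant
  mode; the quadratic factor counts pairs of positions.\<close>

theorem multilinear_bound:
  assumes "list_all2 bdd2 xs ys" "finite S"
  shows "(\<Sum>M\<in>LS S (length xs). of_bool (mom M = q) * (prodl xs M * exp (e2 M)))
    \<le> (real (length xs) + 1)^2 * (b ^ length xs * prod_list ys)"
  using assms(1)
proof (induction xs ys arbitrary: q rule: list_all2_induct)
  case Nil
  show ?case by (simp add: e2_def)
next
  case (Cons x xs y ys)
  let ?n = "length xs" and ?h = "s - s1"
  let ?B = "b ^ ?n * prod_list ys"
  have pos: "0 \<le> prodl xs M" for M using prodl_nonneg[OF Cons(2)] by simp
  have x0: "0 \<le> x K" "0 \<le> y" for K using Cons(1) unfolding bdd2_def by blast+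
  have B0: "0 \<le> ?B" using prod_bdd2_nonneg[OF Cons(2)] b1 by simp
  have e: "exp (e2 (K # M)) \<le> exp (s1 * \<phi> K) * exp (e2 M)
      + exp (s * \<phi> K) * exp (s1 * sm \<phi> M) * exp (?h * mx \<phi> M)" for K M
  proof -
    have "exp (e2 (K # M)) = exp (s1 * (\<phi> K + sm \<phi> M)) * exp (?h * max (top2 \<phi> M) (\<phi> K + mx \<phi> M))"
      by (simp add: e2_def flip: exp_add)
    also have "... \<le> exp (s1 * (\<phi> K + sm \<phi> M)) * (exp (?h * top2 \<phi> M) + exp (?h * (\<phi> K + mx \<phi> M)))"
      by (intro mult_left_mono exp_max_le) auto
    also have "... = exp (s1 * \<phi> K) * exp (e2 M) + exp (s * \<phi> K) * exp (s1 * sm \<phi> M) * exp (?h * mx \<phi> M)"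
      by (simp add: e2_def algebra_simps flip: exp_add)
    finally show ?thesis .
  qed
  have "(\<Sum>M\<in>LS S (length (x # xs)). of_bool (mom M = q) * (prodl (x # xs) M * exp (e2 M)))
    = (\<Sum>K\<in>S. \<Sum>M\<in>LS S ?n. of_bool (smom K + mom M = q) * (x K * prodl xs M * exp (e2 (K # M))))"
    unfolding length_Cons sum_LS_Suc by simp
  also have "... \<le> (\<Sum>K\<in>S. \<Sum>M\<in>LS S ?n. of_bool (smom K + mom M = q) * (x K * prodl xs M *
      (exp (s1 * \<phi> K) * exp (e2 M) + exp (s * \<phi> K) * exp (s1 * sm \<phi> M) * exp (?h * mx \<phi> M))))"
    by (intro sum_mono mult_left_mono e mult_nonneg_nonneg) (use x0 pos in auto)
  also have "... = (\<Sum>K\<in>S. \<Sum>M\<in>LS S ?n. (x K * exp (s1 * \<phi> K)) * (of_bool (mom M = q - smom K) * (prodl xs M * exp (e2 M))))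
      + (\<Sum>K\<in>S. \<Sum>M\<in>LS S ?n. of_bool (smom K + mom M = q) *
        ((x K * exp (s * \<phi> K)) * (prodl xs M * exp (s1 * sm \<phi> M) * exp (?h * mx \<phi> M))))"
    unfolding sum.distrib[symmetric]
  proof (intro sum.cong refl)
    fix K M
    have "smom K + mom M = q \<longleftrightarrow> mom M = q - smom K" by (auto simp: algebra_simps)
    thus "of_bool (smom K + mom M = q) * (x K * prodl xs M *
      (exp (s1 * \<phi> K) * exp (e2 M) + exp (s * \<phi> K) * exp (s1 * sm \<phi> M) * exp (?h * mx \<phi> M)))
      = (x K * exp (s1 * \<phi> K)) * (of_bool (mom M = q - smom K) * (prodl xs M * exp (e2 M)))
      + of_bool (smom K + mom M = q) * ((x K * exp (s * \<phi> K)) * (prodl xs M * exp (s1 * sm \<phi> M) * exp (?h * mx \<phi> M)))"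
      by (simp add: algebra_simps)
  qed
  also have "(\<Sum>K\<in>S. \<Sum>M\<in>LS S ?n. (x K * exp (s1 * \<phi> K)) * (of_bool (mom M = q - smom K) * (prodl xs M * exp (e2 M))))
     \<le> (b * y) * ((real ?n + 1)^2 * ?B)"
  proof -
    have "(\<Sum>K\<in>S. \<Sum>M\<in>LS S ?n. (x K * exp (s1 * \<phi> K)) * (of_bool (mom M = q - smom K) * (prodl xs M * exp (e2 M))))
       \<le> (\<Sum>K\<in>S. (x K * exp (s1 * \<phi> K)) * ((real ?n + 1)^2 * ?B))"
      unfolding sum_distrib_left[symmetric] using x0 Cons.IH by (intro sum_mono mult_left_mono) auto
    also have "... \<le> (b * y) * ((real ?n + 1)^2 * ?B)"
      unfolding sum_distrib_right[symmetric] using bdd2_sum1[OF Cons(1) assms(2)] B0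
      by (intro mult_right_mono) auto
    finally show ?thesis .
  qed
  also have "(\<Sum>K\<in>S. \<Sum>M\<in>LS S ?n. of_bool (smom K + mom M = q) *
        ((x K * exp (s * \<phi> K)) * (prodl xs M * exp (s1 * sm \<phi> M) * exp (?h * mx \<phi> M))))
     \<le> 2 * (real ?n + 1) * y * ?B"
    using Cons(1) assms(2) x0 bdd2_sup[OF Cons(1)]
    by (intro multi1[OF Cons(2) assms(2)]) (auto simp: bdd2_def)
  also have "(b * y) * ((real ?n + 1)^2 * ?B) + 2 * (real ?n + 1) * y * ?B
     \<le> (b * y) * ((real ?n + 1)^2 * ?B) + b * (2 * (real ?n + 1) * y * ?B)"
  proof -
    have "1 * (2 * (real ?n + 1) * y * ?B) \<le> b * (2 * (real ?n + 1) * y * ?B)"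
      using b1 B0 x0 by (intro mult_right_mono) auto
    thus ?thesis by simp
  qed
  also have "... \<le> (real (length (x # xs)) + 1)^2 * (b ^ length (x # xs) * prod_list (y # ys))"
  proof -
    have "(b * y) * ((real ?n + 1)^2 * ?B) + b * (2 * (real ?n + 1) * y * ?B)
       = ((real ?n + 1)^2 + 2 * (real ?n + 1)) * (b * y * ?B)" by (simp add: algebra_simps)
    also have "... \<le> (real (length (x # xs)) + 1)^2 * (b * y * ?B)"
      using b1 x0 B0 by (intro mult_right_mono) (auto simp: power2_eq_square algebra_simps)
    also have "... = (real (length (x # xs)) + 1)^2 * (b ^ length (x # xs) * prod_list (y # ys))"
      by (simp add: mult_ac)
    finally show ?thesis .
  qed
  finally show ?case by simp
qed

end

section \<open>Small divisors\<close>

lemma filter_pick: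
  assumes "0 < length (filter P A)"
  obtains J B where "mset A = mset (J # B)" "P J" "length (filter P A) = Suc (length (filter P B))"
proof -
  obtain J where J: "J \<in> set A" "P J" using assms by (metis filter_False length_greater_0_conv)
  then obtain xs ys where A: "A = xs @ J # ys" by (meson split_list)
  show thesis by (rule that[of J "xs @ ys"]) (use J in \<open>auto simp: A\<close>)
qed

lemma freq_sum_Nil [simp]: "freq_sum w [] = 0"
  and freq_sum_Cons [simp]: "freq_sum w (K # M) = w (fst K) * of_int (sg (snd K)) + freq_sum w M"
  by (simp_all add: freq_sum_def)

lemma abs_sg [simp]: "\<bar>real_of_int (sg \<sigma>)\<bar> = 1"
  by (simp add: sg_def)

lemma freq_sum_abs_le:
  assumes "\<And>K. K \<in> set M \<Longrightarrow> \<bar>w (fst K)\<bar> \<le> x"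
  shows "\<bar>freq_sum w M\<bar> \<le> real (length M) * x"
  using assms
proof (induction M)
  case (Cons K M)
  have "\<bar>freq_sum w (K # M)\<bar> \<le> \<bar>w (fst K)\<bar> + \<bar>freq_sum w M\<bar>"
    by (simp add: abs_mult order_trans[OF abs_triangle_ineq])
  moreover have "\<bar>w (fst K)\<bar> \<le> x" using Cons.prems[of K] by simp
  moreover have "\<bar>freq_sum w M\<bar> \<le> real (length M) * x" using Cons by simp
  ultimately show ?case by (simp add: algebra_simps)
qed simp

lemma freq_sum_nth: "freq_sum w M = (\<Sum>i<length M. w (fst (M ! i)) * of_int (sg (snd (M ! i))))"
  by (simp add: freq_sum_def sum_list_sum_nth atLeast0LessThan)

text \<open>Weights that depend on the frequency alone cancel in the same pairs in which the
  frequencies cancel.\<close>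

lemma paired_freq_sum:
  assumes "paired \<omega> M" and W: "\<And>i j. \<omega> i = \<omega> j \<Longrightarrow> W i = W j"
  shows "freq_sum W M = 0"
proof -
  obtain p h where h: "length M = h + h" and p: "p permutes {..<length M}"
    and eq: "\<And>i. i < h \<Longrightarrow> \<omega> (fst (M ! p i)) = \<omega> (fst (M ! p (i + h)))"
      "\<And>i. i < h \<Longrightarrow> sg (snd (M ! p i)) = - sg (snd (M ! p (i + h)))"
  proof -
    from assms(1) obtain p where *: "even (length M)" "p permutes {..<length M}"
      "\<forall>i < length M div 2. \<omega> (fst (M ! p i)) = \<omega> (fst (M ! p (i + length M div 2))) \<and>
           sg (snd (M ! p i)) = - sg (snd (M ! p (i + length M div 2)))"
      unfolding paired_def by blast
    show thesis by (rule that[of "length M div 2" p]) (use * in auto)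
  qed
  let ?g = "\<lambda>i. W (fst (M ! i)) * real_of_int (sg (snd (M ! i)))"
  have "freq_sum W M = (\<Sum>i<h + h. ?g (p i))"
    unfolding freq_sum_nth using sum.permute[OF p, of ?g] by (simp add: h o_def)
  also have "... = (\<Sum>i<h. ?g (p i)) + (\<Sum>i<h. ?g (p (i + h)))"
  proof -
    have "(\<Sum>i<a + b. f i) = (\<Sum>i<a. f i) + (\<Sum>i<b. f (i + a))" for a b and f :: "nat \<Rightarrow> real"
      by (induction b) (auto simp: add_ac)
    thus ?thesis by blast
  qed
  also have "... = 0"
    unfolding sum.distrib[symmetric]
  proof (intro sum.neutral ballI)
    fix i assume "i \<in> {..<h}"
    thus "?g (p i) + ?g (p (i + h)) = 0" using eq[of i] W[of "fst (M ! p i)" "fst (M ! p (i + h))"] by simp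
  qed
  finally show ?thesis .
qed

context weight
begin

definition g0 :: real where
  "g0 = (s - s0) * (C1 - Cf)"

lemma g0_pos: "0 < g0"
  using s0 Cf by (simp add: g0_def)

text \<open>The two high modes occupy different positions of \<open>A\<close>, so after removing the
  maximum at least \<open>h\<close> remains in the sum that \<open>e2_gain\<close> rewards.\<close>

lemma gain_two_high:
  assumes "mom M = 0" and M: "mset M = mset (K # A)" and A: "mset A = mset (J # L # B)"
    and high: "h \<le> \<phi> J" "h \<le> \<phi> L"
  shows "exp (2 * s * \<phi> K) * exp (e1 M) \<le> exp (- g0 * h) * exp (e2 M)"
proof -
  have "mom (K # A) = 0" using mom_mset[OF M] assms(1) by simp
  moreover have "A \<noteq> []" using A by auto
  ultimately have g: "e1 (K # A) + 2 * s * \<phi> K + g0 * (sm \<phi> A - mx \<phi> A) \<le> e2 (K # A)"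
    using e2_gain[of K A] by (simp add: g0_def)
  have "mx \<phi> (J # L # B) + h \<le> sm \<phi> (J # L # B)"
  proof -
    have "0 \<le> \<phi> J" "0 \<le> \<phi> L" "mx \<phi> B \<le> sm \<phi> B" "0 \<le> mx \<phi> B" using sm_mx by auto
    thus ?thesis using high by (auto simp: max_def simp del: phi_nonneg mx_nonneg)
  qed
  hence "h \<le> sm \<phi> A - mx \<phi> A" using sm_mset[OF A, of \<phi>] top2_mx_mset(2)[OF A, of \<phi>] by simp
  hence "g0 * h \<le> g0 * (sm \<phi> A - mx \<phi> A)" using g0_pos by (intro mult_left_mono) auto
  hence "2 * s * \<phi> K + e1 M \<le> - g0 * h + e2 M" using g e1_mset[OF M] e2_mset[OF M] by simp
  thus ?thesis by (simp flip: exp_add)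
qed

text \<open>With three modes above \<open>N\<close>, every mode of the list has two other high ones,
  and the gain applies. If no mode exceeds \<open>N'\<close>, a small divisor is an exact resonance
  and the weights cancel. In between, one mode is above \<open>N'\<close> and exactly one other is
  above \<open>N\<close>: these two are shown to have equal weights and opposite signs, so they drop
  out of the weight sum and serve as the high modes for all others. \<open>N'\<close> is chosen so
  large that the remaining modes cannot compensate a frequency gap between the two.\<close>

lemma resonant_weight_bound:
  fixes \<omega> W :: "int ^ 'n \<Rightarrow> real"
  assumes W: "\<And>K :: 'n mode. 0 \<le> W (fst K)" "\<And>K :: 'n mode. W (fst K) \<le> CW * exp (2 * s * \<phi> K)"
    and cluster: "\<And>i j. i \<noteq> j \<Longrightarrow> W i = W j \<or> C2 * (site_norm i powr \<delta> + site_norm j powr \<delta>) \<le> \<bar>\<omega> i - \<omega> j\<bar>"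
    and C2: "0 < C2" "0 < \<delta>" and bet: "0 < \<beta>" and c0: "0 < c0"
    and upper: "\<And>j. \<bar>\<omega> j\<bar> \<le> C0 * (1 + site_norm j) powr \<beta>" and C0: "0 \<le> C0"
    and lower: "\<And>j. R \<le> site_norm j \<Longrightarrow> c0 * site_norm j powr \<beta> \<le> \<omega> j"
    and nonres: "\<And>Js. (\<forall>J\<in>set Js. mode_norm J \<le> N') \<Longrightarrow>
          (freq_sum \<omega> Js \<noteq> 0 \<longrightarrow> \<gamma> * N' powr (- \<tau> * real (length Js) powr p) \<le> \<bar>freq_sum \<omega> Js\<bar>) \<and>
          (freq_sum \<omega> Js = 0 \<longrightarrow> paired \<omega> Js)"
    and par: "0 < \<gamma>" "0 < \<tau>" "1 \<le> p"
    and N: "R \<le> N" "1 \<le> N" "real k * N \<le> N'" "R \<le> N'" "1 \<le> k"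
      "1 + real k * (C0 * (1 + N) powr \<beta>) \<le> C2 * N' powr \<delta>"
      "1 + real k * (C0 * (1 + N) powr \<beta>) \<le> c0 * N' powr \<beta>"
    and high: "\<And>J. N < mode_norm J \<Longrightarrow> h \<le> \<phi> J"
    and eta: "\<eta> \<le> \<gamma> * N' powr (- \<tau> * real k powr p)" "\<eta> \<le> 1"
    and M: "mom M = 0" "length M \<le> k" "\<bar>freq_sum \<omega> M\<bar> < \<eta>"
  shows "\<bar>freq_sum W M\<bar> * exp (e1 M) \<le> real (length M) * (CW * exp (- g0 * h) * exp (e2 M))"
proof -
  let ?H = "\<lambda>J :: 'n mode. N < mode_norm J"
  let ?bound = "CW * exp (- g0 * h) * exp (e2 M)"
  have CW: "0 \<le> CW"
    using W[of undefined] by (meson exp_gt_zero mult_le_cancel_right order_trans zero_le_mult_iff not_le mult_neg_pos)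
  have bound0: "0 \<le> ?bound" using CW by simp
  have N'N: "N \<le> N'" "1 \<le> N'"
  proof -
    have "1 * N \<le> real k * N" using N by (intro mult_right_mono) auto
    thus "N \<le> N'" "1 \<le> N'" using N by linarith+
  qed
  have trm: "W (fst K) * exp (e1 M) \<le> ?bound" if M': "mset M = mset (K # A)" "mset A = mset (J # L # B)"
    and H: "?H J" "?H L" for K A J L B
  proof -
    have "W (fst K) * exp (e1 M) \<le> CW * exp (2 * s * \<phi> K) * exp (e1 M)"
      using W(2)[of K] by (intro mult_right_mono) auto
    also have "... = CW * (exp (2 * s * \<phi> K) * exp (e1 M))" by simp
    also have "... \<le> CW * (exp (- g0 * h) * exp (e2 M))"
      using gain_two_high[OF M(1) M', of h] high[OF H(1)] high[OF H(2)] CW by (intro mult_left_mono) auto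
    finally show ?thesis by simp
  qed
  \<comment> \<open>For different weights, equal frequencies contradict the separation unless both
    sites are the origin, and then the sites coincide.\<close>
  have W_eq: "W i = W j" if "\<omega> i = \<omega> j" for i j
  proof (rule ccontr)
    assume ne: "W i \<noteq> W j"
    hence "i \<noteq> j" by auto
    with cluster[of i j] ne that have "C2 * (site_norm i powr \<delta> + site_norm j powr \<delta>) \<le> 0" by auto
    hence "site_norm i powr \<delta> + site_norm j powr \<delta> \<le> 0" using C2 by (simp add: mult_le_0_iff)
    hence "site_norm i powr \<delta> = 0" "site_norm j powr \<delta> = 0"
      using powr_ge_zero[of "site_norm i" \<delta>] powr_ge_zero[of "site_norm j" \<delta>] by linarith+
    hence "site_norm i = 0" "site_norm j = 0" by simp_all
    hence "i = 0" "j = 0" by (simp_all add: site_norm_def vec_eq_iff)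
    thus False using \<open>i \<noteq> j\<close> by simp
  qed
  consider (low) "\<forall>J\<in>set M. mode_norm J \<le> N'" | (three) "3 \<le> length (filter ?H M)"
    | (two) "\<exists>J\<in>set M. N' < mode_norm J" "length (filter ?H M) \<le> 2"
  proof -
    show thesis
    proof (cases "3 \<le> length (filter ?H M)")
      case False
      hence "length (filter ?H M) \<le> 2" by simp
      thus ?thesis using low two not_le by blast
    qed (rule three)
  qed
  thus ?thesis
  proof cases
    case low
    \<comment> \<open>The divisor lies below the smallest nonzero value that \<open>k\<close> modes
      of size up to \<open>N'\<close> can produce.\<close>
    have "freq_sum \<omega> M = 0"
    proof (rule ccontr)
      assume "freq_sum \<omega> M \<noteq> 0"
      hence "\<gamma> * N' powr (- \<tau> * real (length M) powr p) \<le> \<bar>freq_sum \<omega> M\<bar>" using nonres low by blast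
      moreover have "\<gamma> * N' powr (- \<tau> * real k powr p) \<le> \<gamma> * N' powr (- \<tau> * real (length M) powr p)"
      proof -
        have "real (length M) powr p \<le> real k powr p" using par M(2) by (intro powr_mono2) auto
        hence "\<tau> * real (length M) powr p \<le> \<tau> * real k powr p" using par by (intro mult_left_mono) auto
        thus ?thesis using par N'N by (intro mult_left_mono[OF powr_mono]) auto
      qed
      ultimately show False using eta M(3) by simp
    qed
    hence "paired \<omega> M" using nonres low by blast
    hence "freq_sum W M = 0" using paired_freq_sum[of \<omega> M W] W_eq by blast
    thus ?thesis using bound0 by simp
  next
    case three
    have "W (fst K) \<le> ?bound / exp (e1 M)" if Kin: "K \<in> set M" for K
    proof -
      obtain xs ys where K: "M = xs @ K # ys" using Kin by (meson split_list)
      have "length (filter ?H M) \<le> Suc (length (filter ?H (xs @ ys)))" by (simp add: K)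
      hence "0 < length (filter ?H (xs @ ys))" using three by linarith
      then obtain J B where J: "mset (xs @ ys) = mset (J # B)" "?H J"
        "length (filter ?H (xs @ ys)) = Suc (length (filter ?H B))" by (rule filter_pick)
      hence "0 < length (filter ?H B)"
        using three \<open>length (filter ?H M) \<le> Suc (length (filter ?H (xs @ ys)))\<close> by linarith
      then obtain L B' where L: "mset B = mset (L # B')" "?H L" by (rule filter_pick)
      have "W (fst K) * exp (e1 M) \<le> ?bound"
        by (rule trm[of K "xs @ ys" J L B']) (use J L in \<open>auto simp: K\<close>)
      thus ?thesis by (simp add: field_simps)
    qed
    hence "\<bar>freq_sum W M\<bar> \<le> length M * (?bound / exp (e1 M))"
      using W(1) by (intro freq_sum_abs_le) auto
    thus ?thesis by (simp add: field_simps)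
  next
    case two
    obtain J where J: "J \<in> set M" "N' < mode_norm J" using two(1) by blast
    hence HJ: "?H J" using N'N by simp
    obtain xs ys where MJ: "M = xs @ J # ys" using J(1) by (meson split_list)
    define A where "A = xs @ ys"
    have MA: "mset M = mset (J # A)" by (simp add: MJ A_def)
    have fA: "length (filter ?H A) \<le> 1" using two(2) HJ by (simp add: MJ A_def)
    have mA: "mom (J # A) = 0" using mom_mset[OF MA] M(1) by simp
    \<comment> \<open>Without a second mode above \<open>N\<close>, the total size of the others is
      at most \<open>k * N\<close>, too little to balance the momentum of \<open>J\<close>.\<close>
    have "0 < length (filter ?H A)"
    proof (rule ccontr)
      assume "\<not> ?thesis"
      hence "\<forall>L\<in>set A. mode_norm L \<le> N" by (auto simp: filter_empty_conv)
      hence "mnorm A \<le> length A * N"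
        by (induction A) (auto simp: algebra_simps)
      also have "... \<le> real k * N" using M(2) N by (intro mult_right_mono) (auto simp: MJ A_def)
      finally show False using mode_norm_le_mnorm[OF mA] J(2) N by simp
    qed
    then obtain L B where L: "mset A = mset (L # B)" "?H L" "length (filter ?H A) = Suc (length (filter ?H B))"
      by (rule filter_pick)
    have B: "mode_norm K \<le> N" if "K \<in> set B" for K
    proof -
      have "filter ?H B = []" using fA L(3) by simp
      thus ?thesis using that by (auto simp: filter_empty_conv)
    qed
    have MJL: "mset M = mset (J # L # B)" using MA L(1) by simp
    have lenB: "length B \<le> length M" "length B \<le> k" using MJL M(2) by (metis size_mset length_Cons le_SucI order_refl order_trans)+
    have "\<bar>freq_sum \<omega> B\<bar> \<le> length B * (C0 * (1 + N) powr \<beta>)"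
    proof (rule freq_sum_abs_le)
      fix K assume "K \<in> set B"
      hence "site_norm (fst K) \<le> N" using B by (simp add: mode_norm_def)
      moreover have "0 \<le> site_norm (fst K)" by (simp add: site_norm_def)
      ultimately have "C0 * (1 + site_norm (fst K)) powr \<beta> \<le> C0 * (1 + N) powr \<beta>"
        using C0 bet by (intro mult_left_mono powr_mono2) auto
      thus "\<bar>\<omega> (fst K)\<bar> \<le> C0 * (1 + N) powr \<beta>" using upper order_trans by blast
    qed
    also have "... \<le> real k * (C0 * (1 + N) powr \<beta>)" using lenB C0 by (intro mult_right_mono) auto
    finally have fB: "\<bar>freq_sum \<omega> B\<bar> \<le> real k * (C0 * (1 + N) powr \<beta>)" .
    have "freq_sum \<omega> M = freq_sum \<omega> (J # L # B)" by (rule freq_sum_mset[OF MJL])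
    hence fM: "\<bar>\<omega> (fst J) * of_int (sg (snd J)) + \<omega> (fst L) * of_int (sg (snd L))\<bar>
        < 1 + real k * (C0 * (1 + N) powr \<beta>)"
      using M(3) eta(2) fB by simp
    have nJ: "N' \<le> site_norm (fst J)" using J(2) by (simp add: mode_norm_def)
    \<comment> \<open>Equal signs would add two nonnegative frequencies, one of them at least c0
      N'^\<beta>, which the low modes and the divisor cannot offset.\<close>
    have opp: "snd J \<noteq> snd L"
    proof
      assume same: "snd J = snd L"
      have "c0 * N' powr \<beta> \<le> c0 * site_norm (fst J) powr \<beta>"
        using c0 nJ N'N bet by (intro mult_left_mono powr_mono2) auto
      also have "... \<le> \<omega> (fst J)" by (rule lower) (use nJ N in auto)
      finally have 1: "c0 * N' powr \<beta> \<le> \<omega> (fst J)" .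
      have "0 \<le> c0 * site_norm (fst L) powr \<beta>" using c0 by simp
      also have "... \<le> \<omega> (fst L)" by (rule lower) (use L(2) N in \<open>auto simp: mode_norm_def\<close>)
      finally have L0: "0 \<le> \<omega> (fst L)" .
      have "0 \<le> c0 * N' powr \<beta>" using c0 by simp
      hence J0: "0 \<le> \<omega> (fst J)" using 1 by (rule order_trans)
      have "\<bar>\<omega> (fst J) * of_int (sg (snd J)) + \<omega> (fst L) * of_int (sg (snd L))\<bar> = \<omega> (fst J) + \<omega> (fst L)"
        using J0 L0 same by (cases "snd L") (auto simp: sg_def)
      thus False using fM 1 N L0 by linarith
    qed
    \<comment> \<open>With opposite signs the divisor contains the frequency difference of
      \<open>J\<close> and \<open>L\<close>, which the low modes keep below C2 N'^\<delta>;
      different weights would make it at least that large.\<close>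
    have WJL: "W (fst J) = W (fst L)"
    proof (rule ccontr)
      assume ne: "W (fst J) \<noteq> W (fst L)"
      hence "fst J \<noteq> fst L" by auto
      with cluster ne have "C2 * (site_norm (fst J) powr \<delta> + site_norm (fst L) powr \<delta>) \<le> \<bar>\<omega> (fst J) - \<omega> (fst L)\<bar>" by blast
      moreover have "C2 * N' powr \<delta> \<le> C2 * (site_norm (fst J) powr \<delta> + site_norm (fst L) powr \<delta>)"
        using C2 nJ N'N by (intro mult_left_mono add_increasing2 powr_mono2) auto
      moreover have "\<bar>\<omega> (fst J) * of_int (sg (snd J)) + \<omega> (fst L) * of_int (sg (snd L))\<bar> = \<bar>\<omega> (fst J) - \<omega> (fst L)\<bar>"
        using opp by (cases "snd L") (auto simp: sg_def)
      ultimately show False using fM N by linarith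
    qed
    have "freq_sum W M = freq_sum W (J # L # B)" by (rule freq_sum_mset[OF MJL])
    also have "... = freq_sum W B" using WJL opp by (cases "snd L") (auto simp: sg_def)
    finally have fWB: "freq_sum W M = freq_sum W B" .
    have "W (fst K) \<le> ?bound / exp (e1 M)" if Kin: "K \<in> set B" for K
    proof -
      obtain xs ys where K: "B = xs @ K # ys" using Kin by (meson split_list)
      have "W (fst K) * exp (e1 M) \<le> ?bound"
        by (rule trm[of K "J # L # xs @ ys" J L "xs @ ys"]) (use HJ L(2) MJL in \<open>auto simp: K\<close>)
      thus ?thesis by (simp add: field_simps)
    qed
    hence "\<bar>freq_sum W B\<bar> \<le> length B * (?bound / exp (e1 M))"
      using W(1) by (intro freq_sum_abs_le) auto
    also have "... \<le> length M * (?bound / exp (e1 M))"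
      using lenB bound0 by (intro mult_right_mono) auto
    finally show ?thesis unfolding fWB by (simp add: field_simps)
  qed
qed

text \<open>Bracketing with \<open>diag W\<close> multiplies a coefficient by its weight sum, and
  the monomials of the normal form all have small divisors. The resonance estimate therefore applies
  to each of them and trades \<open>e1\<close> for \<open>e2\<close>.\<close>

lemma cls_br_resonant:
  assumes P: "\<And>n. symf (P n)" "\<And>n. zm (P n)" and j: "1 \<le> j" and Z: "cls e1 j z (nZ \<omega> P \<eta> j)" and c: "0 \<le> c"
    and res: "\<And>M. mom M = 0 \<Longrightarrow> length M = j + 2 \<Longrightarrow> \<bar>freq_sum \<omega> M\<bar> < \<eta> \<Longrightarrow>
      \<bar>freq_sum W M\<bar> * exp (e1 M) \<le> c * exp (e2 M)"
  shows "cls e2 j (z * c) (br (diag W) (nZ \<omega> P \<eta> j))"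
  unfolding cls_def
proof (intro conjI allI impI)
  note ZD = clsD[OF Z]
  show "symf (br (diag W) (nZ \<omega> P \<eta> j))" "zm (br (diag W) (nZ \<omega> P \<eta> j))"
    by (intro symf_br zm_br symf_diag zm_diag ZD)+
  show "0 \<le> z * c" using ZD c by simp
  fix M
  have eq: "br (diag W) (nZ \<omega> P \<eta> j) M = \<i> * of_real (freq_sum W M) * nZ \<omega> P \<eta> j M"
    by (subst br_antisym) (simp add: br_diag[OF ZD(1)])
  show "length M = j + 2" if "br (diag W) (nZ \<omega> P \<eta> j) M \<noteq> 0"
    using that ZD(4)[of M] by (auto simp: eq)
  show "cmod (br (diag W) (nZ \<omega> P \<eta> j) M) \<le> z * c * fact (j + 2) * exp (e2 M)"
  proof (cases "nZ \<omega> P \<eta> j M = 0")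
    case True
    thus ?thesis using ZD(3) c by (simp add: eq)
  next
    case False
    hence "mom M = 0" "length M = j + 2" using ZD(2,4) by (auto simp: zm_def)
    moreover have "\<bar>freq_sum \<omega> M\<bar> < \<eta>" using False j by (auto simp: nf_pos split: if_splits)
    ultimately have r: "\<bar>freq_sum W M\<bar> * exp (e1 M) \<le> c * exp (e2 M)" by (rule res)
    have "cmod (br (diag W) (nZ \<omega> P \<eta> j) M) = \<bar>freq_sum W M\<bar> * cmod (nZ \<omega> P \<eta> j M)"
      by (simp add: eq norm_mult)
    also have "... \<le> \<bar>freq_sum W M\<bar> * (z * fact (j + 2) * exp (e1 M))"
      by (intro mult_left_mono ZD) auto
    also have "... = z * fact (j + 2) * (\<bar>freq_sum W M\<bar> * exp (e1 M))" by simp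
    also have "... \<le> z * fact (j + 2) * (c * exp (e2 M))"
      using ZD(3) by (intro mult_left_mono r) auto
    finally show ?thesis by (simp add: mult_ac)
  qed
qed

end

section \<open>Monomials, derivatives and symmetrisation\<close>

definition upr :: "('a \<Rightarrow> complex) \<Rightarrow> 'a list \<Rightarrow> complex" where
  "upr u M = prod_list (map u M)"

text \<open>The derivative of the monomial in direction \<open>h\<close>. With
  \<open>h = ind K\<close> it is \<open>monomial_partial\<close>; with \<open>h\<close> the velocity
  of a curve it is the time derivative of the monomial along the curve.\<close>

fun dupr :: "('a \<Rightarrow> complex) \<Rightarrow> ('a \<Rightarrow> complex) \<Rightarrow> 'a list \<Rightarrow> complex" where
  "dupr u h [] = 0"
| "dupr u h (K # M) = h K * upr u M + u K * dupr u h M"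

definition ind :: "'a \<Rightarrow> 'a \<Rightarrow> complex" where
  "ind K = (\<lambda>J. if J = K then 1 else 0)"

lemma upr_Nil [simp]: "upr u [] = 1" and upr_Cons [simp]: "upr u (K # M) = u K * upr u M"
  by (simp_all add: upr_def)

lemma upr_append [simp]: "upr u (A @ B) = upr u A * upr u B"
  by (induction A) auto

lemma upr_mset: "mset M = mset M' \<Longrightarrow> upr u M = upr u M'"
  by (simp add: upr_def flip: prod_mset_prod_list)

lemma upr_0: "upr u M \<noteq> 0 \<Longrightarrow> set M \<subseteq> {J. u J \<noteq> 0}"
  by (induction M) auto

lemma dupr_0: "dupr u (ind K) M \<noteq> 0 \<Longrightarrow> set M \<subseteq> insert K {J. u J \<noteq> 0}"
proof (induction M)
  case (Cons L M)
  show ?case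
  proof (cases "dupr u (ind K) M = 0")
    case True
    hence "ind K L * upr u M \<noteq> 0" using Cons.prems by simp
    thus ?thesis using upr_0[of u M] by (auto simp: ind_def split: if_splits)
  next
    case False
    thus ?thesis using Cons upr_0[of u M] by (auto simp: ind_def split: if_splits)
  qed
qed simp

lemma dupr_foldr: "(dupr u h M, upr u M) = foldr (\<lambda>K (d, p). (h K * p + u K * d, u K * p)) M (0, 1)"
proof (induction M)
  case (Cons K M)
  show ?case by (simp flip: Cons)
qed simp

lemma dupr_mset:
  assumes "mset M = mset M'"
  shows "dupr u h M = dupr u h M'"
proof -
  have "(dupr u h M, upr u M) = (dupr u h M', upr u M')"
    unfolding dupr_foldr by (rule foldr_mset[OF _ assms]) (auto simp: algebra_simps)
  thus ?thesis by simp
qed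

lemma monomial_partial_Cons:
  "monomial_partial K (J # Js) u = (if J = K then upr u Js else 0) + u J * monomial_partial K Js u"
proof -
  let ?n = "length Js"
  let ?p = "\<lambda>l. \<Prod>m\<in>{..<Suc ?n} - {l}. u ((J # Js) ! m)"
  have set: "{l. l < Suc ?n \<and> (J # Js) ! l = K} = (if J = K then {0} else {}) \<union> Suc ` {l. l < ?n \<and> Js ! l = K}"
  proof (rule set_eqI)
    fix l
    show "l \<in> {l. l < Suc ?n \<and> (J # Js) ! l = K} \<longleftrightarrow> l \<in> (if J = K then {0} else {}) \<union> Suc ` {l. l < ?n \<and> Js ! l = K}"
      by (cases l) auto
  qed
  have p0: "?p 0 = upr u Js"
  proof -
    have "{..<Suc ?n} - {0} = Suc ` {..<?n}" by (auto simp: lessThan_Suc_eq_insert_0)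
    hence "?p 0 = (\<Prod>m<?n. u (Js ! m))" by (simp add: prod.reindex)
    also have "... = upr u Js" by (simp add: upr_def prod.list_conv_set_nth atLeast0LessThan)
    finally show ?thesis .
  qed
  have pS: "?p (Suc l) = u J * (\<Prod>m\<in>{..<?n} - {l}. u (Js ! m))" for l
  proof -
    have "{..<Suc ?n} - {Suc l} = insert 0 (Suc ` ({..<?n} - {l}))" by (auto simp: lessThan_Suc_eq_insert_0)
    hence "?p (Suc l) = (\<Prod>m\<in>insert 0 (Suc ` ({..<?n} - {l})). u ((J # Js) ! m))" by simp
    also have "... = u J * (\<Prod>m\<in>Suc ` ({..<?n} - {l}). u ((J # Js) ! m))"
      by (subst prod.insert) auto
    finally show ?thesis by (simp add: prod.reindex)
  qed
  have "monomial_partial K (J # Js) u = (\<Sum>l\<in>(if J = K then {0} else {}) \<union> Suc ` {l. l < ?n \<and> Js ! l = K}. ?p l)"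
    unfolding monomial_partial_def length_Cons set ..
  also have "... = (\<Sum>l\<in>(if J = K then {0} else {}). ?p l) + (\<Sum>l\<in>Suc ` {l. l < ?n \<and> Js ! l = K}. ?p l)"
    by (rule sum.union_disjoint) auto
  also have "(\<Sum>l\<in>Suc ` {l. l < ?n \<and> Js ! l = K}. ?p l) = u J * monomial_partial K Js u"
    unfolding monomial_partial_def sum_distrib_left by (simp add: sum.reindex pS)
  also have "(\<Sum>l\<in>(if J = K then {0} else {}). ?p l) = (if J = K then upr u Js else 0)"
    using p0 by simp
  finally show ?thesis .
qed

lemma monomial_partial_dupr: "monomial_partial K Js u = dupr u (ind K) Js"
proof (induction Js)
  case Nil
  show ?case by (simp add: monomial_partial_def)
next
  case (Cons J Js)
  thus ?case by (simp add: monomial_partial_Cons ind_def)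
qed

text \<open>For symmetric coefficients all positions of the differentiated factor contribute alike,
  so it may be put first.\<close>

lemma sum_dupr:
  assumes "symf F" "finite S"
  shows "(\<Sum>M\<in>LS S (Suc k). F M * dupr u h M)
    = of_nat (Suc k) * (\<Sum>K\<in>S. \<Sum>A\<in>LS S k. F (K # A) * h K * upr u A)"
  using assms(1)
proof (induction k arbitrary: F)
  case 0
  show ?case by (simp add: sum_LS_Suc)
next
  case (Suc k)
  have sw: "F (K # L # B) = F (L # K # B)" for K L B
    by (rule symfD[OF Suc.prems]) simp
  have "(\<Sum>M\<in>LS S (Suc (Suc k)). F M * dupr u h M)
      = (\<Sum>K\<in>S. \<Sum>A\<in>LS S (Suc k). F (K # A) * h K * upr u A)
        + (\<Sum>K\<in>S. u K * (\<Sum>A\<in>LS S (Suc k). dl K F A * dupr u h A))"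
    unfolding sum_LS_Suc[of _ S "Suc k"]
    by (simp add: dl_def algebra_simps sum.distrib sum_distrib_left)
  also have "(\<Sum>K\<in>S. u K * (\<Sum>A\<in>LS S (Suc k). dl K F A * dupr u h A))
      = (\<Sum>K\<in>S. u K * (of_nat (Suc k) * (\<Sum>L\<in>S. \<Sum>B\<in>LS S k. dl K F (L # B) * h L * upr u B)))"
    by (intro sum.cong refl arg_cong2[where f = "(*)"] Suc.IH symf_dl Suc.prems)
  also have "... = of_nat (Suc k) * (\<Sum>K\<in>S. \<Sum>L\<in>S. \<Sum>B\<in>LS S k. F (L # K # B) * h L * (u K * upr u B))"
    unfolding sum_distrib_left by (intro sum.cong refl) (simp add: dl_def sw[of _ _] mult_ac)
  also have "(\<Sum>K\<in>S. \<Sum>L\<in>S. \<Sum>B\<in>LS S k. F (L # K # B) * h L * (u K * upr u B))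
      = (\<Sum>L\<in>S. \<Sum>K\<in>S. \<Sum>B\<in>LS S k. F (L # K # B) * h L * (u K * upr u B))"
    by (rule sum.swap)
  also have "... = (\<Sum>L\<in>S. \<Sum>A\<in>LS S (Suc k). F (L # A) * h L * upr u A)"
    unfolding sum_LS_Suc by simp
  finally show ?case by (simp add: algebra_simps)
qed

text \<open>There is no division by the factorial: the result is the derivative at the origin of the
  polynomial, the normalisation in which \<open>conv\<close> and \<open>cls\<close> work.\<close>

definition symz :: "('a list \<Rightarrow> complex) \<Rightarrow> 'a list \<Rightarrow> complex" where
  "symz P M = (\<Sum>p | p permutes {..<length M}. P (permute_list p M))"

lemma symf_symz: "symf (symz P)"
proof (rule symfI)
  fix M M' :: "'a list" assume m: "mset M = mset M'"
  then obtain q where q: "q permutes {..<length M'}" "permute_list q M' = M"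
    by (rule mset_eq_permutation)
  have len: "length M = length M'" using m by (metis size_mset)
  have "symz P M' = (\<Sum>p | p permutes {..<length M'}. P (permute_list (q \<circ> p) M'))"
    unfolding symz_def by (rule setum_permutations_compose_left[OF q(1)])
  also have "... = (\<Sum>p | p permutes {..<length M'}. P (permute_list p M))"
    by (intro sum.cong refl) (simp add: permute_list_compose q(2))
  finally show "symz P M = symz P M'" by (simp add: symz_def len)
qed

lemma sum_symz:
  assumes D: "symf D" and S: "finite S"
  shows "(\<Sum>M\<in>LS S k. symz P M * D M) = fact k * (\<Sum>M\<in>LS S k. P M * D M)"
proof -
  have perm: "(\<Sum>M\<in>LS S k. P (permute_list p M) * D M) = (\<Sum>M\<in>LS S k. P M * D M)"
    if p: "p permutes {..<k}" for p
  proof (rule sum.reindex_bij_witness[of _ "permute_list (inv p)" "permute_list p"])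
    have ip: "inv p permutes {..<k}" by (rule permutes_inv[OF p])
    fix M assume M: "M \<in> LS S k"
    hence len: "length M = k" by (simp add: LS_def)
    show "permute_list (inv p) (permute_list p M) = M" "permute_list p (permute_list (inv p) M) = M"
      using permute_list_compose[of "inv p" M p] permute_list_compose[of p M "inv p"] p ip
      by (simp_all add: len permutes_inv_o)
    show "permute_list p M \<in> LS S k" "permute_list (inv p) M \<in> LS S k"
      using M p ip by (auto simp: LS_def)
    have "mset (permute_list p M) = mset M" using p len by simp
    thus "P (permute_list p M) * D (permute_list p M) = P (permute_list p M) * D M"
      using symfD[OF D] by metis
  qed
  have "(\<Sum>M\<in>LS S k. symz P M * D M) = (\<Sum>M\<in>LS S k. \<Sum>p | p permutes {..<k}. P (permute_list p M) * D M)"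
    by (intro sum.cong refl) (auto simp: symz_def sum_distrib_right LS_def)
  also have "... = (\<Sum>p | p permutes {..<k}. \<Sum>M\<in>LS S k. P (permute_list p M) * D M)"
    by (rule sum.swap)
  also have "... = (\<Sum>p | p permutes {..<k}. \<Sum>M\<in>LS S k. P M * D M)"
    by (intro sum.cong refl perm) simp
  also have "... = fact k * (\<Sum>M\<in>LS S k. P M * D M)"
    by (simp add: card_permutations)
  finally show ?thesis .
qed

text \<open>Symmetrising costs \<open>(k + 1)!\<close> and moving the differentiated index to the
  front returns \<open>k + 1\<close>; the quotient \<open>k!\<close> is the one belonging to a
  Taylor term of degree \<open>k\<close>.\<close>

lemma sum_monomial_partial:
  assumes S: "finite S" and K: "K \<in> S"
  shows "(\<Sum>M\<in>LS S (Suc k). P M * monomial_partial K M u)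
    = (\<Sum>A\<in>LS S k. symz P (K # A) * upr u A) / fact k"
proof -
  have "fact (Suc k) * (\<Sum>M\<in>LS S (Suc k). P M * monomial_partial K M u)
      = (\<Sum>M\<in>LS S (Suc k). symz P M * dupr u (ind K) M)"
    unfolding monomial_partial_dupr
    by (rule sum_symz[symmetric, OF symfI S]) (rule dupr_mset)
  also have "... = of_nat (Suc k) * (\<Sum>L\<in>S. \<Sum>A\<in>LS S k. symz P (L # A) * ind K L * upr u A)"
    by (rule sum_dupr[OF symf_symz S])
  also have "(\<Sum>L\<in>S. \<Sum>A\<in>LS S k. symz P (L # A) * ind K L * upr u A)
      = (\<Sum>L\<in>S. if L = K then (\<Sum>A\<in>LS S k. symz P (L # A) * upr u A) else 0)"
    by (intro sum.cong refl) (auto simp: ind_def)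
  also have "... = (\<Sum>A\<in>LS S k. symz P (K # A) * upr u A)"
    using S K by simp
  finally have "of_nat (Suc k) * (fact k * (\<Sum>M\<in>LS S (Suc k). P M * monomial_partial K M u))
      = of_nat (Suc k) * (\<Sum>A\<in>LS S k. symz P (K # A) * upr u A)"
    by (simp add: mult.assoc del: of_nat_Suc)
  hence "fact k * (\<Sum>M\<in>LS S (Suc k). P M * monomial_partial K M u)
      = (\<Sum>A\<in>LS S k. symz P (K # A) * upr u A)"
    unfolding mult_cancel_left by (simp del: of_nat_Suc)
  thus ?thesis by (simp add: field_simps)
qed

section \<open>Coefficient bounds\<close>

text \<open>Cauchy's estimate on the unit circle; convergence on the larger disc supplies continuity
  up to the circle.\<close>

lemma power_series_coeff_bound:
  fixes a :: "nat \<Rightarrow> complex"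
  assumes sums: "\<And>z. cmod z < 2 \<Longrightarrow> (\<lambda>n. a n * z ^ n) sums f z" and B: "\<And>z. cmod z = 1 \<Longrightarrow> cmod (f z) \<le> B"
  shows "cmod (a n) \<le> B"
proof -
  have hol: "f holomorphic_on ball 0 2"
    by (rule power_series_holomorphic[where a = a]) (use sums in \<open>auto simp: dist_norm\<close>)
  have "f has_fps_expansion Abs_fps a"
  proof (rule has_fps_expansionI)
    have "eventually (\<lambda>u :: complex. cmod u < 2) (nhds 0)"
      using eventually_nhds_ball[of 2 "0 :: complex"] by (simp add: dist_norm)
    thus "\<forall>\<^sub>F u in nhds 0. (\<lambda>n. fps_nth (Abs_fps a) n * u ^ n) sums f u"
      by eventually_elim (use sums in auto)
  qed
  hence a: "a n = (deriv ^^ n) f 0 / fact n"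
    using fps_nth_fps_expansion[of f "Abs_fps a" n] by simp
  have "cmod ((deriv ^^ n) f 0) \<le> fact n * B / 1 ^ n"
  proof (rule Cauchy_inequality)
    show "f holomorphic_on ball 0 1" by (rule holomorphic_on_subset[OF hol]) auto
    show "continuous_on (cball 0 1) f"
      by (rule continuous_on_subset[OF holomorphic_on_imp_continuous_on[OF hol]]) auto
  qed (use B in auto)
  thus ?thesis unfolding a by (simp add: norm_divide field_simps)
qed

text \<open>The map \<open>J\<close> may repeat modes. Each occurrence nevertheless has its own
  amplitude \<open>y i\<close>, so a coefficient with coinciding indices can be reached by a term
  that is multilinear in the amplitudes.\<close>

lemma sum_LS_point_masses:
  assumes "finite S" "finite I" "J ` I \<subseteq> S"
  shows "(\<Sum>L\<in>LS S n. c L * upr (\<lambda>K. \<Sum>i\<in>I. if J i = K then y i else 0) L)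
    = (\<Sum>T\<in>LS I n. c (map J T) * upr y T)"
proof (induction n arbitrary: c)
  case (Suc n)
  let ?u = "\<lambda>K. \<Sum>i\<in>I. if J i = K then y i else 0"
  have "(\<Sum>L\<in>LS S (Suc n). c L * upr ?u L) = (\<Sum>K\<in>S. ?u K * (\<Sum>L\<in>LS S n. c (K # L) * upr ?u L))"
    unfolding sum_LS_Suc by (simp add: sum_distrib_left mult_ac)
  also have "... = (\<Sum>K\<in>S. ?u K * (\<Sum>T\<in>LS I n. c (K # map J T) * upr y T))"
    using Suc.IH[of "\<lambda>L. c (_ # L)"] by simp
  also have "... = (\<Sum>K\<in>S. \<Sum>i\<in>I. if J i = K then y i * (\<Sum>T\<in>LS I n. c (J i # map J T) * upr y T) else 0)"
    unfolding sum_distrib_right by (intro sum.cong refl) auto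
  also have "... = (\<Sum>i\<in>I. \<Sum>K\<in>S. if J i = K then y i * (\<Sum>T\<in>LS I n. c (J i # map J T) * upr y T) else 0)"
    by (rule sum.swap)
  also have "... = (\<Sum>i\<in>I. y i * (\<Sum>T\<in>LS I n. c (J i # map J T) * upr y T))"
  proof (rule sum.cong[OF refl])
    fix i assume "i \<in> I"
    hence "J i \<in> S" using assms by auto
    thus "(\<Sum>K\<in>S. if J i = K then y i * (\<Sum>T\<in>LS I n. c (J i # map J T) * upr y T) else 0)
       = y i * (\<Sum>T\<in>LS I n. c (J i # map J T) * upr y T)"
      using assms by simp
  qed
  also have "... = (\<Sum>T\<in>LS I (Suc n). c (map J T) * upr y T)"
    unfolding sum_LS_Suc by (simp add: sum_distrib_left mult_ac)
  finally show ?case .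
qed simp

lemma upr_count:
  assumes "finite I" "set T \<subseteq> I"
  shows "upr y T = (\<Prod>i\<in>I. y i ^ count_list T i)"
  using assms(2)
proof (induction T)
  case (Cons t T)
  have "(\<Prod>i\<in>I. y i ^ count_list (t # T) i) = (\<Prod>i\<in>I. (if i = t then y i else 1) * y i ^ count_list T i)"
    by (intro prod.cong) auto
  also have "... = y t * (\<Prod>i\<in>I. y i ^ count_list T i)"
    using assms(1) Cons.prems by (simp add: prod.distrib prod.delta')
  finally show ?case using Cons by simp
qed simp

lemma count_list_distinct: "distinct T \<Longrightarrow> x \<in> set T \<Longrightarrow> count_list T x = 1"
  by (induction T) (auto simp: count_list_0_iff)

text \<open>Averaging over signs extracts the multilinear coefficient.\<close>

lemma sign_average:
  assumes T: "T \<in> LS {..<n} n"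
  shows "(\<Sum>\<epsilon>\<in>{..<n} \<rightarrow>\<^sub>E {1, -1}. (\<Prod>i<n. \<epsilon> i) * upr \<epsilon> T) = (if set T = {..<n} then 2 ^ n else (0 :: complex))"
proof -
  have "(\<Sum>\<epsilon>\<in>{..<n} \<rightarrow>\<^sub>E {1, -1}. (\<Prod>i<n. \<epsilon> i) * upr \<epsilon> T)
      = (\<Sum>\<epsilon>\<in>{..<n} \<rightarrow>\<^sub>E {1, -1}. \<Prod>i<n. \<epsilon> i ^ Suc (count_list T i))"
    using T by (intro sum.cong refl) (simp add: upr_count[of "{..<n}"] LS_def prod.distrib)
  also have "... = (\<Prod>i<n. \<Sum>e\<in>{1, -1 :: complex}. e ^ Suc (count_list T i))"
    by (rule prod_sum_PiE[symmetric]) auto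
  also have "... = (\<Prod>i<n. 1 + (-1) ^ Suc (count_list T i))"
    by simp
  also have "... = (if set T = {..<n} then 2 ^ n else 0)"
  proof (cases "set T = {..<n}")
    case True
    hence "distinct T" using T by (intro card_distinct) (simp add: LS_def)
    hence "count_list T i = 1" if "i < n" for i
      using True that by (intro count_list_distinct) auto
    hence "(\<Prod>i<n. 1 + (-1 :: complex) ^ Suc (count_list T i)) = (\<Prod>i<n. 2)"
      by (intro prod.cong) auto
    thus ?thesis using True by simp
  next
    case False
    then obtain i where "i < n" "i \<notin> set T" using T by (auto simp: LS_def)
    hence "i \<in> {..<n}" "1 + (-1 :: complex) ^ Suc (count_list T i) = 0" by (auto simp: count_list_0_iff)
    hence "(\<Prod>i<n. 1 + (-1 :: complex) ^ Suc (count_list T i)) = 0" by (intro prod_zero) auto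
    thus ?thesis using False by simp
  qed
  finally show ?thesis .
qed

text \<open>After expansion in the amplitudes, the sign average kills every assignment that is not a
  permutation of the positions. The factor \<open>2 ^ n\<close> counts signs, and
  \<open>fact n\<close> counts permutations, whose terms are all equal by symmetry.\<close>

lemma polarization:
  assumes c: "symf c" and S: "finite S" "J ` {..<n} \<subseteq> S"
  shows "(\<Sum>\<epsilon>\<in>{..<n} \<rightarrow>\<^sub>E {1, -1}. (\<Prod>i<n. \<epsilon> i) *
      (\<Sum>L\<in>LS S n. c L * upr (\<lambda>K. \<Sum>i<n. if J i = K then \<epsilon> i * x i else 0) L))
    = 2 ^ n * fact n * (c (map J [0..<n]) * (\<Prod>i<n. x i))"
proof -
  let ?E = "{..<n} \<rightarrow>\<^sub>E {1, -1 :: complex}"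
  have upr_mult: "upr (\<lambda>i. \<epsilon> i * x i) T = upr \<epsilon> T * upr x T" for \<epsilon> T
    by (induction T) auto
  have "(\<Sum>\<epsilon>\<in>?E. (\<Prod>i<n. \<epsilon> i) * (\<Sum>L\<in>LS S n. c L * upr (\<lambda>K. \<Sum>i<n. if J i = K then \<epsilon> i * x i else 0) L))
      = (\<Sum>\<epsilon>\<in>?E. \<Sum>T\<in>LS {..<n} n. c (map J T) * upr x T * ((\<Prod>i<n. \<epsilon> i) * upr \<epsilon> T))"
    unfolding sum_LS_point_masses[OF S(1) finite_lessThan S(2)]
    by (simp add: sum_distrib_left upr_mult mult_ac)
  also have "... = (\<Sum>T\<in>LS {..<n} n. c (map J T) * upr x T * (\<Sum>\<epsilon>\<in>?E. (\<Prod>i<n. \<epsilon> i) * upr \<epsilon> T))"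
    by (subst sum.swap) (simp add: sum_distrib_left)
  also have "... = (\<Sum>T\<in>LS {..<n} n. if set T = {..<n} then c (map J T) * upr x T * 2 ^ n else 0)"
    by (intro sum.cong refl) (simp add: sign_average)
  also have "... = (\<Sum>T\<in>permutations_of_set {..<n}. c (map J [0..<n]) * (\<Prod>i<n. x i) * 2 ^ n)"
  proof -
    have "{T \<in> LS {..<n} n. set T = {..<n}} = permutations_of_set {..<n}"
    proof (intro set_eqI iffI)
      fix T assume "T \<in> {T \<in> LS {..<n} n. set T = {..<n}}"
      thus "T \<in> permutations_of_set {..<n}"
        by (auto simp: LS_def permutations_of_set_def intro!: card_distinct)
    next
      fix T assume "T \<in> permutations_of_set {..<n}"
      thus "T \<in> {T \<in> LS {..<n} n. set T = {..<n}}"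
        using distinct_card[of T] by (auto simp: LS_def permutations_of_set_def)
    qed
    moreover have "c (map J T) * upr x T * 2 ^ n = c (map J [0..<n]) * (\<Prod>i<n. x i) * 2 ^ n"
      if "T \<in> permutations_of_set {..<n}" for T
    proof -
      have "mset T = mset [0..<n]"
        using that by (intro set_eq_iff_mset_eq_distinct[THEN iffD1])
          (auto simp: permutations_of_set_def atLeast0LessThan)
      hence "c (map J T) = c (map J [0..<n])" "upr x T = upr x [0..<n]"
        using upr_mset by (auto intro!: symfD[OF c] simp: mset_map simp del: mset_upt)
      thus ?thesis by (simp add: upr_def prod.list_conv_set_nth atLeast0LessThan)
    qed
    ultimately show ?thesis
      by (simp add: sum.If_cases Int_def)
  qed
  also have "... = 2 ^ n * fact n * (c (map J [0..<n]) * (\<Prod>i<n. x i))"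
    by (simp add: mult_ac)
  finally show ?thesis .
qed

section \<open>From the norm of the vector field to its coefficients\<close>

lemma infsum_finite_support:
  fixes g :: "'a \<Rightarrow> 'b::{comm_monoid_add, t2_space}"
  assumes "finite S" "S \<subseteq> A" "\<And>x. x \<in> A - S \<Longrightarrow> g x = 0"
  shows "g summable_on A" "infsum g A = sum g S"
proof -
  have "(g has_sum sum g S) S" using assms(1) by (rule has_sum_finite)
  hence "(g has_sum sum g S) A"
    by (rule has_sum_cong_neutral[THEN iffD1, rotated -1]) (use assms in auto)
  thus "g summable_on A" "infsum g A = sum g S"
    by (auto simp: summable_on_def infsumI)
qed

lemma W_norm_finite_support:
  assumes "finite S" "{J. u J \<noteq> 0} \<subseteq> S"
  shows "u \<in> W_space c f s"
    and "W_norm c f s u = sqrt (\<Sum>J\<in>S. (cmod (u J))^2 * exp (2 * s * f (bracket c (fst J))))"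
proof -
  have z: "(cmod (u J))^2 * exp (2 * s * f (bracket c (fst J))) = 0" if "J \<in> UNIV - S" for J
    using that assms by auto
  note * = infsum_finite_support[OF assms(1) subset_UNIV z]
  show "u \<in> W_space c f s" using *(1) by (simp add: W_space_def)
  show "W_norm c f s u = sqrt (\<Sum>J\<in>S. (cmod (u J))^2 * exp (2 * s * f (bracket c (fst J))))"
    using *(2) by (simp add: W_norm_def)
qed

lemma W_norm_component:
  assumes "v \<in> W_space c f s"
  shows "cmod (v J) * exp (s * f (bracket c (fst J))) \<le> W_norm c f s v"
proof -
  let ?g = "\<lambda>J. (cmod (v J))^2 * exp (2 * s * f (bracket c (fst J)))"
  have "sum ?g {J} \<le> infsum ?g UNIV"
    using assms by (intro finite_sum_le_infsum) (auto simp: W_space_def)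
  hence "sqrt (?g J) \<le> W_norm c f s v" by (simp add: W_norm_def)
  moreover have "?g J = (cmod (v J) * exp (s * f (bracket c (fst J))))^2"
    by (simp add: power_mult_distrib mult.assoc flip: exp_double)
  ultimately show ?thesis by simp
qed

lemma ham_partial_degree_0: "ham_partial_degree P 0 K u = 0"
proof -
  have "{Js :: 'a mode list. length Js = 0} = {[]}" by auto
  thus ?thesis by (simp add: ham_partial_degree_def monomial_partial_def)
qed

lemma ham_partial_degree_finite:
  assumes S: "finite S" "{J. u J \<noteq> 0} \<subseteq> S" "K \<in> S"
  shows "ham_partial_degree P (Suc n) K u = (\<Sum>A\<in>LS S n. symz P (K # A) * upr u A) / fact n"
proof -
  have "ham_partial_degree P (Suc n) K u = (\<Sum>Js\<in>LS S (Suc n). P Js * monomial_partial K Js u)"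
    unfolding ham_partial_degree_def
  proof (rule infsum_finite_support(2))
    fix Js assume Js: "Js \<in> {Js. length Js = Suc n} - LS S (Suc n)"
    have "monomial_partial K Js u = 0"
    proof (rule ccontr)
      assume "monomial_partial K Js u \<noteq> 0"
      hence "set Js \<subseteq> insert K {J. u J \<noteq> 0}" unfolding monomial_partial_dupr by (rule dupr_0)
      thus False using Js S by (auto simp: LS_def)
    qed
    thus "P Js * monomial_partial K Js u = 0" by simp
  next
    show "finite (LS S (Suc n))" using S by simp
    show "LS S (Suc n) \<subseteq> {Js. length Js = Suc n}" by (auto simp: LS_def)
  qed
  thus ?thesis using sum_monomial_partial[OF S(1,3), where k = n and P = P and u = u] by simp
qed

lemma upr_scale: "upr (\<lambda>J. z * u J) A = z ^ length A * upr u A"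
  by (induction A) auto

lemma power_le_exp_fact: "real n ^ n \<le> exp 1 ^ n * fact n"
proof -
  have s: "(\<lambda>k. real n ^ k /\<^sub>R fact k) sums exp (real n)" by (rule exp_converges)
  have "(\<Sum>k\<in>{n}. real n ^ k /\<^sub>R fact k) \<le> exp (real n)"
    using sum_le_suminf[of "\<lambda>k. real n ^ k /\<^sub>R fact k" "{n}"] s
    by (simp add: sums_iff)
  hence "real n ^ n \<le> exp (real n) * fact n"
    by (simp add: divide_simps)
  thus ?thesis by (simp flip: exp_of_nat_mult)
qed

text \<open>The vector field is tested on combinations of point masses at the modes of
  \<open>A\<close>. The weighted norm gives its component at \<open>K\<close> the decay in the
  weight of \<open>K\<close>, Cauchy's estimate in a scalar multiple of the state isolates the
  degree, and polarisation isolates the coefficient. The sizes of the point masses produce the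
  growth in the modes of \<open>A\<close>.\<close>

lemma coefficient_bound:
  fixes P :: "('n::finite) ham"
  assumes fin: "vf_norm_finite c f r s0 P" and r: "0 < r"
  obtains Mx where "0 \<le> Mx"
    "\<And>K A. A \<noteq> [] \<Longrightarrow> cmod (symz P (K # A)) \<le> Mx * (2 * exp 1 / r) ^ length A * fact (length A)
       * exp (s0 * (sm (\<lambda>J. f (bracket c (fst J))) A - f (bracket c (fst K))))"
proof -
  define \<phi> where "\<phi> = (\<lambda>J :: 'n mode. f (bracket c (fst J)))"
  obtain B0 where B0: "\<And>u. u \<in> W_ball c f s0 r \<Longrightarrow> 1 / r * W_norm c f s0 (ham_vf P u) \<le> B0"
    using fin by (auto simp: vf_norm_finite_def bdd_above_def)
  define Mx where "Mx = \<bar>r * B0\<bar>"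
  have comp: "cmod (ham_partial P K u) \<le> Mx * exp (- s0 * \<phi> K)" if u: "u \<in> W_ball c f s0 r" for K u
  proof -
    have W: "ham_vf P u \<in> W_space c f s0" using fin u by (auto simp: vf_norm_finite_def)
    have "W_norm c f s0 (ham_vf P u) \<le> r * B0" using B0[OF u] r by (simp add: field_simps)
    hence "cmod (ham_vf P u (bar K)) * exp (s0 * \<phi> K) \<le> Mx"
      using W_norm_component[OF W, of "bar K"] unfolding Mx_def \<phi>_def by simp
    moreover have "cmod (ham_vf P u (bar K)) = cmod (ham_partial P K u)"
      by (simp add: ham_vf_def norm_mult)
    ultimately show ?thesis by (simp add: exp_minus field_simps)
  qed
  have bound: "cmod (symz P (K # A)) \<le> Mx * (2 * exp 1 / r) ^ length A * fact (length A)
       * exp (s0 * (sm \<phi> A - \<phi> K))" if A: "A \<noteq> []" for K A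
  proof -
    define n where "n = length A"
    have n0: "0 < n" using A by (simp add: n_def)
    define J where "J i = A ! i" for i
    define S where "S = insert K (set A)"
    have S: "finite S" "K \<in> S" "J ` {..<n} \<subseteq> S" by (auto simp: S_def J_def n_def)
    have Amap: "map J [0..<n] = A" 
    proof -
      have "J = (!) A" by (auto simp: J_def)
      thus ?thesis by (simp add: n_def map_nth)
    qed
    \<comment> \<open>Each of the \<open>n\<close> point masses has weighted size
      \<open>r / (2 n)\<close>, so the state stays inside the ball even when multiplied by a scalar
      of modulus less than 2.\<close>
    define x where "x i = r / (2 * real n) * exp (- s0 * \<phi> (J i))" for i
    have x0: "0 < x i" for i using r n0 by (simp add: x_def)
    define U where "U \<epsilon> = (\<lambda>L. \<Sum>i<n. if J i = L then \<epsilon> i * of_real (x i) else 0)" for \<epsilon> :: "nat \<Rightarrow> complex"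
    have supp: "{L. z * U \<epsilon> L \<noteq> 0} \<subseteq> S" for z \<epsilon>
    proof
      fix L assume "L \<in> {L. z * U \<epsilon> L \<noteq> 0}"
      hence "(\<Sum>i<n. if J i = L then \<epsilon> i * of_real (x i) else 0) \<noteq> 0" by (auto simp: U_def)
      then obtain i where "i \<in> {..<n}" "(if J i = L then \<epsilon> i * of_real (x i) else 0) \<noteq> 0"
        by (rule sum.not_neutral_contains_not_neutral)
      thus "L \<in> S" using S by (auto split: if_splits)
    qed
    have ball: "(\<lambda>L. z * U \<epsilon> L) \<in> W_ball c f s0 r"
      if e: "\<epsilon> \<in> {..<n} \<rightarrow>\<^sub>E {1, -1}" and z: "cmod z < 2" for z \<epsilon>
    proof -
      have "W_norm c f s0 (\<lambda>L. z * U \<epsilon> L) = L2_set (\<lambda>L. cmod z * (cmod (U \<epsilon> L) * exp (s0 * \<phi> L))) S"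
        unfolding W_norm_finite_support(2)[OF S(1) supp] L2_set_def \<phi>_def
        by (intro arg_cong[where f = sqrt] sum.cong refl)
           (simp add: norm_mult power_mult_distrib mult.assoc flip: exp_double)
      also have "... \<le> (\<Sum>L\<in>S. cmod z * (cmod (U \<epsilon> L) * exp (s0 * \<phi> L)))"
        by (rule L2_set_le_sum) auto
      also have "... = cmod z * (\<Sum>L\<in>S. cmod (U \<epsilon> L) * exp (s0 * \<phi> L))"
        by (simp add: sum_distrib_left)
      also have "(\<Sum>L\<in>S. cmod (U \<epsilon> L) * exp (s0 * \<phi> L)) \<le> (\<Sum>L\<in>S. \<Sum>i<n. if J i = L then x i * exp (s0 * \<phi> L) else 0)"
      proof (rule sum_mono)
        fix L
        have "cmod (U \<epsilon> L) \<le> (\<Sum>i<n. if J i = L then x i else 0)"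
          unfolding U_def
        proof (rule sum_norm_le)
          fix i assume "i \<in> {..<n}"
          hence "\<epsilon> i \<in> {1, -1}" using e by (meson PiE_mem)
          hence "cmod (\<epsilon> i) = 1" by auto
          thus "cmod (if J i = L then \<epsilon> i * of_real (x i) else 0) \<le> (if J i = L then x i else 0)"
            using x0[of i] by (simp add: norm_mult)
        qed
        hence "cmod (U \<epsilon> L) * exp (s0 * \<phi> L) \<le> (\<Sum>i<n. if J i = L then x i else 0) * exp (s0 * \<phi> L)"
          by (intro mult_right_mono) auto
        also have "... = (\<Sum>i<n. if J i = L then x i * exp (s0 * \<phi> L) else 0)"
          unfolding sum_distrib_right by (intro sum.cong refl) auto
        finally show "cmod (U \<epsilon> L) * exp (s0 * \<phi> L) \<le> (\<Sum>i<n. if J i = L then x i * exp (s0 * \<phi> L) else 0)" .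
      qed
      also have "(\<Sum>L\<in>S. \<Sum>i<n. if J i = L then x i * exp (s0 * \<phi> L) else 0) = (\<Sum>i<n. x i * exp (s0 * \<phi> (J i)))"
      proof (subst sum.swap, rule sum.cong[OF refl])
        fix i assume "i \<in> {..<n}"
        hence "J i \<in> S" using S by auto
        thus "(\<Sum>L\<in>S. if J i = L then x i * exp (s0 * \<phi> L) else 0) = x i * exp (s0 * \<phi> (J i))"
          using S by simp
      qed
      also have "... = (\<Sum>i<n. r / (2 * real n))"
        by (intro sum.cong refl) (simp add: x_def flip: exp_add)
      also have "... = r / 2" using n0 by simp
      finally have "W_norm c f s0 (\<lambda>L. z * U \<epsilon> L) \<le> cmod z * (r / 2)" by (simp add: mult_left_mono)
      also have "... < 2 * (r / 2)" using z r by (intro mult_strict_right_mono) auto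
      finally show ?thesis using W_norm_finite_support(1)[OF S(1) supp] by (simp add: W_ball_def)
    qed
    define G where "G \<epsilon> = (\<Sum>L\<in>LS S n. symz P (K # L) * upr (U \<epsilon>) L)" for \<epsilon>
    have G: "cmod (G \<epsilon> / fact n) \<le> Mx * exp (- s0 * \<phi> K)" if e: "\<epsilon> \<in> {..<n} \<rightarrow>\<^sub>E {1, -1}" for \<epsilon>
    proof -
      let ?a = "\<lambda>m. (\<Sum>L\<in>LS S m. symz P (K # L) * upr (U \<epsilon>) L) / fact m"
      have deg: "ham_partial_degree P (Suc m) K (\<lambda>L. z * U \<epsilon> L) = ?a m * z ^ m" for m z
        unfolding ham_partial_degree_finite[OF S(1) supp S(2)] upr_scale sum_divide_distrib sum_distrib_right
        by (intro sum.cong refl) (simp add: LS_def)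
      have "cmod (?a n) \<le> Mx * exp (- s0 * \<phi> K)"
      proof (rule power_series_coeff_bound[of _ "\<lambda>z. ham_partial P K (\<lambda>L. z * U \<epsilon> L)"])
        fix z :: complex assume z: "cmod z < 2"
        have "ham_converges P (\<lambda>L. z * U \<epsilon> L)"
          using ball[OF e z] fin by (simp add: vf_norm_finite_def)
        hence "summable (\<lambda>k. ham_partial_degree P k K (\<lambda>L. z * U \<epsilon> L))"
          unfolding ham_converges_def by blast
        hence "(\<lambda>k. ham_partial_degree P k K (\<lambda>L. z * U \<epsilon> L)) sums ham_partial P K (\<lambda>L. z * U \<epsilon> L)"
          unfolding ham_partial_def by (rule summable_sums)
        thus "(\<lambda>m. ?a m * z ^ m) sums ham_partial P K (\<lambda>L. z * U \<epsilon> L)"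
          using sums_Suc_iff[of "\<lambda>k. ham_partial_degree P k K (\<lambda>L. z * U \<epsilon> L)"]
          by (simp add: deg ham_partial_degree_0)
      next
        fix z :: complex assume "cmod z = 1"
        thus "cmod (ham_partial P K (\<lambda>L. z * U \<epsilon> L)) \<le> Mx * exp (- s0 * \<phi> K)"
          by (intro comp ball[OF e]) simp
      qed
      thus ?thesis by (simp add: G_def)
    qed
    have symc: "symf (\<lambda>L. symz P (K # L))"
      using symf_dl[OF symf_symz[of P], of K] by (simp add: dl_def[abs_def])
    let ?E = "{..<n} \<rightarrow>\<^sub>E {1, -1 :: complex}"
    have pol: "(\<Sum>\<epsilon>\<in>?E. (\<Prod>i<n. \<epsilon> i) * G \<epsilon>) = 2 ^ n * fact n * (symz P (K # A) * (\<Prod>i<n. of_real (x i)))"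
      using polarization[OF symc S(1,3), where x = "\<lambda>i. of_real (x i)"] by (simp add: G_def U_def Amap)
    have "cmod (\<Sum>\<epsilon>\<in>?E. (\<Prod>i<n. \<epsilon> i) * G \<epsilon>) \<le> (\<Sum>\<epsilon>\<in>?E. fact n * (Mx * exp (- s0 * \<phi> K)))"
    proof (rule sum_norm_le)
      fix \<epsilon> assume e: "\<epsilon> \<in> ?E"
      have "cmod (\<epsilon> i) = 1" if "i < n" for i
      proof -
        have "\<epsilon> i \<in> {1, -1}" using e that by (meson PiE_mem lessThan_iff)
        thus ?thesis by auto
      qed
      hence "cmod (\<Prod>i<n. \<epsilon> i) = 1" by (simp add: prod_norm[symmetric])
      thus "cmod ((\<Prod>i<n. \<epsilon> i) * G \<epsilon>) \<le> fact n * (Mx * exp (- s0 * \<phi> K))"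
        using G[OF e] by (simp add: norm_mult norm_divide field_simps)
    qed
    also have "... = 2 ^ n * fact n * (Mx * exp (- s0 * \<phi> K))"
      by (simp add: card_PiE)
    finally have "cmod (symz P (K # A)) * (\<Prod>i<n. x i) \<le> Mx * exp (- s0 * \<phi> K)"
      unfolding pol using x0 by (simp add: norm_mult prod_norm[symmetric] less_imp_le norm_power)
    moreover have "(\<Prod>i<n. x i) = (r / (2 * real n)) ^ n * exp (- s0 * sm \<phi> A)"
    proof -
      have "(\<Sum>i<n. \<phi> (J i)) = sm \<phi> A"
        by (simp add: sm_def J_def n_def sum_list_sum_nth atLeast0LessThan)
      hence "exp (- s0 * sm \<phi> A) = (\<Prod>i<n. exp (- s0 * \<phi> (J i)))"
        by (simp add: exp_sum sum_distrib_left flip: \<open>(\<Sum>i<n. \<phi> (J i)) = sm \<phi> A\<close>)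
      thus ?thesis unfolding x_def prod.distrib by simp
    qed
    ultimately have le: "cmod (symz P (K # A)) * ((r / (2 * real n)) ^ n * exp (- s0 * sm \<phi> A)) \<le> Mx * exp (- s0 * \<phi> K)"
      by simp
    have gen: "a \<le> d * y" if "a * x \<le> d" "x * y = 1" "0 \<le> y" for a d x y :: real
      using mult_right_mono[OF that(1,3)] that(2) by (simp add: mult.assoc)
    have "cmod (symz P (K # A)) * (r / (2 * real n)) ^ n \<le> Mx * exp (- s0 * \<phi> K) * exp (s0 * sm \<phi> A)"
      by (rule gen[where x = "exp (- s0 * sm \<phi> A)"]) (use le in \<open>auto simp: mult.assoc simp flip: exp_add\<close>)
    also have "... = Mx * exp (s0 * (sm \<phi> A - \<phi> K))"
      by (simp add: right_diff_distrib exp_diff exp_minus field_simps)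
    finally have le2: "cmod (symz P (K # A)) * (r / (2 * real n)) ^ n \<le> Mx * exp (s0 * (sm \<phi> A - \<phi> K))" .
    have "cmod (symz P (K # A)) \<le> Mx * exp (s0 * (sm \<phi> A - \<phi> K)) * (2 * real n / r) ^ n"
      by (rule gen[OF le2]) (use r n0 in \<open>auto simp flip: power_mult_distrib\<close>)
    also have "(2 * real n / r) ^ n = (2 / r) ^ n * real n ^ n"
      by (simp add: power_mult_distrib power_divide)
    \<comment> \<open>Sharing the radius among \<open>n\<close> masses costs n^n, which is exchanged
      for e^n and the factorial that \<open>cls\<close> admits.\<close>
    also have "Mx * exp (s0 * (sm \<phi> A - \<phi> K)) * ((2 / r) ^ n * real n ^ n)
        \<le> Mx * exp (s0 * (sm \<phi> A - \<phi> K)) * ((2 / r) ^ n * (exp 1 ^ n * fact n))"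
      using r by (intro mult_left_mono power_le_exp_fact) (auto simp: Mx_def)
    also have "... = Mx * (2 * exp 1 / r) ^ n * fact n * exp (s0 * (sm \<phi> A - \<phi> K))"
      by (simp add: power_mult_distrib power_divide mult_ac)
    finally show ?thesis by (simp add: n_def)
  qed
  show thesis
    by (rule that[of Mx]) (use bound in \<open>auto simp: Mx_def \<phi>_def\<close>)
qed

definition gpart :: "('n::finite) ham \<Rightarrow> nat \<Rightarrow> 'n ham" where
  "gpart P n M = (if length M = n + 2 then symz P M else 0)"

lemma symf_gpart: "symf (gpart P n)"
proof (rule symfI)
  fix M M' :: "'a mode list" assume m: "mset M = mset M'"
  hence "length M = length M'" by (metis size_mset)
  thus "gpart P n M = gpart P n M'" using symfD[OF symf_symz m] by (simp add: gpart_def)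
qed

lemma zm_symz:
  assumes "\<And>Js. P Js \<noteq> 0 \<Longrightarrow> mom Js = 0"
  shows "zm (symz P)"
  unfolding zm_def
proof (intro allI impI)
  fix M :: "'a mode list" assume "symz P M \<noteq> 0"
  hence "(\<Sum>p | p permutes {..<length M}. P (permute_list p M)) \<noteq> 0" by (simp add: symz_def)
  then obtain p where "p \<in> {p. p permutes {..<length M}}" and P: "P (permute_list p M) \<noteq> 0"
    by (rule sum.not_neutral_contains_not_neutral)
  hence p: "p permutes {..<length M}" by simp
  have "mom (permute_list p M) = 0" using assms P by blast
  thus "mom M = 0" using mom_mset[OF mset_permute_list[OF p(1)]] by simp
qed

lemma perturbation_zero_momentum:
  assumes "P \<in> perturbations c f d" "P Js \<noteq> 0"
  shows "d \<le> length Js" "mom Js = 0"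
proof -
  show d: "d \<le> length Js" using assms by (auto simp: perturbations_def not_less[symmetric])
  have h: "degree_part (length Js) P \<in> hom_polys (length Js)" using assms d by (auto simp: perturbations_def)
  have "Js \<in> zero_momentum (length Js)"
  proof (rule ccontr)
    assume "Js \<notin> zero_momentum (length Js)"
    hence "degree_part (length Js) P Js = 0" using h unfolding hom_polys_def by blast
    thus False using assms(2) by (simp add: degree_part_def)
  qed
  thus "mom Js = 0" by (simp add: zero_momentum_def mom_def smom_def cong: map_cong)
qed

lemma mx_attained: "M \<noteq> [] \<Longrightarrow> (\<And>J. 0 \<le> \<phi> J) \<Longrightarrow> \<exists>K\<in>set M. mx \<phi> M = \<phi> K"
proof (induction M)
  case (Cons K M)
  show ?case
  proof (cases "M = []")
    case True
    thus ?thesis using Cons.prems(2)[of K] by simp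
  next
    case False
    thus ?thesis using Cons by (auto simp: max_def)
  qed
qed simp

text \<open>Choosing \<open>K\<close> as the largest mode turns the exponent of the coefficient
  bound into that of \<open>e1\<close>. As the grade is at least 1, the prefactor and the
  \<open>n + 1\<close> powers of the inverse radius fit into an \<open>n\<close>-th power; hence
  \<open>max 1 Mx\<close> and the square of \<open>B\<close> in the constant.\<close>

lemma gpart_bound:
  fixes P :: "('n::finite) ham"
  assumes P: "P \<in> perturbations c f 3" and fin: "vf_norm_finite c f r s0 P" and r: "0 < r"
    and pos: "\<And>J :: 'n mode. 0 \<le> f (bracket c (fst J))"
  obtains A where "1 \<le> A"
    "\<And>n. 1 \<le> n \<Longrightarrow> cls (\<lambda>M. s0 * (sm (\<lambda>J. f (bracket c (fst J))) M - 2 * mx (\<lambda>J. f (bracket c (fst J))) M)) n (A ^ n) (gpart P n)"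
proof -
  let ?\<phi> = "\<lambda>J :: 'n mode. f (bracket c (fst J))"
  obtain Mx where Mx: "0 \<le> Mx" "\<And>K A. A \<noteq> [] \<Longrightarrow> cmod (symz P (K # A)) \<le> Mx * (2 * exp 1 / r) ^ length A * fact (length A)
       * exp (s0 * (sm ?\<phi> A - ?\<phi> K))" using coefficient_bound[OF fin r] by blast
  define B where "B = max 1 (2 * exp 1 / r)"
  define A where "A = max 1 Mx * B^2"
  have B1: "1 \<le> B" by (simp add: B_def)
  have "1 * 1 \<le> max 1 Mx * B^2" using B1 by (intro mult_mono) auto
  hence A1: "1 \<le> A" by (simp add: A_def)
  have "cls (\<lambda>M. s0 * (sm ?\<phi> M - 2 * mx ?\<phi> M)) n (A ^ n) (gpart P n)" if n: "1 \<le> n" for n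
    unfolding cls_def
  proof (intro conjI allI impI)
    show "symf (gpart P n)" by (rule symf_gpart)
    have "zm (symz P)" by (rule zm_symz) (rule perturbation_zero_momentum(2)[OF P])
    thus "zm (gpart P n)" by (simp add: zm_def gpart_def)
    show "0 \<le> A ^ n" using A1 by simp
    fix M
    show "length M = n + 2" if "gpart P n M \<noteq> 0" using that by (simp add: gpart_def split: if_splits)
    show "cmod (gpart P n M) \<le> A ^ n * fact (n + 2) * exp (s0 * (sm ?\<phi> M - 2 * mx ?\<phi> M))"
    proof (cases "length M = n + 2")
      case True
      hence "M \<noteq> []" by auto
      then obtain K where K: "K \<in> set M" "mx ?\<phi> M = ?\<phi> K" using mx_attained[of M ?\<phi>] pos by blast
      then obtain xs ys where M: "M = xs @ K # ys" by (meson split_list)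
      define A' where "A' = xs @ ys"
      have m: "mset M = mset (K # A')" by (simp add: M A'_def)
      have len: "length A' = n + 1" using True by (simp add: M A'_def)
      hence "A' \<noteq> []" by auto
      have "(2 * exp 1 / r) ^ (n + 1) \<le> B ^ (2 * n)"
      proof -
        have "(2 * exp 1 / r) ^ (n + 1) \<le> B ^ (n + 1)" using r by (intro power_mono) (auto simp: B_def)
        also have "... \<le> B ^ (2 * n)" using B1 n by (intro power_increasing) auto
        finally show ?thesis .
      qed
      moreover have "Mx \<le> max 1 Mx ^ n"
        using power_increasing[of 1 n "max 1 Mx"] n by simp
      ultimately have "Mx * (2 * exp 1 / r) ^ (n + 1) \<le> max 1 Mx ^ n * B ^ (2 * n)"
        using Mx(1) r by (intro mult_mono) auto
      also have "... = A ^ n" by (simp add: A_def power_mult_distrib power_mult)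
      finally have le: "Mx * (2 * exp 1 / r) ^ (n + 1) \<le> A ^ n" .
      have "cmod (gpart P n M) = cmod (symz P (K # A'))"
        using True symfD[OF symf_symz m] by (simp add: gpart_def)
      also have "... \<le> Mx * (2 * exp 1 / r) ^ (n + 1) * fact (n + 1) * exp (s0 * (sm ?\<phi> A' - ?\<phi> K))"
        using Mx(2)[OF \<open>A' \<noteq> []\<close>, of K] unfolding len .
      also have "... \<le> A ^ n * fact (n + 2) * exp (s0 * (sm ?\<phi> A' - ?\<phi> K))"
        using A1 r Mx(1) by (intro mult_right_mono mult_mono le fact_mono) auto
      also have "sm ?\<phi> A' - ?\<phi> K = sm ?\<phi> M - 2 * mx ?\<phi> M"
        using sm_mset[OF m, of ?\<phi>] K(2) by simp
      finally show ?thesis .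
    qed (use A1 in \<open>simp add: gpart_def\<close>)
  qed
  thus thesis by (rule that[OF A1])
qed

section \<open>Square summable families\<close>

definition l2 :: "('a \<Rightarrow> complex) \<Rightarrow> bool" where
  "l2 x \<longleftrightarrow> (\<exists>C. \<forall>S. finite S \<longrightarrow> L2_set (\<lambda>i. cmod (x i)) S \<le> C)"

text \<open>A type rather than a set, so that the fixed point and integration theory for the class
  \<open>banach\<close> applies. Only real scalars are provided; phases act through
  \<open>rotg\<close>.\<close>

typedef 'a sqs = "{x :: 'a \<Rightarrow> complex. l2 x}"
  morphisms cd Sqs
  by (rule exI[of _ "\<lambda>_. 0"]) (auto simp: l2_def L2_set_def)

lemma l2_cd [simp]: "l2 (cd x)"
  using cd[of x] by simp

lemma cd_Sqs [simp]: "l2 x \<Longrightarrow> cd (Sqs x) = x"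
  by (simp add: Sqs_inverse)

lemma sqs_eqI: "(\<And>i. cd x i = cd y i) \<Longrightarrow> x = y"
  by (simp add: cd_inject[symmetric] fun_eq_iff)

lemma l2_add: "l2 x \<Longrightarrow> l2 y \<Longrightarrow> l2 (\<lambda>i. x i + y i)"
proof -
  assume "l2 x" "l2 y"
  then obtain C D where C: "\<And>S. finite S \<Longrightarrow> L2_set (\<lambda>i. cmod (x i)) S \<le> C"
    and D: "\<And>S. finite S \<Longrightarrow> L2_set (\<lambda>i. cmod (y i)) S \<le> D" unfolding l2_def by blast
  have "L2_set (\<lambda>i. cmod (x i + y i)) S \<le> C + D" if "finite S" for S
  proof -
    have "L2_set (\<lambda>i. cmod (x i + y i)) S \<le> L2_set (\<lambda>i. cmod (x i) + cmod (y i)) S"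
      by (rule L2_set_mono) (auto intro: norm_triangle_ineq)
    also have "... \<le> L2_set (\<lambda>i. cmod (x i)) S + L2_set (\<lambda>i. cmod (y i)) S" by (rule L2_set_triangle_ineq)
    finally show ?thesis using C[OF that] D[OF that] by simp
  qed
  thus ?thesis unfolding l2_def by blast
qed

lemma l2_mult: "l2 x \<Longrightarrow> (\<And>i. cmod (c i) \<le> B) \<Longrightarrow> l2 (\<lambda>i. c i * x i)"
proof -
  assume "l2 x" and c: "\<And>i. cmod (c i) \<le> B"
  then obtain C where C: "\<And>S. finite S \<Longrightarrow> L2_set (\<lambda>i. cmod (x i)) S \<le> C" unfolding l2_def by blast
  have B: "0 \<le> B" using c[of undefined] norm_ge_zero order_trans by blast
  have "L2_set (\<lambda>i. cmod (c i * x i)) S \<le> B * C" if "finite S" for S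
  proof -
    have "L2_set (\<lambda>i. cmod (c i * x i)) S \<le> L2_set (\<lambda>i. B * cmod (x i)) S"
      by (rule L2_set_mono) (auto simp: norm_mult intro: mult_right_mono c)
    also have "... = B * L2_set (\<lambda>i. cmod (x i)) S" by (simp add: L2_set_right_distrib[OF B])
    also have "... \<le> B * C" by (rule mult_left_mono[OF C[OF that] B])
    finally show ?thesis .
  qed
  thus ?thesis unfolding l2_def by blast
qed

lemma l2_0: "l2 (\<lambda>_. 0)"
  by (auto simp: l2_def L2_set_def)

lemma l2_uminus: "l2 x \<Longrightarrow> l2 (\<lambda>i. - x i)"
  by (simp add: l2_def)

lemma l2_scaleR: "l2 x \<Longrightarrow> l2 (\<lambda>i. r *\<^sub>R x i)"
  using l2_mult[of x "\<lambda>_. of_real r" "\<bar>r\<bar>"] by (simp add: scaleR_conv_of_real)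

instantiation sqs :: (type) real_vector
begin

definition zero_sqs :: "'a sqs" where "zero_sqs = Sqs (\<lambda>_. 0)"
definition plus_sqs :: "'a sqs \<Rightarrow> 'a sqs \<Rightarrow> 'a sqs" where "plus_sqs x y = Sqs (\<lambda>i. cd x i + cd y i)"
definition uminus_sqs :: "'a sqs \<Rightarrow> 'a sqs" where "uminus_sqs x = Sqs (\<lambda>i. - cd x i)"
definition minus_sqs :: "'a sqs \<Rightarrow> 'a sqs \<Rightarrow> 'a sqs" where "minus_sqs x y = Sqs (\<lambda>i. cd x i - cd y i)"
definition scaleR_sqs :: "real \<Rightarrow> 'a sqs \<Rightarrow> 'a sqs" where "scaleR_sqs r x = Sqs (\<lambda>i. r *\<^sub>R cd x i)"

lemma l2_diff: "l2 (\<lambda>i. cd x i - cd y i)"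
  using l2_add[OF l2_cd[of x] l2_uminus[OF l2_cd[of y]]] by simp

instance
  by standard
    (rule sqs_eqI, simp add: zero_sqs_def plus_sqs_def uminus_sqs_def minus_sqs_def scaleR_sqs_def
      l2_0 l2_add l2_uminus l2_diff l2_scaleR algebra_simps)+

end

lemma cd_zero: "cd 0 i = 0"
  by (simp add: zero_sqs_def l2_0)

lemma cd_plus: "cd (x + y) i = cd x i + cd y i"
  by (simp add: plus_sqs_def l2_add)

lemma cd_minus: "cd (x - y) i = cd x i - cd y i"
  by (simp add: minus_sqs_def l2_diff)

lemma cd_scaleR: "cd (r *\<^sub>R x) i = r *\<^sub>R cd x i"
  by (simp add: scaleR_sqs_def l2_scaleR)

instantiation sqs :: (type) real_normed_vector
begin

text \<open>A supremum over finite sets, so that norm estimates reduce to finite sums without any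
  question of convergence.\<close>

definition norm_sqs :: "'a sqs \<Rightarrow> real" where
  "norm_sqs x = (SUP S\<in>{S. finite S}. L2_set (\<lambda>i. cmod (cd x i)) S)"
definition sgn_sqs :: "'a sqs \<Rightarrow> 'a sqs" where
  "sgn_sqs x = x /\<^sub>R norm x"
definition dist_sqs :: "'a sqs \<Rightarrow> 'a sqs \<Rightarrow> real" where
  "dist_sqs x y = norm (x - y)"
definition uniformity_sqs :: "('a sqs \<times> 'a sqs) filter" where
  [code del]: "uniformity_sqs = (INF e\<in>{0 <..}. principal {(x, y). dist x y < e})"
definition open_sqs :: "'a sqs set \<Rightarrow> bool" where
  [code del]: "open_sqs S = (\<forall>x\<in>S. \<forall>\<^sub>F (x', y) in uniformity. x' = x \<longrightarrow> y \<in> S)"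

lemma L2_le_norm: "finite S \<Longrightarrow> L2_set (\<lambda>i. cmod (cd x i)) S \<le> norm x"
proof -
  assume S: "finite S"
  obtain C where "\<And>S. finite S \<Longrightarrow> L2_set (\<lambda>i. cmod (cd x i)) S \<le> C"
    using l2_cd[of x] unfolding l2_def by blast
  hence "bdd_above ((\<lambda>S. L2_set (\<lambda>i. cmod (cd x i)) S) ` {S. finite S})" by (auto simp: bdd_above_def)
  thus ?thesis unfolding norm_sqs_def using S by (intro cSUP_upper) auto
qed

lemma norm_sqs_le: "(\<And>S. finite S \<Longrightarrow> L2_set (\<lambda>i. cmod (cd x i)) S \<le> C) \<Longrightarrow> norm x \<le> C"
  unfolding norm_sqs_def by (rule cSUP_least) (auto intro: exI[of _ "{}"])

lemma cmod_cd_le: "cmod (cd x i) \<le> norm (x :: 'a sqs)"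
  using L2_le_norm[of "{i}" x] by (simp add: L2_set_def)

instance
proof
  fix x y :: "'a sqs" and a :: real
  show "sgn x = x /\<^sub>R norm x" by (simp add: sgn_sqs_def)
  show "dist x y = norm (x - y)" by (simp add: dist_sqs_def)
  show "(uniformity :: ('a sqs \<times> 'a sqs) filter) = (INF e\<in>{0 <..}. principal {(x, y). dist x y < e})"
    by (simp add: uniformity_sqs_def)
  show "open S = (\<forall>x\<in>S. \<forall>\<^sub>F (x', y) in uniformity. x' = x \<longrightarrow> y \<in> S)" for S :: "'a sqs set"
    by (simp add: open_sqs_def)
  show "norm x = 0 \<longleftrightarrow> x = 0"
  proof
    assume "norm x = 0"
    hence "cd x i = 0" for i using cmod_cd_le[of x i] by simp
    thus "x = 0" by (intro sqs_eqI) (simp add: cd_zero)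
  next
    assume "x = 0"
    hence "norm x \<le> 0" by (intro norm_sqs_le) (simp add: cd_zero L2_set_def)
    moreover have "0 \<le> norm x" using cmod_cd_le[of x undefined] norm_ge_zero order_trans by blast
    ultimately show "norm x = 0" by simp
  qed
  show "norm (x + y) \<le> norm x + norm y"
  proof (rule norm_sqs_le)
    fix S :: "'a set" assume S: "finite S"
    have "L2_set (\<lambda>i. cmod (cd (x + y) i)) S \<le> L2_set (\<lambda>i. cmod (cd x i) + cmod (cd y i)) S"
      by (rule L2_set_mono) (auto simp: cd_plus intro: norm_triangle_ineq)
    also have "... \<le> L2_set (\<lambda>i. cmod (cd x i)) S + L2_set (\<lambda>i. cmod (cd y i)) S" by (rule L2_set_triangle_ineq)
    finally show "L2_set (\<lambda>i. cmod (cd (x + y) i)) S \<le> norm x + norm y"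
      using L2_le_norm[OF S, of x] L2_le_norm[OF S, of y] by simp
  qed
  show "norm (a *\<^sub>R x) = \<bar>a\<bar> * norm x"
  proof -
    have le: "norm (a *\<^sub>R x) \<le> \<bar>a\<bar> * norm x" for a :: real and x :: "'a sqs"
    proof (rule norm_sqs_le)
      fix S :: "'a set" assume S: "finite S"
      have "L2_set (\<lambda>i. cmod (cd (a *\<^sub>R x) i)) S = \<bar>a\<bar> * L2_set (\<lambda>i. cmod (cd x i)) S"
        by (simp add: cd_scaleR L2_set_right_distrib)
      also have "... \<le> \<bar>a\<bar> * norm x" by (intro mult_left_mono L2_le_norm S) auto
      finally show "L2_set (\<lambda>i. cmod (cd (a *\<^sub>R x) i)) S \<le> \<bar>a\<bar> * norm x" .
    qed
    have "\<bar>a\<bar> * norm x \<le> norm (a *\<^sub>R x)"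
    proof (cases "a = 0")
      case True
      have "0 \<le> norm (a *\<^sub>R x)" using cmod_cd_le[of "a *\<^sub>R x" undefined] norm_ge_zero order_trans by blast
      thus ?thesis using True by simp
    next
      case False
      have "(1 / a) *\<^sub>R (a *\<^sub>R x) = x" using False by (intro sqs_eqI) (simp add: cd_scaleR)
      hence "norm x \<le> \<bar>1 / a\<bar> * norm (a *\<^sub>R x)" using le[of "1 / a" "a *\<^sub>R x"] by simp
      thus ?thesis using False by (simp add: field_simps)
    qed
    thus ?thesis using le[of a x] by simp
  qed
qed

end

instance sqs :: (type) banach
proof
  fix X :: "nat \<Rightarrow> 'a sqs" assume X: "Cauchy X"
  have "Cauchy (\<lambda>n. cd (X n) i)" for i
  proof (rule metric_CauchyI)
    fix e :: real assume "0 < e"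
    then obtain N where N: "\<And>m n. N \<le> m \<Longrightarrow> N \<le> n \<Longrightarrow> dist (X m) (X n) < e" using X by (meson Cauchy_def)
    have "dist (cd (X m) i) (cd (X n) i) \<le> dist (X m) (X n)" for m n
      using cmod_cd_le[of "X m - X n" i] by (simp add: cd_minus dist_norm)
    thus "\<exists>M. \<forall>m\<ge>M. \<forall>n\<ge>M. dist (cd (X m) i) (cd (X n) i) < e"
      using N by (meson le_less_trans)
  qed
  hence "\<exists>l. (\<lambda>n. cd (X n) i) \<longlonglongrightarrow> l" for i by (simp add: Cauchy_convergent_iff convergent_def)
  then obtain x where x: "\<And>i. (\<lambda>n. cd (X n) i) \<longlonglongrightarrow> x i" by metis
  \<comment> \<open>The Cauchy bound passes to the coordinatewise limit on each finite set,
    uniformly in the set; membership of the limit and convergence in norm both follow.\<close>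
  have tail: "L2_set (\<lambda>i. cmod (cd (X n) i - x i)) S \<le> e"
    if N: "\<And>m n. N \<le> m \<Longrightarrow> N \<le> n \<Longrightarrow> dist (X m) (X n) < e" and n: "N \<le> n" and S: "finite S" for N n e S
  proof (rule LIMSEQ_le_const2)
    show "(\<lambda>m. L2_set (\<lambda>i. cmod (cd (X n) i - cd (X m) i)) S) \<longlonglongrightarrow> L2_set (\<lambda>i. cmod (cd (X n) i - x i)) S"
      unfolding L2_set_def by (intro tendsto_intros x)
    have "L2_set (\<lambda>i. cmod (cd (X n) i - cd (X m) i)) S \<le> e" if "N \<le> m" for m
      using L2_le_norm[OF S, of "X n - X m"] N[OF n that] by (simp add: cd_minus dist_norm)
    thus "\<exists>M. \<forall>m\<ge>M. L2_set (\<lambda>i. cmod (cd (X n) i - cd (X m) i)) S \<le> e" by blast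
  qed
  have lx: "l2 x"
  proof -
    obtain N where N: "\<And>m n. N \<le> m \<Longrightarrow> N \<le> n \<Longrightarrow> dist (X m) (X n) < 1" using X by (meson Cauchy_def zero_less_one)
    have "l2 (\<lambda>i. - (cd (X N) i - x i))"
      unfolding l2_def by (rule exI[of _ 1]) (use tail[OF N] in \<open>auto simp: norm_minus_commute\<close>)
    hence "l2 (\<lambda>i. cd (X N) i + - (cd (X N) i - x i))" by (intro l2_add) auto
    thus ?thesis by simp
  qed
  have "X \<longlonglongrightarrow> Sqs x"
  proof (rule metric_LIMSEQ_I)
    fix e :: real assume "0 < e"
    then obtain N where N: "\<And>m n. N \<le> m \<Longrightarrow> N \<le> n \<Longrightarrow> dist (X m) (X n) < e / 2" using X by (meson Cauchy_def half_gt_zero)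
    have "dist (X n) (Sqs x) \<le> e / 2" if "N \<le> n" for n
      unfolding dist_norm by (rule norm_sqs_le) (use tail[OF N that] lx in \<open>simp add: cd_minus\<close>)
    moreover have "e / 2 < e" using \<open>0 < e\<close> by simp
    ultimately show "\<exists>N. \<forall>n\<ge>N. dist (X n) (Sqs x) < e" by (meson le_less_trans)
  qed
  thus "convergent X" by (auto simp: convergent_def)
qed

lemma bounded_linear_cd: "bounded_linear (\<lambda>x. cd x i)"
proof (rule bounded_linear_intro[where K = 1])
  show "cd (x + y) i = cd x i + cd y i" "cd (r *\<^sub>R x) i = r *\<^sub>R cd x i" for x y :: "'a sqs" and r
    by (simp_all add: cd_plus cd_scaleR)
  show "norm (cd x i) \<le> norm x * 1" for x :: "'a sqs" by (simp add: cmod_cd_le)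
qed

section \<open>Ordinary differential equations in Banach spaces\<close>

text \<open>Curves are measured with the factor exp (- k |t|) (Bielecki's norm), which makes the
  integral operator a contraction on all of \<open>{-T..T}\<close> at once, whatever
  \<open>T\<close> is. With \<open>k = 2 L + 1\<close> the contraction constant is at most
  1/2.\<close>

lemma picard:
  fixes G :: "real \<Rightarrow> 'a::banach \<Rightarrow> 'a"
  assumes T: "0 \<le> T" and L: "0 \<le> L"
    and lip: "\<And>t x y. norm (G t x - G t y) \<le> L * norm (x - y)"
    and cont: "\<And>x S. continuous_on S x \<Longrightarrow> continuous_on S (\<lambda>t. G t (x t))"
  obtains x where "x 0 = x0" "continuous_on {-T..T} x"
    "\<And>t. t \<in> {-T..T} \<Longrightarrow> (x has_vector_derivative G t (x t)) (at t within {-T..T})"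
proof -
  define k where "k = 2 * L + 1"
  have k: "0 < k" "L / k \<le> 1 / 2" using L by (auto simp: k_def divide_le_eq)
  \<comment> \<open>The fixed point is sought for the rescaled curve and \<open>X\<close> undoes the
    rescaling. Below, \<open>cl\<close> extends curves constantly beyond the interval, so that they
    become bounded continuous functions on the line.\<close>
  define X where "X u t = exp (k * \<bar>t\<bar>) *\<^sub>R apply_bcontfun u t" for u :: "real \<Rightarrow>\<^sub>C 'a" and t
  define g where "g u t = G t (X u t)" for u t
  define F where "F u t = x0 + (integral {-T..t} (g u) - integral {-T..0} (g u))" for u t
  define cl where "cl t = max (-T) (min T t)" for t
  have cl: "cl t \<in> {-T..T}" for t using T by (auto simp: cl_def)
  have Xc: "continuous_on S (X u)" for u S
    unfolding X_def[abs_def] by (intro continuous_intros continuous_on_apply_bcontfun)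
  have gc: "continuous_on S (g u)" for u S unfolding g_def[abs_def] by (rule cont[OF Xc])
  have gi: "g u integrable_on {a..b}" for u a b by (rule integrable_continuous_interval[OF gc])
  have Fder: "(F u has_vector_derivative g u t) (at t within {-T..T})" if "t \<in> {-T..T}" for u t
    using has_vector_derivative_add[OF has_vector_derivative_const[of x0]
        has_vector_derivative_diff[OF integral_has_vector_derivative[OF gc that] has_vector_derivative_const]]
    by (simp add: F_def[abs_def])
  hence Fc: "continuous_on {-T..T} (F u)" for u
    by (meson continuous_on_eq_continuous_within has_vector_derivative_continuous)
  \<comment> \<open>The sign \<sigma> treats intervals to the right and to the left of 0 together;
    the bound integrates the exponential weight explicitly, which produces the quotient
    \<open>L / k\<close>.\<close>
  have gen: "norm (integral {a..b} (g u) - integral {a..b} (g v)) \<le> L / k * dist u v * exp (k * \<bar>t\<bar>)"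
    if ab: "a \<le> b" and e: "\<And>s. s \<in> {a..b} \<Longrightarrow> \<bar>s\<bar> = \<sigma> * s" "\<bar>\<sigma>\<bar> = 1" and t: "\<sigma> * exp (k * (\<sigma> * b)) - \<sigma> * exp (k * (\<sigma> * a)) \<le> exp (k * \<bar>t\<bar>)"
    for a b u v t \<sigma>
  proof -
    have "((\<lambda>s. L * dist u v * exp (k * (\<sigma> * s))) has_integral
        (L / k * dist u v * (\<sigma> * exp (k * (\<sigma> * b))) - L / k * dist u v * (\<sigma> * exp (k * (\<sigma> * a))))) {a..b}"
    proof (rule fundamental_theorem_of_calculus[OF ab])
      fix s
      have "\<sigma> * \<sigma> = 1" using e(2) by (metis abs_mult_self_eq mult_1)
      thus "((\<lambda>s. L / k * dist u v * (\<sigma> * exp (k * (\<sigma> * s)))) has_vector_derivative L * dist u v * exp (k * (\<sigma> * s))) (at s within {a..b})"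
        unfolding has_real_derivative_iff_has_vector_derivative[symmetric]
        using k by (auto intro!: derivative_eq_intros simp: field_simps)
    qed
    note hi = this
    have "norm (integral {a..b} (\<lambda>s. g u s - g v s)) \<le> integral {a..b} (\<lambda>s. L * dist u v * exp (k * (\<sigma> * s)))"
    proof (rule integral_norm_bound_integral[OF integrable_diff[OF gi gi] has_integral_integrable[OF hi]])
      fix s assume s: "s \<in> {a..b}"
      have "norm (g u s - g v s) \<le> L * norm (X u s - X v s)" unfolding g_def by (rule lip)
      also have "norm (X u s - X v s) = exp (k * \<bar>s\<bar>) * dist (apply_bcontfun u s) (apply_bcontfun v s)"
        by (simp add: X_def dist_norm flip: scaleR_diff_right)
      also have "L * ... \<le> L * (exp (k * \<bar>s\<bar>) * dist u v)" using L by (intro mult_left_mono dist_bounded) auto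
      finally show "norm (g u s - g v s) \<le> L * dist u v * exp (k * (\<sigma> * s))" using e(1)[OF s] by (simp add: mult_ac)
    qed
    also have "... = L / k * dist u v * (\<sigma> * exp (k * (\<sigma> * b)) - \<sigma> * exp (k * (\<sigma> * a)))"
      using integral_unique[OF hi] by (simp add: right_diff_distrib)
    also have "... \<le> L / k * dist u v * exp (k * \<bar>t\<bar>)" using L k by (intro mult_left_mono t) auto
    finally show ?thesis using integral_diff[OF gi[of u a b] gi[of v a b]] by simp
  qed
  have Fd: "norm (F u t - F v t) \<le> 1 / 2 * dist u v * exp (k * \<bar>t\<bar>)" if t: "t \<in> {-T..T}" for u v t
  proof -
    have "norm (F u t - F v t) \<le> L / k * dist u v * exp (k * \<bar>t\<bar>)"
    proof (cases "0 \<le> t")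
      case True
      have c: "integral {-T..0} (g w) + integral {0..t} (g w) = integral {-T..t} (g w)" for w
        by (rule Henstock_Kurzweil_Integration.integral_combine) (use True T gi in auto)
      have "F u t - F v t = integral {0..t} (g u) - integral {0..t} (g v)" by (simp add: F_def flip: c)
      thus ?thesis using gen[of 0 t 1 t u v] True by simp
    next
      case False
      have c: "integral {-T..t} (g w) + integral {t..0} (g w) = integral {-T..0} (g w)" for w
        by (rule Henstock_Kurzweil_Integration.integral_combine) (use False t gi in auto)
      have "F u t - F v t = integral {t..0} (g v) - integral {t..0} (g u)" by (simp add: F_def flip: c)
      thus ?thesis using gen[of t 0 "-1" t v u] False by (simp add: dist_commute)
    qed
    also have "... \<le> 1 / 2 * dist u v * exp (k * \<bar>t\<bar>)" by (intro mult_right_mono k) auto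
    finally show ?thesis .
  qed
  define \<Phi> where "\<Phi> u = Bcontfun (\<lambda>t. exp (- (k * \<bar>cl t\<bar>)) *\<^sub>R F u (cl t))" for u
  have \<Phi>: "apply_bcontfun (\<Phi> u) t = exp (- (k * \<bar>cl t\<bar>)) *\<^sub>R F u (cl t)" for u t
  proof -
    have c: "continuous_on {-T..T} (\<lambda>t. exp (- (k * \<bar>t\<bar>)) *\<^sub>R F u t)" by (intro continuous_intros Fc)
    have "bounded ((\<lambda>t. exp (- (k * \<bar>t\<bar>)) *\<^sub>R F u t) ` {-T..T})"
      by (intro compact_imp_bounded compact_continuous_image[OF c]) simp
    hence "bounded (range (\<lambda>t. exp (- (k * \<bar>cl t\<bar>)) *\<^sub>R F u (cl t)))"
      by (rule bounded_subset) (use cl in auto)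
    moreover have "continuous_on UNIV (\<lambda>t. exp (- (k * \<bar>cl t\<bar>)) *\<^sub>R F u (cl t))"
      by (rule continuous_on_compose2[OF c]) (use cl in \<open>auto simp: cl_def[abs_def] intro!: continuous_intros\<close>)
    ultimately have "(\<lambda>t. exp (- (k * \<bar>cl t\<bar>)) *\<^sub>R F u (cl t)) \<in> bcontfun" by (simp add: bcontfun_def)
    thus ?thesis by (simp add: \<Phi>_def Bcontfun_inverse)
  qed
  have "dist (\<Phi> u) (\<Phi> v) \<le> 1 / 2 * dist u v" for u v
  proof (rule dist_bound)
    fix t
    have "dist (apply_bcontfun (\<Phi> u) t) (apply_bcontfun (\<Phi> v) t) = exp (- (k * \<bar>cl t\<bar>)) * norm (F u (cl t) - F v (cl t))"
      by (simp add: \<Phi> dist_norm flip: scaleR_diff_right)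
    also have "... \<le> exp (- (k * \<bar>cl t\<bar>)) * (1 / 2 * dist u v * exp (k * \<bar>cl t\<bar>))" by (intro mult_left_mono Fd cl) auto
    also have "... = 1 / 2 * dist u v" by (simp add: exp_minus field_simps)
    finally show "dist (apply_bcontfun (\<Phi> u) t) (apply_bcontfun (\<Phi> v) t) \<le> 1 / 2 * dist u v" .
  qed
  then obtain u where "\<Phi> u = u" using banach_fix_type[of "1 / 2" \<Phi>] by auto
  hence XF: "X u t = F u t" if "t \<in> {-T..T}" for t
  proof -
    have "cl t = t" using that by (auto simp: cl_def)
    hence "apply_bcontfun u t = exp (- (k * \<bar>t\<bar>)) *\<^sub>R F u t" using \<Phi>[of u t] \<open>\<Phi> u = u\<close> by simp
    thus ?thesis by (simp add: X_def flip: exp_add)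
  qed
  show thesis
  proof (rule that[of "X u"])
    show "X u 0 = x0" using XF[of 0] T by (simp add: F_def)
    show "continuous_on {-T..T} (X u)" by (rule Xc)
    show "(X u has_vector_derivative G t (X u t)) (at t within {-T..T})" if t: "t \<in> {-T..T}" for t
      by (rule has_vector_derivative_transform[OF t XF]) (use Fder[OF t] in \<open>auto simp: g_def\<close>)
  qed
qed

text \<open>On so short an interval the mean value inequality bounds the maximum of the difference
  by a proper fraction of itself.\<close>

lemma ode_unique_local:
  fixes x y :: "real \<Rightarrow> 'a::real_normed_vector"
  assumes der: "\<And>t. t \<in> {a..b} \<Longrightarrow> (x has_vector_derivative F t) (at t within {a..b})"
      "\<And>t. t \<in> {a..b} \<Longrightarrow> (y has_vector_derivative H t) (at t within {a..b})"
    and lip: "\<And>t. t \<in> {a..b} \<Longrightarrow> norm (F t - H t) \<le> L * norm (x t - y t)"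
    and L: "0 \<le> L" "L * (b - a) < 1" and t0: "t0 \<in> {a..b}" "x t0 = y t0" and t: "t \<in> {a..b}"
  shows "x t = y t"
proof -
  let ?d = "\<lambda>t. x t - y t"
  have d: "(?d has_vector_derivative (F t - H t)) (at t within {a..b})" if "t \<in> {a..b}" for t
    by (intro has_vector_derivative_diff der that)
  have "continuous_on {a..b} ?d"
    using d by (meson continuous_on_eq_continuous_within has_vector_derivative_continuous)
  hence "continuous_on {a..b} (\<lambda>t. norm (?d t))" by (rule continuous_on_norm)
  then obtain t1 where t1: "t1 \<in> {a..b}" "\<And>t. t \<in> {a..b} \<Longrightarrow> norm (?d t) \<le> norm (?d t1)"
    using continuous_attains_sup[of "{a..b}" "\<lambda>t. norm (?d t)"] t0(1) by auto
  have "norm (?d t1 - ?d t0) \<le> (L * norm (?d t1)) * norm (t1 - t0)"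
  proof (rule differentiable_bound[of "{a..b}" ?d "\<lambda>t h. h *\<^sub>R (F t - H t)"])
    fix t assume t: "t \<in> {a..b}"
    show "(?d has_derivative (\<lambda>h. h *\<^sub>R (F t - H t))) (at t within {a..b})"
      using d[OF t] by (simp add: has_vector_derivative_def)
    have "norm (F t - H t) \<le> L * norm (?d t1)"
      using lip[OF t] t1(2)[OF t] L(1) mult_left_mono order_trans by blast
    thus "onorm (\<lambda>h. h *\<^sub>R (F t - H t)) \<le> L * norm (?d t1)"
      using L(1) by (intro onorm_bound) (auto intro!: mult_left_mono simp: mult.commute[of "L * _"])
  qed (use t0 t1 in auto)
  also have "... \<le> (L * norm (?d t1)) * (b - a)"
    using t0(1) t1(1) L(1) by (intro mult_left_mono) auto
  finally have "norm (?d t1) \<le> L * (b - a) * norm (?d t1)" using t0(2) by (simp add: mult_ac)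
  hence "(1 - L * (b - a)) * norm (?d t1) \<le> 0" by (simp add: algebra_simps)
  hence "norm (?d t1) \<le> 0" using L(2) by (simp add: mult_le_0_iff)
  thus ?thesis using t1(2)[OF t] by simp
qed

no_notation Infinite_Set_Sum.abs_summable_on (infix "abs'_summable'_on" 50)

section \<open>Absolutely convergent multilinear sums\<close>

definition LL :: "nat \<Rightarrow> 'a list set" where
  "LL k = {M. length M = k}"

text \<open>Each position gets its own function: differences and directional derivatives of
  monomials are sums of products in which a single factor is exchanged.\<close>

fun uprl :: "('a \<Rightarrow> complex) list \<Rightarrow> 'a list \<Rightarrow> complex" where
  "uprl (u # us) (J # M) = u J * uprl us M"
| "uprl _ _ = 1"

lemma cmod_uprl: "cmod (uprl us M) = prodl (map (\<lambda>u J. cmod (u J)) us) M"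
  by (induction us M rule: uprl.induct) (auto simp: norm_mult)

lemma uprl_replicate: "length M = k \<Longrightarrow> uprl (replicate k u) M = upr u M"
  by (induction M arbitrary: k) auto

lemma uprl_telescope:
  assumes "length M = k"
  shows "uprl (replicate k u) M - uprl (replicate k v) M
    = (\<Sum>i<k. uprl (replicate i v @ (\<lambda>J. u J - v J) # replicate (k - Suc i) u) M)"
  using assms
proof (induction M arbitrary: k)
  case (Cons J M)
  then obtain k' where k: "k = Suc k'" "length M = k'" by auto
  have "uprl (replicate k u) (J # M) - uprl (replicate k v) (J # M)
      = (u J - v J) * uprl (replicate k' u) M + v J * (uprl (replicate k' u) M - uprl (replicate k' v) M)"
    by (simp add: k algebra_simps)
  also have "... = (u J - v J) * uprl (replicate k' u) M
      + (\<Sum>i<k'. uprl (replicate (Suc i) v @ (\<lambda>J. u J - v J) # replicate (k - Suc (Suc i)) u) (J # M))"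
    by (simp add: Cons.IH[OF k(2)] sum_distrib_left k(1))
  also have "... = (\<Sum>i<k. uprl (replicate i v @ (\<lambda>J. u J - v J) # replicate (k - Suc i) u) (J # M))"
    unfolding k(1) sum.lessThan_Suc_shift by simp
  finally show ?case .
qed simp

lemma LL_Suc: "LL (Suc k) = (\<lambda>(K, M). K # M) ` (UNIV \<times> LL k)"
  by (force simp: LL_def length_Suc_conv)

lemma inj_cons: "inj_on (\<lambda>(K, M). K # M) X"
  by (auto simp: inj_on_def)

lemma abs_summable_LL_Suc:
  fixes g :: "'a list \<Rightarrow> complex"
  assumes "g abs_summable_on LL (Suc k)"
  shows "(\<lambda>(K, L). cmod (g (K # L))) summable_on UNIV \<times> LL k"
  using assms unfolding LL_Suc summable_on_reindex[OF inj_cons] by (simp add: o_def case_prod_unfold)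

lemma infsum_LL_Suc:
  fixes g :: "'a list \<Rightarrow> complex"
  assumes "g abs_summable_on LL (Suc k)"
  shows "infsum g (LL (Suc k)) = (\<Sum>\<^sub>\<infinity>K. \<Sum>\<^sub>\<infinity>L\<in>LL k. g (K # L))"
proof -
  have "(\<lambda>(K, L). g (K # L)) abs_summable_on UNIV \<times> LL k"
    using abs_summable_LL_Suc[OF assms] by (simp add: case_prod_unfold)
  note sum = abs_summable_summable[OF this]
  have "infsum g (LL (Suc k)) = infsum (\<lambda>(K, L). g (K # L)) (UNIV \<times> LL k)"
    unfolding LL_Suc infsum_reindex[OF inj_cons] by (simp add: o_def case_prod_unfold)
  also have "... = (\<Sum>\<^sub>\<infinity>K. \<Sum>\<^sub>\<infinity>L\<in>LL k. g (K # L))"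
    using infsum_Sigma_banach[OF sum] by simp
  finally show ?thesis .
qed

lemma infsum_diff:
  fixes f g :: "'a \<Rightarrow> complex"
  assumes "f summable_on S" "g summable_on S"
  shows "(\<Sum>\<^sub>\<infinity>x\<in>S. f x - g x) = infsum f S - infsum g S"
  using infsum_add[of f S "\<lambda>x. - g x"] assms by (simp add: infsum_uminus summable_on_uminus)

lemma infsum_sum:
  fixes f :: "'i \<Rightarrow> 'a \<Rightarrow> complex"
  assumes "finite I" "\<And>i. i \<in> I \<Longrightarrow> f i summable_on S"
  shows "(\<lambda>x. \<Sum>i\<in>I. f i x) summable_on S" "(\<Sum>\<^sub>\<infinity>x\<in>S. \<Sum>i\<in>I. f i x) = (\<Sum>i\<in>I. infsum (f i) S)"
proof -
  have "(\<lambda>x. \<Sum>i\<in>I. f i x) summable_on S \<and> (\<Sum>\<^sub>\<infinity>x\<in>S. \<Sum>i\<in>I. f i x) = (\<Sum>i\<in>I. infsum (f i) S)"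
    using assms by (induction I rule: finite_induct) (auto simp: summable_on_add infsum_add)
  thus "(\<lambda>x. \<Sum>i\<in>I. f i x) summable_on S" "(\<Sum>\<^sub>\<infinity>x\<in>S. \<Sum>i\<in>I. f i x) = (\<Sum>i\<in>I. infsum (f i) S)"
    by blast+
qed

text \<open>Unordered sums become limits over boxes. Identities that rest on reordering or
  symmetrisation are exact on each box and pass to the limit, so the combinatorics is never done on
  infinite sums.\<close>

lemma tendsto_infsum_mbox:
  fixes g :: "('n::finite) mode list \<Rightarrow> complex"
  assumes "g summable_on LL k"
  shows "(\<lambda>j. \<Sum>M\<in>LS (mbox (real j)) k. g M) \<longlonglongrightarrow> infsum g (LL k)"
proof -
  have "filterlim (\<lambda>j. LS (mbox (real j) :: 'n mode set) k) (finite_subsets_at_top (LL k)) sequentially"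
    unfolding filterlim_finite_subsets_at_top
  proof (intro allI impI)
    fix X :: "'n mode list set" assume X: "finite X \<and> X \<subseteq> LL k"
    obtain j0 :: nat where j0: "\<And>M. M \<in> X \<Longrightarrow> mnorm M \<le> real j0"
    proof -
      have "finite (mnorm ` X)" using X by simp
      then obtain B where B: "\<forall>x\<in>mnorm ` X. x \<le> B" by (meson bdd_above.unfold bdd_above_finite)
      obtain j0 :: nat where "B \<le> real j0" using real_arch_simple by blast
      thus thesis using that B by (meson imageI order_trans)
    qed
    have "X \<subseteq> LS (mbox (real j)) k" if "j0 \<le> j" for j
    proof
      fix M assume M: "M \<in> X"
      hence "mnorm M \<le> real j" using j0[OF M] that by linarith
      hence "mbox (mnorm M) \<subseteq> (mbox (real j) :: 'n mode set)" by (auto simp: mbox_def)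
      thus "M \<in> LS (mbox (real j)) k" using set_subset_mbox[of M] M X by (auto simp: LS_def LL_def)
    qed
    thus "\<forall>\<^sub>F j in sequentially. finite (LS (mbox (real j) :: 'n mode set) k) \<and> X \<subseteq> LS (mbox (real j)) k
        \<and> LS (mbox (real j)) k \<subseteq> LL k"
      unfolding eventually_sequentially
      by (intro exI[of _ j0] allI impI conjI) (simp, blast, auto simp: LS_def LL_def)
  qed
  moreover have "(g has_sum infsum g (LL k)) (LL k)" using assms by simp
  ultimately show ?thesis unfolding has_sum_def by (rule filterlim_compose[rotated])
qed

lemma prod_list_replicate: "prod_list (replicate k (y :: real)) = y ^ k"
  by (induction k) auto

context weight_sum
begin

definition bndF :: "nat \<Rightarrow> real \<Rightarrow> 'n ham \<Rightarrow> bool" where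
  "bndF k B F \<longleftrightarrow> 0 \<le> B \<and> (\<forall>M. length M = k \<longrightarrow> cmod (F M) \<le> of_bool (mom M = 0) * (B * exp (e2 M)))"

definition nb :: "('n mode \<Rightarrow> complex) \<Rightarrow> real \<Rightarrow> bool" where
  "nb u y \<longleftrightarrow> bdd2 (\<lambda>J. cmod (u J)) y"

text \<open>Finitely many lists involve finitely many modes, so every partial sum of absolute values
  falls under the finite multilinear estimate.\<close>

lemma multi_abs:
  assumes F: "bndF k B F" and us: "list_all2 nb us ys" "length us = k"
  shows "(\<lambda>M. F M * uprl us M) abs_summable_on LL k"
    and "cmod (\<Sum>\<^sub>\<infinity>M\<in>LL k. F M * uprl us M) \<le> B * ((real k + 1)^2 * (b ^ k * prod_list ys))"
proof -
  let ?g = "\<lambda>M. F M * uprl us M" and ?C = "B * ((real k + 1)^2 * (b ^ k * prod_list ys))"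
  let ?xs = "map (\<lambda>u J. cmod (u J)) us"
  have xs: "list_all2 bdd2 ?xs ys" using us(1) by (simp add: list_all2_map1 nb_def[abs_def])
  have fin: "(\<Sum>M\<in>T. cmod (?g M)) \<le> ?C" if T: "finite T" "T \<subseteq> LL k" for T
  proof -
    define S where "S = \<Union> (set ` T)"
    have S: "finite S" using T by (simp add: S_def)
    have "T \<subseteq> LS S k" using T by (auto simp: S_def LS_def LL_def)
    hence "(\<Sum>M\<in>T. cmod (?g M)) \<le> (\<Sum>M\<in>LS S k. cmod (?g M))" using S by (intro sum_mono2) auto
    also have "... \<le> (\<Sum>M\<in>LS S k. B * (of_bool (mom M = 0) * (prodl ?xs M * exp (e2 M))))"
    proof (rule sum_mono)
      fix M assume "M \<in> LS S k"
      hence "cmod (F M) \<le> of_bool (mom M = 0) * (B * exp (e2 M))" using F by (auto simp: bndF_def LS_def)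
      hence "cmod (F M) * prodl ?xs M \<le> of_bool (mom M = 0) * (B * exp (e2 M)) * prodl ?xs M"
        by (rule mult_right_mono) (rule prodl_nonneg[OF xs])
      thus "cmod (?g M) \<le> B * (of_bool (mom M = 0) * (prodl ?xs M * exp (e2 M)))"
        by (simp add: norm_mult cmod_uprl mult_ac)
    qed
    also have "... = B * (\<Sum>M\<in>LS S k. of_bool (mom M = 0) * (prodl ?xs M * exp (e2 M)))"
      by (simp add: sum_distrib_left)
    also have "... \<le> B * ((real (length ?xs) + 1)^2 * (b ^ length ?xs * prod_list ys))"
      using F multilinear_bound[OF xs S, of 0] us(2) by (intro mult_left_mono) (auto simp: bndF_def)
    finally show ?thesis using us(2) by simp
  qed
  show abs: "?g abs_summable_on LL k"
    by (rule nonneg_bdd_above_summable_on) (use fin in \<open>auto simp: bdd_above_def\<close>)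
  have "cmod (infsum ?g (LL k)) \<le> (\<Sum>\<^sub>\<infinity>M\<in>LL k. cmod (?g M))" by (rule norm_infsum_bound[OF abs])
  also have "... \<le> ?C" by (rule infsum_le_finite_sums[OF abs]) (use fin in auto)
  finally show "cmod (infsum ?g (LL k)) \<le> ?C" .
qed

lemma nb_finite:
  assumes "finite S" "0 \<le> Z" "(\<Sum>K\<in>S. (cmod (z K) * exp (s * \<phi> K))^2) \<le> Z^2" "\<And>K. K \<notin> S \<Longrightarrow> z K = 0"
  shows "nb z Z"
  unfolding nb_def bdd2_def
proof (intro conjI allI impI)
  fix S' :: "'n mode set" assume S': "finite S'"
  have "(\<Sum>J\<in>S'. (cmod (z J) * exp (s * \<phi> J))^2) = (\<Sum>J\<in>S' \<inter> S. (cmod (z J) * exp (s * \<phi> J))^2)"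
    using S' assms(4) by (intro sum.mono_neutral_right) auto
  also have "... \<le> (\<Sum>J\<in>S. (cmod (z J) * exp (s * \<phi> J))^2)" using assms(1) by (intro sum_mono2) auto
  finally show "(\<Sum>J\<in>S'. (cmod (z J) * exp (s * \<phi> J))^2) \<le> Z^2" using assms(3) by simp
qed (use assms(2) in auto)

text \<open>Passes from coordinates in which the weighted norm is the plain square sum norm back to
  the state itself.\<close>

definition uof :: "'n mode sqs \<Rightarrow> 'n mode \<Rightarrow> complex" where
  "uof x J = of_real (exp (- s * \<phi> J)) * cd x J"

lemma nb_uof: "nb (uof x) (norm x)"
  unfolding nb_def bdd2_def
proof (intro conjI allI impI)
  fix S :: "'n mode set" assume S: "finite S"
  have "(\<Sum>J\<in>S. (cmod (uof x J) * exp (s * \<phi> J))^2) = (\<Sum>J\<in>S. (cmod (cd x J))^2)"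
  proof (intro sum.cong refl)
    fix J
    have "exp (- s * \<phi> J) * exp (s * \<phi> J) = 1" by (simp flip: exp_add)
    moreover have "cmod (uof x J) * exp (s * \<phi> J) = cmod (cd x J) * (exp (- s * \<phi> J) * exp (s * \<phi> J))"
      by (simp add: uof_def norm_mult)
    ultimately show "(cmod (uof x J) * exp (s * \<phi> J))^2 = (cmod (cd x J))^2" by simp
  qed
  also have "... \<le> (norm x)^2"
    using L2_le_norm[OF S, of x] unfolding L2_set_def by (rule sqrt_le_D)
  finally show "(\<Sum>J\<in>S. (cmod (uof x J) * exp (s * \<phi> J))^2) \<le> (norm x)^2" .
qed auto

lemma list_all2_replicate: "nb u y \<Longrightarrow> list_all2 nb (replicate k u) (replicate k y)"
  by (induction k) auto

lemma uof_diff: "uof (x - y) J = uof x J - uof y J"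
  by (simp add: uof_def cd_minus algebra_simps)

end

section \<open>The vector field of the perturbation\<close>

locale ham_pert = weight_sum \<phi> Cf C1 s0 s b for \<phi> :: "('n::finite) mode \<Rightarrow> real" and Cf C1 s0 s b +
  fixes p :: "nat \<Rightarrow> 'n ham" and A :: real
  assumes A1: "1 \<le> A" and p_cls: "1 \<le> n \<Longrightarrow> cls e1 n (A ^ n) (p n)"
begin

definition hpl :: "nat \<Rightarrow> 'n mode \<Rightarrow> ('n mode \<Rightarrow> complex) list \<Rightarrow> complex" where
  "hpl n K us = (\<Sum>\<^sub>\<infinity>L\<in>LL (n + 1). p n (K # L) * uprl us L) / fact (n + 1)"

text \<open>The factors \<open>(n + 3)^2\<close> and \<open>b ^ (n + 2)\<close> come from the
  multilinear estimate for \<open>n + 2\<close> modes, and \<open>n + 2\<close> is the quotient of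
  the factorials in \<open>cls\<close> and in the vector field.\<close>

definition Cn :: "nat \<Rightarrow> real" where
  "Cn n = real (n + 2) * (real n + 3)^2 * A ^ n * b ^ (n + 2)"

lemma Cn_nonneg: "0 \<le> Cn n"
  using A1 b1 by (simp add: Cn_def)

lemma bndF_vf:
  assumes n: "1 \<le> n"
  shows "bndF (n + 2) (A ^ n * fact (n + 2)) (\<lambda>M. p n M * of_real (exp (2 * s * \<phi> (hd M))))"
  unfolding bndF_def
proof (intro conjI allI impI)
  show "0 \<le> A ^ n * fact (n + 2)" using A1 by simp
  fix M :: "'n mode list" assume "length M = n + 2"
  then obtain K L where M: "M = K # L" "L \<noteq> []" by (cases M; cases "tl M") auto
  note D = clsD[OF p_cls[OF n]]
  show "cmod (p n M * of_real (exp (2 * s * \<phi> (hd M)))) \<le> of_bool (mom M = 0) * (A ^ n * fact (n + 2) * exp (e2 M))"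
  proof (cases "mom M = 0")
    case True
    have "cmod (p n M) * exp (2 * s * \<phi> K) \<le> A ^ n * fact (n + 2) * exp (e1 M) * exp (2 * s * \<phi> K)"
      by (intro mult_right_mono D) simp
    also have "... = A ^ n * fact (n + 2) * exp (e1 M + 2 * s * \<phi> K)" by (simp add: exp_add)
    also have "... \<le> A ^ n * fact (n + 2) * exp (e2 M)"
      using e1_vf[of K L] True A1 by (intro mult_left_mono) (auto simp: M)
    finally show ?thesis using True by (simp add: norm_mult M)
  next
    case False
    hence "p n M = 0" using D(2) by (auto simp: zm_def)
    thus ?thesis using False by simp
  qed
qed

text \<open>Duality: with the conjugate of the field, restricted to \<open>S\<close>, as an
  additional argument, the squared norm becomes a value of the multilinear form in
  \<open>n + 2\<close> arguments. The multilinear estimate is linear in the norm of that argument,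
  and one power of the norm cancels.\<close>

lemma hpl_bounds:
  assumes n: "1 \<le> n" and us: "list_all2 nb us ys" "length us = n + 1"
  shows "(\<lambda>L. p n (K # L) * uprl us L) abs_summable_on LL (n + 1)"
    and "finite S \<Longrightarrow> L2_set (\<lambda>K. cmod (hpl n K us) * exp (s * \<phi> K)) S \<le> Cn n * prod_list ys"
proof -
  let ?F = "\<lambda>M. p n M * of_real (exp (2 * s * \<phi> (hd M)))"
  have ab: "(\<lambda>(K, L). cmod (?F (K # L) * uprl (z # us) (K # L))) summable_on UNIV \<times> LL (n + 1)"
    if "nb z Z" for z Z
  proof -
    have "(\<lambda>M. ?F M * uprl (z # us) M) abs_summable_on LL (Suc (n + 1))"
      using multi_abs(1)[OF bndF_vf[OF n], of "z # us" "Z # ys"] us that by simp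
    from abs_summable_LL_Suc[OF this] show ?thesis .
  qed
  \<comment> \<open>A point mass at \<open>K\<close> as first argument reduces summability of one
    component to that of the full form.\<close>
  let ?z = "\<lambda>J. if J = K then 1 else (0 :: complex)"
  have "nb ?z (exp (s * \<phi> K))" by (rule nb_finite[of "{K}"]) auto
  from summable_on_SigmaD1[OF ab[OF this], of K]
  have "(\<lambda>L. ?F (K # L) * uprl (?z # us) (K # L)) abs_summable_on LL (n + 1)" by simp
  hence ea: "(\<lambda>L. of_real (exp (- (2 * s * \<phi> K))) * (?F (K # L) * uprl (?z # us) (K # L))) abs_summable_on LL (n + 1)"
    unfolding norm_mult by (rule summable_on_cmult_right)
  have eb: "of_real (exp (- (2 * s * \<phi> K))) * (?F (K # L) * uprl (?z # us) (K # L)) = p n (K # L) * uprl us L" for L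
  proof -
    have "complex_of_real (exp (- (2 * s * \<phi> K))) * of_real (exp (2 * s * \<phi> K)) = 1"
      by (simp flip: of_real_mult exp_add)
    thus ?thesis by (simp add: mult_ac)
  qed
  show "(\<lambda>L. p n (K # L) * uprl us L) abs_summable_on LL (n + 1)" using ea unfolding eb .
next
  assume S: "finite S"
  let ?F = "\<lambda>M. p n M * of_real (exp (2 * s * \<phi> (hd M)))"
  define Z where "Z = L2_set (\<lambda>K. cmod (hpl n K us) * exp (s * \<phi> K)) S"
  define z where "z K = (if K \<in> S then cnj (hpl n K us) else 0)" for K
  have Z2: "(\<Sum>K\<in>S. (cmod (hpl n K us) * exp (s * \<phi> K))^2) = Z^2"
    by (simp add: Z_def L2_set_def sum_nonneg)
  have Z0: "0 \<le> Z" by (simp add: Z_def L2_set_nonneg)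
  have z: "nb z Z" by (rule nb_finite[OF S Z0]) (auto simp: z_def Z2 cong: sum.cong)
  have la: "list_all2 nb (z # us) (Z # ys)" using z us by simp
  have len: "length (z # us) = n + 2" using us by simp
  note m = multi_abs[OF bndF_vf[OF n] la len]
  have inner: "(\<Sum>\<^sub>\<infinity>L\<in>LL (n + 1). ?F (K # L) * uprl (z # us) (K # L))
      = z K * of_real (exp (2 * s * \<phi> K)) * (fact (n + 1) * hpl n K us)" for K
  proof -
    have "(\<Sum>\<^sub>\<infinity>L\<in>LL (n + 1). ?F (K # L) * uprl (z # us) (K # L))
        = (\<Sum>\<^sub>\<infinity>L\<in>LL (n + 1). (z K * of_real (exp (2 * s * \<phi> K))) * (p n (K # L) * uprl us L))"
      by (intro infsum_cong) (simp add: mult_ac)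
    also have "... = z K * of_real (exp (2 * s * \<phi> K)) * (\<Sum>\<^sub>\<infinity>L\<in>LL (n + 1). p n (K # L) * uprl us L)"
      by (rule infsum_cmult_right')
    also have "(\<Sum>\<^sub>\<infinity>L\<in>LL (n + 1). p n (K # L) * uprl us L) = fact (n + 1) * hpl n K us"
      by (simp add: hpl_def del: fact_Suc)
    finally show ?thesis .
  qed
  have "(\<Sum>\<^sub>\<infinity>M\<in>LL (n + 2). ?F M * uprl (z # us) M)
      = (\<Sum>\<^sub>\<infinity>K. \<Sum>\<^sub>\<infinity>L\<in>LL (n + 1). ?F (K # L) * uprl (z # us) (K # L))"
    using infsum_LL_Suc[of "\<lambda>M. ?F M * uprl (z # us) M" "n + 1"] m(1) by (simp del: list.sel uprl.simps)
  also have "... = (\<Sum>\<^sub>\<infinity>K. z K * of_real (exp (2 * s * \<phi> K)) * (fact (n + 1) * hpl n K us))"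
    by (simp only: inner)
  also have "... = (\<Sum>K\<in>S. z K * of_real (exp (2 * s * \<phi> K)) * (fact (n + 1) * hpl n K us))"
    by (rule infsum_finite_support(2)[OF S]) (auto simp: z_def)
  also have "... = (\<Sum>K\<in>S. of_real (fact (n + 1) * (cmod (hpl n K us) * exp (s * \<phi> K))^2))"
  proof (intro sum.cong refl)
    fix K assume K: "K \<in> S"
    have "cnj (hpl n K us) * hpl n K us = of_real ((cmod (hpl n K us))^2)"
      by (metis complex_norm_square mult.commute of_real_power)
    moreover have "exp (2 * s * \<phi> K) = (exp (s * \<phi> K))^2" by (simp add: mult.assoc flip: exp_double)
    ultimately show "z K * of_real (exp (2 * s * \<phi> K)) * (fact (n + 1) * hpl n K us)
        = of_real (fact (n + 1) * (cmod (hpl n K us) * exp (s * \<phi> K))^2)"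
      using K by (simp add: z_def power_mult_distrib mult_ac)
  qed
  also have "... = of_real (fact (n + 1) * Z^2)"
    unfolding of_real_sum[symmetric] sum_distrib_left[symmetric] Z2 ..
  finally have "fact (n + 1) * Z^2 = cmod (\<Sum>\<^sub>\<infinity>M\<in>LL (n + 2). ?F M * uprl (z # us) M)"
    by (simp only: norm_of_real) simp
  also have "... \<le> A ^ n * fact (n + 2) * ((real (n + 2) + 1)^2 * (b ^ (n + 2) * prod_list (Z # ys)))"
    by (rule m(2))
  also have "... = fact (n + 1) * (Z * (Cn n * prod_list ys))"
    by (simp add: Cn_def algebra_simps)
  finally have "Z * Z \<le> Z * (Cn n * prod_list ys)" by (simp add: power2_eq_square)
  moreover have "0 \<le> prod_list ys"
    using us(1) by (induction us ys rule: list_all2_induct) (auto simp: nb_def bdd2_def)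
  ultimately show "Z \<le> Cn n * prod_list ys"
    using Z0 Cn_nonneg[of n] by (cases "Z = 0") auto
qed

definition V :: "nat \<Rightarrow> ('n mode \<Rightarrow> complex) list \<Rightarrow> 'n mode sqs" where
  "V n us = Sqs (\<lambda>K. cf K * of_real (exp (s * \<phi> K)) * hpl n (bar K) us)"

lemma V_bounds:
  assumes n: "1 \<le> n" and us: "list_all2 nb us ys" "length us = n + 1"
  shows "cd (V n us) K = cf K * of_real (exp (s * \<phi> K)) * hpl n (bar K) us"
    and "norm (V n us) \<le> Cn n * prod_list ys"
proof -
  have L: "L2_set (\<lambda>K. cmod (cf K * of_real (exp (s * \<phi> K)) * hpl n (bar K) us)) S \<le> Cn n * prod_list ys"
    if S: "finite S" for S
  proof -
    have "(\<Sum>K\<in>S. (exp (s * \<phi> K) * cmod (hpl n (bar K) us))^2) = (\<Sum>K\<in>bar ` S. (cmod (hpl n K us) * exp (s * \<phi> K))^2)"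
      by (subst sum.reindex) (auto simp: inj_on_def mult.commute intro: bar_bar dest: arg_cong[where f = bar])
    hence "L2_set (\<lambda>K. cmod (cf K * of_real (exp (s * \<phi> K)) * hpl n (bar K) us)) S
        = L2_set (\<lambda>K. cmod (hpl n K us) * exp (s * \<phi> K)) (bar ` S)"
      by (simp add: L2_set_def norm_mult)
    thus ?thesis using hpl_bounds(2)[OF n us, of "bar ` S"] S by simp
  qed
  hence l: "l2 (\<lambda>K. cf K * of_real (exp (s * \<phi> K)) * hpl n (bar K) us)" unfolding l2_def by blast
  thus "cd (V n us) K = cf K * of_real (exp (s * \<phi> K)) * hpl n (bar K) us" by (simp add: V_def)
  show "norm (V n us) \<le> Cn n * prod_list ys"
    by (rule norm_sqs_le) (use L l in \<open>simp add: V_def\<close>)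
qed

definition Xg :: "nat \<Rightarrow> 'n mode sqs \<Rightarrow> 'n mode sqs" where
  "Xg n x = V n (replicate (n + 1) (uof x))"

lemma norm_Xg:
  assumes "1 \<le> n"
  shows "norm (Xg n x) \<le> Cn n * norm x ^ (n + 1)"
  using V_bounds(2)[OF assms list_all2_replicate[OF nb_uof], of "n + 1" x]
  by (simp add: Xg_def prod_list_replicate del: replicate.simps)

text \<open>The field is a multilinear map on the diagonal. Exchanging its \<open>n + 1\<close>
  arguments one by one gives as many terms, each linear in the difference.\<close>

lemma Xg_lipschitz:
  assumes n: "1 \<le> n" and R: "norm x \<le> R" "norm y \<le> R"
  shows "norm (Xg n x - Xg n y) \<le> Cn n * real (n + 1) * R ^ n * norm (x - y)"
proof -
  let ?w = "\<lambda>J. uof x J - uof y J"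
  define us where "us i = replicate i (uof y) @ ?w # replicate (n - i) (uof x)" for i
  define ys where "ys i = replicate i (norm y) @ norm (x - y) # replicate (n - i) (norm x)" for i
  have w: "nb ?w (norm (x - y))" using nb_uof[of "x - y"] by (simp add: uof_diff[abs_def])
  have la: "list_all2 nb (us i) (ys i)" for i
    unfolding us_def ys_def by (intro list_all2_appendI list_all2_replicate nb_uof list_all2_Cons[THEN iffD2] conjI w)
  have len: "length (us i) = n + 1" if "i < n + 1" for i using that by (simp add: us_def)
  have lx: "length (replicate (n + 1) (uof z)) = n + 1" for z by simp
  have hd: "hpl n K (replicate (n + 1) (uof x)) - hpl n K (replicate (n + 1) (uof y)) = (\<Sum>i<n + 1. hpl n K (us i))" for K
  proof -
    let ?g = "\<lambda>us L. p n (K # L) * uprl us L"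
    note sx = abs_summable_summable[OF hpl_bounds(1)[OF n list_all2_replicate[OF nb_uof] lx]]
    have si: "?g (us i) summable_on LL (n + 1)" if "i < n + 1" for i
      by (rule abs_summable_summable[OF hpl_bounds(1)[OF n la len[OF that]]])
    have "infsum (?g (replicate (n + 1) (uof x))) (LL (n + 1)) - infsum (?g (replicate (n + 1) (uof y))) (LL (n + 1))
        = (\<Sum>\<^sub>\<infinity>L\<in>LL (n + 1). ?g (replicate (n + 1) (uof x)) L - ?g (replicate (n + 1) (uof y)) L)"
      by (rule infsum_diff[symmetric]) (rule sx)+
    also have "... = (\<Sum>\<^sub>\<infinity>L\<in>LL (n + 1). \<Sum>i<n + 1. ?g (us i) L)"
    proof (rule infsum_cong)
      fix L :: "'n mode list" assume "L \<in> LL (n + 1)"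
      hence "length L = n + 1" by (simp add: LL_def)
      from uprl_telescope[OF this, of "uof x" "uof y"]
      show "?g (replicate (n + 1) (uof x)) L - ?g (replicate (n + 1) (uof y)) L = (\<Sum>i<n + 1. ?g (us i) L)"
        unfolding right_diff_distrib[symmetric] sum_distrib_left[symmetric] us_def
        by (simp del: replicate.simps sum.lessThan_Suc)
    qed
    also have "... = (\<Sum>i<n + 1. infsum (?g (us i)) (LL (n + 1)))"
      by (rule infsum_sum(2)) (use si in auto)
    finally show ?thesis unfolding hpl_def diff_divide_distrib[symmetric] sum_divide_distrib[symmetric] by simp
  qed
  have "Xg n x - Xg n y = (\<Sum>i<n + 1. V n (us i))"
  proof (rule sqs_eqI)
    fix K
    have sumcd: "cd (\<Sum>i<m. V n (us i)) K = (\<Sum>i<m. cd (V n (us i)) K)" for m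
      by (induction m) (auto simp: cd_zero cd_plus)
    have "cd (\<Sum>i<n + 1. V n (us i)) K = (\<Sum>i<n + 1. cd (V n (us i)) K)" by (rule sumcd)
    also have "... = (\<Sum>i<n + 1. cf K * of_real (exp (s * \<phi> K)) * hpl n (bar K) (us i))"
      by (intro sum.cong refl V_bounds(1)[OF n la len]) simp
    also have "... = cf K * of_real (exp (s * \<phi> K)) * (\<Sum>i<n + 1. hpl n (bar K) (us i))"
      by (simp only: sum_distrib_left)
    also have "... = cd (Xg n x - Xg n y) K"
      unfolding hd[symmetric] cd_minus Xg_def V_bounds(1)[OF n list_all2_replicate[OF nb_uof] lx]
      by (simp add: right_diff_distrib del: replicate.simps)
    finally show "cd (Xg n x - Xg n y) K = cd (\<Sum>i<n + 1. V n (us i)) K" by simp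
  qed
  hence "norm (Xg n x - Xg n y) \<le> (\<Sum>i<n + 1. norm (V n (us i)))" by (simp only: norm_sum)
  also have "... \<le> (\<Sum>i<n + 1. Cn n * (R ^ n * norm (x - y)))"
  proof (rule sum_mono)
    fix i assume i: "i \<in> {..<n + 1}"
    have "norm (V n (us i)) \<le> Cn n * prod_list (ys i)" by (rule V_bounds(2)[OF n la len]) (use i in simp)
    also have "prod_list (ys i) = norm y ^ i * norm x ^ (n - i) * norm (x - y)"
      by (simp add: ys_def prod_list_replicate)
    also have "... \<le> R ^ i * R ^ (n - i) * norm (x - y)"
      using R order_trans[OF norm_ge_zero R(1)] by (intro mult_right_mono mult_mono power_mono) auto
    also have "R ^ i * R ^ (n - i) = R ^ n" using i by (simp flip: power_add)
    finally show "norm (V n (us i)) \<le> Cn n * (R ^ n * norm (x - y))"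
      using Cn_nonneg[of n] by (simp add: mult_left_mono)
  qed
  also have "... = Cn n * real (n + 1) * R ^ n * norm (x - y)" by simp
  finally show ?thesis .
qed

lemma Cn_le: "Cn n \<le> 27 * b^2 * (8 * A * b) ^ n" and Cn_le': "Cn n * real (n + 1) \<le> 27 * b^2 * (16 * A * b) ^ n"
proof -
  have n3: "real n + 1 \<le> 2 ^ n" 
    by (induction n) auto
  have n3': "real n + 3 \<le> 3 * 2 ^ n" "real (n + 2) \<le> 3 * 2 ^ n" using n3 by auto
  have "real (n + 2) * (real n + 3)^2 \<le> (3 * 2 ^ n) * (3 * 2 ^ n)^2"
    by (intro mult_mono power_mono n3') auto
  also have "... = 27 * (2 ^ n) ^ 3" by (simp add: power2_eq_square power3_eq_cube)
  also have "(2 ^ n) ^ 3 = ((2 :: real) ^ 3) ^ n" by (simp only: power_mult[symmetric] mult.commute)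
  also have "... = 8 ^ n" by simp
  finally have q: "real (n + 2) * (real n + 3)^2 \<le> 27 * 8 ^ n" .
  have "Cn n \<le> 27 * 8 ^ n * A ^ n * b ^ (n + 2)"
    unfolding Cn_def using A1 b1 by (intro mult_right_mono q) auto
  also have "... = 27 * b^2 * (8 * A * b) ^ n" by (simp add: power_mult_distrib power_add power2_eq_square mult_ac)
  finally show 1: "Cn n \<le> 27 * b^2 * (8 * A * b) ^ n" .
  have "Cn n * real (n + 1) \<le> 27 * b^2 * (8 * A * b) ^ n * 2 ^ n"
    using n3 A1 b1 by (intro mult_mono 1) auto
  also have "... = 27 * b^2 * (8 * A * b * 2) ^ n" by (simp only: power_mult_distrib mult.assoc)
  finally show "Cn n * real (n + 1) \<le> 27 * b^2 * (16 * A * b) ^ n" by (simp add: mult_ac)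
qed

text \<open>At this radius the Lipschitz constants of the grades, as bounded by
  \<open>Cn_le'\<close>, form a geometric series of ratio 1/2.\<close>

definition R0 :: real where
  "R0 = 1 / (32 * A * b)"

lemma R0_pos: "0 < R0"
  using A1 b1 by (simp add: R0_def)

lemma lipschitz_series: "norm x \<le> R0 \<Longrightarrow> norm y \<le> R0 \<Longrightarrow>
    norm (Xg (Suc n) x - Xg (Suc n) y) \<le> 27 * b^2 * (1 / 2) ^ Suc n * norm (x - y)"
proof -
  assume xy: "norm x \<le> R0" "norm y \<le> R0"
  have "norm (Xg (Suc n) x - Xg (Suc n) y) \<le> Cn (Suc n) * real (Suc n + 1) * R0 ^ Suc n * norm (x - y)"
    by (rule Xg_lipschitz) (use xy in auto)
  also have "... \<le> 27 * b^2 * (16 * A * b) ^ Suc n * R0 ^ Suc n * norm (x - y)"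
    using R0_pos by (intro mult_right_mono Cn_le') auto
  also have "(27 * b^2 * (16 * A * b) ^ Suc n * R0 ^ Suc n) = 27 * b^2 * (16 * A * b * R0) ^ Suc n"
    by (simp only: power_mult_distrib mult.assoc)
  also have "16 * A * b * R0 = 1 / 2" using A1 b1 by (simp add: R0_def)
  finally show ?thesis .
qed

lemma Xg_zero: "Xg (Suc n) 0 = 0"
  using norm_Xg[of "Suc n" 0] by simp

lemma norm_Xg_le: "norm x \<le> R0 \<Longrightarrow> norm (Xg (Suc n) x) \<le> 27 * b^2 * (1 / 2) ^ Suc n * norm x"
  using lipschitz_series[of x 0 n] R0_pos by (simp add: Xg_zero)

lemma summable_Xg: "norm x \<le> R0 \<Longrightarrow> summable (\<lambda>n. norm (Xg (Suc n) x))"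
proof (rule summable_comparison_test)
  assume "norm x \<le> R0"
  thus "\<exists>N. \<forall>n\<ge>N. norm (norm (Xg (Suc n) x)) \<le> 27 * b^2 * (1 / 2) ^ Suc n * norm x"
    using norm_Xg_le by simp
  have "summable (\<lambda>n. (1 / 2 :: real) ^ Suc n)" by (subst summable_Suc_iff) (rule summable_geometric, simp)
  thus "summable (\<lambda>n. 27 * b^2 * (1 / 2) ^ Suc n * norm x)"
    by (intro summable_mult summable_mult2)
qed

definition XP :: "'n mode sqs \<Rightarrow> 'n mode sqs" where
  "XP x = (\<Sum>n. Xg (Suc n) x)"

lemma XP_lipschitz:
  assumes "norm x \<le> R0" "norm y \<le> R0"
  shows "norm (XP x - XP y) \<le> 27 * b^2 * norm (x - y)"
proof -
  have h: "(\<lambda>n. (1 / 2 :: real) ^ Suc n) sums 1" using power_half_series .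
  have "XP x - XP y = (\<Sum>n. Xg (Suc n) x - Xg (Suc n) y)"
    unfolding XP_def
    by (rule suminf_diff[OF summable_norm_cancel[OF summable_Xg[OF assms(1)]]
          summable_norm_cancel[OF summable_Xg[OF assms(2)]]])
  also have "norm ... \<le> (\<Sum>n. 27 * b^2 * (1 / 2) ^ Suc n * norm (x - y))"
  proof (rule norm_suminf_le)
    show "norm (Xg (Suc n) x - Xg (Suc n) y) \<le> 27 * b^2 * (1 / 2) ^ Suc n * norm (x - y)" for n
      by (rule lipschitz_series) (use assms in auto)
    show "summable (\<lambda>n. 27 * b^2 * (1 / 2) ^ Suc n * norm (x - y))"
      using h by (intro summable_mult summable_mult2) (auto simp: sums_iff)
  qed
  also have "... = 27 * b^2 * norm (x - y)"
    using sums_unique[OF sums_mult2[OF sums_mult[OF h, of "27 * b^2"], of "norm (x - y)"]] by simp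
  finally show ?thesis .
qed

text \<open>The omitted grades form a geometric series in \<open>8 A b y\<close>, which is at most
  1/2 in this range, so the first of them dominates. This is the part of the dynamics that an energy
  of finite order ignores.\<close>

lemma XP_tail:
  assumes x: "norm x \<le> y" "y \<le> R0"
  shows "norm (XP x - (\<Sum>n<m. Xg (Suc n) x)) \<le> 54 * b^2 * y * (8 * A * b * y) ^ Suc m"
proof -
  let ?q = "8 * A * b * y"
  have y0: "0 \<le> y" using x(1) norm_ge_zero order_trans by blast
  have q: "0 \<le> ?q" "?q \<le> 1 / 2"
  proof -
    show "0 \<le> ?q" using y0 A1 b1 by simp
    have "?q \<le> 8 * A * b * R0" using x A1 b1 by (intro mult_left_mono) auto
    also have "... \<le> 1 / 2" using A1 b1 by (simp add: R0_def)
    finally show "?q \<le> 1 / 2" .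
  qed
  have sm: "summable (\<lambda>n. norm (Xg (Suc n) x))" using x by (intro summable_Xg) simp
  have "XP x - (\<Sum>n<m. Xg (Suc n) x) = (\<Sum>n. Xg (Suc (n + m)) x)"
    unfolding XP_def using suminf_minus_initial_segment[OF summable_norm_cancel[OF sm], of m] by simp
  also have "norm ... \<le> (\<Sum>n. 27 * b^2 * y * ?q ^ Suc m * ?q ^ n)"
  proof (rule norm_suminf_le)
    fix n
    have "norm (Xg (Suc (n + m)) x) \<le> Cn (Suc (n + m)) * norm x ^ (Suc (n + m) + 1)" by (rule norm_Xg) simp
    also have "... \<le> (27 * b^2 * (8 * A * b) ^ Suc (n + m)) * y ^ (Suc (n + m) + 1)"
      using x A1 b1 y0 by (intro mult_mono Cn_le power_mono) auto
    also have "... = 27 * b^2 * y * ?q ^ (Suc m + n)"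
      by (simp add: power_mult_distrib power_add mult_ac)
    also have "... = 27 * b^2 * y * ?q ^ Suc m * ?q ^ n" by (simp only: power_add mult.assoc)
    finally show "norm (Xg (Suc (n + m)) x) \<le> 27 * b^2 * y * ?q ^ Suc m * ?q ^ n" .
    show "summable (\<lambda>n. 27 * b^2 * y * ?q ^ Suc m * ?q ^ n)"
      using q by (intro summable_mult summable_geometric) simp
  qed
  also have "... = 27 * b^2 * y * ?q ^ Suc m * (1 / (1 - ?q))"
    using q by (subst suminf_mult) (auto intro: summable_geometric simp: suminf_geometric simp del: power_Suc)
  also have "... \<le> 27 * b^2 * y * ?q ^ Suc m * 2"
    using q y0 A1 b1 by (intro mult_left_mono) (auto simp: divide_le_eq)
  finally show ?thesis by simp
qed

end

section \<open>The rotating frame\<close>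

lemma L2_set_sub_le:
  assumes "finite S" "finite F" "L2_set g (S \<union> F) \<le> N" "N^2 - e^2 \<le> (L2_set g F)^2" "0 \<le> e"
  shows "L2_set g (S - F) \<le> e"
proof -
  have "(L2_set g (S - F))^2 + (L2_set g F)^2 = (L2_set g (S \<union> F))^2"
  proof -
    have "(\<Sum>i\<in>S \<union> F. (g i)^2) = (\<Sum>i\<in>S - F. (g i)^2) + (\<Sum>i\<in>F. (g i)^2)"
      using assms(1,2) by (subst sum.union_disjoint[symmetric]) (auto intro: sum.cong)
    thus ?thesis by (simp add: L2_set_def sum_nonneg)
  qed
  also have "... \<le> N^2" using assms(3) by (intro power_mono) (auto simp: L2_set_nonneg)
  finally have "(L2_set g (S - F))^2 \<le> e^2" using assms(4) by simp
  thus ?thesis using assms(5) by (rule power2_le_imp_le)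
qed

text \<open>A finite set on which the supremum in the norm is nearly attained; by additivity of
  squares little can remain outside it.\<close>

lemma sqs_tail:
  assumes "0 < e"
  obtains F where "finite F" "\<And>S. finite S \<Longrightarrow> L2_set (\<lambda>i. cmod (cd x i)) (S - F) \<le> e"
proof -
  let ?g = "\<lambda>i. cmod (cd x i)"
  have "\<exists>F. finite F \<and> (norm x)\<^sup>2 - e^2 \<le> (L2_set ?g F)^2"
  proof (rule ccontr)
    assume n: "\<not> ?thesis"
    hence lt: "(L2_set ?g F)^2 < (norm x)^2 - e^2" if "finite F" for F
      using that not_le by blast
    have "0 \<le> (norm x)^2 - e^2" using lt[of "{}"] by simp
    hence "norm x \<le> sqrt ((norm x)^2 - e^2)"
      by (intro norm_sqs_le real_le_rsqrt less_imp_le lt)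
    also have "... < sqrt ((norm x)^2)" using assms by (intro real_sqrt_less_mono) simp
    finally show False by simp
  qed
  then obtain F where F: "finite F" "(norm x)^2 - e^2 \<le> (L2_set ?g F)^2" by blast
  show thesis
    by (rule that[OF F(1)]) (rule L2_set_sub_le[OF _ F(1) L2_le_norm F(2)], use assms F in auto)
qed

definition rotg :: "('a \<Rightarrow> real) \<Rightarrow> real \<Rightarrow> 'a sqs \<Rightarrow> 'a sqs" where
  "rotg \<theta> t x = Sqs (\<lambda>J. cis (t * \<theta> J) * cd x J)"

lemma cd_rotg: "cd (rotg \<theta> t x) J = cis (t * \<theta> J) * cd x J"
  by (simp add: rotg_def l2_mult[where B = 1])

lemma norm_rotg [simp]: "norm (rotg \<theta> t x) = norm x"
proof -
  have le: "norm (rotg \<theta> t x) \<le> norm x" for t x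
    by (rule norm_sqs_le) (simp add: cd_rotg norm_mult L2_le_norm)
  have "rotg \<theta> (- t) (rotg \<theta> t x) = x"
    by (rule sqs_eqI) (simp add: cd_rotg cis_mult mult.assoc[symmetric])
  hence "norm x \<le> norm (rotg \<theta> t x)" using le[of "- t" "rotg \<theta> t x"] by simp
  thus ?thesis using le[of t x] by simp
qed

lemma rotg_diff: "rotg \<theta> t (x - y) = rotg \<theta> t x - rotg \<theta> t y"
  by (rule sqs_eqI) (simp add: cd_rotg cd_minus algebra_simps)

lemma rotg_rotg: "rotg \<theta> t (rotg \<theta> t' x) = rotg \<theta> (t + t') x"
  by (rule sqs_eqI) (simp add: cd_rotg distrib_right cis_mult[symmetric] mult.assoc)

lemma rotg_0 [simp]: "rotg \<theta> 0 x = x"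
  by (rule sqs_eqI) (simp add: cd_rotg)

text \<open>The speeds may be unbounded, so no continuity uniform in \<open>x\<close> can be
  expected. For fixed \<open>x\<close>, finitely many coordinates move continuously, and the tail
  changes by at most twice its own size.\<close>

lemma rotg_strong_continuous: "((\<lambda>t. rotg \<theta> t x) \<longlongrightarrow> rotg \<theta> t0 x) (at t0 within T)"
proof (rule tendstoI)
  fix e :: real assume e: "0 < e"
  obtain F where F: "finite F" "\<And>S. finite S \<Longrightarrow> L2_set (\<lambda>i. cmod (cd x i)) (S - F) \<le> e / 8"
    using sqs_tail[of "e / 8" x] e by auto
  have "((\<lambda>t. \<Sum>i\<in>F. cmod (cis (t * \<theta> i) - cis (t0 * \<theta> i)) * cmod (cd x i))
      \<longlongrightarrow> (\<Sum>i\<in>F. cmod (cis (t0 * \<theta> i) - cis (t0 * \<theta> i)) * cmod (cd x i))) (at t0 within T)"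
    unfolding cis_conv_exp by (intro tendsto_intros)
  hence "\<forall>\<^sub>F t in at t0 within T. (\<Sum>i\<in>F. cmod (cis (t * \<theta> i) - cis (t0 * \<theta> i)) * cmod (cd x i)) < e / 2"
    using e by (intro order_tendstoD) auto
  thus "\<forall>\<^sub>F t in at t0 within T. dist (rotg \<theta> t x) (rotg \<theta> t0 x) < e"
  proof eventually_elim
    case (elim t)
    have "norm (rotg \<theta> t x - rotg \<theta> t0 x) \<le> e / 2 + e / 4"
    proof (rule norm_sqs_le)
      fix S :: "'a set" assume S: "finite S"
      let ?g = "\<lambda>i. cmod (cis (t * \<theta> i) - cis (t0 * \<theta> i)) * cmod (cd x i)"
      have c: "cmod (cd (rotg \<theta> t x - rotg \<theta> t0 x) i) = ?g i" for i
        by (simp add: cd_rotg cd_minus left_diff_distrib[symmetric] norm_mult)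
      have split: "L2_set ?g S \<le> L2_set (\<lambda>i. if i \<in> F then ?g i else 0) S + L2_set (\<lambda>i. if i \<in> F then 0 else ?g i) S"
      proof -
        have "L2_set ?g S = L2_set (\<lambda>i. (if i \<in> F then ?g i else 0) + (if i \<in> F then 0 else ?g i)) S"
          by (rule L2_set_cong) auto
        thus ?thesis using L2_set_triangle_ineq[of "\<lambda>i. if i \<in> F then ?g i else 0" "\<lambda>i. if i \<in> F then 0 else ?g i" S] by simp
      qed
      have "L2_set (\<lambda>i. if i \<in> F then ?g i else 0) S \<le> (\<Sum>i\<in>S. if i \<in> F then ?g i else 0)"
        by (rule L2_set_le_sum) auto
      also have "... \<le> (\<Sum>i\<in>F. ?g i)"
        using S F(1) by (simp add: sum.inter_filter[symmetric]) (intro sum_mono2, auto)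
      finally have 1: "L2_set (\<lambda>i. if i \<in> F then ?g i else 0) S \<le> e / 2" using elim by simp
      have "L2_set (\<lambda>i. if i \<in> F then 0 else ?g i) S = L2_set ?g (S - F)"
        unfolding L2_set_def using S by (intro arg_cong[where f = sqrt] sum.mono_neutral_cong_right) auto
      also have "... \<le> L2_set (\<lambda>i. 2 * cmod (cd x i)) (S - F)"
      proof (rule L2_set_mono)
        fix i
        have "cmod (cis (t * \<theta> i) - cis (t0 * \<theta> i)) \<le> 2"
          using norm_triangle_ineq4[of "cis (t * \<theta> i)" "cis (t0 * \<theta> i)"] by simp
        thus "?g i \<le> 2 * cmod (cd x i)" by (intro mult_right_mono) auto
      qed auto
      also have "... = 2 * L2_set (\<lambda>i. cmod (cd x i)) (S - F)" by (simp add: L2_set_right_distrib)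
      also have "... \<le> e / 4" using F(2)[OF S] by simp
      finally show "L2_set (\<lambda>i. cmod (cd (rotg \<theta> t x - rotg \<theta> t0 x) i)) S \<le> e / 2 + e / 4"
        using 1 split unfolding c by simp
    qed
    thus ?case using e by (simp add: dist_norm)
  qed
qed

text \<open>The isometry property controls the change of the argument, strong continuity that of the
  time. The factor \<open>k\<close> is later 1 or -1, for entering and leaving the rotating
  frame.\<close>

lemma continuous_on_rotg:
  assumes x: "continuous_on T x"
  shows "continuous_on T (\<lambda>t. rotg \<theta> (k * t) (x t))"
  unfolding continuous_on_def
proof
  fix t0 assume t0: "t0 \<in> T"
  have l1: "((\<lambda>t. rotg (\<lambda>J. k * \<theta> J) t (x t0)) \<longlongrightarrow> rotg (\<lambda>J. k * \<theta> J) t0 (x t0)) (at t0 within T)"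
    by (rule rotg_strong_continuous)
  have r: "rotg (\<lambda>J. k * \<theta> J) t y = rotg \<theta> (k * t) y" for t y
    by (simp add: rotg_def mult_ac)
  have "((\<lambda>t. norm (x t - x t0)) \<longlongrightarrow> 0) (at t0 within T)"
    using x t0 unfolding continuous_on_def by (simp add: tendsto_norm_zero_iff LIM_zero_iff)
  hence "((\<lambda>t. norm (rotg \<theta> (k * t) (x t) - rotg \<theta> (k * t) (x t0))) \<longlongrightarrow> 0) (at t0 within T)"
    by (simp add: rotg_diff[symmetric])
  hence "((\<lambda>t. rotg \<theta> (k * t) (x t) - rotg \<theta> (k * t) (x t0)) \<longlongrightarrow> 0) (at t0 within T)"
    by (rule tendsto_norm_zero_cancel)
  from tendsto_add[OF this l1[unfolded r]]
  show "((\<lambda>t. rotg \<theta> (k * t) (x t)) \<longlongrightarrow> rotg \<theta> (k * t0) (x t0)) (at t0 within T)" by simp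
qed

section \<open>Radial retraction, uniqueness by connectedness, complex conjugation\<close>

definition proj :: "real \<Rightarrow> 'a::real_normed_vector \<Rightarrow> 'a" where
  "proj R x = (if norm x \<le> R then x else (R / norm x) *\<^sub>R x)"

lemma norm_proj: "0 < R \<Longrightarrow> norm (proj R x) \<le> R"
  by (simp add: proj_def)

text \<open>The retraction multiplies by a scalar m, so its difference is m(x) (x - y) plus (m(x) -
  m(y)) y, and each part has norm at most that of x - y.\<close>

lemma proj_lipschitz:
  assumes R: "0 < R"
  shows "norm (proj R x - proj R y) \<le> 2 * norm (x - y)"
proof -
  define m where "m z = (if norm z \<le> R then 1 else R / norm z)" for z :: 'a
  have p: "proj R z = m z *\<^sub>R z" for z by (simp add: proj_def m_def)
  have m1: "0 \<le> m z" "m z \<le> 1" for z using R by (auto simp: m_def divide_le_eq_1)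
  have d: "\<bar>norm y - norm x\<bar> \<le> norm (x - y)" using norm_triangle_ineq3[of y x] by (simp add: norm_minus_commute)
  have "\<bar>m x - m y\<bar> * norm y \<le> norm (x - y)"
  proof (cases "norm x \<le> R"; cases "norm y \<le> R")
    assume "norm x \<le> R" "\<not> norm y \<le> R"
    moreover from this have "y \<noteq> 0" using R by auto
    ultimately have "\<bar>m x - m y\<bar> * norm y = norm y - R" using R by (simp add: m_def abs_if field_simps)
    thus ?thesis using d \<open>norm x \<le> R\<close> by simp
  next
    assume a: "\<not> norm x \<le> R" "norm y \<le> R"
    moreover from a have "x \<noteq> 0" using R by auto
    ultimately have "\<bar>m x - m y\<bar> * norm y = (norm x - R) * (norm y / norm x)" using R by (simp add: m_def abs_if field_simps)
    also have "... \<le> (norm x - R) * 1" using a R by (intro mult_left_mono) (auto simp: divide_le_eq_1)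
    finally show ?thesis using d a by simp
  next
    assume a: "\<not> norm x \<le> R" "\<not> norm y \<le> R"
    hence "x \<noteq> 0" "y \<noteq> 0" using R by auto
    have "\<bar>m x - m y\<bar> * norm y = \<bar>(m x - m y) * norm y\<bar>" by (simp add: abs_mult)
    also have "(m x - m y) * norm y = (norm y - norm x) * (R / norm x)"
      using a \<open>x \<noteq> 0\<close> \<open>y \<noteq> 0\<close> by (simp add: m_def field_simps)
    also have "\<bar>...\<bar> = \<bar>norm y - norm x\<bar> * (R / norm x)" using a R by (simp add: abs_mult)
    also have "... \<le> \<bar>norm y - norm x\<bar> * 1" using a R by (intro mult_left_mono) (auto simp: divide_le_eq_1)
    finally show ?thesis using d by simp
  qed (simp add: m_def)
  moreover have "norm (proj R x - proj R y) \<le> m x * norm (x - y) + \<bar>m x - m y\<bar> * norm y"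
  proof -
    have "proj R x - proj R y = m x *\<^sub>R (x - y) + (m x - m y) *\<^sub>R y"
      by (simp add: p algebra_simps)
    thus ?thesis using norm_triangle_ineq[of "m x *\<^sub>R (x - y)" "(m x - m y) *\<^sub>R y"] m1[of x] by simp
  qed
  moreover have "m x * norm (x - y) \<le> 1 * norm (x - y)" using m1[of x] by (intro mult_right_mono) auto
  ultimately show ?thesis by simp
qed

text \<open>The set of agreement is closed by continuity and open by local uniqueness, and intervals
  are connected.\<close>

lemma agree_everywhere:
  fixes x y :: "real \<Rightarrow> 'a::real_normed_vector"
  assumes S: "is_interval S" "t0 \<in> S" "x t0 = y t0" and c: "continuous_on S x" "continuous_on S y"
    and loc: "\<And>\<tau>. \<tau> \<in> S \<Longrightarrow> x \<tau> = y \<tau> \<Longrightarrow> \<exists>d>0. \<forall>t\<in>S. \<bar>t - \<tau>\<bar> < d \<longrightarrow> x t = y t"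
    and t: "t \<in> S"
  shows "x t = y t"
proof -
  let ?A = "{t \<in> S. x t = y t}"
  have "connected S" using S(1) by (simp add: is_interval_connected)
  moreover have "openin (top_of_set S) ?A"
  proof (subst openin_subopen, intro ballI)
    fix \<tau> assume "\<tau> \<in> ?A"
    then obtain d where d: "d > 0" "\<And>t. t \<in> S \<Longrightarrow> \<bar>t - \<tau>\<bar> < d \<Longrightarrow> x t = y t" using loc[of \<tau>] by blast
    have "openin (top_of_set S) (S \<inter> ball \<tau> d)" by (rule openin_open_Int) simp
    moreover have "\<tau> \<in> S \<inter> ball \<tau> d" using \<open>\<tau> \<in> ?A\<close> d by simp
    moreover have "S \<inter> ball \<tau> d \<subseteq> ?A" using d by (auto simp: dist_real_def abs_minus_commute)
    ultimately show "\<exists>T. openin (top_of_set S) T \<and> \<tau> \<in> T \<and> T \<subseteq> ?A" by blast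
  qed
  moreover have "closedin (top_of_set S) ?A"
  proof -
    have "closedin (top_of_set S) {t \<in> S. x t - y t = 0}"
      by (rule continuous_closedin_preimage_constant) (intro continuous_intros c)
    thus ?thesis by simp
  qed
  ultimately have "?A = {} \<or> ?A = S" unfolding connected_clopen by blast
  thus ?thesis using S t by blast
qed

text \<open>Solutions are defined through their components, whereas the Lipschitz argument needs
  derivatives in norm. The integral of the continuous field is differentiable in norm and has the
  same components as the curve.\<close>

lemma componentwise_derivative:
  fixes y g :: "real \<Rightarrow> 'a sqs"
  assumes y: "continuous_on {a..b} y" and g: "continuous_on {a..b} g"
    and d: "\<And>t J. t \<in> {a..b} \<Longrightarrow> ((\<lambda>t. cd (y t) J) has_vector_derivative cd (g t) J) (at t within {a..b})"
    and t: "t \<in> {a..b}"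
  shows "(y has_vector_derivative g t) (at t within {a..b})"
proof -
  define z where "z t = y a + integral {a..t} g" for t
  have z: "(z has_vector_derivative g t) (at t within {a..b})" if "t \<in> {a..b}" for t
  proof -
    have "((\<lambda>t. y a + integral {a..t} g) has_vector_derivative 0 + g t) (at t within {a..b})"
      by (intro has_vector_derivative_add has_vector_derivative_const integral_has_vector_derivative g that)
    thus ?thesis by (simp add: z_def[abs_def])
  qed
  have "z t = y t" if t: "t \<in> {a..b}" for t
  proof (rule sqs_eqI)
    fix J
    have zd: "((\<lambda>t. cd (z t) J) has_vector_derivative cd (g t) J) (at t within {a..b})" if "t \<in> {a..b}" for t
      by (rule bounded_linear.has_vector_derivative[OF bounded_linear_cd z[OF that]])
    have "((\<lambda>t. cd (z t) J - cd (y t) J) has_derivative (\<lambda>_. 0)) (at t within {a..b})" if "t \<in> {a..b}" for t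
      using has_vector_derivative_diff[OF zd[OF that] d[OF that, of J]]
      by (simp add: has_vector_derivative_def)
    then obtain k where k: "\<And>t. t \<in> {a..b} \<Longrightarrow> cd (z t) J - cd (y t) J = k"
      using has_derivative_zero_constant[of "{a..b}" "\<lambda>t. cd (z t) J - cd (y t) J"] by auto
    have "a \<in> {a..b}" using t by auto
    hence "k = 0" using k[of a] by (simp add: z_def)
    thus "cd (z t) J = cd (y t) J" using k[OF t] by simp
  qed
  thus ?thesis by (intro has_vector_derivative_transform[OF t _ z[OF t]]) auto
qed

text \<open>An isometric involution whose fixed points correspond to the real states.\<close>

definition cj :: "('n::finite) mode sqs \<Rightarrow> 'n mode sqs" where
  "cj x = Sqs (\<lambda>J. cnj (cd x (bar J)))"

lemma inj_bar: "inj_on bar S"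
  by (metis bar_bar inj_onI)

lemma L2_bar: "L2_set (\<lambda>J. cmod (cd x (bar J))) S = L2_set (\<lambda>J. cmod (cd x J)) (bar ` S)"
  unfolding L2_set_def by (simp add: sum.reindex[OF inj_bar])

lemma cd_cj: "cd (cj x) J = cnj (cd x (bar J))"
proof -
  have "l2 (\<lambda>J. cnj (cd x (bar J)))"
    unfolding l2_def by (intro exI[of _ "norm x"]) (auto simp: L2_bar intro: L2_le_norm)
  thus ?thesis by (simp add: cj_def)
qed

lemma cj_cj [simp]: "cj (cj x) = x"
  by (rule sqs_eqI) (simp add: cd_cj)

lemma norm_cj [simp]: "norm (cj x) = norm x"
proof -
  have le: "norm (cj x) \<le> norm x" for x :: "'a mode sqs"
    by (rule norm_sqs_le) (auto simp: cd_cj L2_bar intro: L2_le_norm)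
  show ?thesis using le[of x] le[of "cj x"] by simp
qed

lemma bounded_linear_cj: "bounded_linear cj"
proof (rule bounded_linear_intro[where K = 1])
  show "cj (x + y) = cj x + cj y" "cj (r *\<^sub>R x) = r *\<^sub>R cj x" for x y :: "'a mode sqs" and r
    by (rule sqs_eqI, simp add: cd_cj cd_plus cd_scaleR)+
qed simp

lemma cj_proj: "cj (proj R x) = proj R (cj x)"
  by (simp add: proj_def linear_scale[OF bounded_linear.linear[OF bounded_linear_cj]])

lemma cj_rotg: "(\<And>J. \<theta> (bar J) = - \<theta> J) \<Longrightarrow> cj (rotg \<theta> t x) = rotg \<theta> t (cj x)"
  by (rule sqs_eqI) (simp add: cd_cj cd_rotg cis_cnj)

section \<open>The equation of motion\<close>

context ham_pert
begin

lemma cj_XP: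
  assumes real: "\<And>n M. p n (map bar M) = cnj (p n M)" and x: "norm x \<le> R0"
  shows "cj (XP x) = XP (cj x)"
proof -
  have "cj (Xg (Suc n) x) = Xg (Suc n) (cj x)" for n
  proof (rule sqs_eqI)
    fix J
    let ?n = "Suc n"
    have bij: "bij_betw (map bar) (LL (?n + 1) :: 'n mode list set) (LL (?n + 1))"
    proof (rule bij_betwI[where g = "map bar"])
    qed (auto simp: LL_def o_def)
    have u: "upr (uof (cj x)) L = cnj (upr (uof x) (map bar L))" for L
      by (induction L) (simp_all add: uof_def cd_cj)
    have "(\<Sum>\<^sub>\<infinity>L\<in>LL (?n + 1). p ?n (bar J # L) * uprl (replicate (?n + 1) (uof (cj x))) L)
        = (\<Sum>\<^sub>\<infinity>L\<in>LL (?n + 1). cnj (p ?n (map bar (bar J # L)) * uprl (replicate (?n + 1) (uof x)) (map bar L)))"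
    proof (rule infsum_cong)
      fix L :: "'n mode list" assume "L \<in> LL (?n + 1)"
      thus "p ?n (bar J # L) * uprl (replicate (?n + 1) (uof (cj x))) L
          = cnj (p ?n (map bar (bar J # L)) * uprl (replicate (?n + 1) (uof x)) (map bar L))"
        using real[of ?n "bar J # L"] by (simp add: LL_def uprl_replicate u del: replicate.simps)
    qed
    also have "... = cnj (\<Sum>\<^sub>\<infinity>L\<in>LL (?n + 1). p ?n (map bar (bar J # L)) * uprl (replicate (?n + 1) (uof x)) (map bar L))"
      by (rule infsum_cnj)
    also have "(\<Sum>\<^sub>\<infinity>L\<in>LL (?n + 1). p ?n (map bar (bar J # L)) * uprl (replicate (?n + 1) (uof x)) (map bar L))
        = (\<Sum>\<^sub>\<infinity>L\<in>LL (?n + 1). p ?n (J # L) * uprl (replicate (?n + 1) (uof x)) L)"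
      using infsum_reindex_bij_betw[OF bij, of "\<lambda>L. p ?n (J # L) * uprl (replicate (?n + 1) (uof x)) L"] by simp
    finally have h: "hpl ?n (bar J) (replicate (?n + 1) (uof (cj x))) = cnj (hpl ?n J (replicate (?n + 1) (uof x)))"
      by (simp add: hpl_def del: replicate.simps)
    have c: "cd (Xg ?n y) K = cf K * of_real (exp (s * \<phi> K)) * hpl ?n (bar K) (replicate (?n + 1) (uof y))" for y K
      unfolding Xg_def by (rule V_bounds(1)[OF _ list_all2_replicate[OF nb_uof]]) auto
    have "cnj (cf J) = - cf J" by (simp add: cf_def sg_def)
    thus "cd (cj (Xg ?n x)) J = cd (Xg ?n (cj x)) J"
      unfolding cd_cj c h by simp
  qed
  moreover have "cj (XP x) = (\<Sum>n. cj (Xg (Suc n) x))"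
    unfolding XP_def by (rule bounded_linear.suminf[OF bounded_linear_cj summable_norm_cancel[OF summable_Xg[OF x]]])
  ultimately show ?thesis by (simp add: XP_def)
qed

text \<open>The perturbation seen in the frame rotating with the linear flow: if z solves the full
  system in square sum coordinates, then the rotated curve has this velocity as long as its norm is
  at most \<open>R\<close>.\<close>

definition Gf :: "('n mode \<Rightarrow> real) \<Rightarrow> real \<Rightarrow> real \<Rightarrow> 'n mode sqs \<Rightarrow> 'n mode sqs" where
  "Gf \<theta> R t x = rotg \<theta> t (XP (proj R (rotg \<theta> (- t) x)))"

lemma Gf_lipschitz:
  assumes "0 < R" "R \<le> R0"
  shows "norm (Gf \<theta> R t x - Gf \<theta> R t y) \<le> 54 * b^2 * norm (x - y)"
proof -
  let ?x = "rotg \<theta> (- t) x" and ?y = "rotg \<theta> (- t) y"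
  have "norm (Gf \<theta> R t x - Gf \<theta> R t y) = norm (XP (proj R ?x) - XP (proj R ?y))"
    by (simp add: Gf_def rotg_diff[symmetric])
  also have "... \<le> 27 * b^2 * norm (proj R ?x - proj R ?y)"
    by (rule XP_lipschitz) (use assms norm_proj[of R] order_trans in blast)+
  also have "... \<le> 27 * b^2 * (2 * norm (?x - ?y))"
    by (intro mult_left_mono proj_lipschitz assms) simp
  also have "norm (?x - ?y) = norm (x - y)" by (simp add: rotg_diff[symmetric])
  finally show ?thesis by simp
qed

lemma Gf_continuous:
  assumes R: "0 < R" "R \<le> R0" and x: "continuous_on S x"
  shows "continuous_on S (\<lambda>t. Gf \<theta> R t (x t))"
proof -
  have "continuous_on UNIV (\<lambda>y. XP (proj R y))"
    unfolding continuous_on_iff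
  proof (intro ballI allI impI)
    fix y :: "'n mode sqs" and e :: real assume e: "0 < e"
    have b0: "0 < 54 * b^2" using b1 by simp
    show "\<exists>d>0. \<forall>z\<in>UNIV. dist z y < d \<longrightarrow> dist (XP (proj R z)) (XP (proj R y)) < e"
    proof (intro exI[of _ "e / (54 * b^2)"] conjI ballI impI)
      show "0 < e / (54 * b^2)" using e b0 by (rule divide_pos_pos)
      fix z assume z: "dist z y < e / (54 * b^2)"
      have "dist (XP (proj R z)) (XP (proj R y)) \<le> 54 * b^2 * dist z y"
        using Gf_lipschitz[OF R, of "\<lambda>_. 0" 0 z y] by (simp add: Gf_def dist_norm)
      also have "... < 54 * b^2 * (e / (54 * b^2))" by (rule mult_strict_left_mono[OF z b0])
      also have "... = e" using b0 by simp
      finally show "dist (XP (proj R z)) (XP (proj R y)) < e" .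
    qed
  qed
  from continuous_on_compose2[OF this continuous_on_rotg[OF x, of \<theta> "-1"]]
  have "continuous_on S (\<lambda>t. XP (proj R (rotg \<theta> (- 1 * t) (x t))))" by simp
  from continuous_on_rotg[OF this, of \<theta> 1] show ?thesis by (simp add: Gf_def)
qed

lemma cj_Gf:
  assumes R: "0 < R" "R \<le> R0" and real: "\<And>n M. p n (map bar M) = cnj (p n M)" and th: "\<And>J. \<theta> (bar J) = - \<theta> J"
  shows "cj (Gf \<theta> R t x) = Gf \<theta> R t (cj x)"
proof -
  have "norm (proj R (rotg \<theta> (- t) x)) \<le> R0" using norm_proj[OF R(1)] R(2) order_trans by blast
  from cj_XP[OF real this] show ?thesis
    by (simp add: Gf_def cj_rotg[where \<theta> = \<theta>, OF th] cj_proj)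
qed

text \<open>The radial retraction makes the field globally Lipschitz; below it is inactive on the solutions
  considered.\<close>

lemma Gf_solution:
  assumes R: "0 < R" "R \<le> R0" and T: "0 \<le> T"
  obtains x where "x 0 = x0" "continuous_on {-T..T} x"
    "\<And>t. t \<in> {-T..T} \<Longrightarrow> (x has_vector_derivative Gf \<theta> R t (x t)) (at t within {-T..T})"
proof (rule picard[OF T, of "54 * b^2" "Gf \<theta> R" x0])
  show "0 \<le> 54 * b^2" by simp
  show "norm (Gf \<theta> R t x - Gf \<theta> R t y) \<le> 54 * b^2 * norm (x - y)" for t x y by (rule Gf_lipschitz[OF R])
  show "continuous_on S (\<lambda>t. Gf \<theta> R t (x t))" if "continuous_on S x" for x S by (rule Gf_continuous[OF R that])
qed (rule that)

text \<open>The differential equations are demanded only on short intervals around times of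
  agreement. A competing solution may be large elsewhere, and there it need not solve the equation
  with the retraction.\<close>

lemma Gf_unique:
  assumes R: "0 < R" "R \<le> R0" and S: "is_interval S" "t0 \<in> S" "x t0 = y t0"
    and c: "continuous_on S x" "continuous_on S y"
    and loc: "\<And>\<tau>. \<tau> \<in> S \<Longrightarrow> x \<tau> = y \<tau> \<Longrightarrow> \<exists>d>0. \<forall>a c. {a..c} \<subseteq> S \<inter> {\<tau> - d <..< \<tau> + d} \<longrightarrow>
        (\<forall>t\<in>{a..c}. (x has_vector_derivative Gf \<theta> R t (x t)) (at t within {a..c}) \<and>
          (y has_vector_derivative Gf \<theta> R t (y t)) (at t within {a..c}))"
    and t: "t \<in> S"
  shows "x t = y t"
proof (rule agree_everywhere[OF S c _ t])
  fix \<tau> assume \<tau>: "\<tau> \<in> S" "x \<tau> = y \<tau>"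
  then obtain d where d: "0 < d" and der: "\<And>a c t. {a..c} \<subseteq> S \<inter> {\<tau> - d <..< \<tau> + d} \<Longrightarrow> t \<in> {a..c} \<Longrightarrow>
      (x has_vector_derivative Gf \<theta> R t (x t)) (at t within {a..c}) \<and>
          (y has_vector_derivative Gf \<theta> R t (y t)) (at t within {a..c})"
    using loc[OF \<tau>] by blast
  define d' where "d' = min d (1 / (55 * b^2))"
  have b2: "1 \<le> b^2" using b1 by simp
  have d': "0 < d'" "d' \<le> d" "54 * b^2 * d' < 1"
  proof -
    show "0 < d'" "d' \<le> d" using d b2 by (auto simp: d'_def)
    have "54 * b^2 * d' \<le> 54 * b^2 * (1 / (55 * b^2))" by (intro mult_left_mono) (auto simp: d'_def)
    also have "... < 1" using b2 by simp
    finally show "54 * b^2 * d' < 1" .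
  qed
  have "x t = y t" if t: "t \<in> S" "\<bar>t - \<tau>\<bar> < d'" for t
  proof -
    define a c where "a = min t \<tau>" and "c = max t \<tau>"
    have sub: "{a..c} \<subseteq> S"
    proof -
      have "a \<in> S" "c \<in> S" using t(1) \<tau>(1) by (auto simp: a_def c_def min_def max_def)
      thus ?thesis using S(1) unfolding is_interval_1 by (meson atLeastAtMost_iff subsetI)
    qed
    have sub2: "{a..c} \<subseteq> S \<inter> {\<tau> - d <..< \<tau> + d}"
      using sub t(2) d'(2) by (auto simp: a_def c_def)
    have ca: "c - a = \<bar>t - \<tau>\<bar>" by (auto simp: a_def c_def)
    have "54 * b^2 * (c - a) \<le> 54 * b^2 * d'" unfolding ca using t(2) by (intro mult_left_mono) auto
    hence small: "54 * b^2 * (c - a) < 1" using d'(3) by simp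
    show ?thesis
    proof (rule ode_unique_local[of a c x "\<lambda>t. Gf \<theta> R t (x t)" y "\<lambda>t. Gf \<theta> R t (y t)" "54 * b^2" \<tau>])
      show "(x has_vector_derivative Gf \<theta> R t (x t)) (at t within {a..c})"
        "(y has_vector_derivative Gf \<theta> R t (y t)) (at t within {a..c})" if "t \<in> {a..c}" for t
        using der[OF sub2 that] by blast+
      show "norm (Gf \<theta> R t (x t) - Gf \<theta> R t (y t)) \<le> 54 * b^2 * norm (x t - y t)" for t
        by (rule Gf_lipschitz[OF R])
      show "\<tau> \<in> {a..c}" "t \<in> {a..c}" by (auto simp: a_def c_def)
    qed (use small \<tau>(2) in auto)
  qed
  thus "\<exists>d>0. \<forall>t\<in>S. \<bar>t - \<tau>\<bar> < d \<longrightarrow> x t = y t" using d'(1) by blast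
qed

end

section \<open>Solutions of the Hamiltonian system\<close>

lemma symz_map_bar:
  assumes "\<And>Js. P (map bar Js) = cnj (P Js)"
  shows "symz P (map bar M) = cnj (symz P M)"
proof -
  have "symz P (map bar M) = (\<Sum>p | p permutes {..<length M}. P (map bar (permute_list p M)))"
    unfolding symz_def length_map
    by (intro sum.cong refl) (simp add: permute_list_map)
  thus ?thesis by (simp add: assms symz_def)
qed

lemma mom_map_bar: "mom (map bar M) = - mom M"
  by (induction M) (auto simp: mom_def smom_bar)

lemma perturbation_map_bar:
  assumes P: "P \<in> perturbations c f d"
  shows "P (map bar Js) = cnj (P Js)"
proof (cases "d \<le> length Js \<and> mom Js = 0")
  case True
  hence h: "degree_part (length Js) P \<in> hom_polys (length Js)" using P by (auto simp: perturbations_def)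
  have "Js \<in> zero_momentum (length Js)"
    using True by (simp add: zero_momentum_def mom_def smom_def cong: map_cong)
  hence "cnj (degree_part (length Js) P Js) = degree_part (length Js) P (map bar Js)"
    using h unfolding hom_polys_def by blast
  thus ?thesis by (simp add: degree_part_def)
next
  case False
  hence "P Js = 0" "P (map bar Js) = 0"
    using perturbation_zero_momentum[OF P, of Js] perturbation_zero_momentum[OF P, of "map bar Js"]
    by (auto simp: mom_map_bar)
  thus ?thesis by simp
qed

lemma H0_partial:
  "(\<lambda>Js. H0 \<omega> Js * monomial_partial K Js u) summable_on {Js. length Js = 2}"
  "ham_partial_degree (H0 \<omega>) 2 K u = of_real (\<omega> (fst K)) * u (bar K)"
proof -
  let ?M = "[(fst K, True), (fst K, False)]"
  have z: "H0 \<omega> Js * monomial_partial K Js u = 0" if "Js \<in> {Js. length Js = 2} - {?M}" for Js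
  proof (cases "\<exists>j. Js = [(j, True), (j, False)]")
    case True
    then obtain j where j: "Js = [(j, True), (j, False)]" by blast
    hence "j \<noteq> fst K" using that by auto
    hence "monomial_partial K Js u = 0" by (cases K) (simp add: j monomial_partial_dupr ind_def)
    thus ?thesis by simp
  qed (simp add: H0_def)
  note * = infsum_finite_support[of "{?M}" "{Js. length Js = 2}", OF _ _ z]
  show "(\<lambda>Js. H0 \<omega> Js * monomial_partial K Js u) summable_on {Js. length Js = 2}"
    by (rule *(1)) auto
  have "ham_partial_degree (H0 \<omega>) 2 K u = H0 \<omega> ?M * monomial_partial K ?M u"
    unfolding ham_partial_degree_def by (subst *(2)) auto
  also have "... = of_real (\<omega> (fst K)) * u (bar K)"
  proof -
    have "H0 \<omega> ?M = of_real (\<omega> (fst K))" by (simp add: H0_def)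
    moreover have "monomial_partial K ?M u = u (bar K)"
      by (cases K; cases "snd K") (auto simp: monomial_partial_dupr ind_def bar_def)
    ultimately show ?thesis by simp
  qed
  finally show "ham_partial_degree (H0 \<omega>) 2 K u = of_real (\<omega> (fst K)) * u (bar K)" .
qed

text \<open>The perturbation has no terms below degree 3 and the quadratic part none but degree 2,
  so no degree mixes the two.\<close>

lemma H0_add_perturbation:
  assumes P: "\<And>Js. length Js < 3 \<Longrightarrow> P Js = 0"
  shows "ham_partial_degree (\<lambda>Js. H0 \<omega> Js + P Js) k K u
      = ham_partial_degree P k K u + (if k = 2 then of_real (\<omega> (fst K)) * u (bar K) else 0)" (is ?deg)
    and "(\<lambda>Js. (H0 \<omega> Js + P Js) * monomial_partial K Js u) summable_on {Js. length Js = k} \<longleftrightarrow>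
      (\<lambda>Js. P Js * monomial_partial K Js u) summable_on {Js. length Js = k}" (is ?sum)
proof -
  have "?deg \<and> ?sum"
  proof (cases "k = 2")
    case True
    have 1: "(H0 \<omega> Js + P Js) * monomial_partial K Js u = H0 \<omega> Js * monomial_partial K Js u"
      and 2: "P Js * monomial_partial K Js u = 0" if "Js \<in> {Js. length Js = k}" for Js
      using P[of Js] that True by auto
    have "ham_partial_degree (\<lambda>Js. H0 \<omega> Js + P Js) k K u = ham_partial_degree (H0 \<omega>) 2 K u"
      unfolding ham_partial_degree_def True by (rule infsum_cong) (use 1 True in simp)
    moreover have "ham_partial_degree P k K u = 0"
      unfolding ham_partial_degree_def by (rule infsum_0) (rule 2)
    moreover have "(\<lambda>Js. (H0 \<omega> Js + P Js) * monomial_partial K Js u) summable_on {Js. length Js = k}"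
      using H0_partial(1)[of \<omega> K u] True 1 by (subst summable_on_cong[OF 1]) auto
    moreover have "(\<lambda>Js. P Js * monomial_partial K Js u) summable_on {Js. length Js = k}"
      by (subst summable_on_cong[OF 2]) auto
    ultimately show ?thesis using True H0_partial(2)[of \<omega> K u] by simp
  next
    case False
    have 1: "(H0 \<omega> Js + P Js) * monomial_partial K Js u = P Js * monomial_partial K Js u"
      if "Js \<in> {Js. length Js = k}" for Js
    proof -
      have "H0 \<omega> Js = 0" using that False by (auto simp: H0_def)
      thus ?thesis by simp
    qed
    have "ham_partial_degree (\<lambda>Js. H0 \<omega> Js + P Js) k K u = ham_partial_degree P k K u"
      unfolding ham_partial_degree_def by (rule infsum_cong[OF 1])
    moreover have ?sum by (rule summable_on_cong[OF 1])
    ultimately show ?thesis using False by simp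
  qed
  thus ?deg ?sum by blast+
qed

locale ham_sys = ham_pert \<phi> Cf C1 s0 s b "gpart P" A
  for \<phi> Cf C1 s0 s b and P :: "('n::finite) ham" and A +
  fixes f :: "real \<Rightarrow> real" and c :: real and \<omega> :: "int ^ 'n \<Rightarrow> real" and rs :: real
  assumes phi: "\<phi> J = f (bracket c (fst J))"
    and P: "P \<in> perturbations c f 3"
    and rs: "0 < rs" and conv: "u \<in> W_ball c f s rs \<Longrightarrow> ham_converges P u"
begin

abbreviation H :: "'n ham" where "H \<equiv> \<lambda>Js. H0 \<omega> Js + P Js"

definition xof :: "('n mode \<Rightarrow> complex) \<Rightarrow> 'n mode sqs" where
  "xof u = Sqs (\<lambda>J. of_real (exp (s * \<phi> J)) * u J)"

lemma weight_sq: "(cmod (u J))^2 * exp (2 * s * f (bracket c (fst J))) = (cmod (of_real (exp (s * \<phi> J)) * u J))^2"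
  by (simp add: phi norm_mult power_mult_distrib mult.assoc mult.commute flip: exp_double)

lemma l2_W:
  assumes "u \<in> W_space c f s"
  shows "l2 (\<lambda>J. of_real (exp (s * \<phi> J)) * u J)"
proof -
  let ?g = "\<lambda>J. (cmod (u J))^2 * exp (2 * s * f (bracket c (fst J)))"
  have "L2_set (\<lambda>J. cmod (of_real (exp (s * \<phi> J)) * u J)) S \<le> sqrt (infsum ?g UNIV)" if "finite S" for S
    unfolding L2_set_def weight_sq[symmetric]
    by (intro real_sqrt_le_mono finite_sum_le_infsum) (use assms that in \<open>auto simp: W_space_def\<close>)
  thus ?thesis unfolding l2_def by blast
qed

lemma cd_xof: "u \<in> W_space c f s \<Longrightarrow> cd (xof u) J = of_real (exp (s * \<phi> J)) * u J"
  using l2_W by (simp add: xof_def)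

lemma exp_cancel [simp]: "complex_of_real (exp (- (s * a))) * (of_real (exp (s * a)) * z) = z"
    "complex_of_real (exp (s * a)) * (of_real (exp (- (s * a))) * z) = z"
proof -
  have 1: "complex_of_real (exp (- (s * a))) * of_real (exp (s * a)) = 1"
    by (simp flip: of_real_mult exp_add)
  show "complex_of_real (exp (- (s * a))) * (of_real (exp (s * a)) * z) = z"
    unfolding mult.assoc[symmetric] 1 by simp
  show "complex_of_real (exp (s * a)) * (of_real (exp (- (s * a))) * z) = z"
    unfolding mult.assoc[symmetric] mult.commute[of "of_real (exp (s * a))"] 1 by simp
qed

lemma uof_xof: "u \<in> W_space c f s \<Longrightarrow> uof (xof u) = u"
  by (rule ext) (simp add: uof_def cd_xof)

lemma uof_W: "uof x \<in> W_space c f s" and W_norm_uof: "W_norm c f s (uof x) = norm x"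
proof -
  let ?g = "\<lambda>J. (cmod (cd x J))^2"
  have g: "(cmod (uof x J))^2 * exp (2 * s * f (bracket c (fst J))) = ?g J" for J
    unfolding weight_sq by (simp add: uof_def)
  have fin: "sum ?g S \<le> (norm x)^2" if "finite S" for S
    using L2_le_norm[OF that, of x] unfolding L2_set_def by (rule sqrt_le_D)
  have sm: "?g summable_on UNIV"
    by (rule nonneg_bdd_above_summable_on) (use fin in \<open>auto simp: bdd_above_def\<close>)
  thus "uof x \<in> W_space c f s" by (simp add: W_space_def g)
  have "infsum ?g UNIV \<le> (norm x)^2" by (rule infsum_le_finite_sums[OF sm]) (use fin in auto)
  hence "sqrt (infsum ?g UNIV) \<le> norm x" by (simp add: real_le_lsqrt)
  moreover have "norm x \<le> sqrt (infsum ?g UNIV)"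
    by (rule norm_sqs_le) (auto simp: L2_set_def intro!: finite_sum_le_infsum sm)
  ultimately show "W_norm c f s (uof x) = norm x" by (simp add: W_norm_def g)
qed

lemma W_norm_diff: "W_norm c f s (\<lambda>J. uof x J - uof y J) = norm (x - y)"
  using W_norm_uof[of "x - y"] by (simp add: uof_diff[abs_def])

lemma P_low: "length Js < 3 \<Longrightarrow> P Js = 0"
  using perturbation_zero_momentum(1)[OF P, of Js] by linarith

text \<open>The left side sums raw coefficients, the right side symmetrised ones. On every box
  containing \<open>K\<close> the finite sums coincide, and both sides are limits over
  boxes.\<close>

lemma partial_degree:
  assumes sm: "(\<lambda>Js. P Js * monomial_partial K Js (uof x)) summable_on {Js. length Js = n + 2}" and n: "1 \<le> n"
  shows "ham_partial_degree P (n + 2) K (uof x) = hpl n K (replicate (n + 1) (uof x))"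
proof -
  let ?u = "uof x"
  have LLe: "{Js :: 'n mode list. length Js = n + 2} = LL (n + 2)" by (simp add: LL_def)
  have l1: "(\<lambda>j. \<Sum>Js\<in>LS (mbox (real j)) (n + 2). P Js * monomial_partial K Js ?u) \<longlonglongrightarrow> ham_partial_degree P (n + 2) K ?u"
    unfolding ham_partial_degree_def LLe by (rule tendsto_infsum_mbox) (use sm LLe in simp)
  have "(\<lambda>j. \<Sum>L\<in>LS (mbox (real j)) (n + 1). gpart P n (K # L) * uprl (replicate (n + 1) ?u) L)
      \<longlonglongrightarrow> (\<Sum>\<^sub>\<infinity>L\<in>LL (n + 1). gpart P n (K # L) * uprl (replicate (n + 1) ?u) L)"
    by (rule tendsto_infsum_mbox, rule abs_summable_summable, rule hpl_bounds(1)[OF n list_all2_replicate[OF nb_uof]]) simp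
  hence l2: "(\<lambda>j. (\<Sum>L\<in>LS (mbox (real j)) (n + 1). gpart P n (K # L) * uprl (replicate (n + 1) ?u) L) / fact (n + 1))
      \<longlonglongrightarrow> hpl n K (replicate (n + 1) ?u)"
    unfolding hpl_def by (rule tendsto_divide[OF _ tendsto_const fact_nonzero])
  obtain j0 :: nat where j0: "mode_norm K \<le> real j0" using real_arch_simple by blast
  have "\<forall>\<^sub>F j in sequentially. (\<Sum>L\<in>LS (mbox (real j)) (n + 1). gpart P n (K # L) * uprl (replicate (n + 1) ?u) L) / fact (n + 1)
      = (\<Sum>Js\<in>LS (mbox (real j)) (n + 2). P Js * monomial_partial K Js ?u)"
    unfolding eventually_sequentially
  proof (intro exI[of _ j0] allI impI)
    fix j assume "j0 \<le> j"
    hence "K \<in> mbox (real j)" using j0 by (simp add: mbox_def)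
    hence "(\<Sum>Js\<in>LS (mbox (real j)) (Suc (n + 1)). P Js * monomial_partial K Js ?u)
        = (\<Sum>L\<in>LS (mbox (real j)) (n + 1). symz P (K # L) * upr ?u L) / fact (n + 1)"
      by (rule sum_monomial_partial[OF finite_box])
    moreover have "(\<Sum>L\<in>LS (mbox (real j)) (n + 1). symz P (K # L) * upr ?u L)
        = (\<Sum>L\<in>LS (mbox (real j)) (n + 1). gpart P n (K # L) * uprl (replicate (n + 1) ?u) L)"
      by (intro sum.cong refl) (auto simp: LS_def gpart_def uprl_replicate simp del: replicate.simps)
    ultimately show "(\<Sum>L\<in>LS (mbox (real j)) (n + 1). gpart P n (K # L) * uprl (replicate (n + 1) ?u) L) / fact (n + 1)
      = (\<Sum>Js\<in>LS (mbox (real j)) (n + 2). P Js * monomial_partial K Js ?u)" by simp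
  qed
  from Lim_transform_eventually[OF l2 this]
  show ?thesis by (rule LIMSEQ_unique[OF l1])
qed

lemma uof_XP:
  assumes x: "norm x < rs" "norm x \<le> R0"
  shows "uof (XP x) J = cf J * ham_partial P (bar J) (uof x)"
proof -
  let ?u = "uof x" and ?K = "bar J"
  have c: "ham_converges P ?u" by (rule conv) (simp add: W_ball_def uof_W W_norm_uof x)
  have low: "ham_partial_degree P k ?K ?u = 0" if "k < 3" for k
    unfolding ham_partial_degree_def by (rule infsum_0) (use that P_low in auto)
  \<comment> \<open>Degree 3 is grade 1 and differentiation removes one factor; hence the shift by 3
    and the \<open>Suc n + 1\<close> arguments.\<close>
  have deg: "ham_partial_degree P (n + 3) ?K ?u = hpl (Suc n) ?K (replicate (Suc n + 1) ?u)" for n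
    using partial_degree[of ?K x "Suc n"] c unfolding ham_converges_def
    by (simp add: eval_nat_numeral del: replicate.simps)
  have "(\<lambda>k. ham_partial_degree P k ?K ?u) sums ham_partial P ?K ?u"
    using c unfolding ham_converges_def ham_partial_def by (blast intro: summable_sums)
  hence "(\<lambda>n. ham_partial_degree P (n + 3) ?K ?u) sums (ham_partial P ?K ?u - (\<Sum>k<3. ham_partial_degree P k ?K ?u))"
    by (rule sums_split_initial_segment)
  hence s1: "(\<lambda>n. hpl (Suc n) ?K (replicate (Suc n + 1) ?u)) sums ham_partial P ?K ?u"
    using low unfolding deg by (simp del: replicate.simps)
  have "(\<lambda>n. cd (Xg (Suc n) x) J) sums cd (XP x) J"
    unfolding XP_def
    by (rule bounded_linear.sums[OF bounded_linear_cd summable_sums[OF summable_norm_cancel[OF summable_Xg[OF x(2)]]]])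
  moreover have "cd (Xg (Suc n) x) J = cf J * of_real (exp (s * \<phi> J)) * hpl (Suc n) ?K (replicate (Suc n + 1) ?u)" for n
    unfolding Xg_def by (rule V_bounds(1)[OF _ list_all2_replicate[OF nb_uof]]) auto
  ultimately have "(\<lambda>n. cf J * of_real (exp (s * \<phi> J)) * hpl (Suc n) ?K (replicate (Suc n + 1) ?u)) sums cd (XP x) J"
    by (simp del: replicate.simps)
  moreover have "(\<lambda>n. cf J * of_real (exp (s * \<phi> J)) * hpl (Suc n) ?K (replicate (Suc n + 1) ?u))
      sums (cf J * of_real (exp (s * \<phi> J)) * ham_partial P ?K ?u)"
    by (rule sums_mult[OF s1])
  ultimately have "cd (XP x) J = cf J * of_real (exp (s * \<phi> J)) * ham_partial P ?K ?u"
    by (rule sums_unique2)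
  thus ?thesis by (simp add: uof_def mult_ac)
qed

lemma H_vf:
  assumes u: "ham_converges P u"
  shows "ham_converges H u" "ham_vf H u J = cf J * (of_real (\<omega> (fst J)) * u J + ham_partial P (bar J) u)"
proof -
  note HP = H0_add_perturbation[of P, OF P_low]
  have "(\<lambda>k. ham_partial_degree H k K u) sums (ham_partial P K u + of_real (\<omega> (fst K)) * u (bar K))" for K
  proof -
    have "(\<lambda>k. ham_partial_degree P k K u) sums ham_partial P K u"
      using u unfolding ham_converges_def ham_partial_def by (blast intro: summable_sums)
    from sums_add[OF this sums_single[of 2 "\<lambda>_. of_real (\<omega> (fst K)) * u (bar K)"]]
    show ?thesis by (simp add: HP(1)[where k = k for k])
  qed note s = this
  show "ham_converges H u" unfolding ham_converges_def
    using u s unfolding ham_converges_def by (auto simp: HP(2) sums_iff)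
  have "ham_partial H (bar J) u = ham_partial P (bar J) u + of_real (\<omega> (fst J)) * u J"
    unfolding ham_partial_def[of H] using s[of "bar J"] by (simp add: sums_iff)
  thus "ham_vf H u J = cf J * (of_real (\<omega> (fst J)) * u J + ham_partial P (bar J) u)"
    by (simp add: ham_vf_def cf_def algebra_simps)
qed

definition \<theta> :: "'n mode \<Rightarrow> real" where
  "\<theta> J = of_int (sg (snd J)) * \<omega> (fst J)"

lemma theta_bar: "\<theta> (bar J) = - \<theta> J"
  by (simp add: \<theta>_def sg_def)

lemma cf_theta: "cf J * of_real (\<omega> (fst J)) = - \<i> * of_real (\<theta> J)"
  by (simp add: cf_def \<theta>_def)

lemma uof_vf:
  assumes "norm x < rs" "norm x \<le> R0"
  shows "ham_converges H (uof x)" "ham_vf H (uof x) J = - \<i> * of_real (\<theta> J) * uof x J + uof (XP x) J"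
proof -
  have c: "ham_converges P (uof x)" by (rule conv) (simp add: W_ball_def uof_W W_norm_uof assms)
  show "ham_converges H (uof x)" by (rule H_vf(1)[OF c])
  show "ham_vf H (uof x) J = - \<i> * of_real (\<theta> J) * uof x J + uof (XP x) J"
    unfolding H_vf(2)[OF c] uof_XP[OF assms] cf_theta[symmetric] by (simp add: algebra_simps)
qed

lemma cis_has_derivative: "((\<lambda>t. cis (t * a)) has_vector_derivative \<i> * of_real a * cis (t * a)) (at t within S)"
proof -
  have "((\<lambda>t. exp (\<i> * of_real a * of_real t)) has_vector_derivative \<i> * of_real a * exp (\<i> * of_real a * of_real t)) (at t within S)"
    by (rule has_vector_derivative_real_field) (auto intro!: derivative_eq_intros)
  thus ?thesis by (simp add: cis_conv_exp mult_ac)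
qed

text \<open>Differentiating the phase restores the linear part of the system. This is done per
  component, since the linear part need not map the space into itself.\<close>

lemma component_derivative:
  assumes der: "(x has_vector_derivative Gf \<theta> R t (x t)) (at t within S)" and R: "norm (x t) \<le> R"
  shows "((\<lambda>t. uof (rotg \<theta> (- t) (x t)) J) has_vector_derivative
    - \<i> * of_real (\<theta> J) * uof (rotg \<theta> (- t) (x t)) J + uof (XP (rotg \<theta> (- t) (x t))) J) (at t within S)"
proof -
  let ?z = "rotg \<theta> (- t) (x t)"
  have d1: "((\<lambda>t. cis (t * - \<theta> J)) has_vector_derivative \<i> * of_real (- \<theta> J) * cis (t * - \<theta> J)) (at t within S)"
    by (rule cis_has_derivative)
  have d2: "((\<lambda>t. cd (x t) J) has_vector_derivative cd (Gf \<theta> R t (x t)) J) (at t within S)"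
    by (rule bounded_linear.has_vector_derivative[OF bounded_linear_cd der])
  have d3: "((\<lambda>t. cis (t * - \<theta> J) * cd (x t) J) has_vector_derivative
      cis (t * - \<theta> J) * cd (Gf \<theta> R t (x t)) J + \<i> * of_real (- \<theta> J) * cis (t * - \<theta> J) * cd (x t) J) (at t within S)"
    by (rule has_vector_derivative_mult[OF d1 d2])
  have "proj R ?z = ?z" using R by (simp add: proj_def)
  hence "cd (Gf \<theta> R t (x t)) J = cis (t * \<theta> J) * cd (XP ?z) J"
    by (simp add: Gf_def cd_rotg)
  hence e: "cis (t * - \<theta> J) * cd (Gf \<theta> R t (x t)) J = cd (XP ?z) J"
    by (simp add: cis_mult mult.assoc[symmetric])
  have "((\<lambda>t. of_real (exp (- s * \<phi> J)) * (cis (t * - \<theta> J) * cd (x t) J)) has_vector_derivative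
      of_real (exp (- s * \<phi> J)) * (cd (XP ?z) J + \<i> * of_real (- \<theta> J) * cis (t * - \<theta> J) * cd (x t) J)) (at t within S)"
    by (rule bounded_linear.has_vector_derivative[OF bounded_linear_mult_right d3[unfolded e]])
  thus ?thesis by (simp add: uof_def cd_rotg algebra_simps)
qed

lemma solution_forward:
  assumes R: "R < rs" "R \<le> R0" and x: "continuous_on S x"
    "\<And>t. t \<in> S \<Longrightarrow> (x has_vector_derivative Gf \<theta> R t (x t)) (at t within S)" "\<And>t. t \<in> S \<Longrightarrow> norm (x t) \<le> R"
  shows "ham_solution c f s H S (\<lambda>t. uof (rotg \<theta> (- t) (x t)))"
  unfolding ham_solution_def
proof (intro ballI conjI allI)
  fix t assume t: "t \<in> S"
  let ?z = "\<lambda>t. rotg \<theta> (- t) (x t)"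
  have b: "norm (?z t) < rs" "norm (?z t) \<le> R0" using x(3)[OF t] R by auto
  show "uof (?z t) \<in> W_space c f s" by (rule uof_W)
  show "ham_converges H (uof (?z t))" by (rule uof_vf(1)[OF b])
  have "continuous_on S ?z" using continuous_on_rotg[OF x(1), of \<theta> "-1"] by simp
  hence "(?z \<longlongrightarrow> ?z t) (at t within S)" using t by (simp add: continuous_on_def)
  thus "((\<lambda>t'. W_norm c f s (\<lambda>J. uof (?z t') J - uof (?z t) J)) \<longlongrightarrow> 0) (at t within S)"
    unfolding W_norm_diff by (simp add: tendsto_norm_zero LIM_zero)
  show "((\<lambda>t'. uof (?z t') J) has_vector_derivative ham_vf H (uof (?z t)) J) (at t within S)" for J
    unfolding uof_vf(2)[OF b] by (rule component_derivative[OF x(2,3)[OF t]])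
qed

lemma solution_backward:
  assumes R: "R < rs" "R \<le> R0" and v: "ham_solution c f s H I v"
    and ac: "{a..d} \<subseteq> I" "\<And>t. t \<in> {a..d} \<Longrightarrow> W_norm c f s (v t) \<le> R" and R0: "0 < R"
  shows "t \<in> {a..d} \<Longrightarrow> ((\<lambda>t. rotg \<theta> t (xof (v t))) has_vector_derivative Gf \<theta> R t (rotg \<theta> t (xof (v t)))) (at t within {a..d})"
    and "continuous_on I (\<lambda>t. rotg \<theta> t (xof (v t)))"
proof -
  have vW: "v t \<in> W_space c f s" if "t \<in> I" for t using v that by (auto simp: ham_solution_def)
  have "continuous_on I (\<lambda>t. xof (v t))"
    unfolding continuous_on_def
  proof
    fix t assume t: "t \<in> I"
    have "((\<lambda>t'. W_norm c f s (\<lambda>J. v t' J - v t J)) \<longlongrightarrow> 0) (at t within I)"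
      using v t by (auto simp: ham_solution_def)
    moreover have "\<forall>\<^sub>F t' in at t within I. W_norm c f s (\<lambda>J. v t' J - v t J) = norm (xof (v t') - xof (v t))"
      unfolding eventually_at_filter
    proof (intro always_eventually allI impI)
      fix t' assume "t' \<in> I"
      thus "W_norm c f s (\<lambda>J. v t' J - v t J) = norm (xof (v t') - xof (v t))"
        using W_norm_diff[of "xof (v t')" "xof (v t)"] by (simp add: uof_xof vW t)
    qed
    ultimately have "((\<lambda>t'. norm (xof (v t') - xof (v t))) \<longlongrightarrow> 0) (at t within I)"
      by (rule Lim_transform_eventually)
    thus "((\<lambda>t'. xof (v t')) \<longlongrightarrow> xof (v t)) (at t within I)"
      by (simp add: tendsto_norm_zero_iff LIM_zero_iff)
  qed
  from continuous_on_rotg[OF this, of \<theta> 1]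
  show cy: "continuous_on I (\<lambda>t. rotg \<theta> t (xof (v t)))" by simp
  let ?y = "\<lambda>t. rotg \<theta> t (xof (v t))"
  assume t: "t \<in> {a..d}"
  show "(?y has_vector_derivative Gf \<theta> R t (?y t)) (at t within {a..d})"
  proof (rule componentwise_derivative[OF _ _ _ t])
    show c: "continuous_on {a..d} ?y" by (rule continuous_on_subset[OF cy ac(1)])
    show "continuous_on {a..d} (\<lambda>t. Gf \<theta> R t (?y t))" by (rule Gf_continuous[OF R0 R(2) c])
    fix t J assume t: "t \<in> {a..d}"
    let ?x = "xof (v t)"
    have tI: "t \<in> I" using t ac by auto
    have nx: "norm ?x \<le> R" using ac(2)[OF t] W_norm_uof[of ?x] by (simp add: uof_xof vW tI)
    have b: "norm ?x < rs" "norm ?x \<le> R0" using nx R by auto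
    have "((\<lambda>t. v t J) has_vector_derivative ham_vf H (v t) J) (at t within {a..d})"
    proof (rule has_vector_derivative_within_subset[OF _ ac(1)])
      show "((\<lambda>t. v t J) has_vector_derivative ham_vf H (v t) J) (at t within I)"
        using v tI unfolding ham_solution_def by blast
    qed
    moreover have "ham_vf H (v t) J = - \<i> * of_real (\<theta> J) * v t J + uof (XP ?x) J"
      using uof_vf(2)[OF b, of J] by (simp add: uof_xof vW tI)
    ultimately have d1: "((\<lambda>t. v t J) has_vector_derivative - \<i> * of_real (\<theta> J) * v t J + uof (XP ?x) J) (at t within {a..d})"
      by simp
    have "((\<lambda>t. cis (t * \<theta> J) * v t J) has_vector_derivative
        cis (t * \<theta> J) * (- \<i> * of_real (\<theta> J) * v t J + uof (XP ?x) J) + \<i> * of_real (\<theta> J) * cis (t * \<theta> J) * v t J) (at t within {a..d})"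
      by (rule has_vector_derivative_mult[OF cis_has_derivative d1])
    hence "((\<lambda>t. cis (t * \<theta> J) * v t J) has_vector_derivative cis (t * \<theta> J) * uof (XP ?x) J) (at t within {a..d})"
      by (simp add: algebra_simps)
    hence d2: "((\<lambda>t. of_real (exp (s * \<phi> J)) * (cis (t * \<theta> J) * v t J)) has_vector_derivative
        of_real (exp (s * \<phi> J)) * (cis (t * \<theta> J) * uof (XP ?x) J)) (at t within {a..d})"
      by (rule bounded_linear.has_vector_derivative[OF bounded_linear_mult_right])
    have "proj R ?x = ?x" using nx by (simp add: proj_def)
    hence "cd (Gf \<theta> R t (?y t)) J = cis (t * \<theta> J) * cd (XP ?x) J"
      by (simp add: Gf_def rotg_rotg cd_rotg)
    also have "... = of_real (exp (s * \<phi> J)) * (cis (t * \<theta> J) * uof (XP ?x) J)"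
      by (simp add: uof_def mult.left_commute)
    finally have e: "cd (Gf \<theta> R t (?y t)) J = of_real (exp (s * \<phi> J)) * (cis (t * \<theta> J) * uof (XP ?x) J)" .
    have "of_real (exp (s * \<phi> J)) * (cis (t * \<theta> J) * v t J) = cd (?y t) J" if "t \<in> {a..d}" for t
      using that ac(1) by (simp add: cd_rotg cd_xof vW subset_iff mult_ac)
    thus "((\<lambda>t. cd (?y t) J) has_vector_derivative cd (Gf \<theta> R t (?y t)) J) (at t within {a..d})"
      unfolding e by (intro has_vector_derivative_transform[OF t _ d2]) auto
  qed
qed

text \<open>The competing solution \<open>v\<close> is not assumed small. Where it agrees with
  \<open>x\<close> its norm is below \<open>R\<close>, and by continuity it stays so nearby, where
  it solves the retracted equation; agreement then spreads over the whole interval.\<close>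

lemma solution_unique:
  assumes R: "0 < R" "R < rs" "R \<le> R0" and T: "0 \<le> T"
    and x: "continuous_on {-T..T} x"
      "\<And>t. t \<in> {-T..T} \<Longrightarrow> (x has_vector_derivative Gf \<theta> R t (x t)) (at t within {-T..T})"
      "\<And>t. t \<in> {-T..T} \<Longrightarrow> norm (x t) < R" "x 0 = xof u0"
    and v: "is_interval I" "0 \<in> I" "ham_solution c f s H I v" "v 0 = u0" and t: "t \<in> I \<inter> {-T..T}"
  shows "v t = uof (rotg \<theta> (- t) (x t))"
proof -
  let ?S = "I \<inter> {-T..T}" and ?y = "\<lambda>t. rotg \<theta> t (xof (v t))"
  have vW: "v t \<in> W_space c f s" if "t \<in> I" for t using v(3) that by (auto simp: ham_solution_def)
  have cy: "continuous_on I ?y"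
    by (rule solution_backward(2)[OF R(2,3) v(3) _ _ R(1), of 1 0]) auto
  have S: "is_interval ?S" "0 \<in> ?S" using v T by (auto intro: is_interval_Int is_interval_cc)
  have cxS: "continuous_on ?S x" and cyS: "continuous_on ?S ?y"
    by (rule continuous_on_subset[OF x(1)], simp, rule continuous_on_subset[OF cy], simp)
  have "x t = ?y t"
  proof (rule Gf_unique[OF R(1,3) S _ cxS cyS _ t])
    show "x 0 = ?y 0" by (simp add: x v)
    fix \<tau> assume \<tau>: "\<tau> \<in> ?S" "x \<tau> = ?y \<tau>"
    have "(?y \<longlongrightarrow> ?y \<tau>) (at \<tau> within ?S)" using cyS \<tau> by (simp add: continuous_on_def)
    hence "((\<lambda>t. norm (?y t)) \<longlongrightarrow> norm (?y \<tau>)) (at \<tau> within ?S)" by (rule tendsto_norm)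
    moreover have "norm (?y \<tau>) < R" using x(3)[of \<tau>] \<tau> by simp
    ultimately have "\<forall>\<^sub>F t in at \<tau> within ?S. norm (?y t) < R" by (rule order_tendstoD)
    then obtain d where d: "0 < d" "\<And>t. t \<in> ?S \<Longrightarrow> t \<noteq> \<tau> \<Longrightarrow> dist t \<tau> < d \<Longrightarrow> norm (?y t) < R"
      unfolding eventually_at by blast
    have d': "W_norm c f s (v t) \<le> R" if "t \<in> ?S" "t \<in> {\<tau> - d <..< \<tau> + d}" for t
    proof -
      have "norm (?y t) < R" using d(2)[OF that(1)] that(2) \<open>norm (?y \<tau>) < R\<close> by (cases "t = \<tau>") (auto simp: dist_real_def)
      thus ?thesis using W_norm_uof[of "xof (v t)"] that by (simp add: uof_xof vW)
    qed
    show "\<exists>d>0. \<forall>a c. {a..c} \<subseteq> ?S \<inter> {\<tau> - d <..< \<tau> + d} \<longrightarrow>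
        (\<forall>t\<in>{a..c}. (x has_vector_derivative Gf \<theta> R t (x t)) (at t within {a..c}) \<and>
          (?y has_vector_derivative Gf \<theta> R t (?y t)) (at t within {a..c}))"
    proof (intro exI[of _ d] conjI d(1) allI impI ballI)
      fix a e t assume sub: "{a..e} \<subseteq> ?S \<inter> {\<tau> - d <..< \<tau> + d}" and t: "t \<in> {a..e}"
      show "(x has_vector_derivative Gf \<theta> R t (x t)) (at t within {a..e})"
        by (rule has_vector_derivative_within_subset[OF x(2)]) (use sub t in blast)+
      show "(?y has_vector_derivative Gf \<theta> R t (?y t)) (at t within {a..e})"
        by (rule solution_backward(1)[OF R(2,3) v(3) _ _ R(1) t]) (use sub d' in blast)+
    qed
  qed
  hence "uof (rotg \<theta> (- t) (x t)) = uof (xof (v t))" by (simp add: rotg_rotg)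
  thus ?thesis using t by (simp add: uof_xof vW)
qed

text \<open>The conjugate curve solves the same equation with the same initial value, because the
  coefficients are real in the sense of \<open>perturbation_map_bar\<close> and conjugation commutes
  with the rotation.\<close>

lemma solution_real:
  assumes R: "0 < R" "R \<le> R0" and T: "0 \<le> T"
    and x: "continuous_on {-T..T} x"
      "\<And>t. t \<in> {-T..T} \<Longrightarrow> (x has_vector_derivative Gf \<theta> R t (x t)) (at t within {-T..T})"
      "x 0 = xof u0" and u0: "real_state u0" "u0 \<in> W_space c f s" and t: "t \<in> {-T..T}"
  shows "real_state (uof (rotg \<theta> (- t) (x t)))"
proof -
  have real: "gpart P n (map bar M) = cnj (gpart P n M)" for n M
    using symz_map_bar[of P M, OF perturbation_map_bar[OF P]] by (simp add: gpart_def)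
  have "cj (x t) = x t"
  proof (rule Gf_unique[OF R is_interval_cc _ _ _ x(1) _ t])
    show "0 \<in> {-T..T}" using T by simp
    show "cj (x 0) = x 0"
    proof (rule sqs_eqI)
      fix J
      have "u0 (bar J) = cnj (u0 J)" using u0 unfolding real_state_def by blast
      thus "cd (cj (x 0)) J = cd (x 0) J" by (simp add: x cd_cj cd_xof u0)
    qed
    show "continuous_on {-T..T} (\<lambda>t. cj (x t))"
      by (rule continuous_on_compose2[OF linear_continuous_on[OF bounded_linear_cj] x(1)]) auto
    show "\<exists>d>0. \<forall>a c. {a..c} \<subseteq> {-T..T} \<inter> {\<tau> - d <..< \<tau> + d} \<longrightarrow>
        (\<forall>t\<in>{a..c}. ((\<lambda>t. cj (x t)) has_vector_derivative Gf \<theta> R t (cj (x t))) (at t within {a..c}) \<and>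
          (x has_vector_derivative Gf \<theta> R t (x t)) (at t within {a..c}))" for \<tau>
    proof (intro exI[of _ 1] conjI allI impI ballI)
      fix a e t assume sub: "{a..e} \<subseteq> {-T..T} \<inter> {\<tau> - 1 <..< \<tau> + 1}" and t: "t \<in> {a..e}"
      show d: "(x has_vector_derivative Gf \<theta> R t (x t)) (at t within {a..e})"
        by (rule has_vector_derivative_within_subset[OF x(2)]) (use sub t in blast)+
      have "Gf \<theta> R t (cj (x t)) = cj (Gf \<theta> R t (x t))"
        by (rule cj_Gf[where \<theta> = \<theta>, OF R real theta_bar, symmetric])
      thus "((\<lambda>t. cj (x t)) has_vector_derivative Gf \<theta> R t (cj (x t))) (at t within {a..e})"
        using bounded_linear.has_vector_derivative[OF bounded_linear_cj d] by simp
    qed simp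
  qed
  hence "cj (rotg \<theta> (- t) (x t)) = rotg \<theta> (- t) (x t)"
    by (simp add: cj_rotg[where \<theta> = \<theta>, OF theta_bar])
  hence e: "cd (rotg \<theta> (- t) (x t)) J = cnj (cd (rotg \<theta> (- t) (x t)) (bar J))" for J
    using cd_cj[of "rotg \<theta> (- t) (x t)" J] by simp
  show ?thesis unfolding real_state_def
    by (intro allI) (simp add: uof_def e[of "bar _"])
qed

end

section \<open>Energies and their derivative along solutions\<close>

lemma norm_div_fact: "cmod y \<le> fact i * B \<Longrightarrow> cmod (y / fact i) \<le> B"
  by (simp add: norm_divide divide_le_eq mult.commute)

lemma pascal_sum:
  fixes f g :: "nat \<Rightarrow> complex"
  shows "(\<Sum>a\<le>k. of_nat (k choose a) * (f (Suc a) * g (k - a))) + (\<Sum>a\<le>k. of_nat (k choose a) * (f a * g (Suc k - a)))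
    = (\<Sum>a\<le>Suc k. of_nat (Suc k choose a) * (f a * g (Suc k - a)))"
proof -
  have "(\<Sum>a\<le>Suc k. of_nat (Suc k choose a) * (f a * g (Suc k - a)))
      = f 0 * g (Suc k) + (\<Sum>a\<le>k. of_nat (Suc k choose Suc a) * (f (Suc a) * g (k - a)))"
    by (subst sum.atMost_Suc_shift) simp
  also have "... = (\<Sum>a\<le>k. of_nat (k choose a) * (f (Suc a) * g (k - a)))
      + (f 0 * g (Suc k) + (\<Sum>a\<le>k. of_nat (k choose Suc a) * (f (Suc a) * g (k - a))))"
    by (simp add: sum.distrib distrib_right)
  also have "f 0 * g (Suc k) + (\<Sum>a\<le>k. of_nat (k choose Suc a) * (f (Suc a) * g (k - a)))
      = (\<Sum>a\<le>Suc k. of_nat (k choose a) * (f a * g (Suc k - a)))"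
    by (subst sum.atMost_Suc_shift) simp
  also have "... = (\<Sum>a\<le>k. of_nat (k choose a) * (f a * g (Suc k - a)))" by (simp add: binomial_eq_0)
  finally show ?thesis by simp
qed

text \<open>Evaluation turns the shuffle product into the product of evaluations; the binomials
  reflect that factorials have not yet been divided out.\<close>

lemma sum_conv_upr:
  "(\<Sum>M\<in>LS S k. conv F G M * upr u M)
    = (\<Sum>a\<le>k. of_nat (k choose a) * ((\<Sum>A\<in>LS S a. F A * upr u A) * (\<Sum>B\<in>LS S (k - a). G B * upr u B)))"
proof (induction k arbitrary: F G)
  case 0
  have "LS S 0 = {[]}" by (auto simp: LS_def)
  thus ?case by simp
next
  case (Suc k)
  define e where "e F a = (\<Sum>A\<in>LS S a. F A * upr u A)" for F a
  have eS: "e F (Suc a) = (\<Sum>K\<in>S. u K * e (dl K F) a)" for F a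
    unfolding e_def sum_LS_Suc by (simp add: dl_def sum_distrib_left mult_ac)
  have IH: "(\<Sum>M\<in>LS S k. conv F G M * upr u M) = (\<Sum>a\<le>k. of_nat (k choose a) * (e F a * e G (k - a)))" for F G
    unfolding e_def by (rule Suc.IH)
  have "(\<Sum>M\<in>LS S (Suc k). conv F G M * upr u M)
      = (\<Sum>K\<in>S. u K * ((\<Sum>M\<in>LS S k. conv (dl K F) G M * upr u M) + (\<Sum>M\<in>LS S k. conv F (dl K G) M * upr u M)))"
    unfolding sum_LS_Suc conv_Cons by (simp add: sum_distrib_left sum.distrib algebra_simps)
  also have "... = (\<Sum>K\<in>S. \<Sum>a\<le>k. of_nat (k choose a) * (u K * e (dl K F) a * e G (k - a)))
      + (\<Sum>K\<in>S. \<Sum>a\<le>k. of_nat (k choose a) * (e F a * (u K * e (dl K G) (k - a))))"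
    unfolding IH by (simp add: sum_distrib_left sum.distrib algebra_simps)
  also have "(\<Sum>K\<in>S. \<Sum>a\<le>k. of_nat (k choose a) * (u K * e (dl K F) a * e G (k - a)))
      = (\<Sum>a\<le>k. of_nat (k choose a) * (e F (Suc a) * e G (k - a)))"
    by (subst sum.swap) (simp add: eS sum_distrib_left sum_distrib_right)
  also have "(\<Sum>K\<in>S. \<Sum>a\<le>k. of_nat (k choose a) * (e F a * (u K * e (dl K G) (k - a))))
      = (\<Sum>a\<le>k. of_nat (k choose a) * (e F a * e G (Suc (k - a))))"
    by (subst sum.swap) (simp add: eS sum_distrib_left)
  also have "(\<Sum>a\<le>k. of_nat (k choose a) * (e F a * e G (Suc (k - a))))
      = (\<Sum>a\<le>k. of_nat (k choose a) * (e F a * e G (Suc k - a)))"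
    by (intro sum.cong refl) (simp add: Suc_diff_le)
  also have "(\<Sum>a\<le>k. of_nat (k choose a) * (e F (Suc a) * e G (k - a))) + ...
      = (\<Sum>a\<le>Suc k. of_nat (Suc k choose a) * (e F a * e G (Suc k - a)))"
    by (rule pascal_sum)
  finally show ?case by (simp only: e_def)
qed

text \<open>The contraction index may leave \<open>S\<close>, but zero momentum keeps it in the box
  enlarged by the number of factors. Since \<open>E\<close> has a single degree, only one term of
  the binomial sum survives.\<close>

lemma sum_br_upr:
  assumes E: "zm E" "\<And>M. E M \<noteq> 0 \<Longrightarrow> length M = m + 2" and k: "k = m + n + 2" and S: "S = mbox R" and R: "0 \<le> R"
    and S': "S' = mbox (real k * R)"
  shows "(\<Sum>M\<in>LS S k. br E p M * upr u M)
    = of_nat (k choose (m + 1)) * (\<Sum>K\<in>S'. cf K * ((\<Sum>A\<in>LS S (m + 1). E (K # A) * upr u A) * (\<Sum>B\<in>LS S (n + 1). p (bar K # B) * upr u B)))"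
proof -
  have sub: "br E p M = pb S' E p M" if M: "M \<in> LS S k" for M
  proof (rule pb_eq_br[symmetric])
    have "mnorm M \<le> real (length M) * R"
    proof -
      have "\<forall>J\<in>set M. mode_norm J \<le> R" using M by (auto simp: LS_def S mbox_def)
      thus ?thesis
      proof (induction M)
        case (Cons J M)
        thus ?case by (simp add: mnorm_def distrib_right)
      qed (simp add: mnorm_def)
    qed
    thus "mbox (mnorm M) \<subseteq> S'" using M by (auto simp: S' mbox_def LS_def)
  qed (use E S' in auto)
  have "(\<Sum>M\<in>LS S k. br E p M * upr u M) = (\<Sum>M\<in>LS S k. \<Sum>K\<in>S'. cf K * (conv (dl K E) (dl (bar K) p) M * upr u M))"
    by (intro sum.cong refl) (simp add: sub pb_def sum_distrib_right mult.assoc)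
  also have "... = (\<Sum>K\<in>S'. cf K * (\<Sum>M\<in>LS S k. conv (dl K E) (dl (bar K) p) M * upr u M))"
    unfolding sum_distrib_left by (rule sum.swap)
  also have "... = (\<Sum>K\<in>S'. cf K * (of_nat (k choose (m + 1)) *
      ((\<Sum>A\<in>LS S (m + 1). E (K # A) * upr u A) * (\<Sum>B\<in>LS S (n + 1). p (bar K # B) * upr u B))))"
  proof (intro sum.cong refl arg_cong2[where f = "(*)"])
    fix K
    let ?t = "\<lambda>a. of_nat (k choose a) * ((\<Sum>A\<in>LS S a. dl K E A * upr u A) * (\<Sum>B\<in>LS S (k - a). dl (bar K) p B * upr u B))"
    have "(\<Sum>A\<in>LS S a. dl K E A * upr u A) = 0" if "a \<noteq> m + 1" for a
    proof (rule sum.neutral, intro ballI)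
      fix A assume "A \<in> LS S a"
      hence "E (K # A) = 0" using E(2)[of "K # A"] that by (auto simp: LS_def)
      thus "dl K E A * upr u A = 0" by (simp add: dl_def)
    qed
    hence "(\<Sum>a\<le>k. ?t a) = (\<Sum>a\<in>{m + 1}. ?t a)" by (intro sum.mono_neutral_right) (auto simp: k)
    thus "(\<Sum>M\<in>LS S k. conv (dl K E) (dl (bar K) p) M * upr u M) = of_nat (k choose (m + 1)) *
      ((\<Sum>A\<in>LS S (m + 1). E (K # A) * upr u A) * (\<Sum>B\<in>LS S (n + 1). p (bar K # B) * upr u B))"
      unfolding sum_conv_upr by (simp add: dl_def k)
  qed
  finally show ?thesis by (simp add: sum_distrib_left mult_ac)
qed

lemma upr_derivative:
  assumes "\<And>J. ((\<lambda>t. u t J) has_vector_derivative u' J) (at t within T)"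
  shows "((\<lambda>t. upr (u t) M) has_vector_derivative dupr (u t) u' M) (at t within T)"
proof (induction M)
  case (Cons K M)
  from has_vector_derivative_mult[OF assms[of K] Cons]
  show ?case by (simp add: add.commute)
qed simp

lemma dupr_rotation:
  assumes "\<And>J. \<theta> J = of_int (sg (snd J)) * \<omega> (fst J)"
  shows "dupr u (\<lambda>J. - \<i> * of_real (\<theta> J) * u J + h J) M = - \<i> * of_real (freq_sum \<omega> M) * upr u M + dupr u h M"
proof (induction M)
  case (Cons K M)
  show ?case unfolding dupr.simps Cons.IH by (simp add: freq_sum_Cons assms algebra_simps)
qed (simp add: freq_sum_Nil)

section \<open>Truncation to boxes and evaluation of energies\<close>

definition tr :: "'a set \<Rightarrow> 'a sqs \<Rightarrow> 'a sqs" where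
  "tr S x = Sqs (\<lambda>J. of_bool (J \<in> S) * cd x J)"

lemma cd_tr: "cd (tr S x) J = of_bool (J \<in> S) * cd x J"
  by (simp add: tr_def l2_mult[where B = 1])

lemma norm_tr_le: "norm (tr S x) \<le> norm x"
proof (rule norm_sqs_le)
  fix T :: "'a set" assume T: "finite T"
  have "L2_set (\<lambda>i. cmod (cd (tr S x) i)) T \<le> L2_set (\<lambda>i. cmod (cd x i)) T"
    by (rule L2_set_mono) (auto simp: cd_tr norm_mult)
  thus "L2_set (\<lambda>i. cmod (cd (tr S x) i)) T \<le> norm x" using L2_le_norm[OF T, of x] by linarith
qed

lemma tendsto_tr:
  fixes x :: "('n::finite) mode sqs"
  shows "(\<lambda>j. norm (x - tr (mbox (real j)) x)) \<longlonglongrightarrow> 0"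
proof (rule LIMSEQ_I)
  fix e :: real assume e: "0 < e"
  obtain F where F: "finite F" "\<And>S. finite S \<Longrightarrow> L2_set (\<lambda>i. cmod (cd x i)) (S - F) \<le> e / 2"
    using sqs_tail[of "e / 2" x] e by auto
  obtain B where B: "\<forall>r\<in>mode_norm ` F. r \<le> B"
    using bdd_above_finite[of "mode_norm ` F"] F(1) by (auto simp: bdd_above_def)
  obtain j0 :: nat where j0: "B \<le> real j0" using real_arch_simple by blast
  have "norm (x - tr (mbox (real j)) x) < e" if j: "j0 \<le> j" for j
  proof -
    have FJ: "F \<subseteq> mbox (real j)" using B j0 j by (force simp: mbox_def)
    have "norm (x - tr (mbox (real j)) x) \<le> e / 2"
    proof (rule norm_sqs_le)
      fix S :: "'n mode set" assume S: "finite S"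
      have "L2_set (\<lambda>i. cmod (cd (x - tr (mbox (real j)) x) i)) S \<le> L2_set (\<lambda>i. if i \<in> F then 0 else cmod (cd x i)) S"
        using FJ by (intro L2_set_mono) (auto simp: cd_minus cd_tr)
      also have "... = L2_set (\<lambda>i. cmod (cd x i)) (S - F)"
        unfolding L2_set_def using S by (intro arg_cong[where f = sqrt] sum.mono_neutral_cong_right) auto
      also have "... \<le> e / 2" by (rule F(2)[OF S])
      finally show "L2_set (\<lambda>i. cmod (cd (x - tr (mbox (real j)) x) i)) S \<le> e / 2" .
    qed
    thus ?thesis using e by simp
  qed
  thus "\<exists>no. \<forall>n\<ge>no. norm (norm (x - tr (mbox (real n)) x) - 0) < e" by auto
qed

context weight_sum
begin

lemma bndF_cls:
  assumes "cls e2 m a E"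
  shows "bndF (m + 2) (a * fact (m + 2)) E"
  unfolding bndF_def
proof (intro conjI allI impI)
  show "0 \<le> a * fact (m + 2)" using clsD(3)[OF assms] by simp
  fix M :: "'n mode list"
  show "cmod (E M) \<le> of_bool (mom M = 0) * (a * fact (m + 2) * exp (e2 M))"
    using clsD(5)[OF assms, of M] clsD(2)[OF assms] by (cases "mom M = 0") (auto simp: zm_def)
qed

lemma multi_finite:
  assumes F: "bndF k B F" and us: "list_all2 nb us ys" "length us = k" and S: "finite S"
  shows "cmod (\<Sum>M\<in>LS S k. F M * uprl us M) \<le> B * ((real k + 1)^2 * (b ^ k * prod_list ys))"
proof -
  let ?F = "\<lambda>M. if M \<in> LS S k then F M else 0"
  have "bndF k B ?F"
    using F by (auto simp: bndF_def)
  from multi_abs(2)[OF this us]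
  have "cmod (\<Sum>\<^sub>\<infinity>M\<in>LL k. ?F M * uprl us M) \<le> B * ((real k + 1)^2 * (b ^ k * prod_list ys))" .
  also have "(\<Sum>\<^sub>\<infinity>M\<in>LL k. ?F M * uprl us M) = (\<Sum>M\<in>LS S k. ?F M * uprl us M)"
  proof (rule infsum_finite_support(2))
    show "finite (LS S k)" using S by simp
  qed (auto simp: LS_def LL_def)
  also have "... = (\<Sum>M\<in>LS S k. F M * uprl us M)" by (intro sum.cong) auto
  finally show ?thesis .
qed

definition msum :: "nat \<Rightarrow> 'n ham \<Rightarrow> 'n mode sqs \<Rightarrow> complex" where
  "msum m F z = (\<Sum>\<^sub>\<infinity>M\<in>LL (m + 2). F M * upr (uof z) M) / fact (m + 2)"

text \<open>For symmetric \<open>F\<close>, the derivative of \<open>msum\<close> at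
  \<open>z\<close> in direction \<open>x\<close>: the differentiated factor can be put first in
  \<open>m + 2\<close> equal ways, which lowers the factorial by one step.\<close>

definition dsum :: "nat \<Rightarrow> 'n ham \<Rightarrow> 'n mode sqs \<Rightarrow> 'n mode sqs \<Rightarrow> complex" where
  "dsum m F z x = (\<Sum>\<^sub>\<infinity>M\<in>LL (m + 2). F M * uprl (uof x # replicate (m + 1) (uof z)) M) / fact (m + 1)"

lemma nb_dsum: "list_all2 nb (uof x # replicate (m + 1) (uof z)) (norm x # replicate (m + 1) (norm z))"
  "length (uof x # replicate (m + 1) (uof z)) = m + 2"
  using list_all2_replicate[OF nb_uof, of "m + 1" z] by (simp_all add: nb_uof)

lemma msum_summable:
  assumes "cls e2 m a F"
  shows "(\<lambda>M. F M * upr (uof z) M) summable_on LL (m + 2)"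
proof -
  have "(\<lambda>M. F M * uprl (replicate (m + 2) (uof z)) M) summable_on LL (m + 2)"
    by (rule abs_summable_summable, rule multi_abs(1)[OF bndF_cls[OF assms] list_all2_replicate[OF nb_uof]]) simp
  thus ?thesis
    by (subst summable_on_cong[where g = "\<lambda>M. F M * uprl (replicate (m + 2) (uof z)) M"])
       (simp_all add: LL_def uprl_replicate del: replicate.simps add_2_eq_Suc')
qed

lemma msum_bounds:
  assumes F: "cls e2 m a F" and y: "norm z \<le> y"
  shows "finite S \<Longrightarrow> cmod (\<Sum>M\<in>LS S (m + 2). F M * upr (uof z) M) \<le> fact (m + 2) * (a * (real m + 3)^2 * b ^ (m + 2) * y ^ (m + 2))"
    and "cmod (msum m F z) \<le> a * (real m + 3)^2 * b ^ (m + 2) * y ^ (m + 2)"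
proof -
  let ?us = "replicate (m + 2) (uof z)" and ?C = "a * (real m + 3)^2 * b ^ (m + 2) * y ^ (m + 2)"
  have "a * fact (m + 2) * ((real (m + 2) + 1)^2 * (b ^ (m + 2) * prod_list (replicate (m + 2) (norm z))))
      = fact (m + 2) * (a * (real m + 3)^2 * b ^ (m + 2) * norm z ^ (m + 2))"
    unfolding prod_list_replicate by (simp add: algebra_simps)
  also have "... \<le> fact (m + 2) * ?C"
    using y clsD(3)[OF F] b1 by (intro mult_left_mono power_mono) auto
  finally have C: "a * fact (m + 2) * ((real (m + 2) + 1)^2 * (b ^ (m + 2) * prod_list (replicate (m + 2) (norm z)))) \<le> fact (m + 2) * ?C" .
  have len: "length ?us = m + 2" by simp
  { assume S: "finite S"
    have e: "(\<Sum>M\<in>LS S (m + 2). F M * upr (uof z) M) = (\<Sum>M\<in>LS S (m + 2). F M * uprl ?us M)"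
      by (intro sum.cong refl) (simp add: LS_def uprl_replicate del: replicate.simps add_2_eq_Suc')
    show "cmod (\<Sum>M\<in>LS S (m + 2). F M * upr (uof z) M) \<le> fact (m + 2) * ?C"
      unfolding e by (rule order_trans[OF multi_finite[OF bndF_cls[OF F] list_all2_replicate[OF nb_uof] len S] C]) }
  have e: "(\<Sum>\<^sub>\<infinity>M\<in>LL (m + 2). F M * upr (uof z) M) = (\<Sum>\<^sub>\<infinity>M\<in>LL (m + 2). F M * uprl ?us M)"
    by (intro infsum_cong) (simp add: LL_def uprl_replicate del: replicate.simps add_2_eq_Suc')
  have "cmod (\<Sum>\<^sub>\<infinity>M\<in>LL (m + 2). F M * upr (uof z) M) \<le> fact (m + 2) * ?C"
    unfolding e by (rule order_trans[OF multi_abs(2)[OF bndF_cls[OF F] list_all2_replicate[OF nb_uof] len] C])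
  thus "cmod (msum m F z) \<le> ?C" unfolding msum_def by (rule norm_div_fact)
qed

lemma dsum_bounds:
  assumes F: "cls e2 m a F" and y: "norm z \<le> y" "norm x \<le> w"
  shows "(\<lambda>M. F M * uprl (uof x # replicate (m + 1) (uof z)) M) summable_on LL (m + 2)"
    and "finite S \<Longrightarrow> cmod (\<Sum>M\<in>LS S (m + 2). F M * uprl (uof x # replicate (m + 1) (uof z)) M)
      \<le> fact (m + 1) * (a * real (m + 2) * (real m + 3)^2 * b ^ (m + 2) * y ^ (m + 1) * w)"
    and "cmod (dsum m F z x) \<le> a * real (m + 2) * (real m + 3)^2 * b ^ (m + 2) * y ^ (m + 1) * w"
proof -
  let ?us = "uof x # replicate (m + 1) (uof z)" and ?C = "a * real (m + 2) * (real m + 3)^2 * b ^ (m + 2) * y ^ (m + 1) * w"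
  have w0: "0 \<le> y" "0 \<le> w" using y norm_ge_zero order_trans by blast+
  have "a * fact (m + 2) * ((real (m + 2) + 1)^2 * (b ^ (m + 2) * prod_list (norm x # replicate (m + 1) (norm z))))
      = fact (m + 1) * (a * real (m + 2) * (real m + 3)^2 * b ^ (m + 2) * (norm z ^ (m + 1) * norm x))"
    unfolding prod_list.Cons prod_list_replicate by (simp add: algebra_simps)
  also have "... \<le> fact (m + 1) * (a * real (m + 2) * (real m + 3)^2 * b ^ (m + 2) * (y ^ (m + 1) * w))"
    using y clsD(3)[OF F] b1 w0 by (intro mult_left_mono mult_mono power_mono) auto
  finally have C: "a * fact (m + 2) * ((real (m + 2) + 1)^2 * (b ^ (m + 2) * prod_list (norm x # replicate (m + 1) (norm z))))
      \<le> fact (m + 1) * ?C" by (simp only: mult.assoc)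
  show "(\<lambda>M. F M * uprl ?us M) summable_on LL (m + 2)"
    by (rule abs_summable_summable, rule multi_abs(1)[OF bndF_cls[OF F] nb_dsum])
  show "cmod (\<Sum>M\<in>LS S (m + 2). F M * uprl ?us M) \<le> fact (m + 1) * ?C" if "finite S"
    by (rule order_trans[OF multi_finite[OF bndF_cls[OF F] nb_dsum that] C])
  have "cmod (\<Sum>\<^sub>\<infinity>M\<in>LL (m + 2). F M * uprl ?us M) \<le> fact (m + 1) * ?C"
    by (rule order_trans[OF multi_abs(2)[OF bndF_cls[OF F] nb_dsum] C])
  thus "cmod (dsum m F z x) \<le> ?C" unfolding dsum_def by (rule norm_div_fact)
qed

lemma dsum_add:
  assumes F: "cls e2 m a F"
  shows "dsum m F z (x + x') = dsum m F z x + dsum m F z x'"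
proof -
  have s: "(\<lambda>M. F M * uprl (uof x # replicate (m + 1) (uof z)) M) summable_on LL (m + 2)" for x
    by (rule dsum_bounds(1)[OF F order_refl order_refl])
  have e: "F M * uprl (uof (x + x') # replicate (m + 1) (uof z)) M
      = F M * uprl (uof x # replicate (m + 1) (uof z)) M + F M * uprl (uof x' # replicate (m + 1) (uof z)) M"
    if "M \<in> LL (m + 2)" for M
    using that by (cases M) (auto simp: LL_def uof_def cd_plus algebra_simps)
  have "(\<Sum>\<^sub>\<infinity>M\<in>LL (m + 2). F M * uprl (uof (x + x') # replicate (m + 1) (uof z)) M)
      = (\<Sum>\<^sub>\<infinity>M\<in>LL (m + 2). F M * uprl (uof x # replicate (m + 1) (uof z)) M + F M * uprl (uof x' # replicate (m + 1) (uof z)) M)"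
    by (rule infsum_cong[OF e])
  also have "... = (\<Sum>\<^sub>\<infinity>M\<in>LL (m + 2). F M * uprl (uof x # replicate (m + 1) (uof z)) M)
      + (\<Sum>\<^sub>\<infinity>M\<in>LL (m + 2). F M * uprl (uof x' # replicate (m + 1) (uof z)) M)"
    by (rule infsum_add[OF s s])
  finally show ?thesis by (simp only: dsum_def add_divide_distrib)
qed

lemma dsum_0:
  assumes F: "cls e2 m a F"
  shows "dsum m F z 0 = 0"
  using dsum_add[OF F, of z 0 0] by simp

lemma dsum_diff:
  assumes F: "cls e2 m a F"
  shows "dsum m F z (x - x') = dsum m F z x - dsum m F z x'"
  using dsum_add[OF F, of z "x - x'" x'] by simp

lemma dsum_sum:
  fixes n :: nat
  assumes F: "cls e2 m a F"
  shows "dsum m F z (\<Sum>i<n. x i) = (\<Sum>i<n. dsum m F z (x i))"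
  by (induction n) (simp_all add: dsum_add[OF F] dsum_0[OF F])

lemma uof_tr: "uof (tr S z) J = of_bool (J \<in> S) * uof z J"
  by (simp add: uof_def cd_tr)

lemma upr_tr: "upr (uof (tr S z)) A = of_bool (set A \<subseteq> S) * upr (uof z) A"
  by (induction A) (auto simp: uof_tr)

end

context ham_pert
begin

text \<open>For a state supported in a box both sides are finite sums, and the chain rule is the
  definition of the bracket. The field of a truncated state still reaches beyond \<open>S\<close>,
  but within the larger box \<open>?S'\<close>.\<close>

lemma dsum_truncated:
  assumes E: "cls e2 m a E" and n: "1 \<le> n" and S: "S = mbox (real j)" and k: "k = m + n + 2"
  shows "dsum m E (tr S z) (Xg n (tr S z)) = (\<Sum>M\<in>LS S k. br E (p n) M * upr (uof z) M) / fact k"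
proof -
  let ?u = "uof z" and ?z = "tr S z"
  let ?S' = "mbox (real k * real j) :: 'n mode set"
  let ?e = "\<lambda>K. \<Sum>A\<in>LS S (m + 1). E (K # A) * upr ?u A"
  let ?g = "\<lambda>K. \<Sum>B\<in>LS S (n + 1). p n (bar K # B) * upr ?u B"
  have finS: "finite S" by (simp add: S)
  have sumtr: "(\<Sum>A\<in>LS S i. c A * upr (uof ?z) A) = (\<Sum>A\<in>LS S i. c A * upr ?u A)" for c i
    by (intro sum.cong refl) (auto simp: upr_tr LS_def)
  have h: "uof (Xg n ?z) K = cf K * (?g K / fact (n + 1))" for K
  proof -
    have c: "cd (Xg n ?z) K = cf K * of_real (exp (s * \<phi> K)) * hpl n (bar K) (replicate (n + 1) (uof ?z))"
      unfolding Xg_def by (rule V_bounds(1)[OF n list_all2_replicate[OF nb_uof]]) auto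
    have "complex_of_real (exp (- s * \<phi> K)) * of_real (exp (s * \<phi> K)) = 1"
      by (simp flip: of_real_mult exp_add)
    hence "uof (Xg n ?z) K = cf K * hpl n (bar K) (replicate (n + 1) (uof ?z))"
      unfolding uof_def c by (simp add: mult.left_commute mult.assoc[symmetric] del: replicate.simps)
    moreover have "(\<Sum>\<^sub>\<infinity>L\<in>LL (n + 1). p n (bar K # L) * uprl (replicate (n + 1) (uof ?z)) L)
        = (\<Sum>L\<in>LS S (n + 1). p n (bar K # L) * uprl (replicate (n + 1) (uof ?z)) L)"
    proof (rule infsum_finite_support(2))
      show "finite (LS S (n + 1))" using finS by simp
    qed (auto simp: LS_def LL_def uprl_replicate upr_tr simp del: replicate.simps)
    moreover have "... = (\<Sum>L\<in>LS S (n + 1). p n (bar K # L) * upr (uof ?z) L)"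
      by (intro sum.cong refl) (simp add: LS_def uprl_replicate del: replicate.simps)
    ultimately show ?thesis unfolding hpl_def sumtr by simp
  qed
  let ?T = "(\<lambda>(K, A). K # A) ` (?S' \<times> LS S (m + 1))"
  have "(\<Sum>\<^sub>\<infinity>M\<in>LL (m + 2). E M * uprl (uof (Xg n ?z) # replicate (m + 1) (uof ?z)) M)
      = (\<Sum>M\<in>?T. E M * uprl (uof (Xg n ?z) # replicate (m + 1) (uof ?z)) M)"
  proof (rule infsum_finite_support(2))
    show "finite ?T" using finS by auto
    show "?T \<subseteq> LL (m + 2)" by (auto simp: LL_def LS_def)
    fix M assume M: "M \<in> LL (m + 2) - ?T"
    then obtain K A where KA: "M = K # A" "length A = m + 1" by (cases M) (auto simp: LL_def)
    show "E M * uprl (uof (Xg n ?z) # replicate (m + 1) (uof ?z)) M = 0"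
    proof (cases "set A \<subseteq> S")
      case True
      hence A: "A \<in> LS S (m + 1)" using KA by (simp add: LS_def)
      hence K: "K \<notin> ?S'" using M KA by auto
      have "mnorm A \<le> real (length A) * real j"
      proof -
        have "\<forall>J\<in>set A. mode_norm J \<le> real j" using A by (auto simp: LS_def S mbox_def)
        thus ?thesis
        proof (induction A)
          case (Cons J A)
          thus ?case by (simp add: mnorm_def distrib_right)
        qed (simp add: mnorm_def)
      qed
      also have "... \<le> real k * real j" using KA by (intro mult_right_mono) (auto simp: k)
      also have "... < mode_norm K" using K by (simp add: mbox_def)
      finally have "mom (K # A) \<noteq> 0" using mode_norm_le_mnorm[of K A] by linarith
      thus ?thesis using clsD(2)[OF E] KA by (auto simp: zm_def)
    next
      case False
      thus ?thesis using KA by (simp add: uprl_replicate upr_tr del: replicate.simps)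
    qed
  qed
  also have "... = (\<Sum>K\<in>?S'. uof (Xg n ?z) K * (\<Sum>A\<in>LS S (m + 1). E (K # A) * upr (uof ?z) A))"
  proof -
    have "inj_on (\<lambda>(K, A). K # A) (?S' \<times> LS S (m + 1))" by (auto simp: inj_on_def)
    hence "(\<Sum>M\<in>?T. E M * uprl (uof (Xg n ?z) # replicate (m + 1) (uof ?z)) M)
        = (\<Sum>K\<in>?S'. \<Sum>A\<in>LS S (m + 1). E (K # A) * uprl (uof (Xg n ?z) # replicate (m + 1) (uof ?z)) (K # A))"
      by (simp add: sum.reindex sum.cartesian_product case_prod_unfold del: replicate.simps)
    also have "... = (\<Sum>K\<in>?S'. \<Sum>A\<in>LS S (m + 1). uof (Xg n ?z) K * (E (K # A) * upr (uof ?z) A))"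
      by (intro sum.cong refl) (simp add: LS_def uprl_replicate del: replicate.simps)
    finally show ?thesis by (simp add: sum_distrib_left)
  qed
  also have "... = (\<Sum>K\<in>?S'. cf K * (?e K * ?g K)) / fact (n + 1)"
    unfolding sumtr h by (subst sum_divide_distrib) (intro sum.cong refl, simp del: fact_Suc)
  finally have 1: "dsum m E ?z (Xg n ?z) = (\<Sum>K\<in>?S'. cf K * (?e K * ?g K)) / (fact (m + 1) * fact (n + 1))"
    by (simp add: dsum_def del: fact_Suc replicate.simps)
  have "(\<Sum>M\<in>LS S k. br E (p n) M * upr ?u M) = of_nat (k choose (m + 1)) * (\<Sum>K\<in>?S'. cf K * (?e K * ?g K))"
    by (rule sum_br_upr[OF clsD(2)[OF E] clsD(4)[OF E] k S _ refl]) auto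
  moreover have "of_nat (k choose (m + 1)) = (fact k :: complex) / (fact (m + 1) * fact (n + 1))"
    using binomial_fact[of "m + 1" k, where ?'a = complex] by (simp add: k del: fact_Suc)
  ultimately show ?thesis unfolding 1 by (simp del: fact_Suc)
qed

lemma cls_br_energy:
  assumes E: "cls e2 m a E" and n: "1 \<le> n"
  shows "cls e2 (m + n) (2 * real (n + 2) * real (m + 2) * A ^ n * a) (br E (p n))"
proof -
  have "cls e2 (n + m) (cmod (- 1) * (2 * real (n + 2) * real (m + 2) * A ^ n * a)) (\<lambda>M. - 1 * br (p n) E M)"
    by (rule cls_scale[OF cls_br_e2[OF p_cls[OF n] E]])
  moreover have "(\<lambda>M. - 1 * br (p n) E M) = br E (p n)"
    using br_antisym[of E "p n"] by auto
  ultimately show ?thesis by (simp add: add.commute)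
qed

text \<open>Truncated states converge to \<open>z\<close>, so the identity for truncations passes to
  the limit. The direction differs from the truncated field by the Lipschitz change of the field and
  by the part of its value outside the box, and both vanish in the limit.\<close>

lemma dsum_Xg:
  assumes E: "cls e2 m a E" and n: "1 \<le> n"
  shows "dsum m E z (Xg n z) = msum (m + n) (br E (p n)) z"
proof -
  let ?tr = "\<lambda>j :: nat. tr (mbox (real j) :: 'n mode set)" and ?X = "Xg n z"
  let ?C = "a * real (m + 2) * (real m + 3)^2 * b ^ (m + 2) * norm z ^ (m + 1)"
  have l0: "(\<lambda>j. \<Sum>M\<in>LS (mbox (real j)) (m + n + 2). br E (p n) M * upr (uof z) M)
      \<longlonglongrightarrow> (\<Sum>\<^sub>\<infinity>M\<in>LL (m + n + 2). br E (p n) M * upr (uof z) M)"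
    by (rule tendsto_infsum_mbox[OF msum_summable[OF cls_br_energy[OF E n]]])
  have l1: "(\<lambda>j. dsum m E (?tr j z) (Xg n (?tr j z))) \<longlonglongrightarrow> msum (m + n) (br E (p n)) z"
    unfolding msum_def dsum_truncated[OF E n refl refl]
    by (rule tendsto_divide[OF l0 tendsto_const fact_nonzero])
  have fin: "dsum m E (?tr j z) (?tr j ?X)
      = (\<Sum>M\<in>LS (mbox (real j)) (m + 2). E M * uprl (uof ?X # replicate (m + 1) (uof z)) M) / fact (m + 1)" for j
  proof -
    let ?S = "mbox (real j) :: 'n mode set"
    have e: "uprl (uof (?tr j ?X) # replicate (m + 1) (uof (?tr j z))) M
        = of_bool (set M \<subseteq> ?S) * uprl (uof ?X # replicate (m + 1) (uof z)) M" if "length M = m + 2" for M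
      using that by (cases M) (auto simp: uof_tr uprl_replicate upr_tr simp del: replicate.simps)
    have "(\<Sum>\<^sub>\<infinity>M\<in>LL (m + 2). E M * uprl (uof (?tr j ?X) # replicate (m + 1) (uof (?tr j z))) M)
        = (\<Sum>M\<in>LS ?S (m + 2). E M * uprl (uof (?tr j ?X) # replicate (m + 1) (uof (?tr j z))) M)"
    proof (rule infsum_finite_support(2))
      fix M assume M: "M \<in> LL (m + 2) - LS ?S (m + 2)"
      hence "length M = m + 2" "\<not> set M \<subseteq> ?S" by (auto simp: LL_def LS_def)
      thus "E M * uprl (uof (?tr j ?X) # replicate (m + 1) (uof (?tr j z))) M = 0"
        using e[of M] by (simp del: replicate.simps)
    next
      show "finite (LS ?S (m + 2))" by simp
    qed (auto simp: LS_def LL_def)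
    also have "... = (\<Sum>M\<in>LS ?S (m + 2). E M * uprl (uof ?X # replicate (m + 1) (uof z)) M)"
      by (intro sum.cong refl) (use e in \<open>simp add: LS_def del: replicate.simps\<close>)
    finally show ?thesis by (simp only: dsum_def)
  qed
  have "(\<lambda>j. dsum m E (?tr j z) (?tr j ?X)) \<longlonglongrightarrow> dsum m E z ?X"
    unfolding fin dsum_def[of m E z ?X]
    by (rule tendsto_divide[OF tendsto_infsum_mbox[OF dsum_bounds(1)[OF E order_refl order_refl]] tendsto_const fact_nonzero])
  moreover have "(\<lambda>j. dsum m E (?tr j z) (Xg n (?tr j z) - ?tr j ?X)) \<longlonglongrightarrow> 0"
  proof (rule Lim_null_comparison)
    let ?L = "Cn n * real (n + 1) * norm z ^ n"
    show "\<forall>\<^sub>F j in sequentially. cmod (dsum m E (?tr j z) (Xg n (?tr j z) - ?tr j ?X))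
        \<le> ?C * (?L * norm (z - ?tr j z) + norm (?X - ?tr j ?X))"
    proof (intro always_eventually allI)
      fix j
      have "norm (Xg n (?tr j z) - ?tr j ?X) \<le> norm (Xg n (?tr j z) - ?X) + norm (?X - ?tr j ?X)"
        using norm_triangle_ineq[of "Xg n (?tr j z) - ?X" "?X - ?tr j ?X"] by simp
      also have "norm (Xg n (?tr j z) - ?X) \<le> ?L * norm (?tr j z - z)"
        by (rule Xg_lipschitz[OF n norm_tr_le order_refl])
      finally have "norm (Xg n (?tr j z) - ?tr j ?X) \<le> ?L * norm (z - ?tr j z) + norm (?X - ?tr j ?X)"
        by (simp add: norm_minus_commute)
      thus "cmod (dsum m E (?tr j z) (Xg n (?tr j z) - ?tr j ?X)) \<le> ?C * (?L * norm (z - ?tr j z) + norm (?X - ?tr j ?X))"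
        by (rule dsum_bounds(3)[OF E norm_tr_le])
    qed
    have "(\<lambda>j. ?C * (?L * norm (z - ?tr j z) + norm (?X - ?tr j ?X))) \<longlonglongrightarrow> ?C * (?L * 0 + 0)"
      by (intro tendsto_mult tendsto_add tendsto_const tendsto_tr)
    thus "(\<lambda>j. ?C * (?L * norm (z - ?tr j z) + norm (?X - ?tr j ?X))) \<longlonglongrightarrow> 0" by simp
  qed
  ultimately have "(\<lambda>j. dsum m E (?tr j z) (?tr j ?X) + dsum m E (?tr j z) (Xg n (?tr j z) - ?tr j ?X)) \<longlonglongrightarrow> dsum m E z ?X + 0"
    by (rule tendsto_add)
  hence "(\<lambda>j. dsum m E (?tr j z) (Xg n (?tr j z))) \<longlonglongrightarrow> dsum m E z ?X"
    by (simp add: dsum_diff[OF E])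
  from LIMSEQ_unique[OF this l1] show ?thesis .
qed

end

context ham_sys
begin

text \<open>The linear part of the field is unbounded, so energies are not differentiated directly.
  Their box sums are differentiable, with the linear part acting through the divisors, that is as
  the bracket with \<open>diag \<omega>\<close>. The class assumed for this bracket gives a uniform
  bound, and dominated convergence yields the integrated identity.\<close>

lemma energy_has_integral:
  assumes E: "cls e2 m a E" "cls e2 m a' (br E (diag \<omega>))" and t01: "t0 \<le> t1"
    and R: "R \<le> R0" and x: "\<And>t. t \<in> {t0..t1} \<Longrightarrow> (x has_vector_derivative Gf \<theta> R t (x t)) (at t within {t0..t1})"
    and xR: "\<And>t. t \<in> {t0..t1} \<Longrightarrow> norm (x t) \<le> R"
  defines "z \<equiv> \<lambda>t. rotg \<theta> (- t) (x t)"
  shows "((\<lambda>t. msum m (br E (diag \<omega>)) (z t) + dsum m E (z t) (XP (z t))) has_integral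
     (msum m E (z t1) - msum m E (z t0))) {t0..t1}"
proof -
  let ?k = "m + 2"
  let ?G = "\<lambda>j t. (\<Sum>M\<in>LS (mbox (real j)) ?k. E M * upr (uof (z t)) M) / fact ?k"
  let ?us = "\<lambda>t. uof (XP (z t)) # replicate (m + 1) (uof (z t))"
  let ?g = "\<lambda>j t. (\<Sum>M\<in>LS (mbox (real j)) ?k. br E (diag \<omega>) M * upr (uof (z t)) M) / fact ?k
      + (\<Sum>M\<in>LS (mbox (real j)) ?k. E M * uprl (?us t) M) / fact (m + 1)"
  let ?h = "\<lambda>t. msum m (br E (diag \<omega>)) (z t) + dsum m E (z t) (XP (z t))"
  have zR: "norm (z t) \<le> R" if "t \<in> {t0..t1}" for t using xR[OF that] by (simp add: z_def)
  have XR: "norm (XP (z t)) \<le> 27 * b^2 * R" if t: "t \<in> {t0..t1}" for t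
  proof -
    have "norm (XP (z t) - XP 0) \<le> 27 * b^2 * norm (z t - 0)"
      by (rule XP_lipschitz) (use zR[OF t] R R0_pos in auto)
    moreover have "XP 0 = 0" by (simp add: XP_def Xg_zero)
    ultimately have "norm (XP (z t)) \<le> 27 * b^2 * norm (z t)" by simp
    also have "... \<le> 27 * b^2 * R" using zR[OF t] by (intro mult_left_mono) auto
    finally show ?thesis .
  qed
  have der: "(?G j has_vector_derivative ?g j t) (at t within {t0..t1})" if t: "t \<in> {t0..t1}" for j t
  proof -
    let ?S = "mbox (real j) :: 'n mode set"
    let ?u' = "\<lambda>J. - \<i> * of_real (\<theta> J) * uof (z t) J + uof (XP (z t)) J"
    have "((\<lambda>t. uof (z t) J) has_vector_derivative ?u' J) (at t within {t0..t1})" for J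
      unfolding z_def by (rule component_derivative[OF x[OF t] xR[OF t]])
    hence "((\<lambda>t. upr (uof (z t)) M) has_vector_derivative dupr (uof (z t)) ?u' M) (at t within {t0..t1})" for M
      by (rule upr_derivative)
    hence d0: "((\<lambda>t. E M * upr (uof (z t)) M) has_vector_derivative E M * dupr (uof (z t)) ?u' M) (at t within {t0..t1})" for M
      by (rule bounded_linear.has_vector_derivative[OF bounded_linear_mult_right])
    have d1: "((\<lambda>t. \<Sum>M\<in>LS ?S ?k. E M * upr (uof (z t)) M) has_vector_derivative
        (\<Sum>M\<in>LS ?S ?k. E M * dupr (uof (z t)) ?u' M)) (at t within {t0..t1})"
      by (rule has_vector_derivative_sum) (rule d0)
    have d: "(?G j has_vector_derivative (\<Sum>M\<in>LS ?S ?k. E M * dupr (uof (z t)) ?u' M) / fact ?k) (at t within {t0..t1})"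
      by (rule bounded_linear.has_vector_derivative[OF bounded_linear_divide d1])
    have "E M * dupr (uof (z t)) ?u' M = br E (diag \<omega>) M * upr (uof (z t)) M + E M * dupr (uof (z t)) (uof (XP (z t))) M" for M
      unfolding dupr_rotation[where \<omega> = \<omega> and \<theta> = \<theta>, OF \<theta>_def] br_diag[OF clsD(1)[OF E(1)]] by (simp add: algebra_simps)
    hence 1: "(\<Sum>M\<in>LS ?S ?k. E M * dupr (uof (z t)) ?u' M) = (\<Sum>M\<in>LS ?S ?k. br E (diag \<omega>) M * upr (uof (z t)) M)
        + (\<Sum>M\<in>LS ?S ?k. E M * dupr (uof (z t)) (uof (XP (z t))) M)"
      by (simp only: sum.distrib)
    have "(\<Sum>M\<in>LS ?S (Suc (m + 1)). E M * dupr (uof (z t)) (uof (XP (z t))) M)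
        = of_nat (Suc (m + 1)) * (\<Sum>K\<in>?S. \<Sum>A\<in>LS ?S (m + 1). E (K # A) * uof (XP (z t)) K * upr (uof (z t)) A)"
      by (rule sum_dupr[OF clsD(1)[OF E(1)] finite_box])
    also have "(\<Sum>K\<in>?S. \<Sum>A\<in>LS ?S (m + 1). E (K # A) * uof (XP (z t)) K * upr (uof (z t)) A)
        = (\<Sum>K\<in>?S. \<Sum>A\<in>LS ?S (m + 1). E (K # A) * uprl (?us t) (K # A))"
      by (intro sum.cong refl) (simp add: LS_def uprl_replicate del: replicate.simps)
    also have "... = (\<Sum>M\<in>LS ?S (Suc (m + 1)). E M * uprl (?us t) M)"
      by (rule sum_LS_Suc[symmetric])
    finally have *: "(\<Sum>M\<in>LS ?S (Suc (m + 1)). E M * dupr (uof (z t)) (uof (XP (z t))) M)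
        = of_nat (Suc (m + 1)) * (\<Sum>M\<in>LS ?S (Suc (m + 1)). E M * uprl (?us t) M)" .
    have 2: "(\<Sum>M\<in>LS ?S ?k. E M * dupr (uof (z t)) (uof (XP (z t))) M) / fact ?k
        = (\<Sum>M\<in>LS ?S ?k. E M * uprl (?us t) M) / fact (m + 1)"
    proof -
      have f: "fact ?k = of_nat (Suc (m + 1)) * (fact (m + 1) :: complex)" by simp
      have gen: "a / fact ?k = c / fact (m + 1)" if "a = of_nat (Suc (m + 1)) * c" for a c :: complex
        unfolding f that by (simp del: of_nat_Suc fact_Suc)
      show ?thesis by (rule gen) (use * in simp)
    qed
    show ?thesis using d unfolding 1 add_divide_distrib 2 .
  qed
  have I: "(?g j has_integral (?G j t1 - ?G j t0)) {t0..t1}" for j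
    by (rule fundamental_theorem_of_calculus[OF t01 der])
  let ?B = "a' * (real m + 3)^2 * b ^ (m + 2) * R ^ (m + 2)
      + a * real (m + 2) * (real m + 3)^2 * b ^ (m + 2) * R ^ (m + 1) * (27 * b^2 * R)"
  have G: "(\<lambda>j. ?G j t) \<longlonglongrightarrow> msum m E (z t)" for t
    unfolding msum_def by (rule tendsto_divide[OF tendsto_infsum_mbox[OF msum_summable[OF E(1)]] tendsto_const fact_nonzero])
  have g: "(\<lambda>j. ?g j t) \<longlonglongrightarrow> ?h t" for t
    unfolding msum_def dsum_def
    by (rule tendsto_add[OF tendsto_divide[OF tendsto_infsum_mbox[OF msum_summable[OF E(2)]] tendsto_const fact_nonzero]
          tendsto_divide[OF tendsto_infsum_mbox[OF dsum_bounds(1)[OF E(1) order_refl order_refl]] tendsto_const fact_nonzero]])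
  have le: "norm (?g j t) \<le> ?B" if t: "t \<in> {t0..t1}" for j t
  proof -
    have "cmod ((\<Sum>M\<in>LS (mbox (real j)) ?k. br E (diag \<omega>) M * upr (uof (z t)) M) / fact ?k)
        \<le> a' * (real m + 3)^2 * b ^ (m + 2) * R ^ (m + 2)"
      by (rule norm_div_fact[OF msum_bounds(1)[OF E(2) zR[OF t] finite_box]])
    moreover have "cmod ((\<Sum>M\<in>LS (mbox (real j)) ?k. E M * uprl (?us t) M) / fact (m + 1))
        \<le> a * real (m + 2) * (real m + 3)^2 * b ^ (m + 2) * R ^ (m + 1) * (27 * b^2 * R)"
      by (rule norm_div_fact[OF dsum_bounds(2)[OF E(1) zR[OF t] XR[OF t] finite_box]])
    ultimately show ?thesis by (rule norm_triangle_mono)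
  qed
  have int: "?g j integrable_on {t0..t1}" for j using I by blast
  have cst: "(\<lambda>_. ?B) integrable_on {t0..t1}" by (rule integrable_const_ivl)
  note dc = dominated_convergence[of ?g "{t0..t1}" "\<lambda>_. ?B" ?h, OF int cst le g]
  have "(\<lambda>j. ?G j t1 - ?G j t0) \<longlonglongrightarrow> integral {t0..t1} ?h"
    using dc(2) integral_unique[OF I] by simp
  moreover have "(\<lambda>j. ?G j t1 - ?G j t0) \<longlonglongrightarrow> msum m E (z t1) - msum m E (z t0)"
    by (rule tendsto_diff[OF G G])
  ultimately have i: "integral {t0..t1} ?h = msum m E (z t1) - msum m E (z t0)" by (rule LIMSEQ_unique)
  show ?thesis using integrable_integral[OF dc(1)] unfolding i .
qed

end

context weight_sum
begin

lemma msum_add: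
  assumes "cls e2 m a F" "cls e2 m a' G"
  shows "msum m (\<lambda>M. F M + G M) z = msum m F z + msum m G z"
proof -
  have "(\<Sum>\<^sub>\<infinity>M\<in>LL (m + 2). (F M + G M) * upr (uof z) M)
      = (\<Sum>\<^sub>\<infinity>M\<in>LL (m + 2). F M * upr (uof z) M + G M * upr (uof z) M)"
    by (simp only: distrib_right)
  also have "... = (\<Sum>\<^sub>\<infinity>M\<in>LL (m + 2). F M * upr (uof z) M) + (\<Sum>\<^sub>\<infinity>M\<in>LL (m + 2). G M * upr (uof z) M)"
    by (rule infsum_add[OF msum_summable[OF assms(1)] msum_summable[OF assms(2)]])
  finally show ?thesis by (simp only: msum_def add_divide_distrib)
qed

lemma msum_sum:
  fixes n :: nat
  assumes "\<And>i. i < n \<Longrightarrow> cls e2 m (a i) (F i)"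
  shows "cls e2 m (\<Sum>i<n. a i) (\<lambda>M. \<Sum>i<n. F i M)" "msum m (\<lambda>M. \<Sum>i<n. F i M) z = (\<Sum>i<n. msum m (F i) z)"
proof -
  have "cls e2 m (\<Sum>i<n. a i) (\<lambda>M. \<Sum>i<n. F i M) \<and> msum m (\<lambda>M. \<Sum>i<n. F i M) z = (\<Sum>i<n. msum m (F i) z)"
    using assms
  proof (induction n)
    case (Suc n)
    hence IH: "cls e2 m (\<Sum>i<n. a i) (\<lambda>M. \<Sum>i<n. F i M)" "msum m (\<lambda>M. \<Sum>i<n. F i M) z = (\<Sum>i<n. msum m (F i) z)"
      and n: "cls e2 m (a n) (F n)" by auto
    show ?case using cls_add[OF IH(1) n] msum_add[OF IH(1) n] IH(2) by simp
  qed (simp add: cls_zero msum_def)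
  thus "cls e2 m (\<Sum>i<n. a i) (\<lambda>M. \<Sum>i<n. F i M)" "msum m (\<lambda>M. \<Sum>i<n. F i M) z = (\<Sum>i<n. msum m (F i) z)"
    by blast+
qed

end

lemma sum_triangle:
  fixes F :: "nat \<Rightarrow> nat \<Rightarrow> 'a::comm_monoid_add"
  shows "(\<Sum>m\<le>r. \<Sum>n<r - m. F m (m + Suc n)) = (\<Sum>g\<le>r. \<Sum>m<g. F m g)"
proof -
  have "(\<Sum>(m, n)\<in>Sigma {..r} (\<lambda>m. {..<r - m}). F m (m + Suc n)) = (\<Sum>(g, m)\<in>Sigma {..r} (\<lambda>g. {..<g}). F m g)"
    by (rule sum.reindex_bij_witness[of _ "\<lambda>(g, m). (m, g - m - 1)" "\<lambda>(m, n). (m + Suc n, m)"]) auto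
  thus ?thesis by (simp add: sum.Sigma)
qed

context ham_sys
begin

text \<open>Collecting the derivative by total grade leaves, up to grade \<open>r\<close>, exactly
  the combinations estimated by \<open>q\<close>, and beyond it only tails of the field. The bracket
  with \<open>diag \<omega>\<close> alone belongs to a class because it differs from such a
  combination by brackets with the perturbation, which are already controlled.\<close>

lemma energy_estimate:
  assumes E: "\<And>m. m \<le> r \<Longrightarrow> cls e2 m (a m) (E m)"
    and Q: "\<And>g. g \<le> r \<Longrightarrow> cls e2 g (q g) (\<lambda>M. br (E g) (diag \<omega>) M + (\<Sum>m<g. br (E m) (gpart P (g - m)) M))"
    and t01: "t0 \<le> t1" and R: "0 < R" "R \<le> R0"
    and x: "\<And>t. t \<in> {t0..t1} \<Longrightarrow> (x has_vector_derivative Gf \<theta> R t (x t)) (at t within {t0..t1})"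
    and xR: "\<And>t. t \<in> {t0..t1} \<Longrightarrow> norm (x t) \<le> y" and y: "y \<le> R"
  defines "z \<equiv> \<lambda>t. rotg \<theta> (- t) (x t)"
  shows "cmod ((\<Sum>m\<le>r. msum m (E m) (z t1)) - (\<Sum>m\<le>r. msum m (E m) (z t0)))
    \<le> ((\<Sum>g\<le>r. q g * (real g + 3)^2 * b ^ (g + 2) * y ^ (g + 2))
      + (\<Sum>m\<le>r. a m * real (m + 2) * (real m + 3)^2 * b ^ (m + 2) * y ^ (m + 1) * (54 * b^2 * y * (8 * A * b * y) ^ Suc (r - m))))
      * (t1 - t0)"
proof -
  let ?p = "gpart P"
  let ?Q = "\<lambda>g M. br (E g) (diag \<omega>) M + (\<Sum>m<g. br (E m) (?p (g - m)) M)"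
  define bq where "bq m g = 2 * real (g - m + 2) * real (m + 2) * A ^ (g - m) * a m" for m g
  have bq: "cls e2 g (bq m g) (br (E m) (?p (g - m)))" if "g \<le> r" "m < g" for m g
  proof -
    have "m \<le> r" and g: "1 \<le> g - m" "m + (g - m) = g" using that by auto
    from cls_br_energy[OF E[OF this(1)] g(1)] show ?thesis unfolding g(2) bq_def .
  qed
  have B: "cls e2 g (\<Sum>m<g. bq m g) (\<lambda>M. \<Sum>m<g. br (E m) (?p (g - m)) M)"
    "msum g (\<lambda>M. \<Sum>m<g. br (E m) (?p (g - m)) M) z = (\<Sum>m<g. msum g (br (E m) (?p (g - m))) z)" if g: "g \<le> r" for g z
    by (rule msum_sum(1)[of g g "\<lambda>m. bq m g" "\<lambda>m. br (E m) (?p (g - m))", OF bq[OF g]], assumption)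
       (rule msum_sum(2)[of g g "\<lambda>m. bq m g" "\<lambda>m. br (E m) (?p (g - m))", OF bq[OF g]], assumption)
  define fq where "fq g = q g + cmod (- 1) * (\<Sum>m<g. bq m g)" for g
  have F: "cls e2 g (fq g) (br (E g) (diag \<omega>))" if g: "g \<le> r" for g
    using cls_add[OF Q[OF g] cls_scale[OF B(1)[OF g], of "- 1"]] by (simp add: fq_def)
  have Qm: "msum g (?Q g) z = msum g (br (E g) (diag \<omega>)) z + (\<Sum>m<g. msum g (br (E m) (?p (g - m))) z)" if g: "g \<le> r" for g z
    using msum_add[OF F[OF g] B(1)[OF g]] B(2)[OF g] by simp
  have xR': "norm (x t) \<le> R" if "t \<in> {t0..t1}" for t using xR[OF that] y by simp
  let ?h = "\<lambda>t. \<Sum>m\<le>r. msum m (br (E m) (diag \<omega>)) (z t) + dsum m (E m) (z t) (XP (z t))"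
  have I: "(?h has_integral (\<Sum>m\<le>r. msum m (E m) (z t1) - msum m (E m) (z t0))) {t0..t1}"
    by (rule has_integral_sum) (auto simp: z_def intro!: energy_has_integral[OF E F t01 R(2) x xR'])
  let ?B1 = "\<Sum>g\<le>r. q g * (real g + 3)^2 * b ^ (g + 2) * y ^ (g + 2)"
  let ?B2 = "\<Sum>m\<le>r. a m * real (m + 2) * (real m + 3)^2 * b ^ (m + 2) * y ^ (m + 1) * (54 * b^2 * y * (8 * A * b * y) ^ Suc (r - m))"
  have bd: "norm (?h t) \<le> ?B1 + ?B2" if t: "t \<in> {t0..t1}" for t
  proof -
    let ?z = "z t"
    have zy: "norm ?z \<le> y" using xR[OF t] by (simp add: z_def)
    let ?tl = "\<lambda>m. XP ?z - (\<Sum>n<r - m. Xg (Suc n) ?z)"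
    \<comment> \<open>The first \<open>r - m\<close> grades of the field produce brackets of total
      grade at most \<open>r\<close>; the tail is kept as an error.\<close>
    have d: "dsum m (E m) ?z (XP ?z) = (\<Sum>n<r - m. msum (m + Suc n) (br (E m) (?p (m + Suc n - m))) ?z) + dsum m (E m) ?z (?tl m)"
      if m: "m \<le> r" for m
      unfolding dsum_diff[OF E[OF m]] dsum_sum[OF E[OF m]] by (simp add: dsum_Xg[OF E[OF m]])
    have "?h t = (\<Sum>m\<le>r. msum m (br (E m) (diag \<omega>)) ?z)
        + (\<Sum>m\<le>r. \<Sum>n<r - m. msum (m + Suc n) (br (E m) (?p (m + Suc n - m))) ?z) + (\<Sum>m\<le>r. dsum m (E m) ?z (?tl m))"
      unfolding sum.distrib[symmetric] by (intro sum.cong refl) (simp only: d atMost_iff add.assoc)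
    also have "(\<Sum>m\<le>r. \<Sum>n<r - m. msum (m + Suc n) (br (E m) (?p (m + Suc n - m))) ?z)
        = (\<Sum>g\<le>r. \<Sum>m<g. msum g (br (E m) (?p (g - m))) ?z)"
      by (rule sum_triangle)
    also have "(\<Sum>m\<le>r. msum m (br (E m) (diag \<omega>)) ?z) + ... = (\<Sum>g\<le>r. msum g (?Q g) ?z)"
      unfolding sum.distrib[symmetric] by (intro sum.cong refl) (simp only: Qm atMost_iff)
    finally have h: "?h t = (\<Sum>g\<le>r. msum g (?Q g) ?z) + (\<Sum>m\<le>r. dsum m (E m) ?z (?tl m))" .
    have "cmod (\<Sum>g\<le>r. msum g (?Q g) ?z) \<le> ?B1"
      by (intro sum_norm_le msum_bounds(2) Q zy) simp
    moreover have "cmod (\<Sum>m\<le>r. dsum m (E m) ?z (?tl m)) \<le> ?B2"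
      by (intro sum_norm_le dsum_bounds(3) E zy XP_tail) (use y R in auto)
    ultimately show ?thesis unfolding h by (rule norm_triangle_mono)
  qed
  have "0 \<le> norm (?h t0)" by simp
  hence "0 \<le> ?B1 + ?B2" using bd[of t0] t01 by (meson atLeastAtMost_iff order_refl order_trans)
  from has_integral_bound_real[OF this finite.emptyI I] bd
  have "norm (\<Sum>m\<le>r. msum m (E m) (z t1) - msum m (E m) (z t0)) \<le> (?B1 + ?B2) * Henstock_Kurzweil_Integration.content {t0..t1}"
    by blast
  thus ?thesis using t01 by (simp add: sum_subtractf)
qed

end

section \<open>Stability over long times\<close>

lemma sq_le_power2: "(real g + 3)^2 \<le> 9 * 2 ^ g"
proof (induction g)
  case (Suc g)
  have "(real (Suc g) + 3)^2 \<le> 2 * (real g + 3)^2" by (simp add: power2_eq_square algebra_simps)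
  thus ?case using Suc by simp
qed simp

lemma sum_half: "(\<Sum>g<r. (1 / 2 :: real) ^ g) \<le> 2"
proof -
  have "(\<Sum>g<r. (1 / 2 :: real) ^ g) = 2 - 2 * (1 / 2) ^ r" by (induction r) auto
  thus ?thesis by simp
qed

lemma sum_sq_geometric:
  fixes l :: real
  assumes "0 \<le> l" "l \<le> 1 / 4"
  shows "(\<Sum>g\<le>r. (real g + 3)^2 * l ^ g) \<le> 18"
    and "(\<Sum>g<r. (real (Suc g) + 3)^2 * l ^ Suc g) \<le> 36 * l"
proof -
  have t: "(real g + 3)^2 * l ^ g \<le> 9 * (1 / 2) ^ g" for g
  proof -
    have "(real g + 3)^2 * l ^ g \<le> 9 * 2 ^ g * (1 / 4) ^ g"
      using assms by (intro mult_mono sq_le_power2 power_mono) auto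
    also have "... = 9 * (2 * (1 / 4)) ^ g" by (simp only: power_mult_distrib mult.assoc)
    finally show ?thesis by simp
  qed
  have "(\<Sum>g\<le>r. (real g + 3)^2 * l ^ g) \<le> (\<Sum>g\<le>r. 9 * (1 / 2) ^ g)" by (intro sum_mono t)
  also have "... = 9 * (\<Sum>g<Suc r. (1 / 2) ^ g)" unfolding lessThan_Suc_atMost by (simp add: sum_distrib_left)
  also have "... \<le> 9 * 2" by (intro mult_left_mono sum_half) auto
  finally show "(\<Sum>g\<le>r. (real g + 3)^2 * l ^ g) \<le> 18" by simp
  have "(real (Suc g) + 3)^2 * l ^ Suc g \<le> 18 * l * (1 / 2) ^ g" for g
  proof -
    have "(real (Suc g) + 3)^2 * l ^ Suc g \<le> 9 * 2 ^ Suc g * l ^ Suc g"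
      using assms by (intro mult_mono sq_le_power2) auto
    also have "... = 18 * l * (2 * l) ^ g" by (simp add: power_mult_distrib)
    also have "... \<le> 18 * l * (1 / 2) ^ g" using assms by (intro mult_left_mono power_mono) auto
    finally show ?thesis .
  qed
  hence "(\<Sum>g<r. (real (Suc g) + 3)^2 * l ^ Suc g) \<le> (\<Sum>g<r. 18 * l * (1 / 2) ^ g)" by (intro sum_mono)
  also have "... = 18 * l * (\<Sum>g<r. (1 / 2) ^ g)" by (simp add: sum_distrib_left)
  also have "... \<le> 18 * l * 2" using assms by (intro mult_left_mono sum_half) auto
  finally show "(\<Sum>g<r. (real (Suc g) + 3)^2 * l ^ Suc g) \<le> 36 * l" by simp
qed

text \<open>Continuity method: at the first time at which the level \<open>y\<close> is reached, the
  bound has held up to then, so the improvement in \<open>step\<close> applies and excludes that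
  time.\<close>

lemma stays_below:
  fixes n :: "real \<Rightarrow> real"
  assumes c: "continuous_on {0..T} n" and n0: "n 0 < y"
    and step: "\<And>t. t \<in> {0..T} \<Longrightarrow> (\<And>s. s \<in> {0..t} \<Longrightarrow> n s \<le> y) \<Longrightarrow> n t < y"
    and t: "t \<in> {0..T}"
  shows "n t < y"
proof (rule ccontr)
  assume "\<not> n t < y"
  let ?S = "{t \<in> {0..T}. y \<le> n t}"
  have "closedin (top_of_set {0..T}) ({0..T} \<inter> n -` {y..})"
    by (rule continuous_closedin_preimage[OF c]) simp
  moreover have "{0..T} \<inter> n -` {y..} = ?S" by auto
  ultimately have "compact ?S" using closedin_compact[of "{0..T}"] by simp
  moreover have "?S \<noteq> {}" using t \<open>\<not> n t < y\<close> by auto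
  ultimately obtain t1 where t1: "t1 \<in> ?S" "\<And>s. s \<in> ?S \<Longrightarrow> t1 \<le> s" by (meson compact_attains_inf)
  have "n t1 \<le> y"
  proof (rule ccontr)
    assume gt: "\<not> n t1 \<le> y"
    have "continuous_on {0..t1} n" using c t1 by (intro continuous_on_subset[OF c]) auto
    then obtain s where s: "0 \<le> s" "s \<le> t1" "n s = y"
      using IVT'[of n 0 y t1] n0 gt t1 by auto
    hence "t1 \<le> s" using t1 by auto
    thus False using s gt by simp
  qed
  moreover have "n s \<le> y" if "s \<in> {0..t1}" "s \<noteq> t1" for s
    using that t1(1) t1(2)[of s] by force
  ultimately have "n t1 < y" using t1(1) by (intro step) auto
  thus False using t1 by simp
qed

context ham_sys
begin

lemma top2_pair: "e2 [K, bar K] = 2 * s * \<phi> K"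
  using phi_pos[of K] by (simp add: e2_def algebra_simps)

lemma diag_pair: "diag w [K, bar K] = of_real (w (fst K))"
  by (simp add: diag_def)

lemma diag_support: "diag w M \<noteq> 0 \<Longrightarrow> \<exists>K. M = [K, bar K]"
  by (auto simp: diag_def numeral_2_eq_2 length_Suc_conv split: if_splits)

lemma cls_diag:
  assumes "\<And>K :: 'n mode. 0 \<le> w (fst K)" "\<And>K. w (fst K) \<le> CW * exp (2 * s * \<phi> K)"
  shows "cls e2 0 CW (diag w)" "0 \<le> CW"
proof -
  have "0 \<le> CW * exp (2 * s * \<phi> undefined)" using assms order_trans by blast
  thus CW: "0 \<le> CW" by (simp add: zero_le_mult_iff)
  show "cls e2 0 CW (diag w)"
    unfolding cls_def
  proof (intro conjI allI impI symf_diag zm_diag CW)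
    fix M :: "'n mode list"
    show "length M = 0 + 2" if "diag w M \<noteq> 0" using diag_support[OF that] by auto
    show "cmod (diag w M) \<le> CW * fact (0 + 2) * exp (e2 M)"
    proof (cases "diag w M = 0")
      case False
      then obtain K where M: "M = [K, bar K]" using diag_support by blast
      have "\<bar>w (fst K)\<bar> \<le> CW * exp (2 * s * \<phi> K)" using assms(1)[of K] assms(2)[of K] by simp
      also have "... \<le> CW * 2 * exp (2 * s * \<phi> K)" using CW by simp
      finally show ?thesis unfolding M diag_pair top2_pair by (simp add: norm_of_real)
    qed (use CW in simp)
  qed
qed

text \<open>For a real state conjugate modes multiply to squared moduli, so the form is real and
  comparable with the norm. Each mode contributes one ordered pair, and the halves come from the
  factor \<open>1 / 2!\<close>.\<close>

lemma quadratic_energy: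
  assumes w: "\<And>K :: 'n mode. c1 * exp (2 * s * \<phi> K) \<le> w (fst K)" "\<And>K. w (fst K) \<le> CW * exp (2 * s * \<phi> K)"
    and c1: "0 \<le> c1" and real: "real_state (uof z)"
  obtains J :: real where "msum 0 (diag w) z = of_real J" "c1 / 2 * (norm z)^2 \<le> J" "J \<le> CW / 2 * (norm z)^2"
proof -
  let ?u = "uof z"
  let ?g = "\<lambda>K. (cmod (?u K))^2 * exp (2 * s * f (bracket c (fst K)))"
  let ?h = "\<lambda>K. w (fst K) * (cmod (?u K))^2"
  have sg: "?g summable_on UNIV" using uof_W[of z] by (simp add: W_space_def)
  have ng: "infsum ?g UNIV = (norm z)^2"
  proof -
    have "0 \<le> infsum ?g UNIV" by (rule infsum_nonneg) simp
    thus ?thesis using W_norm_uof[of z] by (simp add: W_norm_def flip: real_sqrt_pow2_iff)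
  qed
  have le: "c1 * ?g K \<le> ?h K" "?h K \<le> CW * ?g K" for K
    using mult_right_mono[OF w(1)[of K], of "(cmod (?u K))^2"] mult_right_mono[OF w(2)[of K], of "(cmod (?u K))^2"]
    by (simp_all add: phi mult_ac)
  have h0: "0 \<le> ?h K" for K
  proof -
    have "0 \<le> c1 * ?g K" using c1 by simp
    thus ?thesis using le(1)[of K] by linarith
  qed
  have sh: "?h summable_on UNIV"
    by (rule summable_on_comparison_test[OF summable_on_cmult_right[OF sg, of CW]]) (use le h0 in auto)
  have "(\<Sum>\<^sub>\<infinity>M\<in>LL 2. diag w M * upr ?u M) = (\<Sum>\<^sub>\<infinity>M\<in>range (\<lambda>K. [K, bar K]). diag w M * upr ?u M)"
    by (rule infsum_cong_neutral) (use diag_support in \<open>auto simp: LL_def\<close>)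
  also have "... = (\<Sum>\<^sub>\<infinity>K. diag w [K, bar K] * upr ?u [K, bar K])"
    by (subst infsum_reindex) (auto simp: inj_on_def o_def)
  also have "... = (\<Sum>\<^sub>\<infinity>K. of_real (?h K))"
  proof (rule infsum_cong)
    fix K
    have "?u (bar K) = cnj (?u K)" using real unfolding real_state_def by blast
    thus "diag w [K, bar K] * upr ?u [K, bar K] = of_real (?h K)"
      unfolding diag_pair using complex_norm_square[of "?u K"] by simp
  qed
  also have "... = of_real (infsum ?h UNIV)" by (rule infsumI[OF has_sum_of_real[OF has_sum_infsum[OF sh]]])
  finally have 1: "msum 0 (diag w) z = of_real (infsum ?h UNIV / 2)" unfolding msum_def add_0_left fact_2 by simp
  have "infsum (\<lambda>K. c1 * ?g K) UNIV \<le> infsum ?h UNIV"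
    by (rule infsum_mono[OF summable_on_cmult_right[OF sg] sh]) (rule le)
  hence 2: "c1 / 2 * (norm z)^2 \<le> infsum ?h UNIV / 2" unfolding infsum_cmult_right' ng by simp
  have "infsum ?h UNIV \<le> infsum (\<lambda>K. CW * ?g K) UNIV"
    by (rule infsum_mono[OF sh summable_on_cmult_right[OF sg]]) (rule le)
  hence 3: "infsum ?h UNIV / 2 \<le> CW / 2 * (norm z)^2" unfolding infsum_cmult_right' ng by simp
  show thesis by (rule that[OF 1 2 3])
qed

lemma br_diag_diag: "br (diag v) (diag w) M = 0"
proof -
  have "of_real (freq_sum w M) * diag v M = 0"
  proof (cases "diag v M = 0")
    case False
    then obtain K where "M = [K, bar K]" using diag_support by blast
    thus ?thesis by (simp add: sg_def)
  qed simp
  thus ?thesis by (simp add: br_diag[OF symf_diag])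
qed

text \<open>The modified energy is the formal Lie transform of the quadratic energy with weights \<open>w\<close>.\<close>

lemma modified_energy:
  assumes w: "\<And>K :: 'n mode. 0 \<le> w (fst K)" "\<And>K. w (fst K) \<le> CW * exp (2 * s * \<phi> K)"
    and eta: "0 < \<eta>" "\<eta> \<le> 1" and r: "1 \<le> r" and rho: "\<rho> = 32 * A * (real r)^2 * (real (r + 2))^2 / \<eta>"
    and res: "\<And>M. mom M = 0 \<Longrightarrow> length M \<le> r + 2 \<Longrightarrow> \<bar>freq_sum \<omega> M\<bar> < \<eta> \<Longrightarrow> \<bar>freq_sum w M\<bar> * exp (e1 M) \<le> q * exp (e2 M)"
    and q: "0 \<le> q"
  obtains E where "E 0 = diag w" "\<And>m. m \<le> r \<Longrightarrow> cls e2 m (CW * \<rho> ^ m) (E m)"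
    "\<And>g. g \<le> r \<Longrightarrow> cls e2 g (q * \<rho> ^ g) (\<lambda>M. br (E g) (diag \<omega>) M + (\<Sum>m<g. br (E m) (gpart P (g - m)) M))"
proof -
  define pp where "pp n = (if n = 0 then diag \<omega> else gpart P n)" for n
  have pp0: "pp 0 = diag \<omega>" by (simp add: pp_def)
  have pb: "cls e1 n (A ^ n) (pp n)" if "1 \<le> n" for n using p_cls[OF that] that by (simp add: pp_def)
  have pps: "symf (pp n)" "zm (pp n)" for n
    using clsD(1,2)[OF p_cls[of n]] symf_diag[of \<omega>] zm_diag[of \<omega>] by (cases "n = 0"; simp add: pp_def)+
  define \<delta> where "\<delta> = 1 / (4 * real r)"
  define B where "B = \<delta> * \<eta> / (2 * real (r + 2) * real (r + 2) * real r)"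
  have d: "0 < \<delta>" "\<delta> \<le> 1 / 4" using r by (auto simp: \<delta>_def field_simps)
  have B0: "0 < B" using d eta r by (simp add: B_def)
  have rho': "\<rho> = 4 * A / B"
    using r eta by (simp add: rho B_def \<delta>_def power2_eq_square field_simps)
  have rho0: "0 \<le> \<rho>" using B0 A1 by (simp add: rho')
  let ?X = "nX \<omega> pp \<eta>" and ?Z = "nZ \<omega> pp \<eta>"
  have nb: "cls e1 n (B * \<rho> ^ n) (?Z n)" "cls e1 n (real r / \<eta> * B * \<rho> ^ n) (?X n)" if "1 \<le> n" "n \<le> r" for n
    by (rule nf_bounds[of pp, OF pps pp0 eta r A1 pb \<delta>_def B_def rho' that], assumption)+
  have small: "2 * real (r + 2) * real (r + 2) * (real r / \<eta> * B * \<rho> ^ j) \<le> \<delta> * \<rho> ^ j" for j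
  proof -
    define k where "k = 2 * real (r + 2) * real (r + 2)"
    have "0 < k" by (simp add: k_def)
    hence "k * (real r / \<eta> * (\<delta> * \<eta> / (k * real r)) * \<rho> ^ j) = \<delta> * \<rho> ^ j" using eta r by simp
    thus ?thesis unfolding B_def k_def by simp
  qed
  have lie: "cls e2 (g + n) (a * (if n = 0 then 1 else \<delta> * \<rho> ^ n)) (lieT ?X n F)" if "cls e2 g a F" "g + n \<le> r" for g n a F
    by (rule cls_lieT[OF cls_br_e2 nb(2) small that]) (use that d rho0 in auto)
  define E where "E m = lieT ?X m (diag w)" for m
  note cw = cls_diag[of w CW, OF w]
  have E0: "E 0 = diag w" by (simp add: E_def)
  have E: "cls e2 m (CW * \<rho> ^ m) (E m)" if m: "m \<le> r" for m
  proof (rule cls_mono)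
    show "cls e2 m (CW * (if m = 0 then 1 else \<delta> * \<rho> ^ m)) (E m)" using lie[OF cw(1), of m] m by (simp add: E_def)
    have "\<delta> * \<rho> ^ m \<le> 1 * \<rho> ^ m" using d rho0 by (intro mult_right_mono) auto
    thus "CW * (if m = 0 then 1 else \<delta> * \<rho> ^ m) \<le> CW * \<rho> ^ m"
      using cw(2) by (intro mult_left_mono) auto
  qed
  \<comment> \<open>Two diagonal forms commute, so the bound 0 is available at grade 0 although the
    frequencies are unbounded.\<close>
  have Z: "cls e2 j (if j = 0 then 0 else B * \<rho> ^ j * q) (br (diag w) (?Z j))" if j: "j \<le> r" for j
  proof (cases "j = 0")
    case True
    have "br (diag w) (?Z 0) = (\<lambda>_. 0)" by (rule ext) (simp add: nf_0 br_diag_diag)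
    thus ?thesis using True by (simp add: cls_zero)
  next
    case False
    have "cls e2 j (B * \<rho> ^ j * q) (br (diag w) (?Z j))"
      by (rule cls_br_resonant[where P = pp, OF pps _ nb(1) q res]) (use False j in auto)
    thus ?thesis using False by simp
  qed
  have Q: "cls e2 g (q * \<rho> ^ g) (\<lambda>M. br (E g) (diag \<omega>) M + (\<Sum>m<g. br (E m) (gpart P (g - m)) M))" if g: "g \<le> r" for g
  proof -
    have "br (E g) (diag \<omega>) M + (\<Sum>m<g. br (E m) (gpart P (g - m)) M) = (\<Sum>m\<le>g. br (E m) (pp (g - m)) M)" for M
      by (simp add: pp_def lessThan_Suc_atMost[symmetric] add.commute)
    also have "... M = (\<Sum>j\<in>{..g}. lieT ?X (g - j) (br (diag w) (?Z j)) M)" for M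
      unfolding E_def by (rule nf_energy_identity[of pp, OF pps pp0 eta(1)])
    finally have id: "(\<lambda>M. br (E g) (diag \<omega>) M + (\<Sum>m<g. br (E m) (gpart P (g - m)) M))
        = (\<lambda>M. \<Sum>j\<in>{..g}. lieT ?X (g - j) (br (diag w) (?Z j)) M)" by blast
    have "cls e2 g (\<Sum>j\<in>{..g}. B * \<rho> ^ g * q) (\<lambda>M. \<Sum>j\<in>{..g}. lieT ?X (g - j) (br (diag w) (?Z j)) M)"
    proof (rule cls_sum)
      fix j assume "j \<in> {..g}"
      hence j: "j \<le> g" by simp
      show "cls e2 g (B * \<rho> ^ g * q) (lieT ?X (g - j) (br (diag w) (?Z j)))"
      proof (rule cls_mono)
        show "cls e2 g ((if j = 0 then 0 else B * \<rho> ^ j * q) * (if g - j = 0 then 1 else \<delta> * \<rho> ^ (g - j)))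
            (lieT ?X (g - j) (br (diag w) (?Z j)))"
          using lie[OF Z, of j "g - j"] j g by simp
        have "(if g - j = 0 then 1 else \<delta> * \<rho> ^ (g - j)) \<le> \<rho> ^ (g - j)"
          using d rho0 mult_right_mono[of \<delta> 1 "\<rho> ^ (g - j)"] by auto
        hence "(if j = 0 then 0 else B * \<rho> ^ j * q) * (if g - j = 0 then 1 else \<delta> * \<rho> ^ (g - j))
            \<le> (B * \<rho> ^ j * q) * \<rho> ^ (g - j)"
          using B0 rho0 q d by (intro mult_mono) auto
        also have "... = B * (\<rho> ^ j * \<rho> ^ (g - j)) * q" by simp
        also have "\<rho> ^ j * \<rho> ^ (g - j) = \<rho> ^ g" using j by (simp flip: power_add)
        finally show "(if j = 0 then 0 else B * \<rho> ^ j * q) * (if g - j = 0 then 1 else \<delta> * \<rho> ^ (g - j)) \<le> B * \<rho> ^ g * q" .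
      qed
    qed simp
    thus ?thesis unfolding id
    proof (rule cls_mono)
      \<comment> \<open>The number of summands is absorbed by the smallness of \<open>B\<close>,
        which contains the inverse cube of the order.\<close>
      have "real (g + 1) * B \<le> 1"
      proof -
        have "real (g + 1) \<le> 2 * real (r + 2) * real (r + 2) * real r"
        proof -
          have "1 * 1 \<le> (2 * real (r + 2)) * real r" using r by (intro mult_mono) auto
          hence "real (r + 2) * 1 \<le> real (r + 2) * (2 * real (r + 2) * real r)" by (intro mult_left_mono) auto
          also have "... = 2 * real (r + 2) * real (r + 2) * real r" by simp
          finally have "real (r + 2) \<le> 2 * real (r + 2) * real (r + 2) * real r" by simp
          moreover have "real (g + 1) \<le> real (r + 2)" using g by simp
          ultimately show ?thesis by linarith
        qed
        hence "real (g + 1) / (2 * real (r + 2) * real (r + 2) * real r) \<le> 1" using r by (simp add: divide_le_eq_1)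
        moreover have "\<delta> * \<eta> \<le> 1 * 1" using d eta by (intro mult_mono) auto
        ultimately have "(\<delta> * \<eta>) * (real (g + 1) / (2 * real (r + 2) * real (r + 2) * real r)) \<le> 1 * 1"
          using d eta by (intro mult_mono) auto
        thus ?thesis by (simp add: B_def mult_ac)
      qed
      hence "real (g + 1) * B * (\<rho> ^ g * q) \<le> 1 * (\<rho> ^ g * q)" using rho0 q by (intro mult_right_mono) auto
      thus "(\<Sum>j\<in>{..g}. B * \<rho> ^ g * q) \<le> q * \<rho> ^ g" by (simp add: mult_ac)
    qed
  qed
  show thesis by (rule that[OF E0 E Q])
qed

text \<open>A continuity argument for the norm at the level \<open>y\<close>. In units of
  \<open>c1 * y^2\<close> the budget is 1/32 for the drift of the energy, 1/64 at either time for
  its distance from the quadratic part, and 1/32 for the initial energy. The quadratic lower bound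
  then leaves the squared norm at most 3/16 of \<open>y^2\<close>.\<close>

lemma stability:
  assumes w: "\<And>K :: 'n mode. c1 * exp (2 * s * \<phi> K) \<le> w (fst K)" "\<And>K. w (fst K) \<le> CW * exp (2 * s * \<phi> K)" and c1: "0 < c1"
    and eta: "0 < \<eta>" "\<eta> \<le> 1" and r: "1 \<le> r" and rho: "\<rho> = 32 * A * (real r)^2 * (real (r + 2))^2 / \<eta>"
    and res: "\<And>M. mom M = 0 \<Longrightarrow> length M \<le> r + 2 \<Longrightarrow> \<bar>freq_sum \<omega> M\<bar> < \<eta> \<Longrightarrow> \<bar>freq_sum w M\<bar> * exp (e1 M) \<le> q * exp (e2 M)"
    and q: "0 \<le> q"
    and y: "0 < y" "y < rs" "y \<le> R0" and l: "l = \<rho> * b * y" "l \<le> 1 / 4" "2304 * CW * b^2 * l \<le> c1"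
    and T: "0 \<le> T" "(18 * b^2 * q + 4374 * CW * b ^ 4 * (16 * l) ^ r) * T \<le> c1 / 32"
    and u0: "u0 \<in> W_space c f s" "real_state u0" "W_norm c f s u0 = \<epsilon>" "\<epsilon> < y" "16 * CW * \<epsilon>\<^sup>2 \<le> c1 * y^2"
  shows "the_solution_bounded c f s H u0 T (2 * y)"
proof -
  let ?G = "\<lambda>g. q * \<rho> ^ g * (real g + 3)^2 * b ^ (g + 2) * y ^ (g + 2)"
  let ?M = "\<lambda>m. CW * \<rho> ^ m * real (m + 2) * (real m + 3)^2 * b ^ (m + 2) * y ^ (m + 1) * (54 * b^2 * y * (8 * A * b * y) ^ Suc (r - m))"
  obtain x where x: "x 0 = xof u0" "continuous_on {-T..T} x"
    "\<And>t. t \<in> {-T..T} \<Longrightarrow> (x has_vector_derivative Gf \<theta> y t (x t)) (at t within {-T..T})"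
    using Gf_solution[OF y(1,3) T(1), of "xof u0" \<theta>] by metis
  have w0: "0 \<le> w (fst K)" for K :: "'n mode"
    using w(1)[of K] c1 by (meson exp_ge_zero less_imp_le mult_nonneg_nonneg order_trans)
  have CW: "0 \<le> CW" by (rule cls_diag(2)[of w, OF w0 w(2)])
  obtain E where E0: "E 0 = diag w" and E: "\<And>m. m \<le> r \<Longrightarrow> cls e2 m (CW * \<rho> ^ m) (E m)"
    and Q: "\<And>g. g \<le> r \<Longrightarrow> cls e2 g (q * \<rho> ^ g) (\<lambda>M. br (E g) (diag \<omega>) M + (\<Sum>m<g. br (E m) (gpart P (g - m)) M))"
  proof (rule modified_energy[of w CW \<eta> r \<rho> q, OF w0 w(2) eta r rho res q])
    fix E
    assume a: "E 0 = diag w" "\<And>m. m \<le> r \<Longrightarrow> cls e2 m (CW * \<rho> ^ m) (E m)"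
      "\<And>g. g \<le> r \<Longrightarrow> cls e2 g (q * \<rho> ^ g) (\<lambda>M. br (E g) (diag \<omega>) M + (\<Sum>m<g. br (E m) (gpart P (g - m)) M))"
    show thesis by (rule that[OF a])
  qed
  define z where "z t = rotg \<theta> (- t) (x t)" for t
  define S where "S z = (\<Sum>m\<le>r. msum m (E m) z)" for z
  have rho0: "0 \<le> \<rho>" "8 * A \<le> \<rho>"
  proof -
    have "1 * 1 \<le> (real r)^2 * (real (r + 2))^2" using r by (intro mult_mono) auto
    hence "32 * A * 1 \<le> 32 * A * ((real r)^2 * (real (r + 2))^2)" using A1 by (intro mult_left_mono) auto
    also have "... = \<rho> * \<eta>" using eta by (simp add: rho)
    also have "... \<le> \<rho>" using eta A1 by (intro mult_left_le) (auto simp: rho)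
    finally show "8 * A \<le> \<rho>" using A1 by simp
    thus "0 \<le> \<rho>" using A1 by simp
  qed
  have l0: "0 \<le> l" "8 * A * b * y \<le> l"
  proof -
    show "0 \<le> l" using rho0 b1 y by (simp add: l)
    have "8 * A * (b * y) \<le> \<rho> * (b * y)" using rho0 b1 y by (intro mult_right_mono) auto
    thus "8 * A * b * y \<le> l" by (simp add: l mult.assoc)
  qed
  have lpow: "\<rho> ^ m * b ^ (m + 2) * y ^ (m + 2) = b^2 * y^2 * l ^ m" for m
    by (simp add: l power_mult_distrib power_add power2_eq_square mult_ac)
  have near: "cmod (S z - msum 0 (diag w) z) \<le> 36 * CW * b^2 * y^2 * l" if z: "norm z \<le> y" for z
  proof -
    have "S z - msum 0 (diag w) z = (\<Sum>m<r. msum (Suc m) (E (Suc m)) z)"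
      by (simp add: S_def sum.atMost_shift E0)
    also have "cmod ... \<le> (\<Sum>m<r. CW * b^2 * y^2 * ((real (Suc m) + 3)^2 * l ^ Suc m))"
    proof (rule sum_norm_le)
      fix m assume "m \<in> {..<r}"
      hence "cmod (msum (Suc m) (E (Suc m)) z) \<le> CW * \<rho> ^ Suc m * (real (Suc m) + 3)^2 * b ^ (Suc m + 2) * y ^ (Suc m + 2)"
        by (intro msum_bounds(2) E z) simp
      also have "... = CW * (real (Suc m) + 3)^2 * (\<rho> ^ Suc m * b ^ (Suc m + 2) * y ^ (Suc m + 2))" by (simp only: mult_ac)
      finally show "cmod (msum (Suc m) (E (Suc m)) z) \<le> CW * b^2 * y^2 * ((real (Suc m) + 3)^2 * l ^ Suc m)"
        unfolding lpow by (simp only: mult_ac)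
    qed
    also have "... = CW * b^2 * y^2 * (\<Sum>m<r. (real (Suc m) + 3)^2 * l ^ Suc m)" by (simp only: sum_distrib_left)
    also have "... \<le> CW * b^2 * y^2 * (36 * l)"
      using CW by (intro mult_left_mono sum_sq_geometric(2) l0 l(2)) auto
    finally show ?thesis by simp
  qed
  \<comment> \<open>The first part stems from resonant brackets with three high modes, the second
    from the grades beyond \<open>r\<close>. The number 4374 is 54 times 81, and the base 16
    swallows the polynomial factors in \<open>r\<close>.\<close>
  define D where "D = y^2 * (18 * b^2 * q + 4374 * CW * b ^ 4 * (16 * l) ^ r)"
  have rate: "(\<Sum>g\<le>r. ?G g)
      + (\<Sum>m\<le>r. ?M m) \<le> D"
  proof -
    have "(\<Sum>g\<le>r. ?G g) = (\<Sum>g\<le>r. q * (b^2 * y^2) * ((real g + 3)^2 * l ^ g))"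
    proof (intro sum.cong refl)
      fix g
      have "?G g = q * (real g + 3)^2 * (\<rho> ^ g * b ^ (g + 2) * y ^ (g + 2))"
        by (simp only: mult_ac)
      thus "?G g = q * (b^2 * y^2) * ((real g + 3)^2 * l ^ g)"
        unfolding lpow by (simp only: mult_ac)
    qed
    also have "... = q * (b^2 * y^2) * (\<Sum>g\<le>r. (real g + 3)^2 * l ^ g)" by (simp only: sum_distrib_left)
    also have "... \<le> q * (b^2 * y^2) * 18"
      using q by (intro mult_left_mono sum_sq_geometric(1) l0 l(2)) auto
    finally have 1: "(\<Sum>g\<le>r. ?G g) \<le> q * (b^2 * y^2) * 18" .
    have "?M m
        \<le> 54 * CW * b ^ 4 * y^2 * l ^ r * (real (r + 3)) ^ 3" if m: "m \<in> {..r}" for m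
    proof -
      have "?M m
          = 54 * CW * b^2 * (\<rho> ^ m * b ^ (m + 2) * y ^ (m + 2)) * (real (m + 2) * (real m + 3)^2) * (8 * A * b * y) ^ Suc (r - m)"
        by (simp add: mult_ac)
      also have "... \<le> 54 * CW * b^2 * (\<rho> ^ m * b ^ (m + 2) * y ^ (m + 2)) * (real (r + 3) * (real (r + 3))^2) * l ^ (r - m)"
      proof (intro mult_mono)
        have "(8 * A * b * y) ^ Suc (r - m) \<le> l ^ Suc (r - m)" using l0 A1 b1 y by (intro power_mono) auto
        also have "... \<le> l ^ (r - m)" using l0 l(2) by (intro power_decreasing) auto
        finally show "(8 * A * b * y) ^ Suc (r - m) \<le> l ^ (r - m)" .
      qed (use m CW b1 rho0 y A1 l0 in auto)
      also have "... = 54 * CW * b^2 * (b^2 * y^2) * (real (r + 3)) ^ 3 * (l ^ m * l ^ (r - m))"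
        unfolding lpow by (simp add: power3_eq_cube power2_eq_square mult_ac)
      also have "l ^ m * l ^ (r - m) = l ^ r" using m by (simp flip: power_add)
      finally show ?thesis by (simp add: power4_eq_xxxx power2_eq_square mult_ac)
    qed
    hence "(\<Sum>m\<le>r. ?M m)
        \<le> (\<Sum>m\<le>r. 54 * CW * b ^ 4 * y^2 * l ^ r * (real (r + 3)) ^ 3)" by (rule sum_mono)
    also have "... = 54 * CW * b ^ 4 * y^2 * l ^ r * (real (r + 1) * real (r + 3) ^ 3)" by simp
    also have "... \<le> 54 * CW * b ^ 4 * y^2 * l ^ r * (81 * 16 ^ r)"
    proof (intro mult_left_mono)
      have "real (r + 1) * real (r + 3) ^ 3 \<le> real (r + 3) * real (r + 3) ^ 3" by (intro mult_right_mono) auto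
      also have "... = ((real r + 3)^2)^2" by (simp add: power2_eq_square power3_eq_cube add.commute)
      also have "... \<le> (9 * 2 ^ r)^2" by (intro power_mono sq_le_power2) auto
      also have "... = 81 * 4 ^ r" by (simp add: power_mult_distrib power2_eq_square flip: power_mult_distrib)
      also have "(4 :: real) ^ r \<le> 16 ^ r" by (intro power_mono) auto
      finally show "real (r + 1) * real (r + 3) ^ 3 \<le> 81 * 16 ^ r" by simp
    qed (use CW b1 l0 in auto)
    also have "... = y^2 * (4374 * CW * b ^ 4 * (16 * l) ^ r)" by (simp add: power_mult_distrib)
    finally have 2: "(\<Sum>m\<le>r. ?M m)
        \<le> y^2 * (4374 * CW * b ^ 4 * (16 * l) ^ r)" .
    have "D = q * (b^2 * y^2) * 18 + y^2 * (4374 * CW * b ^ 4 * (16 * l) ^ r)" by (simp add: D_def algebra_simps)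
    thus ?thesis using 1 2 by linarith
  qed
  have D0: "0 \<le> D" using q CW b1 l0 by (simp add: D_def)
  have DT: "D * T \<le> c1 * y^2 / 32"
    using mult_left_mono[OF T(2), of "y^2"] by (simp add: D_def mult_ac)
  have zreal: "real_state (uof (z t))" if "t \<in> {-T..T}" for t
    unfolding z_def by (rule solution_real[OF y(1,3) T(1) x(2) x(3) x(1) u0(2,1) that])
  have nx0: "norm (x 0) = \<epsilon>" using W_norm_uof[of "xof u0"] by (simp add: x(1) uof_xof u0)
  \<comment> \<open>The interval from \<open>min 0 t\<close> to \<open>max 0 t\<close> covers
    forward and backward times with one energy estimate.\<close>
  have step: "norm (x t) < y" if t: "t \<in> {-T..T}" and le: "\<And>\<tau>. \<tau> \<in> {min 0 t..max 0 t} \<Longrightarrow> norm (x \<tau>) \<le> y" for t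
  proof -
    let ?t0 = "min 0 t" and ?t1 = "max 0 t"
    have sub: "{?t0..?t1} \<subseteq> {-T..T}" using t T by auto
    have "cmod (S (z ?t1) - S (z ?t0)) \<le> D * (?t1 - ?t0)"
    proof -
      have "cmod (S (z ?t1) - S (z ?t0)) \<le> ((\<Sum>g\<le>r. ?G g)
        + (\<Sum>m\<le>r. ?M m)) * (?t1 - ?t0)"
        unfolding S_def z_def
      proof (rule energy_estimate[where a = "\<lambda>m. CW * \<rho> ^ m" and q = "\<lambda>g. q * \<rho> ^ g" and R = y, OF E Q _ y(1,3)])
        show "(x has_vector_derivative Gf \<theta> y t (x t)) (at t within {?t0..?t1})" if "t \<in> {?t0..?t1}" for t
          by (rule has_vector_derivative_within_subset[OF x(3) sub]) (use that sub in blast)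
      qed (use le in auto)
      also have "... \<le> D * (?t1 - ?t0)" by (rule mult_right_mono[OF rate]) simp
      finally show ?thesis .
    qed
    also have "... \<le> D * T" using t T D0 by (intro mult_left_mono) auto
    finally have "cmod (S (z t) - S (z 0)) \<le> D * T"
      by (cases "0 \<le> t") (simp_all add: min_def max_def norm_minus_commute)
    hence dS: "cmod (S (z t) - S (z 0)) \<le> c1 * y^2 / 32" using DT by linarith
    have zt: "norm (z t) = norm (x t)" "norm (z 0) = \<epsilon>" by (simp_all add: z_def nx0)
    have zy: "norm (z t) \<le> y" "norm (z 0) \<le> y" using le[of t] u0(4) by (simp_all add: zt)
    obtain Jt where Jt: "msum 0 (diag w) (z t) = of_real Jt" "c1 / 2 * (norm (z t))^2 \<le> Jt"
      by (rule quadratic_energy[of c1 w CW "z t", OF w less_imp_le[OF c1] zreal[OF t]])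
    have "0 \<in> {-T..T}" using T by simp
    then obtain J0 where J0: "msum 0 (diag w) (z 0) = of_real J0" "J0 \<le> CW / 2 * (norm (z 0))^2"
      by (rule quadratic_energy[of c1 w CW "z 0", OF w less_imp_le[OF c1] zreal])
    have "36 * CW * b^2 * y^2 * l \<le> c1 * y^2 / 64"
      using mult_right_mono[OF l(3), of "y^2"] by (simp add: mult_ac)
    hence n1: "cmod (S (z t) - of_real Jt) \<le> c1 * y^2 / 64" and n2: "cmod (S (z 0) - of_real J0) \<le> c1 * y^2 / 64"
      using near[OF zy(1)] near[OF zy(2)] by (simp_all add: Jt J0)
    have "cmod (complex_of_real Jt - of_real J0) \<le> cmod (S (z t) - of_real Jt) + cmod (S (z t) - S (z 0)) + cmod (S (z 0) - of_real J0)"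
    proof -
      have "complex_of_real Jt - of_real J0 = - (S (z t) - of_real Jt) + (S (z t) - S (z 0)) + (S (z 0) - of_real J0)" by simp
      also have "cmod ... \<le> cmod (S (z t) - of_real Jt) + cmod (S (z t) - S (z 0)) + cmod (S (z 0) - of_real J0)"
        by (intro norm_triangle_mono order_refl) (simp add: norm_minus_commute)
      finally show ?thesis .
    qed
    hence "\<bar>Jt - J0\<bar> \<le> c1 * y^2 / 16"
      using n1 n2 dS by (simp flip: of_real_diff)
    hence "c1 / 2 * (norm (x t))^2 \<le> CW / 2 * \<epsilon>\<^sup>2 + c1 * y^2 / 16"
      using Jt(2) J0(2) unfolding zt by linarith
    also have "CW / 2 * \<epsilon>\<^sup>2 \<le> c1 * y^2 / 32" using u0(5) by simp
    finally have "c1 / 2 * (norm (x t))^2 \<le> c1 / 2 * (y^2 * (3 / 16))" by simp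
    hence "(norm (x t))^2 \<le> y^2 * (3 / 16)" using c1 by simp
    also have "... < y^2" using y by simp
    finally show ?thesis using y by (simp add: power2_less_imp_less)
  qed
  have cn: "continuous_on {-T..T} (\<lambda>t. norm (x t))" by (intro continuous_on_norm x(2))
  have pos: "norm (x t) < y" if t: "t \<in> {0..T}" for t
  proof (rule stays_below[of T "\<lambda>t. norm (x t)", OF _ _ _ t])
    show "continuous_on {0..T} (\<lambda>t. norm (x t))" by (rule continuous_on_subset[OF cn]) (use T in auto)
    show "norm (x 0) < y" using nx0 u0 by simp
    show "norm (x t) < y" if "t \<in> {0..T}" "\<And>s. s \<in> {0..t} \<Longrightarrow> norm (x s) \<le> y" for t
      by (rule step) (use that T in auto)
  qed
  have neg: "norm (x (- t)) < y" if t: "t \<in> {0..T}" for t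
  proof (rule stays_below[of T "\<lambda>t. norm (x (- t))", OF _ _ _ t])
    show "continuous_on {0..T} (\<lambda>t. norm (x (- t)))"
      by (rule continuous_on_compose2[OF cn]) (auto intro!: continuous_intros)
    show "norm (x (- 0)) < y" using nx0 u0 by simp
    show "norm (x (- t)) < y" if "t \<in> {0..T}" "\<And>s. s \<in> {0..t} \<Longrightarrow> norm (x (- s)) \<le> y" for t
    proof (rule step)
      fix \<tau> assume "\<tau> \<in> {min 0 (- t)..max 0 (- t)}"
      thus "norm (x \<tau>) \<le> y" using that(1) that(2)[of "- \<tau>"] by auto
    qed (use that T in auto)
  qed
  have xy: "norm (x t) < y" if "t \<in> {-T..T}" for t
    using pos[of t] neg[of "- t"] that by (cases "0 \<le> t") auto
  show ?thesis
    unfolding the_solution_bounded_def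
  proof (intro exI[of _ "\<lambda>t. uof (z t)"] conjI allI impI ballI)
    show "ham_solution c f s H {-T..T} (\<lambda>t. uof (z t))"
      unfolding z_def by (rule solution_forward[OF y(2,3) x(2,3)]) (use xy in \<open>auto intro: less_imp_le\<close>)
    show "uof (z 0) = u0" by (simp add: z_def x(1) uof_xof u0)
    have le: "W_norm c f s (uof (z t)) \<le> y" if "t \<in> {-T..T}" for t
      using xy[OF that] by (simp add: W_norm_uof z_def)
    show "bdd_above ((\<lambda>t. W_norm c f s (uof (z t))) ` {-T..T})" by (rule bdd_aboveI[of _ y]) (use le in auto)
    have "(SUP t\<in>{-T..T}. W_norm c f s (uof (z t))) \<le> y" by (rule cSUP_least) (use le T in auto)
    thus "(SUP t\<in>{-T..T}. W_norm c f s (uof (z t))) < 2 * y" using y by simp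
    fix I v t assume v: "is_interval I \<and> 0 \<in> I \<and> ham_solution c f s H I v \<and> v 0 = u0" and t: "t \<in> I \<inter> {-T..T}"
    show "v t = uof (z t)"
      unfolding z_def by (rule solution_unique[OF y T(1) x(2,3) xy x(1) _ _ _ _ t]) (use v in auto)
  qed
qed

end

section \<open>Choice of parameters\<close>

text \<open>The order and the logarithm of the threshold are powers of \<open>L\<close>, up to
  rounding and constants, so every polynomial prefactor is beaten for large \<open>L\<close>. Half
  of the common decay rate is spent on the length of time, the other half on the prefactors.\<close>

lemma parameter_choice:
  fixes q p \<Theta> B G Nm Y Ca c1 g C' C'' :: real
  assumes q: "1 < q" and p: "1 \<le> p" and pos: "0 < \<Theta>" "1 \<le> B" "1 \<le> G" "0 < Y" "0 \<le> Ca" "0 < c1" "0 < g" "0 \<le> C'" "0 \<le> C''"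
  defines "a \<equiv> (q - 1) / (q * p + 1)"
  obtains L0 m0 where "1 \<le> L0" "0 < m0"
    "\<And>L. L0 \<le> L \<Longrightarrow> \<exists>r N. 1 \<le> r \<and> Nm \<le> N \<and> 1 \<le> N \<and>
      G * real (r + 2) ^ 4 * (B * real (r + 2) * N) powr (\<Theta> * real (r + 2) powr p) \<le> exp (L / 2) \<and>
      (\<forall>l. 0 \<le> l \<and> l \<le> Y * exp (- L / 2) \<longrightarrow> l \<le> 1 / 4 \<and> Ca * l \<le> c1 \<and>
        (C' * real (r + 2) * exp (- g * (ln N) powr q) + C'' * (16 * l) ^ r) * exp (m0 * L powr (1 + a)) \<le> c1 / 32)"
proof -
  have qp: "0 < q * p + 1" using q p by (simp add: add_pos_pos)
  have a: "0 < a" "a < 1" "p * a < 1"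
  proof -
    show "0 < a" using q qp by (simp add: a_def)
    have "q * 1 \<le> q * p" using q p by (intro mult_left_mono) auto
    thus "a < 1" using qp by (simp add: a_def divide_less_eq)
    show "p * a < 1" using q p qp by (simp add: a_def divide_less_eq algebra_simps)
  qed
  \<comment> \<open>The balance that determines \<open>a\<close>: the left side is the power of
    \<open>L\<close> in the gain from high modes, the right side the one in the remainder of order
    \<open>r\<close>.\<close>
  have aq: "q * (1 - p * a) = 1 + a"
    using qp unfolding a_def by (simp add: field_simps)
  \<comment> \<open>As \<open>r + 2\<close> is at most three times L^a, this makes the contribution
    of ln N to the logarithm of the divisor loss at most L/8; the remaining terms are allowed L/4 by
    \<open>ev2\<close>.\<close>
  define \<nu> where "\<nu> = 1 / (8 * \<Theta> * 3 powr p)"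
  have nu: "0 < \<nu>" using pos by (simp add: \<nu>_def)
  define m0 where "m0 = min (g * \<nu> powr q) (1 / 8) / 2"
  have m0: "0 < m0" using pos nu by (simp add: m0_def)
  have ev1: "\<forall>\<^sub>F L in at_top. max Nm 1 \<le> exp (\<nu> * L powr (1 - p * a))"
    using a nu by real_asymp
  have ev2: "\<forall>\<^sub>F L in at_top. ln G + 4 * ln (3 * L powr a) + \<Theta> * (3 powr p * L powr (p * a)) * ln (B * (3 * L powr a)) \<le> L / 4"
  proof -
    have gen: "\<forall>\<^sub>F L in at_top. G' + 4 * ln (3 * L powr a) + K * L powr e * ln (B' * L powr a) \<le> L / 4"
      if "0 < a" "0 < K" "0 < B'" "0 < e" "e < 1" for G' K B' e a :: real
      using that by real_asymp
    have "0 < p * a" using a p by simp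
    thus ?thesis using gen[of a "\<Theta> * 3 powr p" "B * 3" "p * a" "ln G"] a pos by (simp add: mult_ac)
  qed
  have ev3: "\<forall>\<^sub>F L in at_top. 16 * (Y * exp (- L / 2)) \<le> exp (- L / 4)"
    using pos by real_asymp
  have ev4: "\<forall>\<^sub>F L in at_top. Ca * (Y * exp (- L / 2)) \<le> c1"
    using pos by real_asymp
  have ev5: "\<forall>\<^sub>F L in at_top. (C' * 3 + C'') * L * exp (- m0 * L) \<le> c1 / 32"
    using pos m0 by real_asymp
  have ev6: "\<forall>\<^sub>F L :: real in at_top. 1 \<le> L" by (rule eventually_ge_at_top)
  define good where "good L \<longleftrightarrow> (\<exists>r N. 1 \<le> r \<and> Nm \<le> N \<and> 1 \<le> N \<and>
      G * real (r + 2) ^ 4 * (B * real (r + 2) * N) powr (\<Theta> * real (r + 2) powr p) \<le> exp (L / 2) \<and>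
      (\<forall>l. 0 \<le> l \<and> l \<le> Y * exp (- L / 2) \<longrightarrow> l \<le> 1 / 4 \<and> Ca * l \<le> c1 \<and>
        (C' * real (r + 2) * exp (- g * (ln N) powr q) + C'' * (16 * l) ^ r) * exp (m0 * L powr (1 + a)) \<le> c1 / 32))" for L
  have "\<forall>\<^sub>F L in at_top. good L"
    using ev1 ev2 ev3 ev4 ev5 ev6
  proof eventually_elim
    case (elim L)
    define x where "x = L powr a"
    define r where "r = nat \<lfloor>x\<rfloor>"
    define N where "N = exp (\<nu> * L powr (1 - p * a))"
    define k where "k = real (r + 2)"
    have x: "1 \<le> x" "x \<le> L"
    proof -
      show "1 \<le> x" using elim(6) a by (simp add: x_def ge_one_powr_ge_zero)
      have "L powr a \<le> L powr 1" using elim(6) a by (intro powr_mono) auto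
      thus "x \<le> L" using elim(6) by (simp add: x_def)
    qed
    have r: "1 \<le> r" "real r \<le> x" "x \<le> 2 * real r"
    proof -
      show "1 \<le> r" using x by (simp add: r_def le_nat_iff)
      have "real r = of_int \<lfloor>x\<rfloor>" using x by (simp add: r_def)
      hence "real r \<le> x" "x \<le> real r + 1" by linarith+
      moreover have "1 \<le> real r" using \<open>1 \<le> r\<close> by simp
      ultimately show "real r \<le> x" "x \<le> 2 * real r" by linarith+
    qed
    have k: "1 \<le> k" "k \<le> 3 * x" using r x by (auto simp: k_def)
    have N: "1 \<le> N" "Nm \<le> N" "ln N = \<nu> * L powr (1 - p * a)" using elim(1) by (auto simp: N_def)
    have kp: "k powr p \<le> 3 powr p * L powr (p * a)"
    proof -
      have "k powr p \<le> (3 * x) powr p" using k p by (intro powr_mono2) auto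
      also have "... = 3 powr p * L powr (p * a)" using x by (simp add: powr_mult x_def powr_powr mult.commute)
      finally show ?thesis .
    qed
    have Q: "G * k ^ 4 * (B * k * N) powr (\<Theta> * k powr p) \<le> exp (L / 2)"
    proof -
      have p0: "0 < G * k ^ 4" "0 < B * k * N" using pos k N by auto
      have "G * k ^ 4 * (B * k * N) powr (\<Theta> * k powr p) = exp (ln (G * k ^ 4) + \<Theta> * k powr p * ln (B * k * N))"
        unfolding exp_add exp_ln[OF p0(1)] powr_def by (simp only: less_imp_neq[OF p0(2), symmetric] if_False)
      also have "ln (G * k ^ 4) = ln G + 4 * ln k" using pos k by (simp add: ln_mult ln_realpow)
      also have "ln (B * k * N) = ln (B * k) + ln N" using pos k N by (simp add: ln_mult)
      also have "ln G + 4 * ln k + \<Theta> * k powr p * (ln (B * k) + ln N) \<le> L / 2"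
      proof -
        have "\<Theta> * k powr p * ln (B * k) \<le> \<Theta> * (3 powr p * L powr (p * a)) * ln (B * (3 * L powr a))"
        proof (intro mult_mono mult_left_mono kp)
          have "1 * 1 \<le> B * k" using pos k by (intro mult_mono) auto
          thus "0 \<le> ln (B * k)" by simp
          have "B * k \<le> B * (3 * x)" using pos k by (intro mult_left_mono) auto
          thus "ln (B * k) \<le> ln (B * (3 * L powr a))" using pos k unfolding x_def by (intro ln_mono) auto
        qed (use pos in auto)
        moreover have "ln k \<le> ln (3 * L powr a)" using k unfolding x_def by (intro ln_mono) auto
        moreover have "\<Theta> * k powr p * ln N \<le> L / 8"
        proof -
          have "\<Theta> * k powr p * ln N \<le> \<Theta> * (3 powr p * L powr (p * a)) * (\<nu> * L powr (1 - p * a))"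
            unfolding N(3) using pos nu by (intro mult_right_mono mult_left_mono kp) auto
          also have "... = (\<Theta> * 3 powr p * \<nu>) * (L powr (p * a) * L powr (1 - p * a))" by simp
          also have "L powr (p * a) * L powr (1 - p * a) = L" using elim(6) by (simp flip: powr_add)
          also have "\<Theta> * 3 powr p * \<nu> = 1 / 8" using pos by (simp add: \<nu>_def)
          finally show ?thesis by simp
        qed
        ultimately have "ln G + 4 * ln k + \<Theta> * k powr p * (ln (B * k) + ln N) \<le> L / 4 + L / 8"
          using elim(2) by (simp add: distrib_left)
        thus ?thesis using elim(6) by simp
      qed
      finally show ?thesis by simp
    qed
    define \<Lambda> where "\<Lambda> = L powr (1 + a)"
    have Lam: "L \<le> \<Lambda>" "\<Lambda> = L * x"
    proof -
      have "L powr 1 \<le> L powr (1 + a)" using elim(6) a by (intro powr_mono) auto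
      thus "L \<le> \<Lambda>" using elim(6) by (simp add: \<Lambda>_def)
      show "\<Lambda> = L * x" using elim(6) by (simp add: \<Lambda>_def x_def powr_add)
    qed
    have h: "exp (- g * (ln N) powr q) \<le> exp (- (2 * m0 * \<Lambda>))"
    proof -
      have "(ln N) powr q = \<nu> powr q * \<Lambda>"
        using nu elim(6) unfolding N(3) \<Lambda>_def by (simp add: powr_mult powr_powr mult.commute[of _ q] aq)
      moreover have "2 * m0 * \<Lambda> \<le> g * \<nu> powr q * \<Lambda>"
        using Lam elim(6) by (intro mult_right_mono) (auto simp: m0_def)
      ultimately show ?thesis by simp
    qed
    have "l \<le> 1 / 4 \<and> Ca * l \<le> c1 \<and>
        (C' * real (r + 2) * exp (- g * (ln N) powr q) + C'' * (16 * l) ^ r) * exp (m0 * L powr (1 + a)) \<le> c1 / 32"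
      if l: "0 \<le> l" "l \<le> Y * exp (- L / 2)" for l
    proof (intro conjI)
      have l16: "16 * l \<le> exp (- L / 4)" using l(2) elim(3) by linarith
      moreover have "exp (- L / 4) \<le> 1" using elim(6) by simp
      ultimately show "l \<le> 1 / 4" by linarith
      show "Ca * l \<le> c1" using mult_left_mono[OF l(2), of Ca] pos elim(4) by linarith
      have "(16 * l) ^ r \<le> exp (- L / 4) ^ r" using l l16 by (intro power_mono) auto
      also have "... = exp (- (real r * L / 4))" by (simp flip: exp_of_nat_mult)
      also have "... \<le> exp (- (2 * m0 * \<Lambda>))"
      proof -
        have "2 * m0 * \<Lambda> \<le> 1 / 8 * \<Lambda>" using Lam elim(6) by (intro mult_right_mono) (auto simp: m0_def)
        also have "... \<le> real r * L / 4"
          using mult_left_mono[OF r(3), of L] elim(6) by (simp add: Lam)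
        finally show ?thesis by simp
      qed
      finally have p2: "(16 * l) ^ r \<le> exp (- (2 * m0 * \<Lambda>))" .
      have "C' * real (r + 2) * exp (- g * (ln N) powr q) + C'' * (16 * l) ^ r
          \<le> C' * (3 * L) * exp (- (2 * m0 * \<Lambda>)) + C'' * L * exp (- (2 * m0 * \<Lambda>))"
      proof (intro add_mono mult_mono h)
        show "real (r + 2) \<le> 3 * L" using k x by (simp add: k_def)
        show "C'' \<le> C'' * L" using pos elim(6) by (simp add: mult_le_cancel_left1)
      qed (use pos p2 l elim(6) in auto)
      also have "... = (C' * 3 + C'') * L * exp (- (2 * m0 * \<Lambda>))" by (simp add: algebra_simps)
      finally have "(C' * real (r + 2) * exp (- g * (ln N) powr q) + C'' * (16 * l) ^ r) * exp (m0 * \<Lambda>)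
          \<le> (C' * 3 + C'') * L * exp (- (2 * m0 * \<Lambda>)) * exp (m0 * \<Lambda>)" by (intro mult_right_mono) auto
      also have "... = (C' * 3 + C'') * L * exp (- m0 * \<Lambda>)" by (simp add: mult.assoc flip: exp_add)
      also have "... \<le> (C' * 3 + C'') * L * exp (- m0 * L)"
        using pos elim(6) Lam m0 by (intro mult_left_mono) auto
      also have "... \<le> c1 / 32" by (rule elim(5))
      finally show "(C' * real (r + 2) * exp (- g * (ln N) powr q) + C'' * (16 * l) ^ r) * exp (m0 * L powr (1 + a)) \<le> c1 / 32"
        by (simp only: \<Lambda>_def)
    qed
    thus ?case unfolding good_def using r(1) N(1,2) Q unfolding k_def by blast
  qed
  then obtain L0 where L0: "\<And>L. L0 \<le> L \<Longrightarrow> good L" unfolding eventually_at_top_linorder by blast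
  show thesis
    by (rule that[of "max 1 L0" m0]) (use m0 L0 in \<open>auto simp: good_def\<close>)
qed

text \<open>All constants are fixed before the datum; only the order, the two thresholds, the
  divisor bound \<eta> and the time depend on its size. The level of confinement is a fixed multiple
  of \<epsilon>, so the factor by which normal form grades grow must stay below
  \<epsilon>^(-1/2).\<close>

lemma (in ham_sys) long_time_stability:
  fixes q p \<gamma> \<tau> \<beta> \<delta> :: real
  assumes w: "\<And>K :: 'n mode. c1 * exp (2 * s * \<phi> K) \<le> w (fst K)" "\<And>K. w (fst K) \<le> CW * exp (2 * s * \<phi> K)" and c1: "0 < c1"
    and cluster: "\<And>i j. i \<noteq> j \<Longrightarrow> w i = w j \<or> C2 * (site_norm i powr \<delta> + site_norm j powr \<delta>) \<le> \<bar>\<omega> i - \<omega> j\<bar>"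
    and C2: "0 < C2" "0 < \<delta>" and bet: "1 < \<beta>" and c0: "0 < c0"
    and upper: "\<And>j. \<bar>\<omega> j\<bar> \<le> U * (1 + site_norm j) powr \<beta>" and U: "0 \<le> U"
    and lower: "\<And>j. R \<le> site_norm j \<Longrightarrow> c0 * site_norm j powr \<beta> \<le> \<omega> j"
    and nonres: "\<And>N Js. N0 \<le> N \<Longrightarrow> (\<forall>J\<in>set Js. mode_norm J \<le> N) \<Longrightarrow>
          (freq_sum \<omega> Js \<noteq> 0 \<longrightarrow> \<gamma> * N powr (- \<tau> * real (length Js) powr p) \<le> \<bar>freq_sum \<omega> Js\<bar>) \<and>
          (freq_sum \<omega> Js = 0 \<longrightarrow> paired \<omega> Js)"
    and par: "0 < \<gamma>" "0 < \<tau>" "1 \<le> p" and q: "1 < q"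
    and phi_low: "\<And>J x. 1 \<le> x \<Longrightarrow> x < mode_norm J \<Longrightarrow> (ln x) powr q \<le> \<phi> J"
  shows "\<exists>\<epsilon>0>0. \<exists>Csta>0. \<exists>Cfin>0. \<forall>u0 \<in> W_space c f s. \<forall>\<epsilon>.
      real_state u0 \<and> \<epsilon> = W_norm c f s u0 \<and> 0 < \<epsilon> \<and> \<epsilon> < \<epsilon>0 \<longrightarrow>
      (\<exists>T. (\<forall>a < (q - 1) / (q * p + 1). 1 / Csta * exp (Cfin * \<bar>ln \<epsilon>\<bar> powr (1 + a)) < T) \<and>
           the_solution_bounded c f s H u0 T (Csta * \<epsilon>))"
proof -
  have w0: "0 \<le> w (fst K)" for K :: "'n mode"
    using w(1)[of K] c1 by (meson exp_ge_zero less_imp_le mult_nonneg_nonneg order_trans)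
  have CW: "0 \<le> CW" by (rule cls_diag(2)[of w, OF w0 w(2)])
  \<comment> \<open>The upper threshold is a power of the lower one, up to constants; the exponent
    \<open>t\<close> makes N'^\<delta> outgrow N^\<beta>, as the comparison of two high modes with
    the low ones requires.\<close>
  define t where "t = max 1 (\<beta> / \<delta>)"
  define V where "V = 1 + U * 2 powr \<beta>"
  define B where "B = Max {1, R, N0, V / C2, V / c0}"
  have B: "1 \<le> B" "R \<le> B" "N0 \<le> B" "V \<le> C2 * B" "V \<le> c0 * B"
  proof -
    have "x \<le> B" if "x \<in> {1, R, N0, V / C2, V / c0}" for x unfolding B_def by (rule Max_ge) (use that in auto)
    from this[of 1] this[of R] this[of N0] this[of "V / C2"] this[of "V / c0"]
    show "1 \<le> B" "R \<le> B" "N0 \<le> B" "V \<le> C2 * B" "V \<le> c0 * B"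
      using C2 c0 by (simp_all add: divide_le_eq mult.commute)
  qed
  have t: "1 \<le> t" "\<beta> \<le> t * \<delta>"
    using C2 by (auto simp: t_def max_def field_simps)
  define \<gamma>' where "\<gamma>' = min \<gamma> 1"
  have g': "0 < \<gamma>'" "\<gamma>' \<le> 1" "\<gamma>' \<le> \<gamma>" using par by (auto simp: \<gamma>'_def)
  \<comment> \<open>The level is \<open>K * \<epsilon>\<close>; the ratio of the two energy bounds
    decides how far above the datum it has to lie.\<close>
  define K where "K = max 2 (4 * sqrt (CW / c1))"
  have K: "2 \<le> K" "16 * CW \<le> c1 * K^2"
  proof -
    show "2 \<le> K" by (simp add: K_def)
    have "(4 * sqrt (CW / c1))^2 \<le> K^2" using CW c1 by (intro power_mono) (auto simp: K_def)
    hence "16 * (CW / c1) \<le> K^2" using CW c1 by (simp add: power_mult_distrib)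
    thus "16 * CW \<le> c1 * K^2" using c1 by (simp add: field_simps)
  qed
  obtain L0 m0 where L0: "1 \<le> L0" "0 < m0"
    and choice: "\<And>L. L0 \<le> L \<Longrightarrow> \<exists>r N. 1 \<le> r \<and> max R 1 \<le> N \<and> 1 \<le> N \<and>
      32 * A / \<gamma>' * real (r + 2) ^ 4 * (B * real (r + 2) * N) powr (t * \<tau> * real (r + 2) powr p) \<le> exp (L / 2) \<and>
      (\<forall>l. 0 \<le> l \<and> l \<le> b * K * exp (- L / 2) \<longrightarrow> l \<le> 1 / 4 \<and> 2304 * CW * b^2 * l \<le> c1 \<and>
        (18 * b^2 * CW * real (r + 2) * exp (- g0 * (ln N) powr q) + 4374 * CW * b ^ 4 * (16 * l) ^ r)
          * exp (m0 * L powr (1 + (q - 1) / (q * p + 1))) \<le> c1 / 32)"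
  proof (rule parameter_choice[of q p "t * \<tau>" B "32 * A / \<gamma>'" "b * K" "2304 * CW * b^2" c1 g0 "18 * b^2 * CW" "4374 * CW * b ^ 4" "max R 1"])
    show "1 < q" "1 \<le> p" by fact+
    show "0 < t * \<tau>" using t par by simp
    show "1 \<le> B" by fact
    have "\<gamma>' \<le> 32 * A" using g' A1 by linarith
    thus "1 \<le> 32 * A / \<gamma>'" using g' by simp
    show "0 < b * K" using b1 K by simp
    show "0 \<le> 2304 * CW * b^2" "0 \<le> 18 * b^2 * CW" "0 \<le> 4374 * CW * b ^ 4" using CW b1 by auto
    show "0 < c1" by fact
    show "0 < g0" by (rule g0_pos)
  qed blast
  \<comment> \<open>The three terms make \<open>L\<close> large enough for the choice of parameters,
    keep the level inside the ball of convergence, and keep it inside the Lipschitz radius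
    \<open>R0\<close>.\<close>
  define \<epsilon>0 where "\<epsilon>0 = min (exp (- L0)) (min (rs / K) (R0 / K))"
  have e0: "0 < \<epsilon>0" using rs(1) R0_pos K by (simp add: \<epsilon>0_def)
  have main: "\<exists>T. (\<forall>a < (q - 1) / (q * p + 1). 1 / (2 * K) * exp (m0 * \<bar>ln \<epsilon>\<bar> powr (1 + a)) < T) \<and>
           the_solution_bounded c f s H u0 T (2 * K * \<epsilon>)"
    if u0: "u0 \<in> W_space c f s" "real_state u0" and eps: "\<epsilon> = W_norm c f s u0" "0 < \<epsilon>" "\<epsilon> < \<epsilon>0" for u0 \<epsilon>
  proof -
    define L where "L = \<bar>ln \<epsilon>\<bar>"
    have "ln \<epsilon> < ln (exp (- L0))" using eps by (subst ln_less_cancel_iff) (auto simp: \<epsilon>0_def)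
    hence L: "L = - ln \<epsilon>" "L0 \<le> L" "1 \<le> L" using L0 by (auto simp: L_def)
    have eL: "exp (- L) = \<epsilon>" using eps by (simp add: L)
    define a where "a = (q - 1) / (q * p + 1)"
    obtain r N where r: "1 \<le> r" and N: "max R 1 \<le> N" "1 \<le> N"
      and Q: "32 * A / \<gamma>' * real (r + 2) ^ 4 * (B * real (r + 2) * N) powr (t * \<tau> * real (r + 2) powr p) \<le> exp (L / 2)"
      and lT: "\<And>l. 0 \<le> l \<Longrightarrow> l \<le> b * K * exp (- L / 2) \<Longrightarrow> l \<le> 1 / 4 \<and> 2304 * CW * b^2 * l \<le> c1 \<and>
        (18 * b^2 * CW * real (r + 2) * exp (- g0 * (ln N) powr q) + 4374 * CW * b ^ 4 * (16 * l) ^ r)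
          * exp (m0 * L powr (1 + a)) \<le> c1 / 32"
      using choice[OF L(2)] unfolding a_def by blast
    define k where "k = r + 2"
    define M where "M = B * real k * N"
    define N' where "N' = M powr t"
    define \<eta> where "\<eta> = \<gamma>' * N' powr (- \<tau> * real k powr p)"
    have k1: "1 \<le> real k" by (simp add: k_def)
    have M: "1 \<le> M" "real k * N \<le> M" "B \<le> M"
    proof -
      have kN: "1 * 1 \<le> real k * N" using k1 N by (intro mult_mono) auto
      have "1 * (real k * N) \<le> B * (real k * N)" using B kN by (intro mult_right_mono) auto
      thus "real k * N \<le> M" by (simp add: M_def mult.assoc)
      thus "1 \<le> M" using kN by simp
      have "B * 1 \<le> B * (real k * N)" using B kN by (intro mult_left_mono) auto
      thus "B \<le> M" by (simp add: M_def mult.assoc)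
    qed
    have N': "M \<le> N'" "1 \<le> N'"
    proof -
      have "M powr 1 \<le> M powr t" using M t by (intro powr_mono) auto
      thus "M \<le> N'" using M by (simp add: N'_def)
      thus "1 \<le> N'" using M by simp
    qed
    \<comment> \<open>Used with \<open>d = \<delta>\<close> for the gap between clusters and with
      \<open>d = \<beta>\<close> for the size of a single high frequency.\<close>
    have cond: "1 + real k * (U * (1 + N) powr \<beta>) \<le> C * N' powr d" if C: "V \<le> C * B" "0 < C" and d: "\<beta> \<le> t * d" for C d
    proof -
      have "(1 + N) powr \<beta> \<le> (2 * N) powr \<beta>" using N bet by (intro powr_mono2) auto
      also have "... = 2 powr \<beta> * N powr \<beta>" using N by (simp add: powr_mult)
      finally have "real k * (U * (1 + N) powr \<beta>) \<le> real k * (U * (2 powr \<beta> * N powr \<beta>))"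
        using U by (intro mult_left_mono) auto
      moreover have "1 * 1 \<le> real k * N powr \<beta>" using k1 N bet by (intro mult_mono) (auto simp: ge_one_powr_ge_zero)
      ultimately have "1 + real k * (U * (1 + N) powr \<beta>) \<le> V * (real k * N powr \<beta>)"
        by (simp add: V_def algebra_simps)
      also have "... \<le> (C * B) * (real k * N powr \<beta>)" using C k1 by (intro mult_right_mono) auto
      also have "... = C * ((B * real k) * N powr \<beta>)" by simp
      also have "... \<le> C * ((B * real k) powr \<beta> * N powr \<beta>)"
      proof (intro mult_left_mono mult_right_mono)
        have "1 * 1 \<le> B * real k" using B k1 by (intro mult_mono) auto
        hence "(B * real k) powr 1 \<le> (B * real k) powr \<beta>" using bet by (intro powr_mono) auto
        thus "B * real k \<le> (B * real k) powr \<beta>" using B k1 by (simp add: powr_one)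
      qed (use C in auto)
      also have "(B * real k) powr \<beta> * N powr \<beta> = M powr \<beta>" using B k1 N by (simp add: M_def powr_mult)
      also have "... \<le> M powr (t * d)" using M d by (intro powr_mono) auto
      also have "... = N' powr d" by (simp add: N'_def powr_powr)
      finally show ?thesis using C by simp
    qed
    have eta: "0 < \<eta>" "\<eta> \<le> 1" "\<eta> \<le> \<gamma> * N' powr (- \<tau> * real k powr p)"
    proof -
      show "0 < \<eta>" using g' N' by (simp add: \<eta>_def)
      have "N' powr (- \<tau> * real k powr p) \<le> N' powr 0" using N' par by (intro powr_mono) auto
      hence "N' powr (- \<tau> * real k powr p) \<le> 1" using N' by simp
      hence "\<gamma>' * N' powr (- \<tau> * real k powr p) \<le> 1 * 1" using g' by (intro mult_mono) auto
      thus "\<eta> \<le> 1" by (simp add: \<eta>_def)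
      show "\<eta> \<le> \<gamma> * N' powr (- \<tau> * real k powr p)" unfolding \<eta>_def using g' by (intro mult_right_mono) auto
    qed
    define h where "h = (ln N) powr q"
    define qc where "qc = real k * (CW * exp (- g0 * h))"
    have res: "\<bar>freq_sum w Js\<bar> * exp (e1 Js) \<le> qc * exp (e2 Js)"
      if Js: "mom Js = 0" "length Js \<le> r + 2" "\<bar>freq_sum \<omega> Js\<bar> < \<eta>" for Js
    proof -
      have "\<bar>freq_sum w Js\<bar> * exp (e1 Js) \<le> real (length Js) * (CW * exp (- g0 * h) * exp (e2 Js))"
      proof (rule resonant_weight_bound[where W = w and ?C2.0 = C2 and \<delta> = \<delta> and \<beta> = \<beta> and ?c0.0 = c0 and ?C0.0 = U and R = R
            and \<gamma> = \<gamma> and \<tau> = \<tau> and p = p and N = N and N' = N' and k = k and \<eta> = \<eta>])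
        show "real k * N \<le> N'" "R \<le> N'" using M N' B by linarith+
        show "1 + real k * (U * (1 + N) powr \<beta>) \<le> C2 * N' powr \<delta>" by (rule cond[OF B(4) C2(1) t(2)])
        show "1 + real k * (U * (1 + N) powr \<beta>) \<le> c0 * N' powr \<beta>"
          by (rule cond[OF B(5) c0]) (use t bet in simp)
        show "h \<le> \<phi> J" if "N < mode_norm J" for J unfolding h_def by (rule phi_low[OF N(2) that])
        have N0': "N0 \<le> N'" using M N' B by linarith
        show "(freq_sum \<omega> Js \<noteq> 0 \<longrightarrow> \<gamma> * N' powr (- \<tau> * real (length Js) powr p) \<le> \<bar>freq_sum \<omega> Js\<bar>) \<and>
          (freq_sum \<omega> Js = 0 \<longrightarrow> paired \<omega> Js)" if "\<forall>J\<in>set Js. mode_norm J \<le> N'" for Js by (rule nonres[OF N0' that])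
        show "length Js \<le> k" using Js by (simp add: k_def)
        show "1 \<le> k" by (simp add: k_def)
        show "0 < \<beta>" using bet by simp
      qed (fact w0 w(2) C2 c0 upper U lower par eta Js N(2) cluster | use N in simp)+
      also have "... \<le> real k * (CW * exp (- g0 * h) * exp (e2 Js))"
        using Js CW by (intro mult_right_mono) (auto simp: k_def)
      finally show ?thesis by (simp add: qc_def)
    qed
    define \<rho> where "\<rho> = 32 * A * (real r)^2 * (real (r + 2))^2 / \<eta>"
    define y where "y = K * \<epsilon>"
    define l where "l = \<rho> * b * y"
    \<comment> \<open>The inverse of the divisor bound enters here; since \<epsilon> is exp (- L),
      the product of \<rho> and the level is still of order exp (- L / 2).\<close>
    have rho: "0 \<le> \<rho>" "\<rho> \<le> exp (L / 2)"
    proof -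
      show "0 \<le> \<rho>" using A1 eta by (simp add: \<rho>_def)
      have "N' powr (- \<tau> * real k powr p) = 1 / M powr (t * \<tau> * real k powr p)"
        by (simp add: N'_def powr_powr powr_minus_divide[symmetric] mult_ac)
      hence "\<rho> = 32 * A / \<gamma>' * ((real r)^2 * (real k)^2) * M powr (t * \<tau> * real k powr p)"
        by (simp add: \<rho>_def \<eta>_def k_def)
      also have "... \<le> 32 * A / \<gamma>' * ((real k)^2 * (real k)^2) * M powr (t * \<tau> * real k powr p)"
        using A1 g' by (intro mult_right_mono mult_left_mono power_mono) (auto simp: k_def)
      also have "(real k)^2 * (real k)^2 = real k ^ 4" by (simp flip: power_add)
      also have "32 * A / \<gamma>' * real k ^ 4 * M powr (t * \<tau> * real k powr p) \<le> exp (L / 2)"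
        using Q by (simp only: M_def k_def)
      finally show "\<rho> \<le> exp (L / 2)" .
    qed
    have y: "0 < y" "y < rs" "y \<le> R0"
      using eps K by (auto simp: y_def \<epsilon>0_def field_simps)
    have l0: "0 \<le> l" using rho b1 y by (simp add: l_def)
    have "\<rho> * (b * y) \<le> exp (L / 2) * (b * y)" using rho b1 y by (intro mult_right_mono) auto
    also have "... = b * K * (exp (L / 2) * exp (- L))" by (simp add: y_def eL)
    also have "exp (L / 2) * exp (- L) = exp (- L / 2)" by (simp flip: exp_add)
    finally have "l \<le> b * K * exp (- L / 2)" by (simp add: l_def mult.assoc)
    note lT = lT[OF l0 this]
    \<comment> \<open>Here \<open>a\<close> is the critical exponent, so one \<open>T\<close> works
      for all smaller exponents; strictness comes from the factor
      \<open>1 / (2 * K)\<close>.\<close>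
    define T where "T = exp (m0 * L powr (1 + a))"
    have "the_solution_bounded c f s H u0 T (2 * y)"
    proof (rule stability[of c1 w CW \<eta> r \<rho> qc y l T u0 \<epsilon>])
      show "\<rho> = 32 * A * (real r)^2 * (real (r + 2))^2 / \<eta>" by (simp add: \<rho>_def)
      show "0 \<le> qc" using CW by (simp add: qc_def)
      show "l = \<rho> * b * y" by (simp add: l_def)
      show "l \<le> 1 / 4" "2304 * CW * b^2 * l \<le> c1" using lT by auto
      show "0 \<le> T" by (simp add: T_def)
      show "(18 * b^2 * qc + 4374 * CW * b ^ 4 * (16 * l) ^ r) * T \<le> c1 / 32"
      proof -
        have e: "18 * b^2 * qc = 18 * b^2 * CW * real (r + 2) * exp (- g0 * (ln N) powr q)"
          by (simp add: qc_def k_def h_def)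
        show ?thesis using lT unfolding T_def e by blast
      qed
      show "W_norm c f s u0 = \<epsilon>" using eps by simp
      have "1 * \<epsilon> < K * \<epsilon>" using eps K by (intro mult_strict_right_mono) auto
      thus "\<epsilon> < y" by (simp add: y_def)
      show "16 * CW * \<epsilon>\<^sup>2 \<le> c1 * y^2"
        using mult_right_mono[OF K(2), of "\<epsilon>\<^sup>2"] by (simp add: y_def power_mult_distrib mult.assoc)
    qed (fact w c1 eta r y u0 res)+
    moreover have "1 / (2 * K) * exp (m0 * L powr (1 + a')) < T" if "a' < a" for a'
    proof -
      have "exp (m0 * L powr (1 + a')) \<le> T"
        unfolding T_def using that L L0 by (simp add: powr_mono)
      moreover have "1 / (2 * K) * exp (m0 * L powr (1 + a')) < 1 * exp (m0 * L powr (1 + a'))"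
        using K by (intro mult_strict_right_mono) auto
      ultimately show ?thesis by simp
    qed
    ultimately show ?thesis by (intro exI[of _ T]) (auto simp: y_def a_def L_def mult.assoc)
  qed
  show ?thesis
  proof (rule exI[of _ \<epsilon>0], rule conjI[OF e0], rule exI[of _ "2 * K"], rule conjI[rotated], rule exI[of _ m0],
      rule conjI[OF L0(2)], intro ballI allI impI)
    fix u0 :: "'n mode \<Rightarrow> complex" and \<epsilon>
    assume "u0 \<in> W_space c f s" "real_state u0 \<and> \<epsilon> = W_norm c f s u0 \<and> 0 < \<epsilon> \<and> \<epsilon> < \<epsilon>0"
    thus "\<exists>T. (\<forall>a < (q - 1) / (q * p + 1). 1 / (2 * K) * exp (m0 * \<bar>ln \<epsilon>\<bar> powr (1 + a)) < T) \<and>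
           the_solution_bounded c f s H u0 T (2 * K * \<epsilon>)"
      using main[of u0 \<epsilon>] by blast
  qed (use K in simp)
qed

section \<open>Logarithmic weights\<close>

lemma mx_ge: "J \<in> set A \<Longrightarrow> \<phi> J \<le> mx \<phi> A"
  by (induction A) (auto simp: le_max_iff_disj)

text \<open>Zero momentum bounds the size of \<open>K\<close> by the sum of the other sizes, and
  each summand is at least \<open>c\<close>, so the bracket obeys the same bound. Monotonicity and
  subadditivity of \<open>f\<close> then apply; the largest argument gives the largest
  weight.\<close>

lemma weight_of_zero_momentum:
  fixes K :: "('n::finite) mode"
  assumes pos: "\<And>x. c \<le> x \<Longrightarrow> 0 < f x" and mono: "mono_on {c..} f"
    and Cf: "\<And>(d :: nat) x m. m < d \<Longrightarrow> (\<forall>l<d. c \<le> x l \<and> x l \<le> x m) \<Longrightarrow>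
        f (\<Sum>l<d. x l) \<le> f (x m) + Cf * (\<Sum>l\<in>{..<d} - {m}. f (x l))"
    and phi: "\<And>J. \<phi> J = f (bracket c (fst J))" and c: "0 < c"
    and mom: "mom (K # A) = 0" and A: "A \<noteq> []"
  shows "\<phi> K \<le> mx \<phi> A + Cf * (sm \<phi> A - mx \<phi> A)"
proof -
  define d where "d = length A"
  define x where "x l = bracket c (fst (A ! l))" for l
  have d: "0 < d" using A by (simp add: d_def)
  have cx: "c \<le> x l" "mode_norm (A ! l) \<le> x l" for l by (simp_all add: x_def bracket_def mode_norm_def)
  have "Max (x ` {..<d}) \<in> x ` {..<d}" using d by (intro Max_in) auto
  then obtain m where m: "m < d" "x m = Max (x ` {..<d})" by auto
  have xm: "x l \<le> x m" if "l < d" for l unfolding m(2) using that by (intro Max_ge) auto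
  have fm: "f y \<le> f z" if "c \<le> y" "y \<le> z" for y z using mono that by (auto simp: mono_on_def)
  have mxA: "mx \<phi> A = f (x m)"
  proof (rule antisym)
    obtain J where J: "J \<in> set A" "mx \<phi> A = \<phi> J"
      using mx_attained[of A \<phi>] A pos by (metis phi bracket_def less_imp_le max.cobounded2)
    then obtain l where l: "l < d" "J = A ! l" by (auto simp: in_set_conv_nth d_def)
    hence "\<phi> J = f (x l)" by (simp add: phi x_def)
    thus "mx \<phi> A \<le> f (x m)" using J fm[OF cx(1) xm[OF l(1)]] by simp
    show "f (x m) \<le> mx \<phi> A"
      using mx_ge[of "A ! m" A \<phi>] m by (simp add: phi x_def d_def)
  qed
  have smA: "(\<Sum>l<d. f (x l)) = sm \<phi> A"
    by (simp add: sm_def sum_list_sum_nth d_def atLeast0LessThan phi x_def)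
  have "bracket c (fst K) \<le> (\<Sum>l<d. x l)"
  proof -
    have "mode_norm K \<le> (\<Sum>l<d. mode_norm (A ! l))"
      using mode_norm_le_mnorm[OF mom] by (simp add: mnorm_def sum_list_sum_nth d_def atLeast0LessThan)
    also have "... \<le> (\<Sum>l<d. x l)" by (intro sum_mono cx)
    finally have "mode_norm K \<le> (\<Sum>l<d. x l)" .
    moreover have "(\<Sum>l\<in>{m}. x l) \<le> (\<Sum>l<d. x l)"
      using m c order_trans[OF less_imp_le[OF c] cx(1)] by (intro sum_mono2) auto
    ultimately show ?thesis using cx(1)[of m] by (simp add: bracket_def mode_norm_def)
  qed
  hence "\<phi> K \<le> f (\<Sum>l<d. x l)" unfolding phi by (intro fm) (simp_all add: bracket_def)
  also have "... \<le> f (x m) + Cf * (\<Sum>l\<in>{..<d} - {m}. f (x l))" using Cf[OF m(1)] cx(1) xm by blast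
  also have "(\<Sum>l\<in>{..<d} - {m}. f (x l)) = sm \<phi> A - mx \<phi> A"
    using m(1) by (simp add: sum_diff1 smA mxA)
  finally show ?thesis by (simp add: mxA)
qed

section \<open>Summability of the logarithmic weight over the lattice\<close>

lemma inverse_square_sum: "(\<Sum>k\<in>{- int n..int n}. 1 / (1 + \<bar>real_of_int k\<bar>)^2) \<le> 4"
proof -
  have tel: "(\<Sum>i\<le>n. 1 / (1 + real i)^2) \<le> 2 - 1 / (1 + real n)" for n
  proof (induction n)
    case (Suc n)
    define x where "x = 1 + real n"
    have x: "0 < x" by (simp add: x_def)
    have "1 / (x + 1)^2 \<le> 1 / (x * (x + 1))"
      using x by (intro divide_left_mono) (auto simp: power2_eq_square)
    also have "... = 1 / x - 1 / (x + 1)" using x by (simp add: field_simps)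
    finally show ?case using Suc by (simp add: x_def add.commute)
  qed simp
  have sub: "{- int n..int n} \<subseteq> int ` {..n} \<union> (\<lambda>i. - int i) ` {..n}"
  proof
    fix k assume "k \<in> {- int n..int n}"
    thus "k \<in> int ` {..n} \<union> (\<lambda>i. - int i) ` {..n}"
      by (cases "0 \<le> k") (auto intro: image_eqI[of _ _ "nat k"] image_eqI[of _ _ "nat (- k)"])
  qed
  have "(\<Sum>k\<in>{- int n..int n}. 1 / (1 + \<bar>real_of_int k\<bar>)^2)
      \<le> (\<Sum>k\<in>int ` {..n} \<union> (\<lambda>i. - int i) ` {..n}. 1 / (1 + \<bar>real_of_int k\<bar>)^2)"
    by (rule sum_mono2[OF _ sub]) auto
  also have "... \<le> (\<Sum>k\<in>int ` {..n}. 1 / (1 + \<bar>real_of_int k\<bar>)^2) + (\<Sum>k\<in>(\<lambda>i. - int i) ` {..n}. 1 / (1 + \<bar>real_of_int k\<bar>)^2)"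
    by (subst sum_Un) (auto intro!: sum_nonneg)
  also have "... = 2 * (\<Sum>i\<le>n. 1 / (1 + real i)^2)"
    by (subst (1 2) sum.reindex) (auto simp: inj_on_def)
  finally have "(\<Sum>k\<in>{- int n..int n}. 1 / (1 + \<bar>real_of_int k\<bar>)^2) \<le> 2 * (\<Sum>i\<le>n. 1 / (1 + real i)^2)" .
  moreover have "0 \<le> 1 / (1 + real n)" by simp
  ultimately show ?thesis using tel[of n] by linarith
qed

text \<open>The summand factorises over the coordinates, so over a cube the sum is a power of the
  one-dimensional one.\<close>

lemma lattice_sum:
  fixes S :: "(int ^ 'n) set"
  assumes "finite S"
  shows "(\<Sum>j\<in>S. \<Prod>i\<in>UNIV. 1 / (1 + \<bar>real_of_int (j $ i)\<bar>)^2) \<le> 4 ^ CARD('n::finite)"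
proof -
  obtain n :: nat where n: "\<And>j. j \<in> S \<Longrightarrow> site_norm j \<le> real n"
  proof -
    obtain B where B: "\<forall>r\<in>site_norm ` S. r \<le> B"
      using bdd_above_finite[of "site_norm ` S"] assms by (auto simp: bdd_above_def)
    obtain n :: nat where "B \<le> real n" using real_arch_simple by blast
    thus thesis using that B by (meson imageI order_trans)
  qed
  let ?I = "{- int n..int n}" and ?t = "\<lambda>k. 1 / (1 + \<bar>real_of_int k\<bar>)^2"
  have inI: "j $ i \<in> ?I" if "j \<in> S" for j :: "int ^ 'n" and i
  proof -
    have "\<bar>real_of_int (j $ i)\<bar> \<le> real n" using abs_le_site_norm[of j i] n[OF that] by linarith
    thus ?thesis by (auto simp: abs_le_iff)
  qed
  have "(\<Sum>j\<in>S. \<Prod>i\<in>UNIV. ?t (j $ i)) = (\<Sum>g\<in>vec_nth ` S. \<Prod>i\<in>UNIV. ?t (g i))"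
    by (subst sum.reindex) (auto simp: inj_on_def vec_nth_inject)
  also have "... \<le> (\<Sum>g\<in>(UNIV :: 'n set) \<rightarrow>\<^sub>E ?I. \<Prod>i\<in>UNIV. ?t (g i))"
  proof (rule sum_mono2)
    show "finite ((UNIV :: 'n set) \<rightarrow>\<^sub>E ?I)" by (intro finite_PiE) auto
    show "vec_nth ` S \<subseteq> UNIV \<rightarrow>\<^sub>E ?I" using inI by (auto simp: PiE_def)
  qed (auto intro!: prod_nonneg)
  also have "... = (\<Prod>i\<in>(UNIV :: 'n set). \<Sum>k\<in>?I. ?t k)"
    by (rule prod_sum_PiE[symmetric, where f = "\<lambda>_. ?t"]) auto
  also have "... \<le> (\<Prod>i\<in>(UNIV :: 'n set). 4)"
    by (intro prod_mono conjI sum_nonneg inverse_square_sum) auto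
  finally show ?thesis by simp
qed

text \<open>\<open>t0\<close> is the point where the two terms balance: beyond it the power wins,
  before it the linear term is bounded by its value there.\<close>

lemma power_dominates:
  fixes q g D :: real
  assumes "1 < q" "0 < g" "0 \<le> D"
  obtains C where "\<And>t. 0 < t \<Longrightarrow> D * t - g * t powr q \<le> C"
proof -
  define t0 where "t0 = (D / g) powr (1 / (q - 1))"
  have "D * t - g * t powr q \<le> D * t0" if t: "0 < t" for t
  proof (cases "t \<le> t0")
    case True
    hence "D * t \<le> D * t0" using assms by (intro mult_left_mono) auto
    moreover have "0 \<le> g * t powr q" using assms by simp
    ultimately show ?thesis by linarith
  next
    case False
    have "t0 powr (q - 1) \<le> t powr (q - 1)" using False assms by (intro powr_mono2) (auto simp: t0_def)
    moreover have "t0 powr (q - 1) = D / g" using assms by (cases "D = 0") (simp_all add: t0_def powr_powr)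
    ultimately have "D \<le> g * t powr (q - 1)" using assms by (simp add: divide_le_eq mult.commute)
    hence "D * t \<le> g * t powr (q - 1) * t" using t by (intro mult_right_mono) auto
    moreover have "t powr (q - 1) * t = t powr q" using t powr_add[of t "q - 1" 1] by simp
    ultimately have "D * t - g * t powr q \<le> 0" by (simp add: mult.assoc)
    moreover have "0 \<le> D * t0" using assms by (simp add: t0_def)
    ultimately show ?thesis by linarith
  qed
  thus thesis by (rule that)
qed

text \<open>Because \<open>q > 1\<close>, the exponential of a multiple of (ln X)^q outgrows every
  power of X. The power \<open>2 * CARD('n)\<close> is what the product of inverse squares over the
  coordinates requires.\<close>

lemma log_weight_summable:
  assumes q: "1 < q" and g: "0 < g" and c: "0 < c" "0 < \<kappa>" "1 < c + \<kappa>"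
  obtains C where "\<And>S :: ('n::finite) mode set. finite S \<Longrightarrow> (\<Sum>J\<in>S. exp (- g * log_weight \<kappa> q (bracket c (fst J)))) \<le> C"
proof -
  let ?d = "2 * real CARD('n)"
  obtain C where C: "\<And>t. 0 < t \<Longrightarrow> ?d * t - g * t powr q \<le> C" using power_dominates[OF q g, of ?d] by auto
  define w where "w j = (\<Prod>i\<in>UNIV. 1 / (1 + \<bar>real_of_int (j $ i)\<bar>)^2)" for j :: "int ^ 'n"
  have le: "exp (- g * log_weight \<kappa> q (bracket c j)) \<le> exp C * 4 ^ CARD('n) * w j" for j :: "int ^ 'n"
  proof -
    define X where "X = bracket c j + \<kappa>"
    have X: "1 < X" "site_norm j \<le> X" using c by (auto simp: X_def bracket_def)
    have "0 < ln X" using X by simp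
    from C[OF this] have "- g * log_weight \<kappa> q (bracket c j) \<le> C - ?d * ln X" by (simp add: log_weight_def X_def)
    hence "exp (- g * log_weight \<kappa> q (bracket c j)) \<le> exp (C - ?d * ln X)" by simp
    also have "... = exp C * (\<Prod>i\<in>(UNIV :: 'n set). 1 / X^2)"
    proof -
      have "exp (?d * ln X) = X ^ (2 * CARD('n))"
        using X exp_of_nat_mult[of "2 * CARD('n)" "ln X"] by simp
      thus ?thesis by (simp add: exp_diff power_mult power_divide)
    qed
    also have "... \<le> exp C * (\<Prod>i\<in>(UNIV :: 'n set). 4 * (1 / (1 + \<bar>real_of_int (j $ i)\<bar>)^2))"
    proof (intro mult_left_mono prod_mono conjI)
      fix i
      have "1 + \<bar>real_of_int (j $ i)\<bar> \<le> 2 * X" using abs_le_site_norm[of j i] X by linarith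
      hence "(1 + \<bar>real_of_int (j $ i)\<bar>)^2 \<le> (2 * X)^2" by (intro power_mono) auto
      hence "4 / (2 * X)^2 \<le> 4 / (1 + \<bar>real_of_int (j $ i)\<bar>)^2"
        using X by (intro divide_left_mono) (auto intro!: mult_pos_pos add_pos_nonneg)
      thus "1 / X^2 \<le> 4 * (1 / (1 + \<bar>real_of_int (j $ i)\<bar>)^2)" using X by (simp add: power_mult_distrib)
    qed auto
    also have "... = exp C * 4 ^ CARD('n) * w j" unfolding prod.distrib by (simp add: w_def)
    finally show ?thesis .
  qed
  have "(\<Sum>J\<in>S. exp (- g * log_weight \<kappa> q (bracket c (fst J)))) \<le> 2 * (exp C * 4 ^ CARD('n) * 4 ^ CARD('n))"
    if S: "finite S" for S :: "'n mode set"
  proof -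
    have w0: "0 \<le> w j" for j by (auto simp: w_def intro!: prod_nonneg)
    have "(\<Sum>J\<in>S. exp (- g * log_weight \<kappa> q (bracket c (fst J)))) \<le> (\<Sum>J\<in>S. exp C * 4 ^ CARD('n) * w (fst J))"
      by (intro sum_mono le)
    also have "... \<le> (\<Sum>J\<in>fst ` S \<times> (UNIV :: bool set). exp C * 4 ^ CARD('n) * w (fst J))"
      using S w0 by (intro sum_mono2) (auto intro: rev_image_eqI)
    also have "... = 2 * (exp C * 4 ^ CARD('n) * (\<Sum>j\<in>fst ` S. w j))"
      by (simp add: sum.cartesian_product' sum_distrib_left)
    also have "... \<le> 2 * (exp C * 4 ^ CARD('n) * 4 ^ CARD('n))"
      unfolding w_def using S by (intro mult_left_mono lattice_sum) auto
    finally show ?thesis .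
  qed
  thus thesis by (rule that)
qed

text \<open>Each block is represented by the size of one chosen mode. This function is constant on
  blocks and stays within bounded distance of the true size, so any weight composed with it takes
  different values only across separated blocks.\<close>

lemma cluster_representatives:
  fixes \<omega> :: "int ^ ('n::finite) \<Rightarrow> real"
  assumes "clustering C0 \<omega>"
  obtains D C2 \<delta> :: real and n :: "int ^ 'n \<Rightarrow> real" where "0 \<le> D" "0 < C2" "0 < \<delta>" "\<And>j. \<bar>n j - site_norm j\<bar> \<le> D"
    "\<And>i j. n i = n j \<or> C2 * (site_norm i powr \<delta> + site_norm j powr \<delta>) \<le> \<bar>\<omega> i - \<omega> j\<bar>"
proof -
  obtain \<B> :: "'n mode set set" where part: "partition_on UNIV \<B>"
    and e: "\<exists>\<Omega>0\<in>\<B>. (\<forall>J\<in>\<Omega>0. mode_norm J \<le> C0) \<and>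
           (\<exists>C1. \<forall>\<Omega>\<in>\<B> - {\<Omega>0}. bdd_above (mode_norm ` \<Omega>) \<and>
              (SUP J\<in>\<Omega>. mode_norm J) - (INF J\<in>\<Omega>. mode_norm J) \<le> C1)"
      "\<exists>C2>0. \<exists>\<delta>>0. \<forall>\<Omega>\<in>\<B>. \<forall>\<Omega>'\<in>\<B>. \<Omega> \<noteq> \<Omega>' \<longrightarrow>
           (\<forall>J1\<in>\<Omega>. \<forall>J2\<in>\<Omega>'. C2 * (mode_norm J1 powr \<delta> + mode_norm J2 powr \<delta>) \<le> \<bar>\<omega> (fst J1) - \<omega> (fst J2)\<bar>)"
    using assms unfolding clustering_def by (elim exE[where P = "\<lambda>\<B>. partition_on _ \<B> \<and> _ \<B>"] conjE) (rule that; assumption)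
  obtain \<Omega>0 where o0: "\<forall>J\<in>\<Omega>0. mode_norm J \<le> C0" and o1: "\<exists>C1. \<forall>\<Omega>\<in>\<B> - {\<Omega>0}. bdd_above (mode_norm ` \<Omega>) \<and>
      (SUP J\<in>\<Omega>. mode_norm J) - (INF J\<in>\<Omega>. mode_norm J) \<le> C1"
    using e(1) by (elim bexE conjE) (rule that; assumption)
  obtain C1 where o2: "\<forall>\<Omega>\<in>\<B> - {\<Omega>0}. bdd_above (mode_norm ` \<Omega>) \<and>
      (SUP J\<in>\<Omega>. mode_norm J) - (INF J\<in>\<Omega>. mode_norm J) \<le> C1"
    using o1 by (elim exE) (rule that)
  have b0: "mode_norm J \<le> C0" if "J \<in> \<Omega>0" for J using o0 that by (rule bspec)
  have b1: "bdd_above (mode_norm ` \<Omega>) \<and> (SUP J\<in>\<Omega>. mode_norm J) - (INF J\<in>\<Omega>. mode_norm J) \<le> C1"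
    if "\<Omega> \<in> \<B>" "\<Omega> \<noteq> \<Omega>0" for \<Omega> by (rule bspec[OF o2]) (use that in simp)
  obtain C2 \<delta> where C2: "0 < C2" "0 < \<delta>"
    and sep': "\<forall>\<Omega>\<in>\<B>. \<forall>\<Omega>'\<in>\<B>. \<Omega> \<noteq> \<Omega>' \<longrightarrow>
           (\<forall>J1\<in>\<Omega>. \<forall>J2\<in>\<Omega>'. C2 * (mode_norm J1 powr \<delta> + mode_norm J2 powr \<delta>) \<le> \<bar>\<omega> (fst J1) - \<omega> (fst J2)\<bar>)"
    using e(2) by (elim exE conjE) (rule that; assumption)
  have sep: "C2 * (mode_norm J1 powr \<delta> + mode_norm J2 powr \<delta>) \<le> \<bar>\<omega> (fst J1) - \<omega> (fst J2)\<bar>"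
    if "\<Omega> \<in> \<B>" "\<Omega>' \<in> \<B>" "\<Omega> \<noteq> \<Omega>'" "J1 \<in> \<Omega>" "J2 \<in> \<Omega>'" for \<Omega> \<Omega>' J1 J2
    using sep' that by blast
  \<comment> \<open>Weights live on sites, so the block of the mode with sign +1 stands for the
    site; frequencies do not see the sign, so the separation carries over.\<close>
  have "\<exists>\<Omega>\<in>\<B>. (j, True) \<in> \<Omega>" for j using partition_onD1[OF part] by blast
  then obtain blk where blk: "\<And>j. blk j \<in> \<B>" "\<And>j. (j, True) \<in> blk j" by metis
  \<comment> \<open>The choice depends on the block only, so sites with the same block share their
    representative.\<close>
  define rep where "rep j = (SOME J. J \<in> blk j)" for j
  have rep: "rep j \<in> blk j" for j unfolding rep_def using blk(2) by (rule someI)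
  define D where "D = max 0 (max C0 C1)"
  have near: "\<bar>mode_norm J - mode_norm J'\<bar> \<le> D" if J: "J \<in> blk j" "J' \<in> blk j" for J J' j
  proof (cases "blk j = \<Omega>0")
    case True
    hence "mode_norm J \<le> C0" "mode_norm J' \<le> C0" using b0 J by auto
    moreover have "0 \<le> mode_norm J" "0 \<le> mode_norm J'" "C0 \<le> D" by (auto simp: D_def)
    ultimately show ?thesis by linarith
  next
    case False
    note b = b1[OF blk(1) False]
    have "mode_norm K \<le> (SUP J\<in>blk j. mode_norm J)" "(INF J\<in>blk j. mode_norm J) \<le> mode_norm K" if "K \<in> blk j" for K
      using b that by (auto intro!: cSUP_upper cINF_lower bdd_belowI2[of _ 0])
    from this[OF J(1)] this[OF J(2)] have "\<bar>mode_norm J - mode_norm J'\<bar> \<le> C1" using b by linarith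
    thus ?thesis by (simp add: D_def)
  qed
  show thesis
  proof (rule that[of D C2 \<delta> "\<lambda>j. mode_norm (rep j)"])
    show "\<bar>mode_norm (rep j) - site_norm j\<bar> \<le> D" for j
      using near[OF rep blk(2), of j] by (simp add: mode_norm_def)
    show "mode_norm (rep i) = mode_norm (rep j) \<or> C2 * (site_norm i powr \<delta> + site_norm j powr \<delta>) \<le> \<bar>\<omega> i - \<omega> j\<bar>" for i j
    proof (cases "blk i = blk j")
      case True
      thus ?thesis by (simp add: rep_def)
    next
      case False
      thus ?thesis using sep[OF blk(1) blk(1) False blk(2) blk(2)] by (simp add: mode_norm_def)
    qed
  qed (use C2 in \<open>auto simp: D_def\<close>)
qed

text \<open>The asymptotics hold beyond some radius; the finitely many sites inside are covered by
  enlarging the upper constant.\<close>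

lemma frequency_growth:
  fixes \<omega> :: "int ^ ('n::finite) \<Rightarrow> real"
  assumes as: "asymptotics C0 \<beta> \<omega>" and C0: "0 < C0"
  obtains R U where "\<And>j. \<bar>\<omega> j\<bar> \<le> U * (1 + site_norm j) powr \<beta>" "0 \<le> U"
    "\<And>j. R \<le> site_norm j \<Longrightarrow> 1 / C0 * site_norm j powr \<beta> \<le> \<omega> j"
proof -
  have bet: "1 < \<beta>" using as by (simp add: asymptotics_def)
  obtain R' where R': "\<And>j. R' \<le> site_norm j \<Longrightarrow> 1 / C0 \<le> \<omega> j / site_norm j powr \<beta> \<and> \<omega> j / site_norm j powr \<beta> \<le> C0"
    using as unfolding asymptotics_def by blast
  define R where "R = max R' 1"
  have low: "1 / C0 * site_norm j powr \<beta> \<le> \<omega> j" and up: "\<omega> j \<le> C0 * site_norm j powr \<beta>" if "R \<le> site_norm j" for j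
  proof -
    have "0 < site_norm j powr \<beta>" using that by (auto simp: R_def)
    thus "1 / C0 * site_norm j powr \<beta> \<le> \<omega> j" "\<omega> j \<le> C0 * site_norm j powr \<beta>"
      using R'[of j] that by (auto simp: R_def le_divide_eq divide_le_eq mult.commute)
  qed
  have "finite {j :: int ^ 'n. site_norm j \<le> R}" by (rule finite_sites)
  hence "bdd_above ((\<lambda>j. \<bar>\<omega> j\<bar>) ` {j. site_norm j \<le> R})" by (intro bdd_above_finite) auto
  then obtain B where B: "\<And>j. site_norm j \<le> R \<Longrightarrow> \<bar>\<omega> j\<bar> \<le> B" by (auto simp: bdd_above_def)
  define U where "U = max 0 (max B C0)"
  have "\<bar>\<omega> j\<bar> \<le> U * (1 + site_norm j) powr \<beta>" for j
  proof (cases "site_norm j \<le> R")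
    case True
    have "0 \<le> site_norm j" by (simp add: site_norm_def)
    hence "1 \<le> (1 + site_norm j) powr \<beta>" using bet by (intro ge_one_powr_ge_zero) auto
    hence "U * 1 \<le> U * (1 + site_norm j) powr \<beta>" by (intro mult_left_mono) (auto simp: U_def)
    thus ?thesis using B[OF True] by (simp add: U_def)
  next
    case False
    have "0 \<le> 1 / C0 * site_norm j powr \<beta>" using C0 by simp
    hence "\<bar>\<omega> j\<bar> \<le> C0 * site_norm j powr \<beta>" using low[of j] up[of j] False by simp
    also have "... \<le> U * (1 + site_norm j) powr \<beta>"
      using bet C0 by (intro mult_mono powr_mono2) (auto simp: U_def site_norm_def)
    finally show ?thesis .
  qed
  thus thesis by (rule that[of U R]) (use low in \<open>auto simp: U_def\<close>)
qed

theorem theorem2: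
  fixes \<omega> :: "int ^ 'n \<Rightarrow> real" and P :: "'n ham" and q \<kappa> c \<beta> p :: real
  assumes "1 < q"
    and "admissible_log_constants \<kappa> c q"
    and "1 < \<beta>"
    and "frequency_assumption \<beta> p \<omega>"
    and "P \<in> perturbations c (log_weight \<kappa> q) 3"
  shows "\<forall>\<^sub>F s in at_top. \<exists>\<epsilon>0>0. \<exists>Csta>0. \<exists>Cfin>0.
    \<forall>u0 \<in> W_space c (log_weight \<kappa> q) s. \<forall>\<epsilon>.
      real_state u0 \<and> \<epsilon> = W_norm c (log_weight \<kappa> q) s u0 \<and> 0 < \<epsilon> \<and> \<epsilon> < \<epsilon>0 \<longrightarrow>
      (\<exists>T. (\<forall>a < (q - 1) / (q * p + 1).
              1 / Csta * exp (Cfin * \<bar>ln \<epsilon>\<bar> powr (1 + a)) < T) \<and>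
           the_solution_bounded c (log_weight \<kappa> q) s (\<lambda>Js. H0 \<omega> Js + P Js) u0 T (Csta * \<epsilon>))"
proof -
  define f where "f = log_weight \<kappa> q"
  define \<phi> where "\<phi> J = f (bracket c (fst J))" for J :: "'n mode"
  note P = assms(5)[folded f_def]
  have c: "0 < \<kappa>" "0 < c" "1 < c + \<kappa>" and adm: "admissible_weight c f"
    using assms(2) by (auto simp: admissible_log_constants_def f_def)
  have fpos: "0 < f x" if "c \<le> x" for x using adm that by (auto simp: admissible_weight_def)
  have fmono: "mono_on {c..} f" using adm by (simp add: admissible_weight_def)
  obtain Cf' where Cf': "Cf' < 1" "\<And>(d :: nat) x m. m < d \<Longrightarrow> (\<forall>l<d. c \<le> x l \<and> x l \<le> x m) \<Longrightarrow>
        f (\<Sum>l<d. x l) \<le> f (x m) + Cf' * (\<Sum>l\<in>{..<d} - {m}. f (x l))"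
    using adm unfolding admissible_weight_def by metis
  \<comment> \<open>The subadditivity constant may be negative; its positive part is admissible
    because the weight is positive.\<close>
  define Cf where "Cf = max 0 Cf'"
  have Cf: "0 \<le> Cf" "Cf < 1" using Cf' by (auto simp: Cf_def)
  have fsum: "f (\<Sum>l<d. x l) \<le> f (x m) + Cf * (\<Sum>l\<in>{..<d} - {m}. f (x l))"
    if "m < d" "\<forall>l<d. c \<le> x l \<and> x l \<le> x m" for d m and x :: "nat \<Rightarrow> real"
  proof -
    have "0 \<le> (\<Sum>l\<in>{..<d} - {m}. f (x l))" using that fpos by (intro sum_nonneg) (auto intro: less_imp_le)
    hence "Cf' * (\<Sum>l\<in>{..<d} - {m}. f (x l)) \<le> Cf * (\<Sum>l\<in>{..<d} - {m}. f (x l))"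
      by (intro mult_right_mono) (auto simp: Cf_def)
    thus ?thesis using Cf'(2)[OF that] by linarith
  qed
  have bc: "c \<le> bracket c j" for j :: "int ^ 'n" by (simp add: bracket_def)
  have phi_pos: "0 < \<phi> J" for J unfolding \<phi>_def by (rule fpos[OF bc])
  have fm: "f y \<le> f z" if "c \<le> y" "y \<le> z" for y z using fmono that by (auto simp: mono_on_def)
  obtain C0 where C0: "0 < C0" "asymptotics C0 \<beta> \<omega>" "clustering C0 \<omega>" and nonres: "nonresonance p \<omega>"
    using assms(4) by (auto simp: frequency_assumption_def)
  obtain D C2 \<delta> and n :: "int ^ 'n \<Rightarrow> real" where D: "0 \<le> D" "0 < C2" "0 < \<delta>" "\<And>j. \<bar>n j - site_norm j\<bar> \<le> D"
    "\<And>i j. n i = n j \<or> C2 * (site_norm i powr \<delta> + site_norm j powr \<delta>) \<le> \<bar>\<omega> i - \<omega> j\<bar>"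
    using cluster_representatives[OF C0(3)] by blast
  obtain R U where growth: "\<And>j. \<bar>\<omega> j\<bar> \<le> U * (1 + site_norm j) powr \<beta>" "0 \<le> U"
    "\<And>j. R \<le> site_norm j \<Longrightarrow> 1 / C0 * site_norm j powr \<beta> \<le> \<omega> j"
    using frequency_growth[OF C0(2,1)] by metis
  obtain \<gamma> \<tau> N0 where p: "1 \<le> p" and par: "0 < \<gamma>" "0 < \<tau>" and
    nr: "\<And>N Js. N0 \<le> N \<Longrightarrow> (\<forall>J\<in>set Js. mode_norm J \<le> N) \<Longrightarrow>
          (freq_sum \<omega> Js \<noteq> 0 \<longrightarrow> \<gamma> * N powr (- \<tau> * real (length Js) powr p) \<le> \<bar>freq_sum \<omega> Js\<bar>) \<and>
          (freq_sum \<omega> Js = 0 \<longrightarrow> paired \<omega> Js)"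
    using nonres unfolding nonresonance_def eventually_at_top_linorder by metis
  \<comment> \<open>At least \<open>c\<close>, since the weight is controlled on
    \<open>{c..}\<close> only.\<close>
  define D' where "D' = max D c"
  \<comment> \<open>The case of two summands, with either of them as the larger one; the factor
    below 1 in front of the smaller weight is dropped.\<close>
  have add: "f (x + D') \<le> f x + f D'" if x: "c \<le> x" for x
  proof -
    have two: "f (y + z) \<le> f y + Cf * f z" if "c \<le> z" "z \<le> y" for y z
      using fsum[of 0 2 "\<lambda>l. if l = 0 then y else z"] that
      by (simp add: numeral_2_eq_2 lessThan_Suc insert_Diff_if less_Suc_eq add.commute)
    have Cle: "Cf * f z \<le> f z" if "c \<le> z" for z using Cf fpos[OF that] by (simp add: mult_left_le_one_le)
    have "c \<le> D'" by (simp add: D'_def)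
    thus ?thesis
      using two[of D' x] two[of x D'] Cle[of x] Cle[of D'] x by (cases "D' \<le> x") (auto simp: add.commute)
  qed
  \<comment> \<open>By subadditivity a bounded change of the argument changes the weight by a
    bounded amount. This makes the weight of the representative comparable with that of the
    site.\<close>
  have shift: "\<bar>f (max (n j) c) - f (bracket c j)\<bar> \<le> f D'" for j
  proof -
    have "c \<le> max (n j) c" "max (n j) c \<le> bracket c j + D'" "bracket c j \<le> max (n j) c + D'"
      using D(4)[of j] D(1) by (auto simp: bracket_def D'_def)
    hence "f (max (n j) c) \<le> f (bracket c j + D')" "f (bracket c j) \<le> f (max (n j) c + D')"
      using bc by (auto intro!: fm)
    thus ?thesis using add[OF bc, of j] add[of "max (n j) c"] by auto
  qed
  obtain s' where s': "\<And>s. s' \<le> s \<Longrightarrow> \<forall>\<^sub>F r in at_right 0. vf_norm_finite c f r s P"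
    using P unfolding perturbations_def eventually_at_top_linorder by blast
  have radius: "\<exists>r>0. vf_norm_finite c f r s P" if "s' \<le> s" for s
    using s'[OF that] unfolding eventually_at_right_field by (meson dense)
  \<comment> \<open>The coefficients are read off from the vector field at this single exponent;
    every larger \<open>s\<close> is then admissible, with constants depending on
    \<open>s\<close>.\<close>
  define s0 where "s0 = max s' 0"
  obtain r0 where r0: "0 < r0" "vf_norm_finite c f r0 s0 P" using radius[of s0] by (auto simp: s0_def)
  obtain A where A: "1 \<le> A"
    "\<And>n. 1 \<le> n \<Longrightarrow> cls (\<lambda>M. s0 * (sm (\<lambda>J. f (bracket c (fst J))) M - 2 * mx (\<lambda>J. f (bracket c (fst J))) M)) n (A ^ n) (gpart P n)"
  proof (rule gpart_bound[OF P r0(2,1)])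
    show "0 \<le> f (bracket c (fst J))" for J :: "'n mode" by (rule less_imp_le[OF fpos[OF bc]])
    fix A
    assume a: "1 \<le> A" "\<And>n. 1 \<le> n \<Longrightarrow>
      cls (\<lambda>M. s0 * (sm (\<lambda>J. f (bracket c (fst J))) M - 2 * mx (\<lambda>J. f (bracket c (fst J))) M)) n (A ^ n) (gpart P n)"
    show thesis by (rule that[OF a])
  qed
  have ev: "\<exists>\<epsilon>0>0. \<exists>Csta>0. \<exists>Cfin>0. \<forall>u0 \<in> W_space c f s. \<forall>\<epsilon>.
      real_state u0 \<and> \<epsilon> = W_norm c f s u0 \<and> 0 < \<epsilon> \<and> \<epsilon> < \<epsilon>0 \<longrightarrow>
      (\<exists>T. (\<forall>a < (q - 1) / (q * p + 1). 1 / Csta * exp (Cfin * \<bar>ln \<epsilon>\<bar> powr (1 + a)) < T) \<and>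
           the_solution_bounded c f s (\<lambda>Js. H0 \<omega> Js + P Js) u0 T (Csta * \<epsilon>))" if s: "s0 < s" for s
  proof -
    obtain rs where rs: "0 < rs" "vf_norm_finite c f rs s P" using radius[of s] s by (auto simp: s0_def)
    define C1 where "C1 = (1 + Cf) / 2"
    interpret w: weight \<phi> Cf C1 s0 s
    proof
      show "\<phi> (bar J) = \<phi> J" for J by (simp add: \<phi>_def)
      show "\<phi> K \<le> mx \<phi> A + Cf * (sm \<phi> A - mx \<phi> A)" if "mom (K # A) = 0" "A \<noteq> []" for K A
        by (rule weight_of_zero_momentum[OF fpos fmono fsum \<phi>_def c(2) that])
    qed (use Cf s phi_pos in \<open>auto simp: C1_def s0_def\<close>)
    have g: "0 < 2 * (s - w.s1)"
    proof -
      have "(s - s0) * C1 < (s - s0) * 1" using s Cf by (intro mult_strict_left_mono) (auto simp: C1_def)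
      thus ?thesis by (simp add: w.s1_def)
    qed
    obtain B where B: "\<And>S :: 'n mode set. finite S \<Longrightarrow> (\<Sum>J\<in>S. exp (- (2 * (s - w.s1)) * f (bracket c (fst J)))) \<le> B"
      using log_weight_summable[OF assms(1) g c(2,1,3)] unfolding f_def by blast
    define b where "b = sqrt (max 1 B)"
    interpret h: ham_sys \<phi> Cf C1 s0 s b P A f c \<omega> rs
    proof
      show "1 \<le> b" by (simp add: b_def)
      show "(\<Sum>J\<in>S. exp (- 2 * (s - w.s1) * \<phi> J)) \<le> b^2" if "finite S" for S
        using B[OF that] by (simp add: b_def \<phi>_def)
      show "cls w.e1 n (A ^ n) (gpart P n)" if "1 \<le> n" for n
      proof -
        have "w.e1 = (\<lambda>M. s0 * (sm \<phi> M - 2 * mx \<phi> M))" by (rule ext) (simp only: w.e1_def)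
        thus ?thesis using A(2)[OF that, folded \<phi>_def] by simp
      qed
      show "ham_converges P u" if "u \<in> W_ball c f s rs" for u
        using rs(2) that by (simp add: vf_norm_finite_def)
    qed (use A P rs in \<open>auto simp: \<phi>_def\<close>)
    \<comment> \<open>The energy weight, a function of the representative alone;
      \<open>shift\<close> supplies its comparison with the true weight up to the factors
      \<open>exp (- 2 * s * f D')\<close> and \<open>exp (2 * s * f D')\<close>.\<close>
    define v where "v j = exp (2 * s * f (max (n j) c))" for j
    have s00: "0 < s" using s by (simp add: s0_def)
    have sh: "s * f (max (n (fst K)) c) \<le> s * (\<phi> K + f D')" "s * \<phi> K \<le> s * (f (max (n (fst K)) c) + f D')" for K :: "'n mode"
      using shift[of "fst K"] s00 unfolding \<phi>_def by (intro mult_left_mono; simp)+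
    have v: "exp (- 2 * s * f D') * exp (2 * s * \<phi> K) \<le> v (fst K)" "v (fst K) \<le> exp (2 * s * f D') * exp (2 * s * \<phi> K)" for K
      unfolding v_def exp_add[symmetric] exp_le_cancel_iff using sh[of K] by (simp_all add: algebra_simps)
    show ?thesis
    proof (rule h.long_time_stability[of "exp (- 2 * s * f D')" v "exp (2 * s * f D')" C2 \<delta> \<beta> "1 / C0" U R N0 \<gamma> \<tau> p q])
      show "v i = v j \<or> C2 * (site_norm i powr \<delta> + site_norm j powr \<delta>) \<le> \<bar>\<omega> i - \<omega> j\<bar>" for i j
        using D(5)[of i j] by (auto simp: v_def)
      show "(ln x) powr q \<le> \<phi> J" if "1 \<le> x" "x < mode_norm J" for J x
      proof -
        have "x \<le> bracket c (fst J) + \<kappa>" using that c by (simp add: bracket_def mode_norm_def)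
        hence "(ln x) powr q \<le> (ln (bracket c (fst J) + \<kappa>)) powr q"
          using that assms(1) by (intro powr_mono2 ln_mono) auto
        thus ?thesis by (simp add: \<phi>_def f_def log_weight_def)
      qed
      show "0 < 1 / C0" using C0 by simp
    qed (fact v D growth nr par p assms | simp)+
  qed
  show ?thesis
    unfolding f_def[symmetric] by (rule eventually_mono[OF eventually_gt_at_top[of s0]]) (rule ev)
qed

end
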